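(* The family of unitaries $\mathcal{E}(\tilde\sigma,\tilde\rho)=g[\tilde\rho](V_\sigma)V_\sigma^*$ ($\tilde\sigma\in Z_{\mathcal{C}_0}(\mathcal{C})_g$, $g\in G$, $\tilde\rho\in Z_{\mathcal{C}_0}(\mathcal{C})$), canonically extended as described in the context, is a $G$-braiding on $Z_{\mathcal{C}_0}(\mathcal{C})$. Namely: (BF0) $\mathcal{E}(\tilde\sigma,\tilde\rho)\in(\tilde\sigma\tilde\rho,\,g[\tilde\rho]\tilde\sigma)$ for $\tilde\sigma\in Z_{\mathcal{C}_0}(\mathcal{C})_g$, $\tilde\rho\in Z_{\mathcal{C}_0}(\mathcal{C})$. (BF1) $g[\tilde\xi](\mathcal{E}(\tilde\sigma,\tilde\eta))\,\mathcal{E}(\tilde\sigma,\tilde\xi)=\mathcal{E}(\tilde\sigma,\tilde\xi\tilde\eta)$ for $\tilde\sigma\in Z_{\mathcal{C}_0}(\mathcal{C})_g$, $\tilde\xi,\tilde\eta\in Z_{\mathcal{C}_0}(\mathcal{C})$; and $\beta_g(T)\mathcal{E}(\tilde\sigma,\tilde\rho)=\mathcal{E}(\tilde\sigma,\tilde\rho')\tilde\sigma(T)$ for $\tilde\sigma\in Z_{\mathcal{C}_0}(\mathcal{C})_g$, $T\in(\tilde\rho,\tilde\rho')$. (BF2) $\mathcal{E}(\tilde\sigma,h[\tilde\xi])\,\tilde\sigma(\mathcal{E}(\tilde\rho,\tilde\xi))=\mathcal{E}(\tilde\sigma\tilde\rho,\tilde\xi)$ for $\tilde\sigma\in Z_{\mathcal{C}_0}(\mathcal{C})_g$,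 $\tilde\rho\in Z_{\mathcal{C}_0}(\mathcal{C})_h$, $\tilde\xi\in Z_{\mathcal{C}_0}(\mathcal{C})$; and $g[\tilde\xi](T)\mathcal{E}(\tilde\sigma,\tilde\xi)=\mathcal{E}(\tilde\sigma',\tilde\xi)T$ for $\tilde\sigma,\tilde\sigma'\in Z_{\mathcal{C}_0}(\mathcal{C})_g$, $T\in(\tilde\sigma,\tilde\sigma')$. (BF3) $\mathcal{E}(k[\tilde\sigma],k[\tilde\rho])=\beta_k(\mathcal{E}(\tilde\sigma,\tilde\rho))$ for all $k\in G$.
   Context: $\mathcal{M}$ is a type III factor with a faithful normal state; $\mathrm{End}(\mathcal{M})$ (resp. $\mathrm{End}_0(\mathcal{M})$) is the set of endomorphisms (resp. of finite index endomorphisms); for homomorphisms $\rho,\sigma$ into an algebra $\mathcal{N}$, $(\rho,\sigma)=\{T\in\mathcal{N}\mid T\rho(x)=\sigma(x)T\ \forall x\}$; $\rho\sim\sigma$ means $\rho=\mathrm{Ad}\,u\circ\sigma$ for a unitary $u$. For $\rho\in\mathrm{End}_0(\mathcal{M})$ with conjugate $\bar\rho$ and dimension $d(\rho)$ a solution of the conjugate equation is a pair $R_\rho\in(\mathrm{id},\bar\rho\rho)$, $\bar R_\rho\in(\mathrm{id},\rho\bar\rho)$ with $R_\rho^*R_\rho=\bar R_\rho^*\bar R_\rho=d(\rho)$, $R_\rho^*\bar\rho(\bar R_\rho)=\bar R_\rho^*\rho(R_\rho)=1$; one is fixed for each object. $\mathcal{C}\subset\mathrm{End}_0(\mathcal{M})$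 is a rigid C$^*$-tensor category (full, closed under unitary equivalence, composition, conjugates, finite direct sums and subobjects, containing $\mathrm{id}$) with at most countable set $\mathrm{Irr}(\mathcal{C})$ of representatives of irreducibles. $G$ is a discrete group with neutral element $0$ (written multiplicatively) and $\mathcal{C}$ is $G$-graded with components $\mathcal{C}_g\ne0$: every irreducible lies in exactly one $\mathcal{C}_g$, $\mathcal{C}_g\mathcal{C}_h\subset\mathcal{C}_{gh}$, $\overline{\mathcal{C}_g}=\mathcal{C}_{g^{-1}}$. $j:\mathcal{M}\to\mathcal{M}^{\mathrm{op}}$, $j(x)=x^*$, $\pi^{\mathrm{op}}=j\pi j^{-1}$, $\mathcal{A}=\mathcal{M}\otimes\mathcal{M}^{\mathrm{op}}$. The Longo-Rehren inclusion $\mathcal{A}\subset\mathcal{B}$ of $\mathcal{C}$: $\mathcal{B}$ is the von Neumann algebra generated by $\mathcal{A}$ and elements $\lambda_\pi$ ($\pi\in\mathcal{C}$) with $\lambda_\pi a=(\pi\otimes\pi^{\mathrm{op}})(a)\lambda_\pi$ ($a\in\mathcal{A}$), $\lambda_\pi\lambda_\rho=\lambda_{\pi\rho}$, $\lambda_\pi^*=(R_\pi\otimes j(R_\pi))^*\lambda_{\bar\pi}$, $(T\otimes1)\lambda_\pi=(1\otimes j(T^* ))\lambda_\rho$ for $T\in(\pi,\rho)$ (so $\lambda_\sigma=\sum_k(w_k\otimes j(w_k))\lambda_{\pi_k}$ if $\sigma=\sum_kw_k\pi_k(\cdot)w_k^*$), together with a faithful normal conditional expectation $E:\mathcal{B}\to\mathcal{A}$,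 $E(a\lambda_\pi)=\delta_{\mathrm{id},\pi}a$ for $\pi\in\mathrm{Irr}(\mathcal{C})$. $\mathcal{B}_g$ is the $\sigma$-weak closure of $\{\sum_{\pi\in\mathrm{Irr}(\mathcal{C}_g)}a_\pi\lambda_\pi\}$ (finite sums); $\mathcal{B}_0$ is the Longo-Rehren algebra of $\mathcal{C}_0$, $\iota:\mathcal{A}\to\mathcal{B}_0$ the inclusion. Fixed are unitaries $u_g\in\mathcal{B}_g$ with $u_gu_h=u_{gh}$ and the resulting action $\beta_g=\mathrm{Ad}\,u_g|_{\mathcal{B}_0}$ of $G$ on $\mathcal{B}_0$ (these exist). For $\pi\in\mathcal{C}_g$, $\Lambda_\pi:=\lambda_\pi u_g^*\in\mathcal{B}_0$. Below $\sigma\in\mathcal{C}$ may also be a countable direct sum $\sigma(x)=\sum_kw_k\xi_k(x)w_k^*$, $\xi_k\in\mathrm{Irr}(\mathcal{C})$, $w_k$ isometries with $\sum_kw_kw_k^*=1$ ($d(\sigma)=\infty$ allowed), with conjugate $\bar\sigma(x)=\sum_k\bar w_k\bar\xi_k(x)\bar w_k^*$; $\sigma\in\mathcal{C}_g$ means all $\xi_k\in\mathcal{C}_g$. A half braiding for $\sigma$ is a family of unitaries $\{\mathcal{E}_\sigma(\pi)\}_{\pi\in\mathcal{C}_0}$ with $\mathcal{E}_\sigma(\pi)\in(\sigma\pi,\pi\sigma)$, $\mathcal{E}_\sigma(\pi\rho)=\pi(\mathcal{E}_\sigma(\rho))\mathcal{E}_\sigma(\pi)$, $\mathcal{E}_\sigma(\rho)\sigma(T)=T\mathcal{E}_\sigma(\pi)$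 for $T\in(\pi,\rho)$. The $\eta$-extension $\tilde\sigma=\eta(\sigma,\mathcal{E}_\sigma)\in\mathrm{End}(\mathcal{B}_0)$ is $\tilde\sigma(a)=(\sigma\otimes\mathrm{id})(a)$, $a\in\mathcal{A}$, $\tilde\sigma(\lambda_\pi)=(\mathcal{E}_\sigma(\pi)^*\otimes1)\lambda_\pi$, $\pi\in\mathcal{C}_0$. $Z_{\mathcal{C}_0}(\mathcal{C})=\{\theta\in\mathrm{End}(\mathcal{B}_0)\mid\theta\sim\eta(\sigma,\mathcal{E}_\sigma)\text{ for some half braiding}\}$, and $Z_{\mathcal{C}_0}(\mathcal{C})_g$ is the set of those $\theta$ with $\sigma\in\mathcal{C}_g$; symbols $\tilde\sigma,\tilde\rho,\dots$ denote $\eta$-extensions of half braidings $(\sigma,\mathcal{E}_\sigma),(\rho,\mathcal{E}_\rho),\dots$. For $\theta\in Z_{\mathcal{C}_0}(\mathcal{C})$, $g[\theta]:=\beta_g\theta\beta_g^{-1}$ (again in $Z_{\mathcal{C}_0}(\mathcal{C})$). For $\sigma\in\mathcal{C}_g$ with $d(\sigma)<\infty$, $V_\sigma:=(1\otimes j(\bar R_\sigma^* ))\Lambda_\sigma$; for $d(\sigma)=\infty$, $V_\sigma:=\sum_k(w_k\otimes1)V_{\xi_k}\beta_g(1\otimes j(\bar w_k^* ))$ (an identity when $d(\sigma)<\infty$). $V_\sigma\in\mathcal{B}_0$ is unitary. For $\theta_1=\mathrm{Ad}\,u\circ\tilde\sigma$ with $\tilde\sigma\in Z_{\mathcal{C}_0}(\mathcal{C})_g$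 and $\theta_2=\mathrm{Ad}\,v\circ\tilde\rho$ ($u,v\in\mathcal{B}_0$ unitaries) the canonical extension is $\mathcal{E}(\theta_1,\theta_2)=\beta_g(v)\,g[\tilde\rho](u)\,\mathcal{E}(\tilde\sigma,\tilde\rho)\,u^*\theta_1(v^* )$. *)

theory Defs
  imports "HOL-Analysis.Analysis" "HOL-Library.FuncSet"
begin

section \<open>Complex Hilbert spaces and bounded operators\<close>

text \<open>The inner product is conjugate linear in the first, linear in the second argument.\<close>

class chilbert = real_inner + complete_space +
  fixes scaleC :: "complex \<Rightarrow> 'a \<Rightarrow> 'a" (infixr "*\<^sub>C" 75)
    and cinner :: "'a \<Rightarrow> 'a \<Rightarrow> complex"
  assumes scaleC_add_right: "c *\<^sub>C (x + y) = c *\<^sub>C x + c *\<^sub>C y"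
    and scaleC_add_left: "(c + d) *\<^sub>C x = c *\<^sub>C x + d *\<^sub>C x"
    and scaleC_scaleC: "c *\<^sub>C (d *\<^sub>C x) = (c * d) *\<^sub>C x"
    and scaleC_of_real: "complex_of_real r *\<^sub>C x = r *\<^sub>R x"
    and cinner_commute: "cinner x y = cnj (cinner y x)"
    and cinner_add_right: "cinner x (y + z) = cinner x y + cinner x z"
    and cinner_scaleC_right: "cinner x (c *\<^sub>C y) = c * cinner x y"
    and inner_eq_Re_cinner: "inner x y = Re (cinner x y)"

lemma scaleC_zero_right: "c *\<^sub>C (0 :: 'a::chilbert) = 0"
  using scaleC_add_right[of c 0 "0 :: 'a"] by simp

lemma scaleC_minus_right: "c *\<^sub>C (- x) = - (c *\<^sub>C (x :: 'a::chilbert))"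
proof -
  have "c *\<^sub>C x + c *\<^sub>C (- x) = 0"
    using scaleC_add_right[of c x "- x"] by (simp add: scaleC_zero_right)
  then show ?thesis by (simp add: add_eq_0_iff)
qed

lemma scaleC_diff_right: "c *\<^sub>C (x - y) = c *\<^sub>C x - c *\<^sub>C (y :: 'a::chilbert)"
  using scaleC_add_right[of c x "- y"] scaleC_minus_right[of c y] by simp

lemma scaleC_left_commute: "c *\<^sub>C (d *\<^sub>C x) = d *\<^sub>C (c *\<^sub>C (x :: 'a::chilbert))"
  by (simp add: scaleC_scaleC mult.commute)

lemma scaleC_bounded_linear: "bounded_linear (\<lambda>x :: 'a::chilbert. c *\<^sub>C x)"
proof (rule bounded_linear_intro[where K = "cmod c"])
  show "c *\<^sub>C (x + y) = c *\<^sub>C x + c *\<^sub>C y" for x y :: 'a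
    by (rule scaleC_add_right)
  show "c *\<^sub>C (r *\<^sub>R x) = r *\<^sub>R (c *\<^sub>C x)" for r and x :: 'a
    using scaleC_left_commute[of c "complex_of_real r" x] by (simp add: scaleC_of_real)
  show "norm (c *\<^sub>C x) \<le> norm x * cmod c" for x :: 'a
  proof -
    have left: "cinner (c *\<^sub>C x) y = cnj c * cinner x y" for y
      using cinner_commute[of "c *\<^sub>C x" y] cinner_scaleC_right[of y c x] cinner_commute[of x y]
      by simp
    have "cinner (c *\<^sub>C x) (c *\<^sub>C x) = complex_of_real ((cmod c)\<^sup>2) * cinner x x"
      unfolding complex_norm_square by (simp add: left cinner_scaleC_right)
    then have "(norm (c *\<^sub>C x))\<^sup>2 = (cmod c * norm x)\<^sup>2"
      by (simp add: power2_norm_eq_inner inner_eq_Re_cinner power_mult_distrib)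
    then have "norm (c *\<^sub>C x) = cmod c * norm x"
      by (simp add: power2_eq_iff_nonneg)
    then show ?thesis by (simp add: mult.commute)
  qed
qed

typedef (overloaded) 'h bop =
  "{f :: 'h::chilbert \<Rightarrow> 'h. bounded_linear f \<and> (\<forall>c x. f (c *\<^sub>C x) = c *\<^sub>C f x)}"
  morphisms app Bop
  by (rule exI[of _ "\<lambda>x. x"]) simp

setup_lifting type_definition_bop

instantiation bop :: (chilbert) "{ring, monoid_mult}"
begin

lift_definition zero_bop :: "'a bop" is "\<lambda>x. 0"
  by (simp add: scaleC_zero_right)

lift_definition one_bop :: "'a bop" is "\<lambda>x. x"
  by simp

lift_definition plus_bop :: "'a bop \<Rightarrow> 'a bop \<Rightarrow> 'a bop" is "\<lambda>f g x. f x + g x"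
  by (simp add: bounded_linear_add scaleC_add_right)

lift_definition minus_bop :: "'a bop \<Rightarrow> 'a bop \<Rightarrow> 'a bop" is "\<lambda>f g x. f x - g x"
  by (simp add: bounded_linear_sub scaleC_diff_right)

lift_definition uminus_bop :: "'a bop \<Rightarrow> 'a bop" is "\<lambda>f x. - f x"
  by (simp add: bounded_linear_minus scaleC_minus_right)

lift_definition times_bop :: "'a bop \<Rightarrow> 'a bop \<Rightarrow> 'a bop" is "\<lambda>f g x. f (g x)"
  by (simp add: bounded_linear_compose)

instance
proof
  fix a b c :: "'a bop"
  show "a * b * c = a * (b * c)" by transfer simp
  show "1 * a = a" by transfer simp
  show "a * 1 = a" by transfer simp
  show "a + b + c = a + (b + c)" by transfer (simp add: add.assoc)
  show "a + b = b + a" by transfer (simp add: add.commute)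
  show "0 + a = a" by transfer simp
  show "- a + a = 0" by transfer simp
  show "a - b = a + - b" by transfer simp
  show "(a + b) * c = a * c + b * c" by transfer simp
  show "a * (b + c) = a * b + a * c"
    by transfer (auto simp: linear_simps bounded_linear.linear linear_add)
qed

end

lift_definition scaleOp :: "complex \<Rightarrow> 'h::chilbert bop \<Rightarrow> 'h bop" is "\<lambda>c f x. c *\<^sub>C f x"
  by (auto intro: bounded_linear_compose[OF scaleC_bounded_linear] simp: scaleC_left_commute)

definition adj :: "'h::chilbert bop \<Rightarrow> 'h bop" where
  "adj x = (THE y. \<forall>a b. cinner (app y a) b = cinner a (app x b))"

definition pos_op :: "'h::chilbert bop \<Rightarrow> bool" where
  "pos_op x \<longleftrightarrow> (\<forall>a. Im (cinner a (app x a)) = 0 \<and> 0 \<le> Re (cinner a (app x a)))"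

text \<open>Unconditional convergence in the strong operator topology. All infinite sums below are
  of the form \<open>\<Sum>\<^sub>k v\<^sub>k x\<^sub>k w\<^sub>k\<^sup>*\<close> with bounded \<open>x\<^sub>k\<close> and families \<open>v\<^sub>k\<close>, \<open>w\<^sub>k\<close> of isometries with
  orthogonal ranges, for which all the usual topologies give the same sum.\<close>

definition strong_sum :: "(nat \<Rightarrow> 'h::chilbert bop) \<Rightarrow> nat set \<Rightarrow> 'h bop \<Rightarrow> bool" where
  "strong_sum f K s \<longleftrightarrow> (\<forall>a. ((\<lambda>k. app (f k) a) has_sum app s a) K)"

text \<open>The weak topology generated by the functionals
  \<open>x \<mapsto> \<Sum>\<^sub>n \<langle>a\<^sub>n, x b\<^sub>n\<rangle>\<close> with square summable sequences \<open>a\<close>, \<open>b\<close> of vectors.\<close>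

definition sigma_weak :: "'h::chilbert bop topology" where
  "sigma_weak = topology_generated_by
     {{x. (\<Sum>n. cinner (a n) (app x (b n))) \<in> U} | (a :: nat \<Rightarrow> 'h) (b :: nat \<Rightarrow> 'h) U.
        summable (\<lambda>n. (norm (a n))\<^sup>2) \<and> summable (\<lambda>n. (norm (b n))\<^sup>2) \<and> open U}"

section \<open>Von Neumann algebras, homomorphisms, conditional expectations\<close>

definition commutant :: "'h::chilbert bop set \<Rightarrow> 'h bop set" where
  "commutant S = {x. \<forall>y\<in>S. x * y = y * x}"

definition von_neumann_algebra :: "'h::chilbert bop set \<Rightarrow> bool" where
  "von_neumann_algebra M \<longleftrightarrow> (\<forall>x\<in>M. adj x \<in> M) \<and> commutant (commutant M) = M"

definition vn_generated :: "'h::chilbert bop set \<Rightarrow> 'h bop set" where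
  "vn_generated S = commutant (commutant (S \<union> adj ` S))"

definition unitaries :: "'h::chilbert bop set \<Rightarrow> 'h bop set" where
  "unitaries M = {u \<in> M. adj u * u = 1 \<and> u * adj u = 1}"

definition isometries :: "'h::chilbert bop set \<Rightarrow> 'h bop set" where
  "isometries M = {w \<in> M. adj w * w = 1}"

definition is_factor :: "'h::chilbert bop set \<Rightarrow> bool" where
  "is_factor M \<longleftrightarrow> von_neumann_algebra M \<and> (1 :: 'h bop) \<noteq> 0 \<and>
     M \<inter> commutant M = range (\<lambda>c. scaleOp c 1)"

definition finite_projection :: "'h::chilbert bop set \<Rightarrow> 'h bop \<Rightarrow> bool" where
  "finite_projection M p \<longleftrightarrow> p \<in> M \<and> adj p = p \<and> p * p = p \<and>
     (\<forall>v\<in>M. adj v * v = p \<and> p * (v * adj v) = v * adj v \<longrightarrow> v * adj v = p)"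

definition type_III_factor :: "'h::chilbert bop set \<Rightarrow> bool" where
  "type_III_factor M \<longleftrightarrow> is_factor M \<and> (\<forall>p. finite_projection M p \<longrightarrow> p = 0)"

definition faithful_normal_state :: "'h::chilbert bop set \<Rightarrow> ('h bop \<Rightarrow> complex) \<Rightarrow> bool" where
  "faithful_normal_state M \<phi> \<longleftrightarrow>
     (\<forall>x\<in>M. \<forall>y\<in>M. \<phi> (x + y) = \<phi> x + \<phi> y) \<and>
     (\<forall>c. \<forall>x\<in>M. \<phi> (scaleOp c x) = c * \<phi> x) \<and>
     (\<forall>x\<in>M. Im (\<phi> (adj x * x)) = 0 \<and> 0 \<le> Re (\<phi> (adj x * x))) \<and>
     \<phi> 1 = 1 \<and>
     (\<forall>x\<in>M. \<phi> (adj x * x) = 0 \<longrightarrow> x = 0) \<and>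
     continuous_map (subtopology sigma_weak M) euclidean \<phi>"

text \<open>Maps on an algebra \<open>M\<close> are represented by functions that are undefined outside \<open>M\<close>
  (as in \<^theory>\<open>HOL-Library.FuncSet\<close>), so that equality of maps is equality on \<open>M\<close>.
  Homomorphisms are unital, involutive and normal.\<close>

definition normal_homs ::
  "'h::chilbert bop set \<Rightarrow> 'k::chilbert bop set \<Rightarrow> ('h bop \<Rightarrow> 'k bop) set" where
  "normal_homs M N = {\<phi> \<in> M \<rightarrow>\<^sub>E N.
     (\<forall>x\<in>M. \<forall>y\<in>M. \<phi> (x + y) = \<phi> x + \<phi> y) \<and>
     (\<forall>c. \<forall>x\<in>M. \<phi> (scaleOp c x) = scaleOp c (\<phi> x)) \<and>
     (\<forall>x\<in>M. \<forall>y\<in>M. \<phi> (x * y) = \<phi> x * \<phi> y) \<and>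
     (\<forall>x\<in>M. \<phi> (adj x) = adj (\<phi> x)) \<and>
     \<phi> 1 = 1 \<and>
     continuous_map (subtopology sigma_weak M) (subtopology sigma_weak N) \<phi>}"

type_synonym 'h endo = "'h bop \<Rightarrow> 'h bop"

abbreviation End :: "'h::chilbert bop set \<Rightarrow> 'h endo set" where
  "End M \<equiv> normal_homs M M"

abbreviation id_on :: "'h::chilbert bop set \<Rightarrow> 'h endo" where
  "id_on M \<equiv> (\<lambda>x\<in>M. x)"

text \<open>The intertwiner space \<open>(\<rho>,\<sigma>)\<close> of endomorphisms of \<open>M\<close>.\<close>

definition intertwiners ::
  "'h::chilbert bop set \<Rightarrow> 'h endo \<Rightarrow> 'h endo \<Rightarrow> 'h bop set" where
  "intertwiners M \<rho> \<sigma> = {T \<in> M. \<forall>x\<in>M. T * \<rho> x = \<sigma> x * T}"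

definition Ad :: "'h::chilbert bop set \<Rightarrow> 'h bop \<Rightarrow> 'h endo \<Rightarrow> 'h endo" where
  "Ad M u \<rho> = (\<lambda>x\<in>M. u * \<rho> x * adj u)"

definition unitarily_equivalent ::
  "'h::chilbert bop set \<Rightarrow> 'h endo \<Rightarrow> 'h endo \<Rightarrow> bool" where
  "unitarily_equivalent M \<rho> \<sigma> \<longleftrightarrow> (\<exists>u\<in>unitaries M. \<rho> = Ad M u \<sigma>)"

definition irreducible_endo :: "'h::chilbert bop set \<Rightarrow> 'h endo \<Rightarrow> bool" where
  "irreducible_endo M \<rho> \<longleftrightarrow> intertwiners M \<rho> \<rho> = range (\<lambda>c. scaleOp c 1)"

definition subobject :: "'h::chilbert bop set \<Rightarrow> 'h endo \<Rightarrow> 'h endo \<Rightarrow> bool" where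
  "subobject M \<sigma> \<rho> \<longleftrightarrow> \<sigma> \<in> End M \<and> (\<exists>w\<in>isometries M. w \<in> intertwiners M \<sigma> \<rho>)"

text \<open>\<open>\<sigma>(x) = \<Sum>\<^sub>k w\<^sub>k \<xi>\<^sub>k(x) w\<^sub>k\<^sup>*\<close> with \<open>k\<close> ranging over a finite or infinite set \<open>K\<close> of
  natural numbers.\<close>

definition isometry_family ::
  "'h::chilbert bop set \<Rightarrow> nat set \<Rightarrow> (nat \<Rightarrow> 'h bop) \<Rightarrow> bool" where
  "isometry_family M K w \<longleftrightarrow>
     (\<forall>k\<in>K. w k \<in> isometries M) \<and> strong_sum (\<lambda>k. w k * adj (w k)) K 1"

definition direct_sum ::
  "'h::chilbert bop set \<Rightarrow> nat set \<Rightarrow> (nat \<Rightarrow> 'h bop) \<Rightarrow> (nat \<Rightarrow> 'h endo) \<Rightarrow> 'h endo \<Rightarrow> bool" where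
  "direct_sum M K w \<xi> \<sigma> \<longleftrightarrow> \<sigma> \<in> End M \<and> isometry_family M K w \<and>
     (\<forall>x\<in>M. strong_sum (\<lambda>k. w k * \<xi> k x * adj (w k)) K (\<sigma> x))"

definition normal_cond_exp ::
  "'h::chilbert bop set \<Rightarrow> 'h bop set \<Rightarrow> ('h bop \<Rightarrow> 'h bop) \<Rightarrow> bool" where
  "normal_cond_exp M N E \<longleftrightarrow> E \<in> M \<rightarrow>\<^sub>E N \<and>
     (\<forall>x\<in>M. \<forall>y\<in>M. E (x + y) = E x + E y) \<and>
     (\<forall>c. \<forall>x\<in>M. E (scaleOp c x) = scaleOp c (E x)) \<and>
     (\<forall>x\<in>M. pos_op x \<longrightarrow> pos_op (E x)) \<and>
     (\<forall>n\<in>N. E n = n) \<and>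
     (\<forall>a\<in>N. \<forall>b\<in>N. \<forall>x\<in>M. E (a * x * b) = a * E x * b) \<and>
     continuous_map (subtopology sigma_weak M) (subtopology sigma_weak N) E"

definition faithful_on :: "'h::chilbert bop set \<Rightarrow> ('h bop \<Rightarrow> 'h bop) \<Rightarrow> bool" where
  "faithful_on M E \<longleftrightarrow> (\<forall>x\<in>M. E (adj x * x) = 0 \<longrightarrow> x = 0)"

text \<open>Index by the Pimsner-Popa inequality \<open>E(x) \<ge> c x\<close> for positive \<open>x\<close>: for the infinite factors
  considered here, the index of \<open>E\<close> is \<open>1/c\<close> for the best constant \<open>c\<close>, and the minimal index is the
  minimum over all \<open>E\<close>.\<close>

definition pp_constants :: "'h::chilbert bop set \<Rightarrow> 'h bop set \<Rightarrow> real set" where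
  "pp_constants M N = {c. c > 0 \<and> (\<exists>E. normal_cond_exp M N E \<and>
     (\<forall>x\<in>M. pos_op x \<longrightarrow> pos_op (E x - scaleOp (complex_of_real c) x)))}"

definition minimal_index :: "'h::chilbert bop set \<Rightarrow> 'h bop set \<Rightarrow> real" where
  "minimal_index M N = Inf ((\<lambda>c. 1 / c) ` pp_constants M N)"

definition End0 :: "'h::chilbert bop set \<Rightarrow> 'h endo set" where
  "End0 M = {\<rho> \<in> End M. pp_constants M (\<rho> ` M) \<noteq> {}}"

definition dimension :: "'h::chilbert bop set \<Rightarrow> 'h endo \<Rightarrow> real" where
  "dimension M \<rho> = sqrt (minimal_index M (\<rho> ` M))"

definition conjugate_solution ::
  "'h::chilbert bop set \<Rightarrow> 'h endo \<Rightarrow> 'h endo \<Rightarrow> 'h bop \<Rightarrow> 'h bop \<Rightarrow> bool" where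
  "conjugate_solution M \<rho> \<rho>' R R' \<longleftrightarrow>
     R \<in> intertwiners M (id_on M) (compose M \<rho>' \<rho>) \<and>
     R' \<in> intertwiners M (id_on M) (compose M \<rho> \<rho>') \<and>
     adj R * R = scaleOp (complex_of_real (dimension M \<rho>)) 1 \<and>
     adj R' * R' = scaleOp (complex_of_real (dimension M \<rho>)) 1 \<and>
     adj R * \<rho>' R' = 1 \<and> adj R' * \<rho> R = 1"

section \<open>Opposite algebras and tensor products\<close>

text \<open>The opposite algebra \<open>M\<^sup>o\<^sup>p\<close> is represented by an arbitrary von Neumann algebra \<open>N\<close> on
  some Hilbert space that is isomorphic to it. The isomorphism is recorded through the map
  \<open>j(x) = x\<^sup>*\<close> from \<open>M\<close> to \<open>M\<^sup>o\<^sup>p\<close>, which is a multiplicative conjugate linear bijection; the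
  element \<open>x\<close> of \<open>M\<^sup>o\<^sup>p\<close> is \<open>j(x\<^sup>*)\<close>.\<close>

definition opposite_algebra ::
  "'h::chilbert bop set \<Rightarrow> 'h2::chilbert bop set \<Rightarrow> ('h bop \<Rightarrow> 'h2 bop) \<Rightarrow> bool" where
  "opposite_algebra M N j \<longleftrightarrow> von_neumann_algebra N \<and> bij_betw j M N \<and>
     (\<forall>x\<in>M. \<forall>y\<in>M. j (x + y) = j x + j y) \<and>
     (\<forall>c. \<forall>x\<in>M. j (scaleOp c x) = scaleOp (cnj c) (j x)) \<and>
     (\<forall>x\<in>M. \<forall>y\<in>M. j (x * y) = j x * j y) \<and>
     (\<forall>x\<in>M. j (adj x) = adj (j x))"

text \<open>\<open>'k\<close> is the Hilbert space tensor product of \<open>'h\<close> and \<open>'h2\<close> with elementary tensors \<open>t a b\<close>.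
  The real span in the last clause is a complex subspace, as elementary tensors are closed under
  complex multiples.\<close>

definition hilbert_tensor :: "('h::chilbert \<Rightarrow> 'h2::chilbert \<Rightarrow> 'k::chilbert) \<Rightarrow> bool" where
  "hilbert_tensor t \<longleftrightarrow>
     (\<forall>a a' b. t (a + a') b = t a b + t a' b) \<and>
     (\<forall>a b b'. t a (b + b') = t a b + t a b') \<and>
     (\<forall>c a b. t (c *\<^sub>C a) b = c *\<^sub>C t a b) \<and>
     (\<forall>c a b. t a (c *\<^sub>C b) = c *\<^sub>C t a b) \<and>
     (\<forall>a b a' b'. cinner (t a b) (t a' b') = cinner a a' * cinner b b') \<and>
     closure (span {t a b | a b. True}) = UNIV"

definition tensor_op ::
  "('h::chilbert \<Rightarrow> 'h2::chilbert \<Rightarrow> 'k::chilbert) \<Rightarrow> 'h bop \<Rightarrow> 'h2 bop \<Rightarrow> 'k bop" where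
  "tensor_op t x y = (THE z. \<forall>a b. app z (t a b) = t (app x a) (app y b))"

definition vn_tensor ::
  "('h::chilbert \<Rightarrow> 'h2::chilbert \<Rightarrow> 'k::chilbert) \<Rightarrow> 'h bop set \<Rightarrow> 'h2 bop set \<Rightarrow> 'k bop set" where
  "vn_tensor t M N = vn_generated {tensor_op t x y | x y. x \<in> M \<and> y \<in> N}"

text \<open>\<open>\<Phi> = \<rho> \<otimes> \<tau>\<close>, the unique normal endomorphism with the given values on elementary tensors.\<close>

definition is_tensor_endo ::
  "('h::chilbert \<Rightarrow> 'h2::chilbert \<Rightarrow> 'k::chilbert) \<Rightarrow> 'h bop set \<Rightarrow> 'h2 bop set \<Rightarrow>
   'h endo \<Rightarrow> 'h2 endo \<Rightarrow> 'k endo \<Rightarrow> bool" where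
  "is_tensor_endo t M N \<rho> \<tau> \<Phi> \<longleftrightarrow> \<Phi> \<in> End (vn_tensor t M N) \<and>
     (\<forall>x\<in>M. \<forall>y\<in>N. \<Phi> (tensor_op t x y) = tensor_op t (\<rho> x) (\<tau> y))"

section \<open>The data\<close>

text \<open>The group \<open>G\<close> is the type \<open>'g\<close>; the class \<^class>\<open>group_add\<close> does not assume commutativity.
  The product \<open>gh\<close> is written \<open>g + h\<close>, the inverse \<open>- g\<close> and the neutral element \<open>0\<close>.
  For \<open>\<rho>\<close> in the category, \<open>conjC\<close>, \<open>solR\<close> and \<open>solRbar\<close> give the fixed conjugate and solution of the
  conjugate equation.\<close>

record (overloaded) ('h::chilbert, 'h2::chilbert, 'k::chilbert, 'l::chilbert, 'g::group_add) lr_data =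
  algM :: "'h bop set"
  algMop :: "'h2 bop set"
  jmap :: "'h bop \<Rightarrow> 'h2 bop"
  tens :: "'h \<Rightarrow> 'h2 \<Rightarrow> 'k"
  catC :: "'h endo set"
  irrC :: "'h endo set"
  grC :: "'g \<Rightarrow> 'h endo set"
  conjC :: "'h endo \<Rightarrow> 'h endo"
  solR :: "'h endo \<Rightarrow> 'h bop"
  solRbar :: "'h endo \<Rightarrow> 'h bop"
  algB :: "'l bop set"
  incl :: "'k bop \<Rightarrow> 'l bop"
  lam :: "'h endo \<Rightarrow> 'l bop"
  expB :: "'l bop \<Rightarrow> 'l bop"
  ug :: "'g \<Rightarrow> 'l bop"

definition rigid_tensor_category ::
  "('h::chilbert, 'h2::chilbert, 'k::chilbert, 'l::chilbert, 'g::group_add) lr_data \<Rightarrow> bool" where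
  "rigid_tensor_category D \<longleftrightarrow> (let M = algM D; C = catC D in
     C \<subseteq> End0 M \<and> id_on M \<in> C \<and>
     (\<forall>\<rho>\<in>C. \<forall>\<sigma>\<in>End M. unitarily_equivalent M \<sigma> \<rho> \<longrightarrow> \<sigma> \<in> C) \<and>
     (\<forall>\<rho>\<in>C. \<forall>\<sigma>\<in>C. compose M \<rho> \<sigma> \<in> C) \<and>
     (\<forall>K w \<xi> \<sigma>. finite K \<and> (\<forall>k\<in>K. \<xi> k \<in> C) \<and> direct_sum M K w \<xi> \<sigma> \<longrightarrow> \<sigma> \<in> C) \<and>
     (\<forall>\<rho>\<in>C. \<forall>\<sigma>. subobject M \<sigma> \<rho> \<longrightarrow> \<sigma> \<in> C) \<and>
     (\<forall>\<rho>\<in>C. conjC D \<rho> \<in> C \<and> conjugate_solution M \<rho> (conjC D \<rho>) (solR D \<rho>) (solRbar D \<rho>)))"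

definition irreducible_representatives ::
  "('h::chilbert, 'h2::chilbert, 'k::chilbert, 'l::chilbert, 'g::group_add) lr_data \<Rightarrow> bool" where
  "irreducible_representatives D \<longleftrightarrow>
     countable (irrC D) \<and> id_on (algM D) \<in> irrC D \<and>
     (\<forall>\<xi>\<in>irrC D. \<xi> \<in> catC D \<and> irreducible_endo (algM D) \<xi>) \<and>
     (\<forall>\<rho>\<in>catC D. irreducible_endo (algM D) \<rho> \<longrightarrow>
        (\<exists>!\<xi>. \<xi> \<in> irrC D \<and> unitarily_equivalent (algM D) \<rho> \<xi>))"

definition graded ::
  "('h::chilbert, 'h2::chilbert, 'k::chilbert, 'l::chilbert, 'g::group_add) lr_data \<Rightarrow> bool" where
  "graded D \<longleftrightarrow>
     (\<forall>g. grC D g \<noteq> {}) \<and>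
     (\<forall>\<xi>\<in>catC D. irreducible_endo (algM D) \<xi> \<longrightarrow> (\<exists>!g. \<xi> \<in> grC D g)) \<and>
     (\<forall>g \<sigma>. \<sigma> \<in> grC D g \<longleftrightarrow> \<sigma> \<in> catC D \<and>
        (\<forall>\<xi>. irreducible_endo (algM D) \<xi> \<and> subobject (algM D) \<xi> \<sigma> \<longrightarrow> \<xi> \<in> grC D g)) \<and>
     (\<forall>g h. \<forall>\<rho>\<in>grC D g. \<forall>\<sigma>\<in>grC D h. compose (algM D) \<rho> \<sigma> \<in> grC D (g + h)) \<and>
     (\<forall>g. \<forall>\<rho>\<in>grC D g. conjC D \<rho> \<in> grC D (- g))"

definition op_endo ::
  "('h::chilbert, 'h2::chilbert, 'k::chilbert, 'l::chilbert, 'g::group_add) lr_data \<Rightarrow>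
   'h endo \<Rightarrow> 'h2 endo" where
  "op_endo D \<pi> = (\<lambda>y\<in>algMop D. jmap D (\<pi> (inv_into (algM D) (jmap D) y)))"

definition algA ::
  "('h::chilbert, 'h2::chilbert, 'k::chilbert, 'l::chilbert, 'g::group_add) lr_data \<Rightarrow>
   'k bop set" where
  "algA D = vn_tensor (tens D) (algM D) (algMop D)"

text \<open>The element \<open>x \<otimes> j(y)\<close> of \<open>\<A>\<close>, viewed in \<open>\<B>\<close>.\<close>

definition el ::
  "('h::chilbert, 'h2::chilbert, 'k::chilbert, 'l::chilbert, 'g::group_add) lr_data \<Rightarrow>
   'h bop \<Rightarrow> 'h bop \<Rightarrow> 'l bop" where
  "el D x y = incl D (tensor_op (tens D) x (jmap D y))"

definition longo_rehren ::
  "('h::chilbert, 'h2::chilbert, 'k::chilbert, 'l::chilbert, 'g::group_add) lr_data \<Rightarrow> bool" where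
  "longo_rehren D \<longleftrightarrow> (let M = algM D; A = algA D; C = catC D; \<iota> = incl D; lm = lam D in
     von_neumann_algebra (algB D) \<and>
     \<iota> \<in> normal_homs A (algB D) \<and> inj_on \<iota> A \<and>
     algB D = vn_generated (\<iota> ` A \<union> lm ` C) \<and>
     (\<forall>\<pi>\<in>C. \<exists>\<Phi>. is_tensor_endo (tens D) M (algMop D) \<pi> (op_endo D \<pi>) \<Phi> \<and>
        (\<forall>a\<in>A. lm \<pi> * \<iota> a = \<iota> (\<Phi> a) * lm \<pi>)) \<and>
     (\<forall>\<pi>\<in>C. \<forall>\<rho>\<in>C. lm \<pi> * lm \<rho> = lm (compose M \<pi> \<rho>)) \<and>
     (\<forall>\<pi>\<in>C. adj (lm \<pi>) = adj (el D (solR D \<pi>) (solR D \<pi>)) * lm (conjC D \<pi>)) \<and>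
     (\<forall>\<pi>\<in>C. \<forall>\<rho>\<in>C. \<forall>T\<in>intertwiners M \<pi> \<rho>. el D T 1 * lm \<pi> = el D 1 (adj T) * lm \<rho>) \<and>
     normal_cond_exp (algB D) (\<iota> ` A) (expB D) \<and> faithful_on (algB D) (expB D) \<and>
     (\<forall>a\<in>A. \<forall>\<pi>\<in>irrC D. expB D (\<iota> a * lm \<pi>) = (if \<pi> = id_on M then \<iota> a else 0)))"

definition algBg ::
  "('h::chilbert, 'h2::chilbert, 'k::chilbert, 'l::chilbert, 'g::group_add) lr_data \<Rightarrow> 'g \<Rightarrow>
   'l bop set" where
  "algBg D g = sigma_weak closure_of
     {\<Sum>\<pi>\<in>F. incl D (a \<pi>) * lam D \<pi> | F a.
        finite F \<and> F \<subseteq> irrC D \<inter> grC D g \<and> (\<forall>\<pi>\<in>F. a \<pi> \<in> algA D)}"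

abbreviation algB0 ::
  "('h::chilbert, 'h2::chilbert, 'k::chilbert, 'l::chilbert, 'g::group_add) lr_data \<Rightarrow>
   'l bop set" where
  "algB0 D \<equiv> algBg D 0"

definition lr_setting ::
  "('h::chilbert, 'h2::chilbert, 'k::chilbert, 'l::chilbert, 'g::group_add) lr_data \<Rightarrow> bool" where
  "lr_setting D \<longleftrightarrow>
     type_III_factor (algM D) \<and> (\<exists>\<phi>. faithful_normal_state (algM D) \<phi>) \<and>
     opposite_algebra (algM D) (algMop D) (jmap D) \<and> hilbert_tensor (tens D) \<and>
     rigid_tensor_category D \<and> irreducible_representatives D \<and> graded D \<and> longo_rehren D \<and>
     (\<forall>g. ug D g \<in> unitaries (algB D) \<and> ug D g \<in> algBg D g) \<and>
     (\<forall>g h. ug D g * ug D h = ug D (g + h))"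

section \<open>The relative Drinfeld center as endomorphisms of \<open>\<B>\<^sub>0\<close>\<close>

definition beta ::
  "('h::chilbert, 'h2::chilbert, 'k::chilbert, 'l::chilbert, 'g::group_add) lr_data \<Rightarrow> 'g \<Rightarrow>
   'l endo" where
  "beta D g = (\<lambda>x\<in>algB0 D. ug D g * x * adj (ug D g))"

text \<open>\<open>g[\<theta>]\<close>; as \<open>\<beta>\<close> is an action, \<open>\<beta>\<^sub>g\<close> has the inverse \<open>\<beta> (- g)\<close>.\<close>

definition gact ::
  "('h::chilbert, 'h2::chilbert, 'k::chilbert, 'l::chilbert, 'g::group_add) lr_data \<Rightarrow> 'g \<Rightarrow>
   'l endo \<Rightarrow> 'l endo" where
  "gact D g \<theta> = (\<lambda>x\<in>algB0 D. beta D g (\<theta> (beta D (- g) x)))"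

text \<open>Countable direct sums of elements of \<open>Irr(\<C>)\<close>, respectively of \<open>Irr(\<C>\<^sub>g)\<close>.\<close>

definition dsums ::
  "('h::chilbert, 'h2::chilbert, 'k::chilbert, 'l::chilbert, 'g::group_add) lr_data \<Rightarrow>
   'h endo set" where
  "dsums D = {\<sigma>. \<exists>K w \<xi>. direct_sum (algM D) K w \<xi> \<sigma> \<and> (\<forall>k\<in>K. \<xi> k \<in> irrC D)}"

definition dsums_deg ::
  "('h::chilbert, 'h2::chilbert, 'k::chilbert, 'l::chilbert, 'g::group_add) lr_data \<Rightarrow> 'g \<Rightarrow>
   'h endo set" where
  "dsums_deg D g = {\<sigma>. \<exists>K w \<xi>. direct_sum (algM D) K w \<xi> \<sigma> \<and> (\<forall>k\<in>K. \<xi> k \<in> irrC D \<inter> grC D g)}"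

definition half_braiding ::
  "('h::chilbert, 'h2::chilbert, 'k::chilbert, 'l::chilbert, 'g::group_add) lr_data \<Rightarrow>
   'h endo \<Rightarrow> ('h endo \<Rightarrow> 'h bop) \<Rightarrow> bool" where
  "half_braiding D \<sigma> e \<longleftrightarrow> (let M = algM D; C0 = grC D 0 in
     \<sigma> \<in> dsums D \<and>
     (\<forall>\<pi>\<in>C0. e \<pi> \<in> unitaries M \<and> e \<pi> \<in> intertwiners M (compose M \<sigma> \<pi>) (compose M \<pi> \<sigma>)) \<and>
     (\<forall>\<pi>\<in>C0. \<forall>\<rho>\<in>C0. e (compose M \<pi> \<rho>) = \<pi> (e \<rho>) * e \<pi>) \<and>
     (\<forall>\<pi>\<in>C0. \<forall>\<rho>\<in>C0. \<forall>T\<in>intertwiners M \<pi> \<rho>. e \<rho> * \<sigma> T = T * e \<pi>))"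

text \<open>\<open>\<theta> = \<eta>(\<sigma>, e)\<close>; the endomorphism \<open>\<theta>\<close> of \<open>\<B>\<^sub>0\<close> is determined by its values on \<open>\<A>\<close> and on
  the \<open>\<lambda>\<^sub>\<pi>\<close>.\<close>

definition is_eta ::
  "('h::chilbert, 'h2::chilbert, 'k::chilbert, 'l::chilbert, 'g::group_add) lr_data \<Rightarrow>
   'h endo \<Rightarrow> ('h endo \<Rightarrow> 'h bop) \<Rightarrow> 'l endo \<Rightarrow> bool" where
  "is_eta D \<sigma> e \<theta> \<longleftrightarrow> half_braiding D \<sigma> e \<and> \<theta> \<in> End (algB0 D) \<and>
     (\<exists>\<Phi>. is_tensor_endo (tens D) (algM D) (algMop D) \<sigma> (id_on (algMop D)) \<Phi> \<and>
        (\<forall>a\<in>algA D. \<theta> (incl D a) = incl D (\<Phi> a))) \<and>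
     (\<forall>\<pi>\<in>grC D 0. \<theta> (lam D \<pi>) = el D (adj (e \<pi>)) 1 * lam D \<pi>)"

definition Zcat ::
  "('h::chilbert, 'h2::chilbert, 'k::chilbert, 'l::chilbert, 'g::group_add) lr_data \<Rightarrow>
   'l endo set" where
  "Zcat D = {\<theta> \<in> End (algB0 D). \<exists>\<sigma> e \<theta>'. is_eta D \<sigma> e \<theta>' \<and>
     unitarily_equivalent (algB0 D) \<theta> \<theta>'}"

definition Zdeg ::
  "('h::chilbert, 'h2::chilbert, 'k::chilbert, 'l::chilbert, 'g::group_add) lr_data \<Rightarrow> 'g \<Rightarrow>
   'l endo set" where
  "Zdeg D g = {\<theta> \<in> End (algB0 D). \<exists>\<sigma> e \<theta>'. \<sigma> \<in> dsums_deg D g \<and> is_eta D \<sigma> e \<theta>' \<and>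
     unitarily_equivalent (algB0 D) \<theta> \<theta>'}"

definition Vfin ::
  "('h::chilbert, 'h2::chilbert, 'k::chilbert, 'l::chilbert, 'g::group_add) lr_data \<Rightarrow> 'g \<Rightarrow>
   'h endo \<Rightarrow> 'l bop" where
  "Vfin D g \<sigma> = el D 1 (adj (solRbar D \<sigma>)) * (lam D \<sigma> * adj (ug D g))"

text \<open>\<open>V\<close> is an operator \<open>V\<^sub>\<sigma>\<close> for \<open>\<sigma>\<close> of degree \<open>g\<close>. Among the countable direct sums, the ones of
  finite dimension are those in \<open>\<C>\<close>. If \<open>\<sigma>\<close> has infinite dimension, then \<open>V\<^sub>\<sigma>\<close> depends on the chosen
  decomposition \<open>(w\<^sub>k, \<xi>\<^sub>k)\<close> of \<open>\<sigma>\<close> and on the isometries \<open>v\<^sub>k\<close> that define the conjugate of \<open>\<sigma>\<close>;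
  all choices are admitted.\<close>

definition is_V ::
  "('h::chilbert, 'h2::chilbert, 'k::chilbert, 'l::chilbert, 'g::group_add) lr_data \<Rightarrow> 'g \<Rightarrow>
   'h endo \<Rightarrow> 'l bop \<Rightarrow> bool" where
  "is_V D g \<sigma> V \<longleftrightarrow> (if \<sigma> \<in> catC D then V = Vfin D g \<sigma>
     else (\<exists>K w \<xi> v. direct_sum (algM D) K w \<xi> \<sigma> \<and> (\<forall>k\<in>K. \<xi> k \<in> irrC D \<inter> grC D g) \<and>
        isometry_family (algM D) K v \<and>
        strong_sum (\<lambda>k. el D (w k) 1 * Vfin D g (\<xi> k) * beta D g (el D 1 (adj (v k)))) K V))"

text \<open>\<open>W\<close> is the value \<open>\<E>(\<theta>\<^sub>1, \<theta>\<^sub>2)\<close> computed from presentations \<open>\<theta>\<^sub>1 = Ad u \<circ> \<sigma>t\<close>,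
  \<open>\<theta>\<^sub>2 = Ad v \<circ> \<rho>t\<close> by \<open>\<eta>\<close>-extensions \<open>\<sigma>t\<close> (of degree \<open>g\<close>) and \<open>\<rho>t\<close>.\<close>

definition braiding_value ::
  "('h::chilbert, 'h2::chilbert, 'k::chilbert, 'l::chilbert, 'g::group_add) lr_data \<Rightarrow>
   'l endo \<Rightarrow> 'l endo \<Rightarrow> 'l bop \<Rightarrow> bool" where
  "braiding_value D \<theta>1 \<theta>2 W \<longleftrightarrow>
     (\<exists>g \<sigma> e \<sigma>t \<rho> f \<rho>t V. \<exists>u\<in>unitaries (algB0 D). \<exists>v\<in>unitaries (algB0 D).
        \<sigma> \<in> dsums_deg D g \<and> is_eta D \<sigma> e \<sigma>t \<and> is_eta D \<rho> f \<rho>t \<and> is_V D g \<sigma> V \<and>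
        \<theta>1 = Ad (algB0 D) u \<sigma>t \<and> \<theta>2 = Ad (algB0 D) v \<rho>t \<and>
        W = beta D g v * gact D g \<rho>t u * (gact D g \<rho>t V * adj V) * adj u * \<theta>1 (adj v))"

definition braiding ::
  "('h::chilbert, 'h2::chilbert, 'k::chilbert, 'l::chilbert, 'g::group_add) lr_data \<Rightarrow>
   'l endo \<Rightarrow> 'l endo \<Rightarrow> 'l bop" where
  "braiding D \<theta>1 \<theta>2 = (THE W. braiding_value D \<theta>1 \<theta>2 W)"

end

theory Submission
  imports Defs
begin

text \<open>An \<open>\<eta>\<close>-extension \<open>\<rho>t\<close> fixes \<open>1 \<otimes> M\<^sup>o\<^sup>p\<close>. If \<open>\<sigma>t\<close> is an \<open>\<eta>\<close>-extension of degree \<open>g\<close>, then the unitary \<open>V\<^sub>\<sigma>\<close>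
  satisfies \<open>V\<^sub>\<sigma> \<beta>\<^sub>g(x \<otimes> 1) = (\<sigma>(x) \<otimes> 1) V\<^sub>\<sigma>\<close>, so that \<open>\<sigma>t = \<beta>\<^sub>g \<circ> Ad X \<circ> \<alpha>\<close> with \<open>X = \<beta>\<^sub>g\<^sup>-\<^sup>1(V\<^sub>\<sigma>)\<close> and an endomorphism
  \<open>\<alpha>\<close> fixing \<open>M \<otimes> 1\<close>. As \<open>M \<otimes> 1\<close> and \<open>1 \<otimes> M\<^sup>o\<^sup>p\<close> are relative commutants of each other in \<open>\<B>\<^sub>0\<close>,
  endomorphisms fixing \<open>M \<otimes> 1\<close> commute with endomorphisms fixing \<open>1 \<otimes> M\<^sup>o\<^sup>p\<close>. The braiding of
  \<open>\<theta>\<^sub>1 = \<beta>\<^sub>g \<circ> Ad X \<circ> \<alpha>\<close> and \<open>\<theta>\<^sub>2 = Ad v \<circ> \<rho>\<close> is \<open>\<beta>\<^sub>g(v \<rho>(X) \<alpha>(v\<^sup>*) X\<^sup>*)\<close>. It does not depend on the presentations,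
  since the choices of \<open>X\<close> and \<open>v\<close> differ by elements of \<open>1 \<otimes> M\<^sup>o\<^sup>p\<close> and \<open>M \<otimes> 1\<close>, and the axioms become
  formal consequences of \<open>\<alpha>\<rho> = \<rho>\<alpha>\<close>. It remains to see that the center is closed under composition and
  under the action of \<open>G\<close>, that is, that the endomorphisms of \<open>M\<close> induced by the composed and the
  translated \<open>\<eta>\<close>-extensions are again countable direct sums of irreducibles of \<open>\<C>\<close>.\<close>

section \<open>Hilbert spaces\<close>

text \<open>The relative commutants come from Fourier coefficients. In a nonzero degree the same
  argument gives T = 0, which makes the degree of an endomorphism unique. The obstacle in the graded
  setting is that \<open>\<beta>\<^sub>h\<close> need not preserve M \<otimes> 1 or 1 \<otimes>
  M^op, so products and translates of presentations are not presentations as they stand. They are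
  repaired with V of an arbitrary object of degree h, whose choice cancels in the braiding. Infinite
  direct sums are never composed term by term. Being such a sum is expressed by
  \<open>generated_by\<close>, which passes to compositions by Frobenius reciprocity; conversely
  Zorn's lemma yields a decomposition, and the faithful normal state makes it countable.\<close>

lemma min_dist_attained:
  fixes S :: "'a::{real_inner, complete_space} set"
  assumes "closed S" "convex S" "S \<noteq> {}"
  shows "\<exists>s\<in>S. \<forall>t\<in>S. norm (x - s) \<le> norm (x - t)"
proof -
  define d where "d = infdist x S"
  have dle: "d \<le> norm (x - t)" if "t \<in> S" for t
    using infdist_le[OF that, of x] by (simp add: d_def dist_norm)
  have d0: "d \<ge> 0" by (simp add: d_def infdist_nonneg)
  have "\<exists>t\<in>S. (norm (x - t))\<^sup>2 < d\<^sup>2 + 1 / real (Suc n)" for n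
  proof -
    have "d < sqrt (d\<^sup>2 + 1 / real (Suc n))"
      using d0 by (intro real_less_rsqrt) simp
    then obtain y where y: "y \<in> dist x ` S" "y < sqrt (d\<^sup>2 + 1 / real (Suc n))"
      using cInf_lessD[of "dist x ` S" "sqrt (d\<^sup>2 + 1 / real (Suc n))"] assms(3)
      by (simp add: d_def infdist_def) blast
    then obtain t where t: "t \<in> S" "dist x t < sqrt (d\<^sup>2 + 1 / real (Suc n))" by blast
    then have "(norm (x - t))\<^sup>2 < (sqrt (d\<^sup>2 + 1 / real (Suc n)))\<^sup>2"
      by (intro power_strict_mono) (auto simp: dist_norm)
    moreover have "(sqrt (d\<^sup>2 + 1 / real (Suc n)))\<^sup>2 = d\<^sup>2 + 1 / real (Suc n)"
      by (rule real_sqrt_pow2) simp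
    ultimately show ?thesis using t(1) by metis
  qed
  then obtain t where tS: "\<And>n. t n \<in> S" and t: "\<And>n. (norm (x - t n))\<^sup>2 < d\<^sup>2 + 1 / real (Suc n)"
    by metis
  \<comment> \<open>The parallelogram identity: the midpoint of two points of the minimizing
    sequence lies in the convex set, so its distance to x is at least d, and this forces the two
    points together.\<close>
  have par: "(norm (t m - t n))\<^sup>2 \<le> 2 / real (Suc m) + 2 / real (Suc n)" for m n
  proof -
    have "(1/2) *\<^sub>R t m + (1/2) *\<^sub>R t n \<in> S"
      using assms(2) tS by (simp add: convexD)
    from dle[OF this] have "d\<^sup>2 \<le> (norm (x - ((1/2) *\<^sub>R t m + (1/2) *\<^sub>R t n)))\<^sup>2"
      using d0 by (intro power_mono)
    moreover have "4 * (norm (x - ((1/2) *\<^sub>R t m + (1/2) *\<^sub>R t n)))\<^sup>2 + (norm (t m - t n))\<^sup>2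
        = 2 * (norm (x - t m))\<^sup>2 + 2 * (norm (x - t n))\<^sup>2"
      unfolding power2_norm_eq_inner by (simp add: algebra_simps inner_commute)
    ultimately show ?thesis using t[of m] t[of n] by (simp add: algebra_simps)
  qed
  have "Cauchy t"
  proof (rule metric_CauchyI)
    fix e :: real assume "e > 0"
    obtain N where N: "4 / e\<^sup>2 < real N" using reals_Archimedean2 by blast
    have "dist (t m) (t n) < e" if "m \<ge> N" "n \<ge> N" for m n
    proof -
      have N0: "real N > 0" using N \<open>e > 0\<close> by (meson divide_pos_pos less_trans zero_less_numeral zero_less_power)
      have *: "2 / real (Suc k) \<le> 2 / real N" if "k \<ge> N" for k
        using that N0 by (intro divide_left_mono) auto
      have "(norm (t m - t n))\<^sup>2 \<le> 4 / real N"
        using par[of m n] *[OF that(1)] *[OF that(2)] by simp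
      also have "\<dots> < e\<^sup>2" using N N0 \<open>e > 0\<close> by (simp add: field_simps)
      finally have "norm (t m - t n) < e" using \<open>e > 0\<close> by (auto intro: power2_less_imp_less[rotated])
      then show ?thesis by (simp add: dist_norm)
    qed
    then show "\<exists>M. \<forall>m\<ge>M. \<forall>n\<ge>M. dist (t m) (t n) < e" by blast
  qed
  then obtain s where s: "t \<longlonglongrightarrow> s" using Cauchy_convergent convergent_def by blast
  have sS: "s \<in> S" using closed_sequentially[OF assms(1)] tS s by blast
  have "(\<lambda>n. (norm (x - t n))\<^sup>2) \<longlonglongrightarrow> (norm (x - s))\<^sup>2"
    by (intro tendsto_intros s)
  moreover have "(\<lambda>n. d\<^sup>2 + 1 / real (Suc n)) \<longlonglongrightarrow> d\<^sup>2 + 0"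
    by (intro tendsto_intros LIMSEQ_Suc lim_inverse_n'[unfolded])
  ultimately have "(norm (x - s))\<^sup>2 \<le> d\<^sup>2 + 0"
    by (rule LIMSEQ_le) (use t less_imp_le in blast)
  then have "norm (x - s) \<le> d" using d0 by (auto intro: power2_le_imp_le)
  then show ?thesis using sS dle by force
qed

lemma orthogonal_decomposition:
  fixes S :: "'a::{real_inner, complete_space} set"
  assumes "closed S" "subspace S"
  shows "\<exists>s\<in>S. \<forall>t\<in>S. inner (x - s) t = 0"
proof -
  obtain s where s: "s \<in> S" "\<And>t. t \<in> S \<Longrightarrow> norm (x - s) \<le> norm (x - t)"
    using min_dist_attained[OF assms(1) subspace_imp_convex[OF assms(2)]] subspace_0[OF assms(2)]
    by (metis empty_iff)
  have "inner (x - s) t = 0" if t: "t \<in> S" for t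
  proof (cases "t = 0")
    case False
    \<comment> \<open>The point s + c t is the one closest to x on the line through s in direction
      t; minimality of s then forces the inner product to vanish.\<close>
    define c where "c = inner (x - s) t / (inner t t)"
    have tt: "inner t t > 0" using False by simp
    have "s + c *\<^sub>R t \<in> S" using s(1) t assms(2) by (simp add: subspace_add subspace_scale)
    from s(2)[OF this] have "(norm (x - s))\<^sup>2 \<le> (norm (x - (s + c *\<^sub>R t)))\<^sup>2" by (intro power_mono) auto
    then have "2 * c * inner (x - s) t \<le> c * c * inner t t"
      unfolding power2_norm_eq_inner by (simp add: algebra_simps inner_commute)
    then have "2 * (inner (x - s) t)\<^sup>2 \<le> (inner (x - s) t)\<^sup>2"
      using tt by (simp add: c_def power2_eq_square field_simps)
    then show ?thesis by simp
  qed simp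
  then show ?thesis using s(1) by blast
qed

section \<open>Calculus of the complex inner product and the Riesz representation\<close>

lemma cinner_zero_right [simp]: "cinner x (0::'a::chilbert) = 0"
  using cinner_add_right[of x 0 0] by simp
lemma cinner_zero_left [simp]: "cinner (0::'a::chilbert) x = 0"
  using cinner_commute[of 0 x] by simp
lemma cinner_add_left: "cinner (x + y) (z::'a::chilbert) = cinner x z + cinner y z"
  by (metis cinner_add_right cinner_commute complex_cnj_add)
lemma cinner_scaleC_left: "cinner (c *\<^sub>C x) (y::'a::chilbert) = cnj c * cinner x y"
  by (metis cinner_scaleC_right cinner_commute complex_cnj_mult)
lemma scaleC_minus_one: "(- 1) *\<^sub>C x = - (x::'a::chilbert)"
  using scaleC_of_real[of "-1" x] by simp
lemma scaleC_one [simp]: "1 *\<^sub>C x = (x::'a::chilbert)"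
  using scaleC_of_real[of 1 x] by simp
lemma cinner_minus_right: "cinner x (- y::'a::chilbert) = - cinner x y"
  using cinner_scaleC_right[of x "-1" y] by (simp add: scaleC_minus_one)
lemma cinner_minus_left: "cinner (- x::'a::chilbert) y = - cinner x y"
  using cinner_scaleC_left[of "-1" x y] by (simp add: scaleC_minus_one)
lemma cinner_diff_right: "cinner x (y - z::'a::chilbert) = cinner x y - cinner x z"
  using cinner_add_right[of x y "- z"] by (simp add: cinner_minus_right)
lemma cinner_diff_left: "cinner (x - y::'a::chilbert) z = cinner x z - cinner y z"
  using cinner_add_left[of x "- y" z] by (simp add: cinner_minus_left)
lemma scaleR_scaleC: "r *\<^sub>R x = complex_of_real r *\<^sub>C (x::'a::chilbert)"
  by (simp add: scaleC_of_real)
lemma cinner_scaleR_right: "cinner x (r *\<^sub>R y::'a::chilbert) = complex_of_real r * cinner x y"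
  by (simp add: scaleR_scaleC cinner_scaleC_right)
lemma cinner_scaleR_left: "cinner (r *\<^sub>R x::'a::chilbert) y = complex_of_real r * cinner x y"
  by (simp add: scaleR_scaleC cinner_scaleC_left)
lemma cinner_self: "cinner x (x::'a::chilbert) = complex_of_real ((norm x)\<^sup>2)"
proof -
  have "Im (cinner x x) = 0" using cinner_commute[of x x] by (metis complex_cnj_cancel_iff Reals_cnj_iff complex_is_Real_iff)
  then show ?thesis by (simp add: complex_eq_iff power2_norm_eq_inner inner_eq_Re_cinner)
qed
lemma cinner_ext: "(\<And>z. cinner z x = cinner z y) \<Longrightarrow> x = (y::'a::chilbert)"
  using cinner_self[of "x - y"] cinner_diff_right[of "x - y" x y] by simp
lemma cinner_ext_left: "(\<And>z. cinner x z = cinner y z) \<Longrightarrow> x = (y::'a::chilbert)"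
  by (metis cinner_ext cinner_commute)
lemma norm_scaleC: "norm (c *\<^sub>C (x::'a::chilbert)) = cmod c * norm x"
proof -
  have "complex_of_real ((norm (c *\<^sub>C x))\<^sup>2) = (c * cnj c) * cinner x x"
    unfolding cinner_self[symmetric] by (simp add: cinner_scaleC_left cinner_scaleC_right)
  also have "\<dots> = complex_of_real ((cmod c * norm x)\<^sup>2)"
    unfolding complex_norm_square[symmetric] cinner_self by (simp add: power_mult_distrib)
  finally have "complex_of_real ((norm (c *\<^sub>C x))\<^sup>2) = complex_of_real ((cmod c * norm x)\<^sup>2)" .
  then have "(norm (c *\<^sub>C x))\<^sup>2 = (cmod c * norm x)\<^sup>2" by (simp only: of_real_eq_iff)
  then show ?thesis by (simp add: power2_eq_iff_nonneg)
qed
lemma cmod_cinner_le: "cmod (cinner x (y::'a::chilbert)) \<le> norm x * norm y"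
proof (cases "cinner x y = 0")
  case False
  \<comment> \<open>A unimodular factor rotates the value onto the positive axis, where the real
    Cauchy-Schwarz inequality applies.\<close>
  define c where "c = cnj (cinner x y) / complex_of_real (cmod (cinner x y))"
  have c: "cmod c = 1" using False by (simp add: c_def norm_divide)
  have "c * cinner x y = complex_of_real (cmod (cinner x y))"
    using False complex_norm_square[of "cinner x y"] by (simp add: c_def power2_eq_square field_simps)
  then have "cmod (cinner x y) = inner x (c *\<^sub>C y)"
    by (simp add: inner_eq_Re_cinner cinner_scaleC_right)
  also have "\<dots> \<le> norm x * norm (c *\<^sub>C y)" by (rule norm_cauchy_schwarz)
  finally show ?thesis by (simp add: norm_scaleC c)
qed simp
lemma cinner_inner: "cinner x (y::'a::chilbert) = Complex (inner x y) (inner (\<i> *\<^sub>C x) y)"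
  by (simp add: complex_eq_iff inner_eq_Re_cinner cinner_scaleC_left)
lemma bounded_linear_cinner_right: "bounded_linear (\<lambda>y::'a::chilbert. cinner x y)"
  by (rule bounded_linear_intro[where K="norm x"])
    (auto simp: cinner_add_right cinner_scaleR_right scaleR_conv_of_real mult.commute[of "norm x"] intro: order_trans[OF cmod_cinner_le])
lemma bounded_linear_cinner_left: "bounded_linear (\<lambda>x::'a::chilbert. cinner x y)"
  by (rule bounded_linear_intro[where K="norm y"])
    (auto simp: cinner_add_left cinner_scaleR_left scaleR_conv_of_real intro: order_trans[OF cmod_cinner_le])
lemmas tendsto_cinner_right = bounded_linear.tendsto[OF bounded_linear_cinner_right]
lemmas tendsto_cinner_left = bounded_linear.tendsto[OF bounded_linear_cinner_left]
lemma riesz: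
  fixes f :: "'a::{real_inner, complete_space} \<Rightarrow> real"
  assumes "bounded_linear f"
  shows "\<exists>y. \<forall>x. f x = inner y x"
proof (cases "\<forall>x. f x = 0")
  case False
  then obtain z where z: "f z \<noteq> 0" by blast
  interpret f: bounded_linear f by fact
  define S where "S = {x. f x = 0}"
  have "closed S" unfolding S_def
    by (intro closed_Collect_eq linear_continuous_on assms continuous_intros)
  moreover have "subspace S" by (auto simp: S_def subspace_def f.zero f.add f.scaleR)
  ultimately obtain s where s: "s \<in> S" "\<And>t. t \<in> S \<Longrightarrow> inner (z - s) t = 0"
    using orthogonal_decomposition by blast
  define w where "w = z - s"
  have fw: "f w \<noteq> 0" using z s(1) by (simp add: w_def f.diff S_def)
  have ww: "inner w w \<noteq> 0" using fw by (auto simp: f.zero)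
  have "f x = inner ((f w / inner w w) *\<^sub>R w) x" for x
  proof -
    have "x - (f x / f w) *\<^sub>R w \<in> S" using fw by (simp add: S_def f.diff f.scaleR)
    from s(2)[OF this] have "inner w x = (f x / f w) * inner w w" by (simp add: w_def[symmetric] inner_diff_right)
    then show ?thesis using fw ww by (simp add: field_simps)
  qed
  then show ?thesis by blast
qed (auto intro: exI[of _ 0])

section \<open>Bounded operators\<close>

lemma app_bounded_linear: "bounded_linear (app x)" using app[of x] by simp
lemma app_scaleC: "app x (c *\<^sub>C a) = c *\<^sub>C app x a" using app[of x] by simp
lemma app_add: "app x (a + b) = app x a + app x b"
  by (rule linear_add[OF bounded_linear.linear[OF app_bounded_linear]])
lemma app_diff: "app x (a - b) = app x a - app x b"
  by (rule linear_diff[OF bounded_linear.linear[OF app_bounded_linear]])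
lemma app_zero [simp]: "app x 0 = 0"
  by (rule linear_0[OF bounded_linear.linear[OF app_bounded_linear]])
lemma app_scaleR: "app x (r *\<^sub>R a) = r *\<^sub>R app x a"
  by (rule linear_cmul[OF bounded_linear.linear[OF app_bounded_linear]])
lemmas tendsto_app = bounded_linear.tendsto[OF app_bounded_linear]
lemma continuous_on_app: "continuous_on S (app x)"
  by (rule linear_continuous_on[OF app_bounded_linear])
lemma app_plus_op [simp]: "app (x + y) a = app x a + app y a" by transfer simp
lemma app_diff_op [simp]: "app (x - y) a = app x a - app y a" by transfer simp
lemma app_minus_op [simp]: "app (- x) a = - app x a" by transfer simp
lemma app_times [simp]: "app (x * y) a = app x (app y a)" by transfer simp
lemma app_zero_op [simp]: "app 0 a = 0" by transfer simp
lemma app_one [simp]: "app 1 a = a" by transfer simp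
lemma app_scaleOp [simp]: "app (scaleOp c x) a = c *\<^sub>C app x a" by transfer simp
lemma app_sum_op: "app (sum f A) a = (\<Sum>k\<in>A. app (f k) a)"
  by (induction A rule: infinite_finite_induct) auto
lemma bop_eqI: "(\<And>a. app x a = app y a) \<Longrightarrow> x = y"
  by (metis app_inverse ext)
lemma bop_eqI_cinner: "(\<And>a b. cinner a (app x b) = cinner a (app y b)) \<Longrightarrow> x = y"
  by (intro bop_eqI cinner_ext) auto
lemma app_bound: "\<exists>c>0. \<forall>a. norm (app x a) \<le> c * norm a"
  using bounded_linear.pos_bounded[OF app_bounded_linear] by (metis mult.commute)

lemma scaleC_zero_left [simp]: "0 *\<^sub>C x = (0::'a::chilbert)"
  using scaleC_of_real[of 0 x] by simp
lemma scaleOp_one [simp]: "scaleOp 1 x = x" by (rule bop_eqI) simp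
lemma scaleOp_zero [simp]: "scaleOp 0 x = 0" by (rule bop_eqI) simp
lemma scaleOp_zero_right [simp]: "scaleOp c 0 = 0" by (rule bop_eqI) (simp add: scaleC_zero_right)
lemma scaleOp_scaleOp [simp]: "scaleOp c (scaleOp d x) = scaleOp (c * d) x"
  by (rule bop_eqI) (simp add: scaleC_scaleC)
lemma scaleOp_times_left [simp]: "scaleOp c x * y = scaleOp c (x * y)" by (rule bop_eqI) simp
lemma scaleOp_times_right [simp]: "x * scaleOp c y = scaleOp c (x * y)"
  by (rule bop_eqI) (simp add: app_scaleC)
lemma scaleOp_add: "scaleOp c (x + y) = scaleOp c x + scaleOp c y"
  by (rule bop_eqI) (simp add: scaleC_add_right)
lemma scaleOp_diff: "scaleOp c (x - y) = scaleOp c x - scaleOp c y"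
  by (rule bop_eqI) (simp add: scaleC_diff_right)
lemma scaleOp_add_left: "scaleOp (c + d) x = scaleOp c x + scaleOp d x"
  by (rule bop_eqI) (simp add: scaleC_add_left)
lemma scaleOp_minus_one: "scaleOp (- 1) x = - x" by (rule bop_eqI) (simp add: scaleC_minus_one)
lemma scaleOp_eq_0_iff: "scaleOp c x = 0 \<longleftrightarrow> c = 0 \<or> x = 0"
proof (cases "c = 0")
  case False
  have "x = scaleOp (inverse c) (scaleOp c x)" using False by simp
  then show ?thesis using False by fastforce
qed simp
lemma Bop_app:
  assumes "bounded_linear f" "\<And>c x. f (c *\<^sub>C x) = c *\<^sub>C f x"
  shows "app (Bop f) a = f a"
  using assms by (simp add: Bop_inverse)

lemma bop_of_bound:
  assumes "\<And>x y. f (x + y) = f x + f y" "\<And>c x. f (c *\<^sub>C x) = c *\<^sub>C f x" "\<And>x. norm (f x) \<le> K * norm x"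
  shows "\<exists>y. app y = f"
proof -
  have "bounded_linear f"
    by (rule bounded_linear_intro[where K=K])
      (use assms in \<open>auto simp: mult.commute[of K] scaleR_scaleC\<close>)
  then show ?thesis using Bop_app[of f] assms(2) by blast
qed

lemma adjoint_exists: "\<exists>y. \<forall>a b. cinner (app y a) b = cinner a (app x b)"
proof -
  have "\<exists>z. \<forall>b. cinner z b = cinner a (app x b)" for a
  proof -
    have "bounded_linear (\<lambda>b. inner a (app x b))"
      by (rule bounded_linear_compose[OF bounded_linear_inner_right app_bounded_linear])
    from riesz[OF this] obtain z where z: "\<And>b. inner a (app x b) = inner z b" by blast
    \<comment> \<open>The real Riesz theorem only matches real parts; replacing b by -\<i> b
      supplies the imaginary part.\<close>
    have "cinner z b = cinner a (app x b)" for b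
    proof -
      have "Re (cinner z b) = Re (cinner a (app x b))" for b
        using z[of b] by (simp add: inner_eq_Re_cinner)
      from this[of b] this[of "(- \<i>) *\<^sub>C b"] show ?thesis
        by (simp add: app_scaleC cinner_scaleC_right complex_eq_iff)
    qed
    then show ?thesis by blast
  qed
  then obtain f where f: "\<And>a b. cinner (f a) b = cinner a (app x b)" by metis
  obtain K where K: "K > 0" "\<And>a. norm (app x a) \<le> K * norm a" using app_bound by blast
  have "\<exists>y. app y = f"
  proof (rule bop_of_bound)
    show "f (a + b) = f a + f b" for a b by (rule cinner_ext_left) (simp add: f cinner_add_left)
    show "f (c *\<^sub>C a) = c *\<^sub>C f a" for c a by (rule cinner_ext_left) (simp add: f cinner_scaleC_left)
    show "norm (f a) \<le> K * norm a" for a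
    proof (cases "f a = 0")
      case True then show ?thesis using K(1) by simp
    next
      case False
      have "(norm (f a))\<^sup>2 = cmod (cinner (f a) (f a))" by (simp add: cinner_self norm_power)
      also have "\<dots> = cmod (cinner a (app x (f a)))" by (simp add: f)
      also have "\<dots> \<le> norm a * norm (app x (f a))" by (rule cmod_cinner_le)
      also have "\<dots> \<le> norm a * (K * norm (f a))" by (intro mult_left_mono K) auto
      finally show ?thesis using False by (simp add: power2_eq_square mult.commute mult.left_commute)
    qed
  qed
  then show ?thesis using f by metis
qed

lemma cinner_adj: "cinner (app (adj x) a) b = cinner a (app x b)"
proof -
  have "\<exists>!y. \<forall>a b. cinner (app y a) b = cinner a (app x b)"
    using adjoint_exists[of x] by (metis bop_eqI cinner_ext_left)
  from theI'[OF this] show ?thesis unfolding adj_def by blast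
qed
lemma cinner_adj': "cinner a (app (adj x) b) = cinner (app x a) b"
  by (metis cinner_adj cinner_commute)
lemma adj_eqI: "(\<And>a b. cinner (app y a) b = cinner a (app x b)) \<Longrightarrow> adj x = y"
  by (intro bop_eqI cinner_ext_left) (simp add: cinner_adj)
lemma adj_adj [simp]: "adj (adj x) = x" by (rule adj_eqI) (simp add: cinner_adj')
lemma adj_mult [simp]: "adj (x * y) = adj y * adj x" by (rule adj_eqI) (simp add: cinner_adj)
lemma adj_add [simp]: "adj (x + y) = adj x + adj y"
  by (rule adj_eqI) (simp add: cinner_adj cinner_add_left cinner_add_right)
lemma adj_diff [simp]: "adj (x - y) = adj x - adj y"
  by (rule adj_eqI) (simp add: cinner_adj cinner_diff_left cinner_diff_right)
lemma adj_one [simp]: "adj 1 = 1" by (rule adj_eqI) simp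
lemma adj_zero [simp]: "adj 0 = 0" by (rule adj_eqI) simp
lemma adj_scaleOp [simp]: "adj (scaleOp c x) = scaleOp (cnj c) (adj x)"
  by (rule adj_eqI) (simp add: cinner_adj cinner_scaleC_left cinner_scaleC_right)
lemma adj_sum: "adj (sum f A) = (\<Sum>k\<in>A. adj (f k))"
  by (induction A rule: infinite_finite_induct) auto
lemma adj_eq_0_iff [simp]: "adj x = 0 \<longleftrightarrow> x = 0" by (metis adj_adj adj_zero)
lemma cinner_app_self: "cinner (app x a) (app x a) = cinner a (app (adj x * x) a)"
  by (simp add: cinner_adj')
section \<open>The \<open>\<sigma>\<close>-weak topology and strong sums\<close>

abbreviation sqsum :: "(nat \<Rightarrow> 'h::real_normed_vector) \<Rightarrow> bool" where
  "sqsum b \<equiv> summable (\<lambda>n. (norm (b n))\<^sup>2)"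

lemma sqsum_app:
  fixes b :: "nat \<Rightarrow> 'h::chilbert"
  assumes "sqsum b" shows "sqsum (\<lambda>n. app x (b n))"
proof -
  obtain c where c: "c > 0" "\<And>a. norm (app x a) \<le> c * norm a" using app_bound by blast
  show ?thesis
  proof (rule summable_comparison_test')
    show "summable (\<lambda>n. c\<^sup>2 * (norm (b n))\<^sup>2)" using assms by (rule summable_mult)
    show "norm ((norm (app x (b n)))\<^sup>2) \<le> c\<^sup>2 * (norm (b n))\<^sup>2" for n
      using power_mono[OF c(2)[of "b n"] norm_ge_zero, of 2] by (simp add: power_mult_distrib)
  qed
qed

lemma sqsum_mult_norm:
  assumes "sqsum a" "sqsum b"
  shows "summable (\<lambda>n. norm (a n) * norm (b n))"
proof (rule summable_comparison_test')
  show "summable (\<lambda>n. (norm (a n))\<^sup>2 + (norm (b n))\<^sup>2)" using assms by (rule summable_add)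
  show "norm (norm (a n) * norm (b n)) \<le> (norm (a n))\<^sup>2 + (norm (b n))\<^sup>2" for n
  proof -
    have "2 * (norm (a n) * norm (b n)) \<le> (norm (a n))\<^sup>2 + (norm (b n))\<^sup>2"
      using sum_squares_bound[of "norm (a n)" "norm (b n)"] by simp
    moreover have "0 \<le> norm (a n) * norm (b n)" by simp
    ultimately show ?thesis unfolding real_norm_def abs_of_nonneg[OF \<open>0 \<le> _\<close>] by linarith
  qed
qed

lemma sqsum_cinner:
  fixes a b :: "nat \<Rightarrow> 'h::chilbert"
  assumes "sqsum a" "sqsum b"
  shows "summable (\<lambda>n. cinner (a n) (b n))"
  using sqsum_mult_norm[OF assms] by (rule summable_comparison_test'[where N=0]) (rule cmod_cinner_le)

lemma sqsum_single: "sqsum (\<lambda>n. if n = 0 then b else (0::'h::real_normed_vector))"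
  by (rule summable_finite[of "{0}"]) auto

lemma topspace_sigma_weak [simp]: "topspace (sigma_weak :: 'h::chilbert bop topology) = UNIV"
proof -
  have "UNIV \<in> {{x. (\<Sum>n. cinner (a n) (app x (b n))) \<in> U} | (a :: nat \<Rightarrow> 'h::chilbert) (b :: nat \<Rightarrow> 'h) U.
        summable (\<lambda>n. (norm (a n))\<^sup>2) \<and> summable (\<lambda>n. (norm (b n))\<^sup>2) \<and> open U}"
    by (rule CollectI, rule exI[of _ "\<lambda>n. 0"], rule exI[of _ "\<lambda>n. 0"], rule exI[of _ UNIV]) auto
  then show ?thesis unfolding sigma_weak_def topology_generated_by_topspace
    by (intro equalityI subset_UNIV Union_upper)
qed

lemmas sigma_weak_cover = topspace_sigma_weak[unfolded sigma_weak_def topology_generated_by_topspace]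

lemma continuous_map_sigma_weak_iff:
  fixes f :: "_ \<Rightarrow> 'h::chilbert bop"
  shows "continuous_map X sigma_weak f \<longleftrightarrow>
   (\<forall>(a :: nat \<Rightarrow> 'h) (b :: nat \<Rightarrow> 'h). sqsum a \<longrightarrow> sqsum b \<longrightarrow> continuous_map X euclidean (\<lambda>x. \<Sum>n. cinner (a n) (app (f x) (b n))))"
    (is "?L = ?R")
proof
  assume L: ?L
  show ?R
  proof (intro allI impI)
    fix a b :: "nat \<Rightarrow> 'h" assume ab: "sqsum a" "sqsum b"
    show "continuous_map X euclidean (\<lambda>x. \<Sum>n. cinner (a n) (app (f x) (b n)))"
      unfolding continuous_map_alt
    proof (intro conjI allI impI)
      fix U :: "complex set" assume "openin euclidean U"
      then have "openin sigma_weak {x. (\<Sum>n. cinner (a n) (app x (b n))) \<in> U}"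
        unfolding sigma_weak_def using ab by (intro topology_generated_by_Basis) auto
      with L have "openin X (f -` {x. (\<Sum>n. cinner (a n) (app x (b n))) \<in> U} \<inter> topspace X)"
        unfolding continuous_map_alt by blast
      then show "openin X ((\<lambda>x. \<Sum>n. cinner (a n) (app (f x) (b n))) -` U \<inter> topspace X)"
        by (simp add: vimage_def)
    qed auto
  qed
next
  assume R: ?R
  show ?L unfolding sigma_weak_def
  proof (rule continuous_on_generated_topo)
    show "f ` topspace X \<subseteq> \<Union> {{x. (\<Sum>n. cinner (a n) (app x (b n))) \<in> U} | a b U.
        sqsum (a :: nat \<Rightarrow> 'h) \<and> sqsum (b :: nat \<Rightarrow> 'h) \<and> open U}"
      by (simp only: sigma_weak_cover subset_UNIV)
  next
    fix V assume "V \<in> {{x. (\<Sum>n. cinner (a n) (app x (b n))) \<in> U} | (a :: nat \<Rightarrow> 'h) (b :: nat \<Rightarrow> 'h) U. sqsum a \<and> sqsum b \<and> open U}"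
    then obtain a b U where V: "V = {x. (\<Sum>n. cinner (a n) (app x (b n))) \<in> U}" "sqsum a" "sqsum b" "open U"
      by blast
    then have "openin X ((\<lambda>x. \<Sum>n. cinner (a n) (app (f x) (b n))) -` U \<inter> topspace X)"
      using R unfolding continuous_map_alt by simp
    then show "openin X (f -` V \<inter> topspace X)" by (simp add: V(1) vimage_def)
  qed
qed

lemma continuous_map_sigma_weak_functional:
  fixes a b :: "nat \<Rightarrow> 'h::chilbert"
  assumes "sqsum a" "sqsum b"
  shows "continuous_map sigma_weak euclidean (\<lambda>x. \<Sum>n. cinner (a n) (app x (b n)))"
proof -
  have "continuous_map sigma_weak sigma_weak (\<lambda>x :: 'h bop. x)"
    using continuous_map_id[of sigma_weak] by (simp only: id_def)
  from continuous_map_sigma_weak_iff[THEN iffD1, OF this] show ?thesis using assms by blast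
qed

lemma continuous_map_sigma_weak_mult_left: "continuous_map sigma_weak sigma_weak (\<lambda>x. y * x)"
  unfolding continuous_map_sigma_weak_iff
proof (intro allI impI)
  fix a b :: "nat \<Rightarrow> 'a" assume "sqsum a" "sqsum b"
  from continuous_map_sigma_weak_functional[OF sqsum_app[OF this(1), of "adj y"] this(2)]
  show "continuous_map sigma_weak euclidean (\<lambda>x. \<Sum>n. cinner (a n) (app (y * x) (b n)))"
    by (simp add: cinner_adj)
qed

lemma continuous_map_sigma_weak_mult_right: "continuous_map sigma_weak sigma_weak (\<lambda>x. x * y)"
  unfolding continuous_map_sigma_weak_iff
proof (intro allI impI)
  fix a b :: "nat \<Rightarrow> 'a" assume "sqsum a" "sqsum b"
  from continuous_map_sigma_weak_functional[OF this(1) sqsum_app[OF this(2), of y]]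
  show "continuous_map sigma_weak euclidean (\<lambda>x. \<Sum>n. cinner (a n) (app (x * y) (b n)))" by simp
qed

lemma continuous_map_mult_both:
  assumes "continuous_map (subtopology sigma_weak U) sigma_weak f"
  shows "continuous_map (subtopology sigma_weak U) sigma_weak (\<lambda>x. b * f x * c)"
  using continuous_map_compose[OF continuous_map_compose[OF assms continuous_map_sigma_weak_mult_left[of b]]
      continuous_map_sigma_weak_mult_right[of c]] by (simp add: o_def)

lemma continuous_map_sigma_weak_adj: "continuous_map sigma_weak sigma_weak adj"
  unfolding continuous_map_sigma_weak_iff
proof (intro allI impI)
  fix a b :: "nat \<Rightarrow> 'a" assume ab: "sqsum a" "sqsum b"
  have eq: "(\<Sum>n. cinner (a n) (app (adj x) (b n))) = cnj (\<Sum>n. cinner (b n) (app x (a n)))" for x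
  proof -
    have "(\<lambda>n. cnj (cinner (b n) (app x (a n)))) sums cnj (\<Sum>n. cinner (b n) (app x (a n)))"
      by (subst sums_cnj) (rule summable_sums[OF sqsum_cinner[OF ab(2) sqsum_app[OF ab(1)]]])
    moreover have "cnj (cinner (b n) (app x (a n))) = cinner (a n) (app (adj x) (b n))" for n
      by (metis cinner_adj' cinner_commute)
    ultimately show ?thesis by (simp add: sums_iff)
  qed
  show "continuous_map sigma_weak euclidean (\<lambda>x. \<Sum>n. cinner (a n) (app (adj x) (b n)))"
    unfolding eq
    using continuous_map_compose[OF continuous_map_sigma_weak_functional[OF ab(2,1)], of euclidean cnj]
    by (simp add: o_def continuous_on_cnj)
qed

lemma swf_add:
  fixes a b :: "nat \<Rightarrow> 'h::chilbert"
  assumes "sqsum a" "sqsum b"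
  shows "(\<Sum>n. cinner (a n) (app (x + y) (b n))) = (\<Sum>n. cinner (a n) (app x (b n))) + (\<Sum>n. cinner (a n) (app y (b n)))"
  using assms by (simp add: cinner_add_right suminf_add sqsum_cinner sqsum_app)

lemma continuous_map_sigma_weak_add:
  fixes f :: "_ \<Rightarrow> 'h::chilbert bop"
  assumes "continuous_map X sigma_weak f" "continuous_map X sigma_weak g"
  shows "continuous_map X sigma_weak (\<lambda>x. f x + g x)"
  unfolding continuous_map_sigma_weak_iff
proof (intro allI impI)
  fix a b :: "nat \<Rightarrow> 'h" assume ab: "sqsum a" "sqsum b"
  show "continuous_map X euclidean (\<lambda>x. \<Sum>n. cinner (a n) (app (f x + g x) (b n)))"
    unfolding swf_add[OF ab]
    using assms[unfolded continuous_map_sigma_weak_iff] ab by (intro continuous_map_add) blast+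
qed

lemma continuous_map_sigma_weak_vector:
  "continuous_map sigma_weak euclidean (\<lambda>x. cinner a (app x b))"
proof -
  have "(\<Sum>n. cinner (if n = 0 then a else 0) (app x (if n = 0 then b else 0))) = cinner a (app x b)" for x
    by (subst suminf_finite[of "{0::nat}"]) auto
  then show ?thesis using continuous_map_sigma_weak_functional[OF sqsum_single[of a] sqsum_single[of b]]
    by simp
qed

lemma Hausdorff_sigma_weak: "Hausdorff_space sigma_weak"
  unfolding Hausdorff_space_def
proof (intro allI impI)
  fix x y :: "'a bop" assume "x \<in> topspace sigma_weak \<and> y \<in> topspace sigma_weak \<and> x \<noteq> y"
  then obtain a b where ab: "cinner a (app x b) \<noteq> cinner a (app y b)" using bop_eqI_cinner by metis
  then obtain U V where UV: "open U" "open V" "cinner a (app x b) \<in> U" "cinner a (app y b) \<in> V" "U \<inter> V = {}"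
    by (metis hausdorff)
  let ?W = "\<lambda>U. {x. cinner a (app x b) \<in> U}"
  have "openin sigma_weak (?W U)" if "open U" for U
    using continuous_map_sigma_weak_vector[of a b] that unfolding continuous_map_alt by (simp add: vimage_def)
  then show "\<exists>U V. openin sigma_weak U \<and> openin sigma_weak V \<and> x \<in> U \<and> y \<in> V \<and> disjnt U V"
    using UV by (intro exI[of _ "?W U"] exI[of _ "?W V"]) (auto simp: disjnt_def)
qed

lemma closedin_sigma_weak_eq:
  assumes "continuous_map sigma_weak sigma_weak f" "continuous_map sigma_weak sigma_weak g"
  shows "closedin sigma_weak {x. f x = g x}"
proof -
  have "sigma_weak closure_of {x. f x = g x} \<subseteq> {x. f x = g x}"
    using forall_in_closure_of_eq[OF _ Hausdorff_sigma_weak assms] by blast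
  then show ?thesis by (simp flip: closure_of_subset_eq)
qed

lemma strong_sum_unique: "strong_sum f K s \<Longrightarrow> strong_sum f K t \<Longrightarrow> s = t"
  unfolding strong_sum_def by (metis bop_eqI has_sum_unique)

lemma strong_sum_cong: "(\<And>k. k \<in> K \<Longrightarrow> f k = g k) \<Longrightarrow> strong_sum f K s = strong_sum g K s"
  unfolding strong_sum_def by (intro all_cong1 has_sum_cong) simp

lemma strong_sum_eq: "strong_sum f K s \<Longrightarrow> (\<And>k. k \<in> K \<Longrightarrow> f k = g k) \<Longrightarrow> strong_sum g K s"
  using strong_sum_cong[of K f g s] by blast

lemma strong_sum_mult_left: "strong_sum f K s \<Longrightarrow> strong_sum (\<lambda>k. x * f k) K (x * s)"
  unfolding strong_sum_def by (auto intro: has_sum_bounded_linear[OF app_bounded_linear])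

lemma strong_sum_mult_right: "strong_sum f K s \<Longrightarrow> strong_sum (\<lambda>k. f k * x) K (s * x)"
  unfolding strong_sum_def by auto

lemma strong_sum_finite: "finite K \<Longrightarrow> strong_sum f K s \<longleftrightarrow> s = sum f K"
  unfolding strong_sum_def by (auto simp: has_sum_finite_iff app_sum_op intro: bop_eqI)

lemma strong_sum_single: "k \<in> K \<Longrightarrow> strong_sum (\<lambda>l. if l = k then x else 0) K x"
  unfolding strong_sum_def by (intro allI has_sum_finite_neutralI[of "{k}"]) auto

lemma norm_sum_orthogonal:
  fixes v :: "'i \<Rightarrow> 'a::real_inner"
  assumes "finite F" "\<And>k l. k \<in> F \<Longrightarrow> l \<in> F \<Longrightarrow> k \<noteq> l \<Longrightarrow> inner (v k) (v l) = 0"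
  shows "(norm (sum v F))\<^sup>2 = (\<Sum>k\<in>F. (norm (v k))\<^sup>2)"
  by (rule norm_sum_Pythagorean[OF assms(1)]) (use assms(2) in \<open>auto simp: pairwise_def orthogonal_def\<close>)

text \<open>The net of finite partial sums is Cauchy: by orthogonality, the squared distance of two
  partial sums is at most the sum of the squared norms over the symmetric difference of the index
  sets, and this is small once both contain a large finite set.\<close>

lemma orthogonal_summable_on:
  fixes v :: "'i \<Rightarrow> 'a::{real_inner, complete_space}"
  assumes orth: "\<And>k l. k \<in> K \<Longrightarrow> l \<in> K \<Longrightarrow> k \<noteq> l \<Longrightarrow> inner (v k) (v l) = 0"
    and sm: "(\<lambda>k. (norm (v k))\<^sup>2) summable_on K"
  shows "v summable_on K"
proof -
  have dist: "(norm (sum v A - sum v B))\<^sup>2 \<le> (\<Sum>k\<in>(A - B) \<union> (B - A). (norm (v k))\<^sup>2)"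
    if AB: "finite A" "A \<subseteq> K" "finite B" "B \<subseteq> K" for A B
  proof -
    have o: "inner (v k) (v l) = 0" if "k \<in> A \<union> B" "l \<in> A \<union> B" "k \<noteq> l" for k l
      using orth[of k l] AB that by blast
    have "sum v A - sum v B = sum v (A - B) - sum v (B - A)"
      using sum.Int_Diff[OF AB(1), of v B] sum.Int_Diff[OF AB(3), of v A] by (simp add: Int_commute)
    also have "\<dots> = (\<Sum>k\<in>(A - B) \<union> (B - A). if k \<in> A then v k else - v k)" (is "_ = sum ?w _")
    proof -
      have "sum ?w ((A - B) \<union> (B - A)) = sum ?w (A - B) + sum ?w (B - A)"
        by (rule sum.union_disjoint) (use AB in auto)
      moreover have "sum ?w (A - B) = sum v (A - B)" by (rule sum.cong) auto
      moreover have "sum ?w (B - A) = - sum v (B - A)" by (subst sum_negf[symmetric], rule sum.cong) auto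
      ultimately show ?thesis by simp
    qed
    also have "(norm \<dots>)\<^sup>2 = (\<Sum>k\<in>(A - B) \<union> (B - A). (norm (?w k))\<^sup>2)"
      by (rule norm_sum_orthogonal) (use AB in \<open>auto simp: o inner_minus_left inner_minus_right\<close>)
    also have "\<dots> = (\<Sum>k\<in>(A - B) \<union> (B - A). (norm (v k))\<^sup>2)" by (rule sum.cong) auto
    finally show ?thesis by simp
  qed
  obtain S where S: "((\<lambda>k. (norm (v k))\<^sup>2) has_sum S) K" using sm by (auto simp: summable_on_def)
  have "cauchy_filter (filtermap (sum v) (finite_subsets_at_top K))"
    unfolding cauchy_filter_metric_filtermap
  proof (intro allI impI)
    fix e :: real assume "e > 0"
    obtain F0 where F0: "finite F0" "F0 \<subseteq> K" "dist (\<Sum>k\<in>F0. (norm (v k))\<^sup>2) S \<le> e\<^sup>2 / 4"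
      using has_sum_finite_approximation[OF S, of "e\<^sup>2 / 4"] \<open>e > 0\<close> by auto
    let ?P = "\<lambda>F. finite F \<and> F0 \<subseteq> F \<and> F \<subseteq> K"
    have "dist (sum v A) (sum v B) < e" if "?P A" "?P B" for A B
    proof -
      have "(norm (sum v A - sum v B))\<^sup>2 \<le> (\<Sum>k\<in>(A - B) \<union> (B - A). (norm (v k))\<^sup>2)"
        by (rule dist) (use that in auto)
      also have "\<dots> + (\<Sum>k\<in>F0. (norm (v k))\<^sup>2) = (\<Sum>k\<in>(A - B) \<union> (B - A) \<union> F0. (norm (v k))\<^sup>2)"
        by (rule sum.union_disjoint[symmetric]) (use that F0 in auto)
      moreover have "\<dots> \<le> S"
        by (rule finite_sum_le_has_sum[OF S]) (use that F0 in auto)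
      ultimately have "(norm (sum v A - sum v B))\<^sup>2 \<le> S - (\<Sum>k\<in>F0. (norm (v k))\<^sup>2)" by linarith
      also have "\<dots> \<le> e\<^sup>2 / 4" using F0(3) unfolding dist_real_def by linarith
      also have "\<dots> < e\<^sup>2" using \<open>e > 0\<close> by simp
      finally show ?thesis unfolding dist_norm by (rule power2_less_imp_less) (use \<open>e > 0\<close> in simp)
    qed
    moreover have "eventually ?P (finite_subsets_at_top K)"
      using F0 by (auto simp: eventually_finite_subsets_at_top)
    ultimately show "\<exists>P. eventually P (finite_subsets_at_top K) \<and> (\<forall>x y. P x \<and> P y \<longrightarrow> dist (sum v x) (sum v y) < e)"
      by (intro exI[of _ ?P]) simp
  qed
  moreover have "complete (UNIV::'a set)"
    by (meson Cauchy_convergent UNIV_I complete_def convergent_def)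
  ultimately obtain L where "(sum v \<longlongrightarrow> L) (finite_subsets_at_top K)"
    using cauchy_filter_complete_converges[of "filtermap (sum v) (finite_subsets_at_top K)" UNIV]
    by (auto simp add: filterlim_def filtermap_bot_iff)
  then show ?thesis by (auto simp: summable_on_def has_sum_def)
qed

lemma inner_adj_mult_zero: "adj x * y = 0 \<Longrightarrow> inner (app x a) (app y b) = 0"
  by (metis app_times app_zero_op cinner_adj' cinner_zero_right inner_eq_Re_cinner zero_complex.sel(1))

lemma norm_sum_orthogonal_ops:
  assumes "finite F" "\<And>k l. k \<in> F \<Longrightarrow> l \<in> F \<Longrightarrow> k \<noteq> l \<Longrightarrow> adj (f k) * f l = 0"
  shows "(norm (app (sum f F) a))\<^sup>2 = (\<Sum>k\<in>F. (norm (app (f k) a))\<^sup>2)"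
  unfolding app_sum_op by (rule norm_sum_orthogonal[OF assms(1)]) (use assms(2) inner_adj_mult_zero in blast)

text \<open>Applied to a vector, the terms are orthogonal with square summable norms, hence
  summable. The same bound passes to the limit, so that the pointwise sum is a contraction and thus
  a bounded operator.\<close>

lemma strong_sum_orthogonal:
  assumes orth: "\<And>k l. k \<in> K \<Longrightarrow> l \<in> K \<Longrightarrow> k \<noteq> l \<Longrightarrow> adj (f k) * f l = 0"
    and bd: "\<And>F a. finite F \<Longrightarrow> F \<subseteq> K \<Longrightarrow> (\<Sum>k\<in>F. (norm (app (f k) a))\<^sup>2) \<le> (norm a)\<^sup>2"
  shows "\<exists>s. strong_sum f K s"
proof -
  have sm: "(\<lambda>k. app (f k) a) summable_on K" for a
  proof (rule orthogonal_summable_on)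
    show "inner (app (f k) a) (app (f l) a) = 0" if "k \<in> K" "l \<in> K" "k \<noteq> l" for k l
      using orth[OF that] by (rule inner_adj_mult_zero)
    show "(\<lambda>k. (norm (app (f k) a))\<^sup>2) summable_on K"
      by (rule nonneg_bdd_above_summable_on) (use bd in \<open>auto intro!: bdd_aboveI[where M="(norm a)\<^sup>2"]\<close>)
  qed
  define L where "L a = infsum (\<lambda>k. app (f k) a) K" for a
  have L: "((\<lambda>k. app (f k) a) has_sum L a) K" for a using sm by (simp add: L_def)
  have "\<exists>s. app s = L"
  proof (rule bop_of_bound[where K=1])
    show "L (a + b) = L a + L b" for a b
      using has_sum_unique[OF L[of "a + b"]] has_sum_add[OF L[of a] L[of b]] by (simp add: app_add)
    show "L (c *\<^sub>C a) = c *\<^sub>C L a" for c a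
      using has_sum_unique[OF L[of "c *\<^sub>C a"]] has_sum_bounded_linear[OF scaleC_bounded_linear[of c] L[of a]]
      by (simp add: app_scaleC)
    show "norm (L a) \<le> 1 * norm a" for a
    proof -
      have "norm (sum (\<lambda>k. app (f k) a) F) \<le> norm a" if "finite F" "F \<subseteq> K" for F
      proof -
        have "(norm (app (sum f F) a))\<^sup>2 = (\<Sum>k\<in>F. (norm (app (f k) a))\<^sup>2)"
          by (rule norm_sum_orthogonal_ops) (use that orth in auto)
        with bd[OF that, of a] show ?thesis by (simp add: app_sum_op power2_le_imp_le)
      qed
      then have "eventually (\<lambda>F. norm (sum (\<lambda>k. app (f k) a) F) \<le> norm a) (finite_subsets_at_top K)"
        by (intro eventually_finite_subsets_at_top_weakI)
      with L[of a] show ?thesis unfolding has_sum_def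
        by (simp add: tendsto_upperbound[OF tendsto_norm])
    qed
  qed
  then show ?thesis using L by (auto simp: strong_sum_def)
qed

section \<open>Square roots\<close>

lemma bop_of_limit:
  assumes "\<And>a. (\<lambda>n::nat. app (f n) a) \<longlonglongrightarrow> L a" "\<And>n a. norm (app (f n) a) \<le> K * norm a"
  shows "\<exists>s. app s = L"
proof (rule bop_of_bound)
  show "L (a + b) = L a + L b" for a b
    using LIMSEQ_unique[OF assms(1)[of "a + b"]] tendsto_add[OF assms(1)[of a] assms(1)[of b]] by (simp add: app_add)
  show "L (c *\<^sub>C a) = c *\<^sub>C L a" for c a
    using LIMSEQ_unique[OF assms(1)[of "c *\<^sub>C a"]] bounded_linear.tendsto[OF scaleC_bounded_linear[of c] assms(1)[of a]]
    by (simp add: app_scaleC)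
  show "norm (L a) \<le> K * norm a" for a
    by (rule tendsto_upperbound[OF tendsto_norm[OF assms(1)]]) (use assms(2) in auto)
qed

primrec sqrt_iter :: "'h::chilbert bop \<Rightarrow> nat \<Rightarrow> 'h bop" where
  "sqrt_iter k 0 = 0"
| "sqrt_iter k (Suc n) = scaleOp (1/2) (k + sqrt_iter k n * sqrt_iter k n)"

primrec sqrt_bound :: "nat \<Rightarrow> real" where
  "sqrt_bound 0 = 0"
| "sqrt_bound (Suc n) = (1 + sqrt_bound n * sqrt_bound n) / 2"

lemma sqrt_bound_range: "0 \<le> sqrt_bound n \<and> sqrt_bound n \<le> 1"
  by (induction n) (auto simp: mult_le_one)

lemma sqrt_bound_mono: "sqrt_bound n \<le> sqrt_bound (Suc n)"
proof -
  have "0 \<le> (1 - sqrt_bound n) * (1 - sqrt_bound n)" by simp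
  then show ?thesis by (simp add: algebra_simps)
qed

text \<open>The iteration \<open>r \<mapsto> (k + r\<^sup>2)/2\<close> is a sequence of polynomials in \<open>k\<close> with nonnegative
  coefficients, so that it is dominated by the same iteration for the number \<open>1\<close>; its limit \<open>r\<close>
  satisfies \<open>(1 - r)\<^sup>2 = 1 - k\<close>.\<close>

lemma op_sqrt:
  assumes sa: "adj k = k" and bd: "\<And>a. norm (app k a) \<le> norm a"
  shows "\<exists>s. adj s = s \<and> s * s = 1 - k \<and> (\<forall>a. 0 \<le> Re (cinner a (app s a))) \<and> (\<forall>y. y * k = k * y \<longrightarrow> y * s = s * y)"
proof -
  let ?r = "sqrt_iter k" and ?b = sqrt_bound
  have com: "y * ?r n = ?r n * y" if "y * k = k * y" for y n
  proof (induction n)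
    case (Suc n)
    have "y * (?r n * ?r n) = ?r n * ?r n * y" using Suc by (metis mult.assoc)
    then show ?case using that by (simp add: distrib_left distrib_right scaleOp_add)
  qed simp
  have comr: "?r m * ?r n = ?r n * ?r m" for m n
    by (rule com) (rule com[symmetric], simp)
  have adjr: "adj (?r n) = ?r n" for n by (induction n) (auto simp: sa)
  have nr: "norm (app (?r n) a) \<le> ?b n * norm a" for n a
  proof (induction n arbitrary: a)
    case (Suc n)
    have *: "norm (app (?r n) (app (?r n) a)) \<le> ?b n * (?b n * norm a)"
      using order_trans[OF Suc[of "app (?r n) a"] mult_left_mono[OF Suc[of a]]] sqrt_bound_range by auto
    show ?case
      using order_trans[OF norm_triangle_ineq add_mono[OF bd[of a] *]]
      by (simp add: norm_scaleC norm_divide algebra_simps)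
  qed simp
  have nd: "norm (app (?r (Suc n) - ?r n) a) \<le> (?b (Suc n) - ?b n) * norm a" for n a
  proof (induction n arbitrary: a)
    case 0 then show ?case using bd[of a] by (simp add: norm_scaleC)
  next
    case (Suc n)
    \<comment> \<open>The iterates commute, so a difference of squares factors. The numerical
      iteration factors in the same way, which is why its increments bound those of the
      operators.\<close>
    have eq: "?r (Suc (Suc n)) - ?r (Suc n)
        = scaleOp (1/2) ((?r (Suc n) + ?r n) * (?r (Suc n) - ?r n))"
    proof -
      have "scaleOp c (k + p * p) - scaleOp c (k + q * q) = scaleOp c ((p + q) * (p - q))"
        if "p * q = q * p" for c p q using that by (simp add: algebra_simps flip: scaleOp_diff)
      from this[OF comr[of "Suc n" n]] show ?thesis
        by (rule trans[OF arg_cong2[of _ _ _ _ minus, OF sqrt_iter.simps(2) sqrt_iter.simps(2)]])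
    qed
    let ?v = "app (?r (Suc n) - ?r n) a"
    have "norm (app (?r (Suc n) + ?r n) ?v) \<le> ?b (Suc n) * norm ?v + ?b n * norm ?v"
      using order_trans[OF norm_triangle_ineq add_mono[OF nr[of "Suc n" ?v] nr[of n ?v]]] by simp
    also have "\<dots> = (?b (Suc n) + ?b n) * norm ?v" by (simp add: algebra_simps)
    also have "\<dots> \<le> (?b (Suc n) + ?b n) * ((?b (Suc n) - ?b n) * norm a)"
      using Suc[of a] sqrt_bound_range[of n] sqrt_bound_range[of "Suc n"] by (intro mult_left_mono) auto
    finally have "norm (app (?r (Suc n) + ?r n) ?v) \<le> \<dots>" .
    moreover have "app (?r (Suc (Suc n)) - ?r (Suc n)) a = (1/2) *\<^sub>C app (?r (Suc n) + ?r n) ?v"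
      unfolding eq by (simp only: app_scaleOp app_times)
    moreover have "?b (Suc (Suc n)) - ?b (Suc n) = (?b (Suc n) + ?b n) * (?b (Suc n) - ?b n) / 2"
      by (rule trans[OF arg_cong2[of _ _ _ _ minus, OF sqrt_bound.simps(2) sqrt_bound.simps(2)]])
        (simp only: diff_divide_distrib[symmetric] algebra_simps, simp)
    ultimately show ?case by (simp only: norm_scaleC) simp
  qed
  have nmn: "norm (app (?r (m + d)) a - app (?r m) a) \<le> (?b (m + d) - ?b m) * norm a" for m d a
  proof (induction d)
    case (Suc d)
    have "norm (app (?r (m + Suc d)) a - app (?r m) a)
       \<le> norm (app (?r (Suc (m + d)) - ?r (m + d)) a) + norm (app (?r (m + d)) a - app (?r m) a)"
      using norm_triangle_ineq[of "app (?r (Suc (m + d)) - ?r (m + d)) a" "app (?r (m + d)) a - app (?r m) a"]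
      by simp
    also have "\<dots> \<le> (?b (Suc (m + d)) - ?b (m + d)) * norm a + (?b (m + d) - ?b m) * norm a"
      by (intro add_mono nd Suc)
    finally show ?case by (simp add: algebra_simps)
  qed simp
  have "incseq ?b" using sqrt_bound_mono by (simp add: incseq_SucI)
  then have "convergent ?b"
    using sqrt_bound_range by (metis convergentI incseq_convergent)
  then have Cb: "Cauchy ?b" by (rule convergent_Cauchy)
  have "Cauchy (\<lambda>n. app (?r n) a)" for a
  proof (rule metric_CauchyI)
    fix e :: real assume "e > 0"
    then obtain N where N: "\<And>m n. m \<ge> N \<Longrightarrow> n \<ge> N \<Longrightarrow> dist (?b m) (?b n) < e / (norm a + 1)"
      using metric_CauchyD[OF Cb, of "e / (norm a + 1)"] by (metis add_nonneg_pos divide_pos_pos norm_ge_zero zero_less_one)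
    have *: "dist (app (?r m) a) (app (?r n) a) < e" if mn: "m \<ge> N" "n \<ge> m" for m n
    proof -
      obtain d where d: "n = m + d" using le_Suc_ex[OF mn(2)] by blast
      have "(?b n - ?b m) * norm a \<le> (?b n - ?b m) * (norm a + 1)"
        using incseqD[OF \<open>incseq ?b\<close> that(2)] by (intro mult_left_mono) auto
      also have "\<dots> < e"
      proof -
        have "?b n - ?b m < e / (norm a + 1)"
          using N[of n m] that by (simp add: dist_real_def)
        then show ?thesis using add_nonneg_pos[OF norm_ge_zero[of a] zero_less_one] by (simp add: pos_less_divide_eq)
      qed
      finally show ?thesis using nmn[of m d a] d by (simp add: dist_norm norm_minus_commute)
    qed
    show "\<exists>M. \<forall>m\<ge>M. \<forall>n\<ge>M. dist (app (?r m) a) (app (?r n) a) < e"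
    proof (intro exI[of _ N] allI impI)
      fix m n assume mn: "m \<ge> N" "n \<ge> N"
      show "dist (app (?r m) a) (app (?r n) a) < e"
      proof (cases "m \<le> n")
        case False
        then show ?thesis using *[of n m] mn by (simp add: dist_commute)
      qed (use * mn in auto)
    qed
  qed
  then have "\<And>a. convergent (\<lambda>n. app (?r n) a)" by (simp add: Cauchy_convergent)
  then have "\<forall>a. \<exists>L. (\<lambda>n. app (?r n) a) \<longlonglongrightarrow> L" by (simp add: convergent_def)
  then obtain L where L: "\<And>a. (\<lambda>n. app (?r n) a) \<longlonglongrightarrow> L a" by metis
  have nr1: "norm (app (?r n) a) \<le> 1 * norm a" for n a
    using nr[of n a] sqrt_bound_range[of n] by (meson mult_right_mono norm_ge_zero order_trans)
  obtain R where R: "app R = L" using bop_of_limit[OF L nr1] by blast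
  have lim: "(\<lambda>n. app (?r n) a) \<longlonglongrightarrow> app R a" for a using L R by simp
  \<comment> \<open>The uniform bound on the iterates is what allows the strong limit to pass
    through the square.\<close>
  have lim2: "(\<lambda>n. app (?r n) (app (?r n) a)) \<longlonglongrightarrow> app R (app R a)" for a
  proof -
    have "(\<lambda>n. app (?r n) (app (?r n) a - app R a)) \<longlonglongrightarrow> 0"
    proof (rule Lim_null_comparison)
      show "\<forall>\<^sub>F n in sequentially. norm (app (?r n) (app (?r n) a - app R a)) \<le> norm (app (?r n) a - app R a)"
        using nr1 by simp
      show "(\<lambda>n. norm (app (?r n) a - app R a)) \<longlonglongrightarrow> 0"
        using tendsto_norm[OF tendsto_diff[OF lim[of a] tendsto_const[of "app R a"]]] by simp
    qed
    from tendsto_add[OF this lim[of "app R a"]] show ?thesis by (simp add: app_diff)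
  qed
  have fix_eq: "R = scaleOp (1/2) (k + R * R)"
  proof (rule bop_eqI)
    fix a
    have "(\<lambda>n. app (?r (Suc n)) a) \<longlonglongrightarrow> (1/2) *\<^sub>C (app k a + app R (app R a))"
      by (simp, intro bounded_linear.tendsto[OF scaleC_bounded_linear] tendsto_add tendsto_const lim2)
    with LIMSEQ_Suc[OF lim[of a]] show "app R a = app (scaleOp (1/2) (k + R * R)) a"
      by (simp add: LIMSEQ_unique)
  qed
  have comR: "y * R = R * y" if "y * k = k * y" for y
  proof (rule bop_eqI)
    fix a
    have "(\<lambda>n. app y (app (?r n) a)) \<longlonglongrightarrow> app y (app R a)" by (rule tendsto_app[OF lim])
    moreover have "app y (app (?r n) a) = app (?r n) (app y a)" for n
      using com[OF that, of n] by (metis app_times)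
    ultimately show "app (y * R) a = app (R * y) a" using lim[of "app y a"] by (simp add: LIMSEQ_unique)
  qed
  have adjR: "adj R = R"
  proof (rule adj_eqI)
    fix a b
    have "cinner (app (?r n) a) b = cinner a (app (?r n) b)" for n
      using cinner_adj[of "?r n" a b] by (simp add: adjr)
    with tendsto_cinner_left[OF lim[of a], of b] tendsto_cinner_right[OF lim[of b], of a]
    show "cinner (app R a) b = cinner a (app R b)" by (simp add: LIMSEQ_unique)
  qed
  have nR: "norm (app R a) \<le> norm a" for a
    by (rule tendsto_upperbound[OF tendsto_norm[OF lim]]) (use nr1 in auto)
  have "R + R = k + R * R"
  proof -
    have "scaleOp 2 R = k + R * R" by (subst fix_eq) simp
    then show ?thesis using scaleOp_add_left[of 1 1 R] by simp
  qed
  then have f1: "(1 - R) * (1 - R) = 1 - k" by (simp add: algebra_simps)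
  have f2: "0 \<le> Re (cinner a (app (1 - R) a))" for a
  proof -
    have "Re (cinner a (app R a)) \<le> norm a * norm (app R a)"
      using order_trans[OF complex_Re_le_cmod cmod_cinner_le] by blast
    also have "\<dots> \<le> norm a * norm a" using nR by (intro mult_left_mono) auto
    finally show ?thesis by (simp add: cinner_diff_right cinner_self power2_eq_square)
  qed
  have f3: "y * (1 - R) = (1 - R) * y" if "y * k = k * y" for y
    by (simp add: left_diff_distrib right_diff_distrib comR[OF that])
  have f4: "adj (1 - R) = 1 - R" by (simp only: adj_diff adj_one adjR)
  show ?thesis
    by (rule exI[of _ "1 - R"], intro conjI allI impI; (rule f1 f2 f4 | erule f3))
qed

section \<open>Orthogonal projections and the bicommutant theorem\<close>

lemma subspace_closure:
  fixes S :: "'a::real_normed_vector set"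
  assumes "subspace S" shows "subspace (closure S)"
  unfolding subspace_def
proof (intro conjI ballI allI)
  show "0 \<in> closure S" using subspace_0[OF assms] closure_subset by blast
  show "x + y \<in> closure S" if xy: "x \<in> closure S" "y \<in> closure S" for x y
  proof -
    obtain f g where fg: "\<And>n. f n \<in> S" "f \<longlonglongrightarrow> x" "\<And>n. g n \<in> S" "g \<longlonglongrightarrow> y"
      using xy unfolding closure_sequential by metis
    show ?thesis unfolding closure_sequential
      by (rule exI[of _ "\<lambda>n. f n + g n"]) (simp add: fg subspace_add[OF assms] tendsto_add)
  qed
  show "c *\<^sub>R x \<in> closure S" if "x \<in> closure S" for c x
  proof -
    obtain f where f: "\<And>n. f n \<in> S" "f \<longlonglongrightarrow> x" using \<open>x \<in> closure S\<close> unfolding closure_sequential by blast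
    show ?thesis unfolding closure_sequential
      by (rule exI[of _ "\<lambda>n. c *\<^sub>R f n"]) (simp add: f subspace_scale[OF assms] tendsto_scaleR)
  qed
qed

text \<open>The uniqueness clause is the tool for commutation: an operator y commutes with e as soon
  as y (e v) lies in S and differs from y v by a vector orthogonal to S.\<close>

lemma projection_exists:
  fixes S :: "'a::{real_inner, complete_space} set"
  assumes "closed S" "subspace S"
  shows "\<exists>e. bounded_linear e \<and> (\<forall>v. e v \<in> S) \<and> (\<forall>v. \<forall>t\<in>S. inner (v - e v) t = 0)
    \<and> (\<forall>v s. s \<in> S \<longrightarrow> (\<forall>t\<in>S. inner (v - s) t = 0) \<longrightarrow> e v = s)"
proof -
  obtain e where e: "\<And>v. e v \<in> S" "\<And>v t. t \<in> S \<Longrightarrow> inner (v - e v) t = 0"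
    using orthogonal_decomposition[OF assms] by metis
  have uniq: "e v = s" if "s \<in> S" "\<And>t. t \<in> S \<Longrightarrow> inner (v - s) t = 0" for v s
  proof -
    have m: "e v - s \<in> S" using e(1) that(1) assms(2) by (simp add: subspace_diff)
    have "inner (e v - s) (e v - s) = inner (v - s) (e v - s) - inner (v - e v) (e v - s)"
      by (simp add: inner_diff_left)
    then show ?thesis using that(2)[OF m] e(2)[OF m] by simp
  qed
  have "bounded_linear e"
  proof (rule bounded_linear_intro[where K=1])
    show "e (x + y) = e x + e y" for x y
    proof (rule uniq)
      fix t assume "t \<in> S"
      then have "inner (x - e x) t + inner (y - e y) t = 0" by (simp add: e(2))
      then show "inner (x + y - (e x + e y)) t = 0" by (simp add: inner_diff_left inner_add_left)
    qed (simp add: subspace_add[OF assms(2)] e(1))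
    show "e (r *\<^sub>R x) = r *\<^sub>R e x" for r x
    proof (rule uniq)
      fix t assume "t \<in> S"
      then have "r * inner (x - e x) t = 0" by (simp add: e(2))
      then show "inner (r *\<^sub>R x - r *\<^sub>R e x) t = 0" by (simp add: inner_diff_left right_diff_distrib)
    qed (simp add: subspace_scale[OF assms(2)] e(1))
    show "norm (e x) \<le> norm x * 1" for x
    proof -
      have "inner x x = inner (x - e x) (x - e x) + inner (e x) (e x)"
        using e(2)[OF e(1), of x x] by (simp add: inner_diff_left inner_diff_right inner_commute)
      then have "(norm (e x))\<^sup>2 \<le> (norm x)\<^sup>2" by (simp add: power2_norm_eq_inner)
      then show ?thesis unfolding mult_1_right by (rule power2_le_imp_le) simp
    qed
  qed
  then show ?thesis using e uniq by blast
qed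

section \<open>Square summable sequences of vectors and the bicommutant theorem\<close>

typedef (overloaded) 'a ell2 = "{f :: nat \<Rightarrow> 'a::{real_inner, complete_space}. sqsum f}"
  by (rule exI[of _ "\<lambda>n. 0"]) simp

setup_lifting type_definition_ell2

lemma sqsum_add:
  fixes f g :: "nat \<Rightarrow> 'a::real_normed_vector"
  assumes "sqsum f" "sqsum g" shows "sqsum (\<lambda>n. f n + g n)"
proof (rule summable_comparison_test'[where N=0])
  show "summable (\<lambda>n. 2 * (norm (f n))\<^sup>2 + 2 * (norm (g n))\<^sup>2)"
    using assms by (intro summable_add summable_mult)
  show "norm ((norm (f n + g n))\<^sup>2) \<le> 2 * (norm (f n))\<^sup>2 + 2 * (norm (g n))\<^sup>2" for n
  proof -
    have "(norm (f n + g n))\<^sup>2 \<le> (norm (f n) + norm (g n))\<^sup>2"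
      by (intro power_mono norm_triangle_ineq) simp
    then show ?thesis using sum_squares_bound[of "norm (f n)" "norm (g n)"] by (simp add: power2_sum)
  qed
qed

lemma sqsum_scaleR:
  fixes f :: "nat \<Rightarrow> 'a::real_normed_vector"
  assumes "sqsum f" shows "sqsum (\<lambda>n. r *\<^sub>R f n)"
  using summable_mult[OF assms, of "r\<^sup>2"] by (simp add: power_mult_distrib)

lemma sqsum_uminus: "sqsum f \<Longrightarrow> sqsum (\<lambda>n. - f n)" by simp

lemma sqsum_diff:
  fixes f g :: "nat \<Rightarrow> 'a::real_normed_vector"
  assumes "sqsum f" "sqsum g" shows "sqsum (\<lambda>n. f n - g n)"
  using sqsum_add[OF assms(1) sqsum_uminus[OF assms(2)]] by simp

lemma sqsum_inner:
  fixes f g :: "nat \<Rightarrow> 'a::real_inner"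
  assumes "sqsum f" "sqsum g" shows "summable (\<lambda>n. inner (f n) (g n))"
  by (rule summable_comparison_test'[OF sqsum_mult_norm[OF assms], where N=0])
    (simp add: Cauchy_Schwarz_ineq2)

instantiation ell2 :: ("{real_inner, complete_space}") real_inner
begin

lift_definition zero_ell2 :: "'a ell2" is "\<lambda>n. 0" by simp
lift_definition plus_ell2 :: "'a ell2 \<Rightarrow> 'a ell2 \<Rightarrow> 'a ell2" is "\<lambda>f g n. f n + g n" by (rule sqsum_add)
lift_definition minus_ell2 :: "'a ell2 \<Rightarrow> 'a ell2 \<Rightarrow> 'a ell2" is "\<lambda>f g n. f n - g n" by (rule sqsum_diff)
lift_definition uminus_ell2 :: "'a ell2 \<Rightarrow> 'a ell2" is "\<lambda>f n. - f n" by simp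
lift_definition scaleR_ell2 :: "real \<Rightarrow> 'a ell2 \<Rightarrow> 'a ell2" is "\<lambda>r f n. r *\<^sub>R f n" by (rule sqsum_scaleR)
lift_definition inner_ell2 :: "'a ell2 \<Rightarrow> 'a ell2 \<Rightarrow> real" is "\<lambda>f g. \<Sum>n. inner (f n) (g n)" .
definition norm_ell2 :: "'a ell2 \<Rightarrow> real" where "norm_ell2 x = sqrt (inner x x)"
definition dist_ell2 :: "'a ell2 \<Rightarrow> 'a ell2 \<Rightarrow> real" where "dist_ell2 x y = norm (x - y)"
definition sgn_ell2 :: "'a ell2 \<Rightarrow> 'a ell2" where "sgn_ell2 x = inverse (norm x) *\<^sub>R x"
definition uniformity_ell2 :: "('a ell2 \<times> 'a ell2) filter" where
  "uniformity_ell2 = (INF e\<in>{0<..}. principal {(x, y). dist x y < e})"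
definition open_ell2 :: "'a ell2 set \<Rightarrow> bool" where
  "open_ell2 U = (\<forall>x\<in>U. eventually (\<lambda>(x', y). x' = x \<longrightarrow> y \<in> U) uniformity)"

instance
proof
  fix x y z :: "'a ell2" and r s :: real
  show "x + y + z = x + (y + z)" by transfer (simp add: add.assoc)
  show "x + y = y + x" by transfer (simp add: add.commute)
  show "0 + x = x" by transfer simp
  show "- x + x = 0" by transfer simp
  show "x - y = x + - y" by transfer simp
  show "r *\<^sub>R (x + y) = r *\<^sub>R x + r *\<^sub>R y" by transfer (simp add: scaleR_add_right)
  show "(r + s) *\<^sub>R x = r *\<^sub>R x + s *\<^sub>R x" by transfer (simp add: scaleR_add_left)
  show "r *\<^sub>R s *\<^sub>R x = (r * s) *\<^sub>R x" by transfer simp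
  show "1 *\<^sub>R x = x" by transfer simp
  show "dist x y = norm (x - y)" by (rule dist_ell2_def)
  show "sgn x = inverse (norm x) *\<^sub>R x" by (rule sgn_ell2_def)
  show "uniformity = (INF e\<in>{0<..}. principal {(x :: 'a ell2, y). dist x y < e})" by (rule uniformity_ell2_def)
  show "open U = (\<forall>x\<in>U. \<forall>\<^sub>F (x', y) in uniformity. x' = x \<longrightarrow> y \<in> U)" for U :: "'a ell2 set"
    by (rule open_ell2_def)
  show "inner x y = inner y x" by transfer (simp add: inner_commute)
  show "inner (x + y) z = inner x z + inner y z"
    by transfer (simp add: inner_add_left suminf_add sqsum_inner)
  show "inner (r *\<^sub>R x) y = r * inner x y" by transfer (simp add: suminf_mult sqsum_inner)
  show "0 \<le> inner x x" by transfer (simp add: suminf_nonneg sqsum_inner)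
  show "inner x x = 0 \<longleftrightarrow> x = 0"
  proof transfer
    fix f :: "nat \<Rightarrow> 'a" assume f: "sqsum f"
    show "(\<Sum>n. inner (f n) (f n)) = 0 \<longleftrightarrow> f = (\<lambda>n. 0)"
      by (subst suminf_eq_zero_iff[OF sqsum_inner[OF f f]]) (auto simp: fun_eq_iff)
  qed
  show "norm x = sqrt (inner x x)" by (rule norm_ell2_def)
qed

end

lemma norm_ell2_square: "(norm x)\<^sup>2 = (\<Sum>n. (norm (Rep_ell2 x n))\<^sup>2)"
  by (simp only: power2_norm_eq_inner inner_ell2.rep_eq)

lemma sqsum_Rep_ell2: "sqsum (Rep_ell2 x)" using Rep_ell2[of x] by simp

lemma norm_Rep_ell2: "norm (Rep_ell2 x n) \<le> norm x"
proof -
  have "(norm (Rep_ell2 x n))\<^sup>2 = (\<Sum>k\<in>{n}. (norm (Rep_ell2 x k))\<^sup>2)" by simp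
  also have "\<dots> \<le> (norm x)\<^sup>2" unfolding norm_ell2_square
    by (rule sum_le_suminf[OF sqsum_Rep_ell2]) auto
  finally show ?thesis by (rule power2_le_imp_le) simp
qed

instance ell2 :: ("{real_inner, complete_space}") complete_space
proof
  fix X :: "nat \<Rightarrow> 'a ell2" assume X: "Cauchy X"
  have "Cauchy (\<lambda>i. Rep_ell2 (X i) n)" for n
  proof (rule metric_CauchyI)
    fix e :: real assume "e > 0"
    from metric_CauchyD[OF X this] obtain M where M: "\<And>m n. m \<ge> M \<Longrightarrow> n \<ge> M \<Longrightarrow> dist (X m) (X n) < e" by blast
    have "dist (Rep_ell2 (X i) n) (Rep_ell2 (X j) n) \<le> dist (X i) (X j)" for i j
      using norm_Rep_ell2[of "X i - X j" n] by (simp add: dist_norm minus_ell2.rep_eq)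
    then show "\<exists>M. \<forall>m\<ge>M. \<forall>na\<ge>M. dist (Rep_ell2 (X m) n) (Rep_ell2 (X na) n) < e"
      using M by (meson le_less_trans)
  qed
  then have "\<forall>n. \<exists>L. (\<lambda>i. Rep_ell2 (X i) n) \<longlonglongrightarrow> L" by (simp add: Cauchy_convergent convergent_def[symmetric])
  then obtain L where L: "\<And>n. (\<lambda>i. Rep_ell2 (X i) n) \<longlonglongrightarrow> L n" by metis
  \<comment> \<open>Only finite partial sums are taken to the limit in j; the bound e^2 does not
    depend on m and so extends to the whole series.\<close>
  have bd: "(\<Sum>n<m. (norm (Rep_ell2 (X i) n - L n))\<^sup>2) \<le> e\<^sup>2"
    if "\<And>j. j \<ge> M \<Longrightarrow> dist (X i) (X j) \<le> e" for m i e M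
  proof (rule tendsto_upperbound)
    show "(\<lambda>j. \<Sum>n<m. (norm (Rep_ell2 (X i) n - Rep_ell2 (X j) n))\<^sup>2) \<longlonglongrightarrow> (\<Sum>n<m. (norm (Rep_ell2 (X i) n - L n))\<^sup>2)"
      by (intro tendsto_intros L)
    have "(\<Sum>n<m. (norm (Rep_ell2 (X i) n - Rep_ell2 (X j) n))\<^sup>2) \<le> e\<^sup>2" if "j \<ge> M" for j
    proof -
      have "(\<Sum>n<m. (norm (Rep_ell2 (X i - X j) n))\<^sup>2) \<le> (norm (X i - X j))\<^sup>2"
        unfolding norm_ell2_square by (rule sum_le_suminf[OF sqsum_Rep_ell2]) auto
      also have "\<dots> \<le> e\<^sup>2" using \<open>\<And>j. j \<ge> M \<Longrightarrow> dist (X i) (X j) \<le> e\<close>[OF that]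
        by (intro power_mono) (auto simp: dist_norm)
      finally show ?thesis by (simp add: minus_ell2.rep_eq)
    qed
    then show "\<forall>\<^sub>F j in sequentially. (\<Sum>n<m. (norm (Rep_ell2 (X i) n - Rep_ell2 (X j) n))\<^sup>2) \<le> e\<^sup>2"
      unfolding eventually_sequentially by blast
  qed simp
  have sq: "sqsum (\<lambda>n. Rep_ell2 (X i) n - L n)" if "\<And>j. j \<ge> M \<Longrightarrow> dist (X i) (X j) \<le> e" for i e M
  proof (rule bounded_imp_summable[where B="e\<^sup>2"])
    show "(\<Sum>k\<le>n. (norm (Rep_ell2 (X i) k - L k))\<^sup>2) \<le> e\<^sup>2" for n
      using bd[of M i e "Suc n"] that by (simp only: lessThan_Suc_atMost)
  qed simp
  from metric_CauchyD[OF X zero_less_one] obtain M where M: "\<And>m n. m \<ge> M \<Longrightarrow> n \<ge> M \<Longrightarrow> dist (X m) (X n) < 1" by blast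
  have "sqsum (\<lambda>n. Rep_ell2 (X M) n - (Rep_ell2 (X M) n - L n))"
    by (rule sqsum_diff[OF sqsum_Rep_ell2 sq[of M M 1]]) (use M less_imp_le in blast)
  then have "sqsum L" by simp
  then obtain Y where Y: "Rep_ell2 Y = L" using Abs_ell2_inverse by blast
  have "X \<longlonglongrightarrow> Y"
  proof (rule metric_LIMSEQ_I)
    fix e :: real assume "e > 0"
    then have "e / 2 > 0" by simp
    from metric_CauchyD[OF X this] obtain M where M: "\<And>m n. m \<ge> M \<Longrightarrow> n \<ge> M \<Longrightarrow> dist (X m) (X n) < e / 2" by blast
    have "dist (X i) Y < e" if "i \<ge> M" for i
    proof -
      have *: "dist (X i) (X j) \<le> e / 2" if "j \<ge> M" for j using M[OF \<open>i \<ge> M\<close> that] by simp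
      have "(norm (X i - Y))\<^sup>2 \<le> (e / 2)\<^sup>2"
        unfolding norm_ell2_square minus_ell2.rep_eq Y
        by (rule suminf_le_const[OF sq[of M i "e/2"]]) (use bd[of M i "e/2"] * in auto)
      then have "norm (X i - Y) \<le> e / 2" by (rule power2_le_imp_le) (use \<open>e > 0\<close> in simp)
      then show ?thesis using \<open>e > 0\<close> by (simp add: dist_norm)
    qed
    then show "\<exists>no. \<forall>n\<ge>no. dist (X n) Y < e" by blast
  qed
  then show "convergent X" by (rule convergentI)
qed

text \<open>The amplification of x to countably many copies of the Hilbert space. The sequences that
  define the \<sigma>-weak topology become single vectors for it.\<close>

lift_definition diag :: "'h::chilbert bop \<Rightarrow> 'h ell2 \<Rightarrow> 'h ell2" is "\<lambda>x f n. app x (f n)" by (rule sqsum_app)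

lift_definition single :: "nat \<Rightarrow> 'h::chilbert \<Rightarrow> 'h ell2" is "\<lambda>k a n. if n = k then a else 0"
  by (rule summable_finite[of "{k}" for k]) auto

lemma bounded_linear_diag: "bounded_linear (diag x)"
proof -
  obtain c where c: "c > 0" "\<And>a. norm (app x a) \<le> c * norm a" using app_bound by blast
  show ?thesis
  proof (rule bounded_linear_intro[where K=c])
    show "diag x (v + w) = diag x v + diag x w" for v w by transfer (simp add: app_add)
    show "diag x (r *\<^sub>R v) = r *\<^sub>R diag x v" for r v by transfer (simp add: app_scaleR)
    show "norm (diag x v) \<le> norm v * c" for v
    proof -
      have "(norm (diag x v))\<^sup>2 \<le> (\<Sum>n. c\<^sup>2 * (norm (Rep_ell2 v n))\<^sup>2)"
        unfolding norm_ell2_square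
      proof (rule suminf_le)
        show "(norm (Rep_ell2 (diag x v) n))\<^sup>2 \<le> c\<^sup>2 * (norm (Rep_ell2 v n))\<^sup>2" for n
          using power_mono[OF c(2) norm_ge_zero, where n=2] by (simp add: diag.rep_eq power_mult_distrib)
      qed (use sqsum_Rep_ell2 in \<open>auto intro: summable_mult\<close>)
      also have "\<dots> = (norm v * c)\<^sup>2"
        by (simp add: suminf_mult[OF sqsum_Rep_ell2] norm_ell2_square power_mult_distrib)
      finally show ?thesis by (rule power2_le_imp_le) (use c in simp)
    qed
  qed
qed

lemma bounded_linear_single: "bounded_linear (single k)"
proof (rule bounded_linear_intro[where K=1])
  show "single k (a + b) = single k a + single k b" for a b :: 'a by transfer auto
  show "single k (r *\<^sub>R a) = r *\<^sub>R single k a" for r and a :: 'a by transfer auto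
  show "norm (single k a) \<le> norm a * 1" for a :: 'a
  proof -
    have "(norm (single k a))\<^sup>2 = (norm a)\<^sup>2"
      unfolding norm_ell2_square single.rep_eq by (subst suminf_finite[of "{k}"]) auto
    then show ?thesis by simp
  qed
qed

lemma ell2_eqI: "(\<And>n. Rep_ell2 v n = Rep_ell2 w n) \<Longrightarrow> v = w"
  by (simp add: Rep_ell2_inject[symmetric] fun_eq_iff)
lemma diag_single: "diag x (single k a) = single k (app x a)"
  by (rule ell2_eqI) (simp add: diag.rep_eq single.rep_eq)
lemma diag_mult: "diag x (diag y v) = diag (x * y) v"
  by (rule ell2_eqI) (simp add: diag.rep_eq)
lemma diag_add: "diag (x + y) v = diag x v + diag y v"
  by (rule ell2_eqI) (simp add: diag.rep_eq plus_ell2.rep_eq)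
lemma diag_diff: "diag (x - y) v = diag x v - diag y v"
  by (rule ell2_eqI) (simp add: diag.rep_eq minus_ell2.rep_eq)
lemma diag_one: "diag 1 v = v"
  by (rule ell2_eqI) (simp add: diag.rep_eq)
lemma inner_diag: "inner (diag x v) w = inner v (diag (adj x) w)"
  by (simp add: inner_ell2.rep_eq diag.rep_eq inner_eq_Re_cinner cinner_adj')

lemma bounded_linear_Rep_ell2: "bounded_linear (\<lambda>v. Rep_ell2 v n)"
  by (rule bounded_linear_intro[where K=1])
    (auto simp: plus_ell2.rep_eq scaleR_ell2.rep_eq norm_Rep_ell2)

lemma Rep_ell2_sum: "Rep_ell2 (sum f F) n = (\<Sum>k\<in>F. Rep_ell2 (f k) n)"
  by (rule linear_sum[OF bounded_linear.linear[OF bounded_linear_Rep_ell2]])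

lemma ell2_expansion:
  fixes v :: "'h::chilbert ell2"
  shows "(\<lambda>N. \<Sum>k<N. single k (Rep_ell2 v k)) \<longlonglongrightarrow> v"
proof -
  let ?g = "\<lambda>n. (norm (Rep_ell2 v n))\<^sup>2"
  have "(norm ((\<Sum>k<N. single k (Rep_ell2 v k)) - v))\<^sup>2 = suminf ?g - (\<Sum>k<N. ?g k)" for N
  proof -
    have "(norm ((\<Sum>k<N. single k (Rep_ell2 v k)) - v))\<^sup>2 = (\<Sum>n. if n < N then 0 else ?g n)"
      unfolding norm_ell2_square minus_ell2.rep_eq Rep_ell2_sum single.rep_eq
      by (rule suminf_cong) (simp add: sum.delta)
    also have "\<dots> = (\<Sum>n. ?g n - (if n \<in> {..<N} then ?g n else 0))" by (rule suminf_cong) simp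
    also have "\<dots> = suminf ?g - (\<Sum>n. if n \<in> {..<N} then ?g n else 0)"
      by (rule suminf_diff[symmetric, OF sqsum_Rep_ell2]) (rule summable_If_finite_set, simp)
    also have "(\<Sum>n. if n \<in> {..<N} then ?g n else 0) = (\<Sum>k<N. ?g k)"
      using sums_unique[OF sums_If_finite_set[of "{..<N}" ?g]] by simp
    finally show ?thesis .
  qed
  moreover have "(\<lambda>N. suminf ?g - (\<Sum>k<N. ?g k)) \<longlonglongrightarrow> suminf ?g - suminf ?g"
    by (intro tendsto_diff tendsto_const summable_LIMSEQ sqsum_Rep_ell2)
  ultimately have "(\<lambda>N. (norm ((\<Sum>k<N. single k (Rep_ell2 v k)) - v))\<^sup>2) \<longlonglongrightarrow> 0" by simp
  from tendsto_real_sqrt[OF this] have "(\<lambda>N. norm ((\<Sum>k<N. single k (Rep_ell2 v k)) - v)) \<longlonglongrightarrow> 0" by simp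
  then show ?thesis by (rule LIM_zero_cancel[OF tendsto_norm_zero_cancel])
qed

text \<open>By Cauchy-Schwarz, a functional given by sequences A and B is bounded by
  \<open>norm A\<close> times the norm of the amplified operator at B. Working with one vector
  instead of finitely many is what lets the bicommutant theorem be proved with a single cyclic
  subspace.\<close>

lemma sigma_weak_neighbourhood:
  fixes x :: "'h::chilbert bop"
  assumes "openin sigma_weak U" "x \<in> U"
  shows "\<exists>b d. 0 < d \<and> (\<forall>y. (norm (diag (y - x) b))\<^sup>2 < d \<longrightarrow> y \<in> U)"
proof -
  have "generate_topology_on {{x. (\<Sum>n. cinner (a n) (app x (b n))) \<in> U} | (a :: nat \<Rightarrow> 'h) (b :: nat \<Rightarrow> 'h) U.
        sqsum a \<and> sqsum b \<and> open U} U"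
    using assms(1) unfolding sigma_weak_def by (rule openin_topology_generated_by)
  then show ?thesis using assms(2)
  proof (induction U)
    case (Int U V)
    from Int obtain b d where b: "0 < d" "\<And>y. (norm (diag (y - x) b))\<^sup>2 < d \<Longrightarrow> y \<in> U" by auto
    from Int obtain c e where c: "0 < e" "\<And>y. (norm (diag (y - x) c))\<^sup>2 < e \<Longrightarrow> y \<in> V" by auto
    \<comment> \<open>Interleaving the two sequences gives one vector whose squared norm under any
      amplified operator is the sum of the two, so it controls both neighbourhoods.\<close>
    define f where "f n = (if even n then Rep_ell2 c (n div 2) else Rep_ell2 b ((n - 1) div 2))" for n :: nat
    have sums: "(\<lambda>n. (norm (app z (f n)))\<^sup>2) sums ((norm (diag z c))\<^sup>2 + (norm (diag z b))\<^sup>2)" for z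
    proof -
      have s: "(\<lambda>n. (norm (app z (Rep_ell2 v n)))\<^sup>2) sums (norm (diag z v))\<^sup>2" for v
        using summable_sums[OF sqsum_Rep_ell2[of "diag z v"]] by (simp add: norm_ell2_square diag.rep_eq)
      have "(\<lambda>n. if even n then (norm (app z (Rep_ell2 c (n div 2))))\<^sup>2 else (norm (app z (Rep_ell2 b ((n - 1) div 2))))\<^sup>2)
          sums ((norm (diag z c))\<^sup>2 + (norm (diag z b))\<^sup>2)"
        by (subst add.commute) (rule sums_if[OF s s])
      moreover have "(norm (app z (f n)))\<^sup>2 = (if even n then (norm (app z (Rep_ell2 c (n div 2))))\<^sup>2 else (norm (app z (Rep_ell2 b ((n - 1) div 2))))\<^sup>2)" for n
        by (simp add: f_def)
      ultimately show ?thesis by simp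
    qed
    have "sqsum f" using sums_summable[OF sums[of 1]] by simp
    then have Rf: "Rep_ell2 (Abs_ell2 f) = f" by (simp add: Abs_ell2_inverse)
    have nf: "(norm (diag z (Abs_ell2 f)))\<^sup>2 = (norm (diag z c))\<^sup>2 + (norm (diag z b))\<^sup>2" for z
      unfolding norm_ell2_square[of "diag z (Abs_ell2 f)"] diag.rep_eq Rf using sums_unique[OF sums] by simp
    show ?case
    proof (intro exI conjI allI impI)
      show "0 < min d e" using b(1) c(1) by simp
      fix y assume "(norm (diag (y - x) (Abs_ell2 f)))\<^sup>2 < min d e"
      then have "(norm (diag (y - x) b))\<^sup>2 < d" "(norm (diag (y - x) c))\<^sup>2 < e"
        unfolding nf using zero_le_power2[of "norm (diag (y - x) b)"] zero_le_power2[of "norm (diag (y - x) c)"] by linarith+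
      then show "y \<in> U \<inter> V" using b(2) c(2) by blast
    qed
  next
    case (UN K)
    then obtain k where k: "k \<in> K" "x \<in> k" by blast
    from UN.IH[OF this] obtain b d where "0 < d" "\<And>y. (norm (diag (y - x) b))\<^sup>2 < d \<Longrightarrow> y \<in> k" by blast
    then show ?case using k by (intro exI[of _ b] exI[of _ d]) blast
  next
    case (Basis V)
    then obtain a b and W :: "complex set" where V: "V = {x. (\<Sum>n. cinner (a n) (app x (b n))) \<in> W}"
      "sqsum (a :: nat \<Rightarrow> 'h)" "sqsum (b :: nat \<Rightarrow> 'h)" "open W" by blast
    let ?f = "\<lambda>y. (\<Sum>n. cinner (a n) (app y (b n)))"
    from V(4) Basis(2) obtain e where e: "e > 0" "ball (?f x) e \<subseteq> W" unfolding V(1) open_contains_ball by auto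
    define A where "A = Abs_ell2 a" define B where "B = Abs_ell2 b"
    have AB: "Rep_ell2 A = a" "Rep_ell2 B = b" using V by (simp_all add: A_def B_def Abs_ell2_inverse)
    have fb: "cmod (?f z) \<le> norm A * norm (diag z B)" for z
    proof -
      have sm: "summable (\<lambda>n. norm (a n) * norm (app z (b n)))" by (rule sqsum_mult_norm[OF V(2) sqsum_app[OF V(3)]])
      have "cmod (?f z) \<le> (\<Sum>n. norm (a n) * norm (app z (b n)))"
        by (rule norm_suminf_le[OF _ sm]) (rule cmod_cinner_le)
      also have "\<dots> \<le> norm A * norm (diag z B)"
      proof (rule suminf_le_const[OF sm])
        fix m
        have "(\<Sum>n<m. norm (a n) * norm (app z (b n))) \<le> L2_set (\<lambda>n. norm (a n)) {..<m} * L2_set (\<lambda>n. norm (app z (b n))) {..<m}"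
          using L2_set_mult_ineq[of "\<lambda>n. norm (a n)" "\<lambda>n. norm (app z (b n))" "{..<m}"] by simp
        also have "\<dots> \<le> norm A * norm (diag z B)"
        proof (rule mult_mono)
          have *: "L2_set (\<lambda>n. norm (Rep_ell2 v n)) {..<m} \<le> norm v" for v :: "'h ell2"
            unfolding L2_set_def
            by (rule real_le_lsqrt) (auto simp: norm_ell2_square sum_nonneg intro: sum_le_suminf[OF sqsum_Rep_ell2])
          show "L2_set (\<lambda>n. norm (a n)) {..<m} \<le> norm A" using *[of A] by (simp add: AB)
          show "L2_set (\<lambda>n. norm (app z (b n))) {..<m} \<le> norm (diag z B)" using *[of "diag z B"] by (simp add: AB diag.rep_eq)
        qed auto
        finally show "(\<Sum>n<m. norm (a n) * norm (app z (b n))) \<le> norm A * norm (diag z B)" .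
      qed
      finally show ?thesis .
    qed
    \<comment> \<open>The added 1 avoids a division by zero when A is the zero sequence.\<close>
    define d where "d = (e / (norm A + 1))\<^sup>2"
    have A1: "norm A + 1 > 0" by (simp add: add_nonneg_pos)
    show ?case
    proof (intro exI conjI allI impI)
      show "0 < d" using e(1) A1 by (simp add: d_def)
      fix y assume "(norm (diag (y - x) B))\<^sup>2 < d"
      then have "norm (diag (y - x) B) < e / (norm A + 1)"
        unfolding d_def by (rule power2_less_imp_less) (use e A1 in simp)
      then have *: "norm (diag (y - x) B) * (norm A + 1) < e" using A1 by (simp add: pos_less_divide_eq)
      have "?f (x + (y - x)) = ?f x + ?f (y - x)" by (rule swf_add[OF V(2,3)])
      then have "dist (?f x) (?f y) = cmod (?f (y - x))" by (simp add: dist_norm norm_minus_commute)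
      also have "\<dots> \<le> norm A * norm (diag (y - x) B)" by (rule fb)
      also have "\<dots> \<le> norm (diag (y - x) B) * (norm A + 1)" by (simp add: algebra_simps)
      finally have "?f y \<in> ball (?f x) e" using * by simp
      then show "y \<in> V" unfolding V(1) using e(2) by blast
    qed
  qed simp
qed

text \<open>In the amplification let e project onto the closure of A b. It commutes with the
  amplified A, so its matrix entries lie in the commutant of A and commute with x; hence e commutes
  with the amplified x. As 1 is in A, the vector b is fixed by e, and so x b lies in the closure of
  A b.\<close>

theorem bicommutant:
  fixes A :: "'h::chilbert bop set"
  assumes one: "1 \<in> A" and add: "\<And>x y. x \<in> A \<Longrightarrow> y \<in> A \<Longrightarrow> x + y \<in> A"
    and mult: "\<And>x y. x \<in> A \<Longrightarrow> y \<in> A \<Longrightarrow> x * y \<in> A"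
    and scale: "\<And>c x. x \<in> A \<Longrightarrow> scaleOp c x \<in> A" and adj: "\<And>x. x \<in> A \<Longrightarrow> adj x \<in> A"
  shows "commutant (commutant A) \<subseteq> sigma_weak closure_of A"
proof
  fix x assume x: "x \<in> commutant (commutant A)"
  have key: "\<exists>y\<in>A. (norm (diag (y - x) b))\<^sup>2 < d" if d: "d > 0" for b :: "'h ell2" and d
  proof -
    define S0 where "S0 = (\<lambda>y. diag y b) ` A"
    define S where "S = closure S0"
    have "subspace S0"
      unfolding subspace_def
    proof (intro conjI ballI allI)
      have "diag 0 b = 0" by transfer simp
      moreover have "0 \<in> A" using scale[OF one, of 0] by simp
      ultimately show "0 \<in> S0" unfolding S0_def by (metis image_eqI)
      show "v + w \<in> S0" if "v \<in> S0" "w \<in> S0" for v w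
        using that add unfolding S0_def by (auto simp flip: diag_add)
      show "r *\<^sub>R v \<in> S0" if v: "v \<in> S0" for r v
      proof -
        obtain y where y: "y \<in> A" "v = diag y b" using v by (auto simp: S0_def)
        have "r *\<^sub>R v = diag (scaleOp (complex_of_real r) y) b" unfolding y(2) by transfer (simp add: scaleR_scaleC)
        then show ?thesis using scale[OF y(1)] by (simp add: S0_def)
      qed
    qed
    then have subS: "subspace S" unfolding S_def by (rule subspace_closure)
    have clS: "closed S" by (simp add: S_def)
    obtain e where e: "bounded_linear e" "\<And>v. e v \<in> S" "\<And>v t. t \<in> S \<Longrightarrow> inner (v - e v) t = 0"
      "\<And>v s. s \<in> S \<Longrightarrow> (\<And>t. t \<in> S \<Longrightarrow> inner (v - s) t = 0) \<Longrightarrow> e v = s"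
      using projection_exists[OF clS subS] by metis
    interpret e: bounded_linear e by (rule e(1))
    have inv: "diag y v \<in> S" if "y \<in> A" "v \<in> S" for y v
    proof -
      have "diag y ` closure S0 \<subseteq> closure S0"
      proof (rule image_closure_subset)
        show "continuous_on (closure S0) (diag y)" by (rule linear_continuous_on[OF bounded_linear_diag])
        show "diag y ` S0 \<subseteq> closure S0"
          using mult[OF \<open>y \<in> A\<close>] by (auto simp: S0_def diag_mult intro!: closure_subset[THEN subsetD])
      qed simp
      then show ?thesis using that(2) by (auto simp: S_def)
    qed
    have ecom: "e (diag y v) = diag y (e v)" if "y \<in> A" for y v
    proof (rule e(4))
      show "diag y (e v) \<in> S" by (rule inv[OF that e(2)])
      fix t assume "t \<in> S"
      then have "inner (v - e v) (diag (adj y) t) = 0" by (intro e(3) inv adj that)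
      then show "inner (diag y v - diag y (e v)) t = 0"
        using inner_diag[of y "v - e v" t] by (simp add: linear_diff[OF bounded_linear.linear[OF bounded_linear_diag]])
    qed
    define E where "E m n a = Rep_ell2 (e (single n a)) m" for m n and a :: 'h
    have Ebl: "bounded_linear (E m n)" for m n
      unfolding E_def
      by (rule bounded_linear_compose[OF bounded_linear_Rep_ell2 bounded_linear_compose[OF e(1) bounded_linear_single]])
    have Ecom: "E m n (app y a) = app y (E m n a)" if "y \<in> A" for y m n a
      using ecom[OF that, of "single n a"] unfolding E_def by (simp add: diag_single diag.rep_eq)
    have E: "\<exists>z. app z = E m n" for m n
    proof -
      obtain K where "\<And>a. norm (E m n a) \<le> norm a * K" using bounded_linear.bounded[OF Ebl] by blast
      then show ?thesis
      proof (intro bop_of_bound[where K=K])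
        show "E m n (a + c) = E m n a + E m n c" for a c by (rule linear_add[OF bounded_linear.linear[OF Ebl]])
        \<comment> \<open>The projection was constructed for the real inner product only. Complex
          linearity holds because it commutes with the scalar operators, which belong to A.\<close>
        show "E m n (c *\<^sub>C a) = c *\<^sub>C E m n a" for c a
          using Ecom[OF scale[OF one], of m n c a] by simp
      qed (simp add: mult.commute)
    qed
    have Ex: "E m n (app x a) = app x (E m n a)" for m n a
    proof -
      obtain z where z: "app z = E m n" using E by blast
      have "z \<in> commutant A" unfolding commutant_def
        using Ecom z by (auto intro!: bop_eqI)
      then have "x * z = z * x" using x unfolding commutant_def by auto
      then show ?thesis using z by (metis app_times)
    qed
    have ex: "e (diag x v) = diag x (e v)" for v
    proof -
      have "Rep_ell2 (e (diag x v)) m = Rep_ell2 (diag x (e v)) m" for m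
      proof -
        have bl: "bounded_linear (\<lambda>v. Rep_ell2 (e (diag x v)) m)" "bounded_linear (\<lambda>v. Rep_ell2 (diag x (e v)) m)"
          by (intro bounded_linear_compose[OF bounded_linear_Rep_ell2] bounded_linear_compose[OF e(1) bounded_linear_diag]
              bounded_linear_compose[OF bounded_linear_diag e(1)])+
        have "Rep_ell2 (e (diag x (\<Sum>k<N. single k (Rep_ell2 v k)))) m = Rep_ell2 (diag x (e (\<Sum>k<N. single k (Rep_ell2 v k)))) m" for N
          unfolding linear_sum[OF bounded_linear.linear[OF bl(1)]] linear_sum[OF bounded_linear.linear[OF bl(2)]]
          using Ex[of m] unfolding E_def by (simp add: diag_single diag.rep_eq)
        with bounded_linear.tendsto[OF bl(1) ell2_expansion[of v]] bounded_linear.tendsto[OF bl(2) ell2_expansion[of v]]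
        show ?thesis by (simp add: LIMSEQ_unique)
      qed
      then show ?thesis by (simp add: Rep_ell2_inject[symmetric] fun_eq_iff)
    qed
    have "b \<in> S0" unfolding S0_def using one by (metis diag_one image_eqI)
    then have "e b = b" by (intro e(4)) (auto simp: S_def intro: closure_subset[THEN subsetD])
    then have "diag x b \<in> S" using ex[of b] e(2)[of "diag x b"] by simp
    then obtain w where w: "w \<in> S0" "dist w (diag x b) < sqrt d"
      using d unfolding S_def closure_approachable by (metis real_sqrt_gt_0_iff)
    then obtain y where y: "y \<in> A" "w = diag y b" by (auto simp: S0_def)
    have "(norm (diag (y - x) b))\<^sup>2 < (sqrt d)\<^sup>2"
      using w(2) unfolding y(2) dist_norm diag_diff by (intro power_strict_mono) auto
    then show ?thesis using y(1) d by auto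
  qed
  show "x \<in> sigma_weak closure_of A"
    unfolding in_closure_of
  proof (intro conjI allI impI)
    fix T assume T: "x \<in> T \<and> openin sigma_weak T"
    obtain b d where bd: "0 < d" "\<And>y. (norm (diag (y - x) b))\<^sup>2 < d \<Longrightarrow> y \<in> T"
      using sigma_weak_neighbourhood T by metis
    from key[OF bd(1)] show "\<exists>y. y \<in> A \<and> y \<in> T" using bd(2) by blast
  qed simp
qed

section \<open>Von Neumann algebras\<close>

lemma commutant_antimono: "S \<subseteq> T \<Longrightarrow> commutant T \<subseteq> commutant S" by (auto simp: commutant_def)
lemma subset_bicommutant: "S \<subseteq> commutant (commutant S)" by (auto simp: commutant_def)
lemma commutant_triple [simp]: "commutant (commutant (commutant S)) = commutant S"
  by (rule equalityI[OF commutant_antimono[OF subset_bicommutant] subset_bicommutant])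
lemma commutant_one: "1 \<in> commutant S" by (simp add: commutant_def)
lemma commutant_zero: "0 \<in> commutant S" by (simp add: commutant_def)
lemma commutant_add: "x \<in> commutant S \<Longrightarrow> y \<in> commutant S \<Longrightarrow> x + y \<in> commutant S"
  by (simp add: commutant_def distrib_left distrib_right)
lemma commutant_diff: "x \<in> commutant S \<Longrightarrow> y \<in> commutant S \<Longrightarrow> x - y \<in> commutant S"
  by (simp add: commutant_def left_diff_distrib right_diff_distrib)
lemma commutant_scale: "x \<in> commutant S \<Longrightarrow> scaleOp c x \<in> commutant S" by (simp add: commutant_def)
lemma commutant_mult: "x \<in> commutant S \<Longrightarrow> y \<in> commutant S \<Longrightarrow> x * y \<in> commutant S"
  unfolding commutant_def
proof (intro CollectI ballI)
  fix z assume *: "x \<in> {x. \<forall>y\<in>S. x * y = y * x}" "y \<in> {x. \<forall>y\<in>S. x * y = y * x}" "z \<in> S"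
  have "x * y * z = x * (z * y)" using * by (simp add: mult.assoc)
  also have "\<dots> = z * (x * y)" using * by (simp flip: mult.assoc)
  finally show "x * y * z = z * (x * y)" .
qed
lemma commutant_adj:
  assumes "\<And>y. y \<in> S \<Longrightarrow> adj y \<in> S" "x \<in> commutant S" shows "adj x \<in> commutant S"
  unfolding commutant_def
proof (intro CollectI ballI)
  fix y assume "y \<in> S"
  then have "x * adj y = adj y * x" using assms by (simp add: commutant_def)
  then have "adj (x * adj y) = adj (adj y * x)" by simp
  then show "adj x * y = y * adj x" by simp
qed

lemma closedin_commutant: "closedin sigma_weak (commutant S)"
proof -
  have eq: "commutant S = \<Inter> (insert UNIV ((\<lambda>y. {x. x * y = y * x}) ` S))" by (auto simp: commutant_def)
  have "closedin sigma_weak (UNIV :: 'a bop set)" using closedin_topspace[of "sigma_weak :: 'a bop topology"] by simp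
  then show ?thesis unfolding eq
    by (intro closedin_Inter)
      (auto intro: closedin_sigma_weak_eq continuous_map_sigma_weak_mult_left continuous_map_sigma_weak_mult_right)
qed

lemma commutant_strong_sum:
  assumes "strong_sum f K s" "\<And>k. k \<in> K \<Longrightarrow> f k \<in> commutant S" shows "s \<in> commutant S"
  unfolding commutant_def
proof (intro CollectI ballI)
  fix y assume "y \<in> S"
  then have "strong_sum (\<lambda>k. f k * y) K (y * s)"
    using strong_sum_mult_left[OF assms(1), of y] assms(2)
      strong_sum_cong[of K "\<lambda>k. f k * y" "\<lambda>k. y * f k"] by (simp add: commutant_def)
  then show "s * y = y * s" using strong_sum_mult_right[OF assms(1), of y] strong_sum_unique by blast
qed

text \<open>The operator e is the projection onto the closed range of x. Since S is closed under
  adjoints, its elements leave the range and its orthogonal complement invariant, which puts e into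
  the commutant.\<close>

lemma range_projection:
  fixes x :: "'h::chilbert bop"
  assumes adj: "\<And>y. y \<in> S \<Longrightarrow> adj y \<in> S" and x: "x \<in> commutant S"
  shows "\<exists>e. e \<in> commutant S \<and> adj e = e \<and> e * e = e \<and> e * x = x \<and> (\<forall>y. y * x = 0 \<longrightarrow> y * e = 0)"
proof -
  define R where "R = closure (range (app x))"
  have "subspace (range (app x))"
    by (rule linear_subspace_image[OF bounded_linear.linear[OF app_bounded_linear] subspace_UNIV])
  then have subR: "subspace R" unfolding R_def by (rule subspace_closure)
  obtain e where e: "bounded_linear e" "\<And>v. e v \<in> R" "\<And>v t. t \<in> R \<Longrightarrow> inner (v - e v) t = 0"
    "\<And>v s. s \<in> R \<Longrightarrow> (\<And>t. t \<in> R \<Longrightarrow> inner (v - s) t = 0) \<Longrightarrow> e v = s"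
    using projection_exists[OF _ subR] unfolding R_def by (metis closed_closure)
  have inv: "app y v \<in> R" if "y * x = x * z" "v \<in> R" for y z v
  proof -
    have "app y ` closure (range (app x)) \<subseteq> closure (range (app x))"
    proof (rule image_closure_subset[OF continuous_on_app])
      have "app y (app x a) = app x (app z a)" for a using that(1) by (metis app_times)
      then show "app y ` range (app x) \<subseteq> closure (range (app x))"
        by (auto intro!: closure_subset[THEN subsetD])
    qed simp
    then show ?thesis using that(2) by (auto simp: R_def)
  qed
  have ecom: "e (app y v) = app y (e v)" if "y * x = x * z" "adj y * x = x * z'" for y z z' v
  proof (rule e(4))
    show "app y (e v) \<in> R" by (rule inv[OF that(1) e(2)])
    fix t assume "t \<in> R"
    then have "inner (v - e v) (app (adj y) t) = 0" by (intro e(3) inv[OF that(2)])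
    then show "inner (app y v - app y (e v)) t = 0"
      by (simp add: inner_eq_Re_cinner cinner_adj' app_diff)
  qed
  obtain K where K: "\<And>a. norm (e a) \<le> norm a * K" using bounded_linear.bounded[OF e(1)] by blast
  \<comment> \<open>Scalar operators commute with x, so \<open>ecom\<close> applies to them and
    upgrades real to complex linearity.\<close>
  have esc: "e (c *\<^sub>C a) = c *\<^sub>C e a" for c a
    using ecom[of "scaleOp c 1" "scaleOp c 1" "scaleOp (cnj c) 1" a] by simp
  obtain p where p: "app p = e"
    using bop_of_bound[of e K, OF linear_add[OF bounded_linear.linear[OF e(1)]] esc] K by (auto simp: mult.commute)
  have pR: "e v = v" if "v \<in> R" for v using e(4)[OF that] by simp
  have "p \<in> commutant S" unfolding commutant_def
  proof (intro CollectI ballI bop_eqI)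
    fix y a assume "y \<in> S"
    then have "y * x = x * y" "adj y * x = x * adj y" using x adj by (auto simp: commutant_def)
    from ecom[OF this] show "app (p * y) a = app (y * p) a" by (simp add: p)
  qed
  moreover have "adj p = p"
  proof (rule adj_eqI)
    fix a b
    have *: "inner (e a) b = inner a (e b)" for a b
      using e(3)[OF e(2), of a b] e(3)[OF e(2), of b a] inner_commute[of b "e a"] inner_commute[of "e b" "e a"]
      unfolding inner_diff_left by linarith
    show "cinner (app p a) b = cinner a (app p b)"
      unfolding p cinner_inner using *[of a b] *[of "\<i> *\<^sub>C a" b] by (simp add: esc)
  qed
  moreover have "p * p = p" by (rule bop_eqI) (simp add: p pR e(2))
  moreover have "p * x = x"
    by (rule bop_eqI) (simp add: p pR R_def closure_subset[THEN subsetD])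
  moreover have "y * p = 0" if y: "y * x = 0" for y
  proof (rule bop_eqI)
    fix a
    have "closure (range (app x)) \<subseteq> {v. app y v = 0}"
    proof (rule closure_minimal)
      show "range (app x) \<subseteq> {v. app y v = 0}" using y by auto (metis app_times app_zero_op)
      show "closed {v. app y v = 0}" by (intro closed_Collect_eq continuous_on_app continuous_on_const)
    qed
    then show "app (y * p) a = app 0 a" using e(2)[of a] by (auto simp: p R_def)
  qed
  ultimately show ?thesis by blast
qed

section \<open>Tensor products\<close>

lemma sesquilinear_form_bop:
  fixes B :: "'h::chilbert \<Rightarrow> 'h \<Rightarrow> complex"
  assumes addl: "\<And>a b c. B (a + b) c = B a c + B b c" and scl: "\<And>r a c. B (r *\<^sub>C a) c = cnj r * B a c"
    and addr: "\<And>a b c. B a (b + c) = B a b + B a c" and scr: "\<And>r a c. B a (r *\<^sub>C c) = r * B a c"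
    and bd: "\<And>a c. cmod (B a c) \<le> K * norm a * norm c"
  shows "\<exists>x. \<forall>a b. cinner a (app x b) = B a b"
proof -
  have "\<exists>z. \<forall>a. cinner a z = B a c" for c
  proof -
    have "bounded_linear (\<lambda>a. Re (B a c))"
    proof (rule bounded_linear_intro[where K="K * norm c"])
      show "norm (Re (B a c)) \<le> norm a * (K * norm c)" for a
        using order_trans[OF abs_Re_le_cmod bd[of a c]] by (simp add: mult_ac)
    qed (simp_all add: addl scaleR_scaleC scl)
    from riesz[OF this] obtain z where z: "\<And>a. Re (B a c) = inner z a" by blast
    have Re: "Re (cinner a z) = Re (B a c)" for a
      using z[of a] by (simp add: inner_eq_Re_cinner[symmetric] inner_commute)
    have "cinner a z = B a c" for a
      using Re[of a] Re[of "\<i> *\<^sub>C a"] by (simp add: scl cinner_scaleC_left complex_eq_iff)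
    then show ?thesis by blast
  qed
  then obtain f where f: "\<And>c a. cinner a (f c) = B a c" by metis
  have "\<exists>x. app x = f"
  proof (rule bop_of_bound)
    show "f (a + b) = f a + f b" for a b by (rule cinner_ext) (simp add: f cinner_add_right addr)
    show "f (c *\<^sub>C a) = c *\<^sub>C f a" for c a by (rule cinner_ext) (simp add: f cinner_scaleC_right scr)
    show "norm (f a) \<le> K * norm a" for a
    proof (cases "f a = 0")
      case True
      show ?thesis
      proof (cases "a = 0")
        case False
        have "0 \<le> K * norm a * norm a" using order_trans[OF norm_ge_zero bd[of a a]] .
        then have "0 \<le> K" using False by (simp add: zero_le_mult_iff)
        then show ?thesis using True by simp
      qed (use True in simp)
    next
      case False
      have "(norm (f a))\<^sup>2 = cmod (cinner (f a) (f a))" by (simp add: cinner_self norm_power)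
      also have "\<dots> \<le> K * norm (f a) * norm a" unfolding f by (rule bd)
      finally show ?thesis using False by (simp add: power2_eq_square mult.commute mult.left_commute)
    qed
  qed
  then show ?thesis using f by metis
qed

lemma bop_extension:
  fixes f :: "'h::chilbert \<Rightarrow> 'h"
  assumes add: "\<And>a b. a \<in> U \<Longrightarrow> b \<in> U \<Longrightarrow> a + b \<in> U \<and> f (a + b) = f a + f b"
    and sc: "\<And>c a. a \<in> U \<Longrightarrow> c *\<^sub>C a \<in> U \<and> f (c *\<^sub>C a) = c *\<^sub>C f a"
    and bd: "\<And>a. a \<in> U \<Longrightarrow> norm (f a) \<le> K * norm a" and dense: "closure U = UNIV" and K: "K \<ge> 0"
  shows "\<exists>z. \<forall>a\<in>U. app z a = f a"
proof -
  have diff: "norm (f a - f b) \<le> K * norm (a - b)" if "a \<in> U" "b \<in> U" for a b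
  proof -
    have mb: "(-1) *\<^sub>C b \<in> U" "f ((-1) *\<^sub>C b) = (-1) *\<^sub>C f b" using sc that by auto
    have "a + (-1) *\<^sub>C b \<in> U" "f (a + (-1) *\<^sub>C b) = f a + (-1) *\<^sub>C f b" using add[OF that(1) mb(1)] mb(2) by auto
    then show ?thesis using bd[of "a + (-1) *\<^sub>C b"] by (simp add: scaleC_minus_one)
  qed
  have "uniformly_continuous_on U f"
    unfolding uniformly_continuous_on_def
  proof (intro allI impI)
    fix e :: real assume "e > 0"
    have "dist (f b) (f a) < e" if "a \<in> U" "b \<in> U" "dist b a < e / (K + 1)" for a b
    proof -
      have "dist (f b) (f a) \<le> K * dist b a" using diff[OF that(2,1)] by (simp add: dist_norm)
      also have "\<dots> \<le> (K + 1) * dist b a" by (intro mult_right_mono) auto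
      also have "\<dots> < e" using that(3) K by (simp add: pos_less_divide_eq mult.commute)
      finally show ?thesis .
    qed
    moreover have "e / (K + 1) > 0" using \<open>e > 0\<close> K by simp
    ultimately show "\<exists>d>0. \<forall>x\<in>U. \<forall>x'\<in>U. dist x' x < d \<longrightarrow> dist (f x') (f x) < e" by blast
  qed
  then obtain g where g: "uniformly_continuous_on (closure U) g" "\<And>x. x \<in> U \<Longrightarrow> f x = g x"
    using uniformly_continuous_on_extension_on_closure by metis
  have cg: "continuous_on UNIV g" using uniformly_continuous_imp_continuous[OF g(1)] dense by simp
  then have lim: "(\<lambda>n. g (u n)) \<longlonglongrightarrow> g a" if "u \<longlonglongrightarrow> a" for u a
    using continuous_on_tendsto_compose[OF cg that] by simp
  have seq: "\<exists>u. (\<forall>n. u n \<in> U) \<and> u \<longlonglongrightarrow> a" for a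
    using dense unfolding closure_sequential[symmetric] by simp
  have "\<exists>z. app z = g"
  proof (rule bop_of_bound)
    fix a b c
    obtain u where u: "\<And>n. u n \<in> U" "u \<longlonglongrightarrow> a" using seq by metis
    obtain w where w: "\<And>n. w n \<in> U" "w \<longlonglongrightarrow> b" using seq by metis
    have "(\<lambda>n. g (u n + w n)) \<longlonglongrightarrow> g (a + b)" by (intro lim tendsto_add u w)
    moreover have "g (u n + w n) = g (u n) + g (w n)" for n using add[OF u(1) w(1)] g(2) u(1) w(1) by metis
    moreover have "(\<lambda>n. g (u n) + g (w n)) \<longlonglongrightarrow> g a + g b" by (intro tendsto_add lim u w)
    ultimately show "g (a + b) = g a + g b" by (simp add: LIMSEQ_unique)
    have "(\<lambda>n. g (c *\<^sub>C u n)) \<longlonglongrightarrow> g (c *\<^sub>C a)"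
      by (intro lim bounded_linear.tendsto[OF scaleC_bounded_linear] u)
    moreover have "g (c *\<^sub>C u n) = c *\<^sub>C g (u n)" for n using sc[OF u(1)] g(2) u(1) by metis
    moreover have "(\<lambda>n. c *\<^sub>C g (u n)) \<longlonglongrightarrow> c *\<^sub>C g a"
      by (intro bounded_linear.tendsto[OF scaleC_bounded_linear] lim u)
    ultimately show "g (c *\<^sub>C a) = c *\<^sub>C g a" by (simp add: LIMSEQ_unique)
    have "norm (g (u n)) \<le> K * norm (u n)" for n using bd[OF u(1)] g(2)[OF u(1)] by simp
    then show "norm (g a) \<le> K * norm a"
      by (intro LIMSEQ_le[OF tendsto_norm[OF lim[OF u(2)]] tendsto_mult_left[OF tendsto_norm[OF u(2)]]]) auto
  qed
  then show ?thesis using g(2) by metis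
qed

section \<open>Operators on a Hilbert space tensor product and slice maps\<close>

locale htensor =
  fixes t :: "'h::chilbert \<Rightarrow> 'h2::chilbert \<Rightarrow> 'k::chilbert"
  assumes ht: "hilbert_tensor t"
begin

lemma add_left: "t (a + a') b = t a b + t a' b" using ht by (simp add: hilbert_tensor_def)
lemma scale_left: "t (c *\<^sub>C a) b = c *\<^sub>C t a b" using ht by (simp add: hilbert_tensor_def)
lemma cinner_t: "cinner (t a b) (t a' b') = cinner a a' * cinner b b'" using ht by (simp add: hilbert_tensor_def)
lemma dense: "closure (span {t a b | a b. True}) = UNIV" using ht by (simp add: hilbert_tensor_def)
lemma norm_t: "norm (t a b) = norm a * norm b"
proof -
  have "complex_of_real ((norm (t a b))\<^sup>2) = complex_of_real ((norm a * norm b)\<^sup>2)"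
    unfolding cinner_self[symmetric] cinner_t by (simp add: cinner_self power_mult_distrib)
  then have "(norm (t a b))\<^sup>2 = (norm a * norm b)\<^sup>2" by (simp only: of_real_eq_iff)
  then show ?thesis by (simp add: power2_eq_iff_nonneg)
qed

lemma bop_ext_t: "(\<And>a b. app x (t a b) = app y (t a b)) \<Longrightarrow> x = y"
proof (rule bop_eqI)
  fix v assume *: "\<And>a b. app x (t a b) = app y (t a b)"
  have "span {t a b | a b. True} \<subseteq> {v. app x v = app y v}"
  proof (rule span_minimal)
    show "subspace {v. app x v = app y v}"
      by (auto simp: subspace_def app_add app_scaleR)
  qed (use * in auto)
  then have "closure (span {t a b | a b. True}) \<subseteq> {v. app x v = app y v}"
    by (intro closure_minimal closed_Collect_eq continuous_on_app)
  then show "app x v = app y v" using dense by auto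
qed

lemma bop_ext_cinner_t:
  assumes "\<And>a b a' b'. cinner (t a b) (app x (t a' b')) = cinner (t a b) (app y (t a' b'))"
  shows "x = y"
proof (rule bop_ext_t)
  fix a' b'
  let ?d = "app x (t a' b') - app y (t a' b')"
  have "span {t a b | a b. True} \<subseteq> {v. cinner v ?d = 0}"
  proof (rule span_minimal)
    show "subspace {v. cinner v ?d = 0}"
      by (auto simp: subspace_def cinner_add_left cinner_scaleR_left)
  qed (use assms in \<open>auto simp: cinner_diff_right\<close>)
  then have "closure (span {t a b | a b. True}) \<subseteq> {v. cinner v ?d = 0}"
    by (intro closure_minimal closed_Collect_eq linear_continuous_on bounded_linear_cinner_left continuous_on_const)
  then have "cinner ?d ?d = 0" using dense by auto
  then show "app x (t a' b') = app y (t a' b')" by (simp add: cinner_self)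
qed

text \<open>This is y \<otimes> 1 applied to the sum of the elementary tensors in the list, without
  presupposing that y \<otimes> 1 exists. Lists keep apart the different ways of writing one
  vector.\<close>

definition tsum :: "'h bop \<Rightarrow> ('h \<times> 'h2) list \<Rightarrow> 'k" where
  "tsum y xs = (\<Sum>(a, b)\<leftarrow>xs. t (app y a) b)"

lemma tsum_simps [simp]: "tsum y [] = 0" "tsum y (p # xs) = t (app y (fst p)) (snd p) + tsum y xs"
  by (simp_all add: tsum_def case_prod_unfold)
lemma tsum_append: "tsum y (xs @ ys) = tsum y xs + tsum y ys" by (simp add: tsum_def)
lemma tsum_scale: "tsum y (map (\<lambda>(a, b). (c *\<^sub>C a, b)) xs) = c *\<^sub>C tsum y xs"
  by (induction xs) (auto simp: app_scaleC scale_left scaleC_add_right scaleC_zero_right)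
lemma tsum_diff_op: "tsum (y - z) xs = tsum y xs - tsum z xs"
proof (induction xs)
  case (Cons p xs)
  have "t (a - a') b = t a b - t a' b" for a a' b
    using add_left[of a "- a'" b] scale_left[of "-1" a' b] by (simp add: scaleC_minus_one)
  then show ?case using Cons by simp
qed simp
lemma tsum_scale_op: "tsum (scaleOp c y) xs = c *\<^sub>C tsum y xs"
  by (induction xs) (auto simp: scale_left scaleC_add_right scaleC_zero_right)

lemma cinner_tsum: "cinner (tsum y xs) (tsum z ys) = cinner (tsum 1 xs) (tsum (adj y * z) ys)"
proof (induction xs)
  case (Cons p xs)
  have "cinner (t (app y a) b) (tsum z ys) = cinner (t a b) (tsum (adj y * z) ys)" for a b
    by (induction ys) (auto simp: cinner_add_right cinner_t cinner_adj')
  then show ?case using Cons by (simp add: cinner_add_left)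
qed simp

text \<open>After scaling to a contraction y, write 1 - y^* y = s^2 with s self-adjoint. The squared
  norms of the sums for y and for s add up to that of the sum for 1, so the sum for y is no longer
  than the sum for 1.\<close>

lemma norm_tsum: "\<exists>K\<ge>0. \<forall>xs. norm (tsum x xs) \<le> K * norm (tsum 1 xs)"
proof -
  obtain c where c: "c > 0" "\<And>a. norm (app x a) \<le> c * norm a" using app_bound by blast
  define y where "y = scaleOp (complex_of_real (1 / c)) x"
  have y: "norm (app y a) \<le> norm a" for a
    using c(2)[of a] c(1) by (simp add: y_def norm_scaleC norm_divide field_simps)
  have ky: "norm (app (adj y * y) a) \<le> norm a" for a
  proof (cases "app (adj y * y) a = 0")
    case False
    let ?v = "app (adj y * y) a"
    have "(norm ?v)\<^sup>2 = cmod (cinner ?v ?v)" by (simp add: cinner_self norm_power)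
    also have "\<dots> = cmod (cinner (app y ?v) (app y a))" by (simp add: cinner_adj')
    also have "\<dots> \<le> norm (app y ?v) * norm (app y a)" by (rule cmod_cinner_le)
    also have "\<dots> \<le> norm ?v * norm a" by (intro mult_mono y) auto
    finally show ?thesis using False by (simp add: power2_eq_square)
  qed simp
  obtain s where s: "adj s = s" "s * s = 1 - adj y * y"
    using op_sqrt[of "adj y * y"] ky by auto
  have le: "norm (tsum y xs) \<le> norm (tsum 1 xs)" for xs
  proof -
    have "cinner (tsum s xs) (tsum s xs) = cinner (tsum 1 xs) (tsum 1 xs) - cinner (tsum y xs) (tsum y xs)"
      using cinner_tsum[of s xs s xs] cinner_tsum[of y xs y xs] by (simp add: s tsum_diff_op cinner_diff_right)
    then have "complex_of_real ((norm (tsum s xs))\<^sup>2) = complex_of_real ((norm (tsum 1 xs))\<^sup>2 - (norm (tsum y xs))\<^sup>2)"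
      by (simp add: cinner_self)
    then have "(norm (tsum s xs))\<^sup>2 = (norm (tsum 1 xs))\<^sup>2 - (norm (tsum y xs))\<^sup>2" by (simp only: of_real_eq_iff)
    then have "(norm (tsum y xs))\<^sup>2 \<le> (norm (tsum 1 xs))\<^sup>2" by (metis diff_ge_0_iff_ge zero_le_power2)
    then show ?thesis by (rule power2_le_imp_le) simp
  qed
  have "x = scaleOp (complex_of_real c) y" using c(1) by (simp add: y_def flip: of_real_mult)
  then have "norm (tsum x xs) \<le> c * norm (tsum 1 xs)" for xs
    using le[of xs] c(1) by (simp add: tsum_scale_op norm_scaleC)
  then show ?thesis using c(1) by (intro exI[of _ c]) auto
qed

lemma tensor_left_exists: "\<exists>z. \<forall>a b. app z (t a b) = t (app x a) b"
proof -
  obtain K where K: "K \<ge> 0" "\<And>xs. norm (tsum x xs) \<le> K * norm (tsum 1 xs)" using norm_tsum by blast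
  define U where "U = range (tsum 1)"
  \<comment> \<open>Concatenating one list with the negative of the other represents 0, and the norm
    bound then kills its image.\<close>
  have wd: "tsum x xs = tsum x ys" if "tsum 1 xs = tsum 1 ys" for xs ys
  proof -
    let ?zs = "xs @ map (\<lambda>(a, b). ((-1) *\<^sub>C a, b)) ys"
    have "norm (tsum x ?zs) \<le> K * norm (tsum 1 ?zs)" by (rule K)
    also have "tsum 1 ?zs = 0" unfolding tsum_append tsum_scale by (simp add: that scaleC_minus_one)
    finally have "tsum x ?zs = 0" by simp
    then show ?thesis unfolding tsum_append tsum_scale by (simp add: scaleC_minus_one)
  qed
  define f where "f v = tsum x (SOME xs. tsum 1 xs = v)" for v
  have f: "f (tsum 1 xs) = tsum x xs" for xs
    unfolding f_def by (rule wd) (rule someI[of _ xs], rule refl)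
  have "span {t a b | a b. True} \<subseteq> U"
  proof (rule span_minimal)
    show "subspace U" unfolding subspace_def
    proof (intro conjI ballI allI)
      show "0 \<in> U" unfolding U_def by (metis rangeI tsum_simps(1))
      show "v + w \<in> U" if "v \<in> U" "w \<in> U" for v w
        using that unfolding U_def by (auto simp flip: tsum_append)
      show "r *\<^sub>R v \<in> U" if "v \<in> U" for r v
        using that unfolding U_def by (auto simp: scaleR_scaleC simp flip: tsum_scale)
    qed
    show "{t a b | a b. True} \<subseteq> U"
    proof (clarify)
      fix a b
      have "t a b = tsum 1 [(a, b)]" by simp
      then show "t a b \<in> U" unfolding U_def by blast
    qed
  qed
  then have dU: "closure U = UNIV" using closure_mono dense by blast
  have "\<exists>z. \<forall>a\<in>U. app z a = f a"
  proof (rule bop_extension[OF _ _ _ dU K(1)])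
    show "a + b \<in> U \<and> f (a + b) = f a + f b" if ab: "a \<in> U" "b \<in> U" for a b
    proof -
      obtain xs ys where "a = tsum 1 xs" "b = tsum 1 ys" using ab by (auto simp: U_def)
      then show ?thesis using f[of "xs @ ys"] unfolding U_def by (auto simp: f tsum_append simp flip: tsum_append)
    qed
    show "c *\<^sub>C a \<in> U \<and> f (c *\<^sub>C a) = c *\<^sub>C f a" if a: "a \<in> U" for c a
    proof -
      obtain xs where "a = tsum 1 xs" using a by (auto simp: U_def)
      then show ?thesis using f[of "map (\<lambda>(a, b). (c *\<^sub>C a, b)) xs"] unfolding U_def
        by (auto simp: f tsum_scale simp flip: tsum_scale)
    qed
    show "norm (f a) \<le> K * norm a" if "a \<in> U" for a
      using that K(2) by (auto simp: U_def f)
  qed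
  then obtain z where z: "\<And>a. a \<in> U \<Longrightarrow> app z a = f a" by blast
  have "app z (t a b) = t (app x a) b" for a b
  proof -
    have "t a b = tsum 1 [(a, b)]" by simp
    moreover have "tsum 1 [(a, b)] \<in> U" by (simp only: U_def rangeI)
    ultimately show ?thesis using z f[of "[(a, b)]"] by simp
  qed
  then show ?thesis by blast
qed

lemma swap: "htensor (\<lambda>b a. t a b)"
proof
  have "{t a b | b a. True} = {t a b | a b. True}" by blast
  then show "hilbert_tensor (\<lambda>b a. t a b)" using ht unfolding hilbert_tensor_def by (simp add: mult.commute)
qed

lemma app_tensor_op: "app (tensor_op t x y) (t a b) = t (app x a) (app y b)"
proof -
  obtain z where z: "\<And>a b. app z (t a b) = t (app x a) b" using tensor_left_exists by blast
  obtain w where w: "\<And>a b. app w (t a b) = t a (app y b)"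
    using htensor.tensor_left_exists[OF swap, of y] by blast
  have "\<forall>a b. app (z * w) (t a b) = t (app x a) (app y b)" by (simp add: z w)
  then have "\<exists>!z. \<forall>a b. app z (t a b) = t (app x a) (app y b)" using bop_ext_t by metis
  from theI'[OF this] show ?thesis unfolding tensor_op_def by blast
qed

lemma tensor_op_one [simp]: "tensor_op t 1 1 = 1" by (rule bop_ext_t) (simp add: app_tensor_op)
lemma tensor_op_mult: "tensor_op t x y * tensor_op t x' y' = tensor_op t (x * x') (y * y')"
  by (rule bop_ext_t) (simp add: app_tensor_op)
lemma tensor_op_adj: "adj (tensor_op t x y) = tensor_op t (adj x) (adj y)"
  by (rule bop_ext_cinner_t) (simp add: cinner_adj' app_tensor_op cinner_t)
lemma tensor_op_add_left: "tensor_op t (x + x') y = tensor_op t x y + tensor_op t x' y"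
  by (rule bop_ext_t) (simp add: app_tensor_op add_left)
lemma tensor_op_scale_left: "tensor_op t (scaleOp c x) y = scaleOp c (tensor_op t x y)"
  by (rule bop_ext_t) (simp add: app_tensor_op scale_left)
text \<open>The slice map id \<otimes> \<omega> for the vector functional \<omega>(y) = <b, y b'>.
  With the two tensor legs exchanged it gives the slices into the other algebra.\<close>

definition slice :: "'h2 \<Rightarrow> 'h2 \<Rightarrow> 'k bop \<Rightarrow> 'h bop" where
  "slice b b' c = (SOME s. \<forall>a a'. cinner a (app s a') = cinner (t a b) (app c (t a' b')))"

lemma cinner_slice: "cinner a (app (slice b b' c) a') = cinner (t a b) (app c (t a' b'))"
proof -
  obtain K where K: "K > 0" "\<And>v. norm (app c v) \<le> K * norm v" using app_bound by blast
  have "\<exists>s. \<forall>a a'. cinner a (app s a') = cinner (t a b) (app c (t a' b'))"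
  proof (rule sesquilinear_form_bop[where K="norm b * K * norm b'"])
    show "cmod (cinner (t a b) (app c (t a' b'))) \<le> norm b * K * norm b' * norm a * norm a'" for a a'
      using order_trans[OF cmod_cinner_le[of "t a b" "app c (t a' b')"] mult_left_mono[OF K(2) norm_ge_zero]]
      by (simp add: norm_t mult_ac)
  qed (simp_all add: add_left scale_left app_add app_scaleC cinner_add_left cinner_add_right cinner_scaleC_left cinner_scaleC_right)
  from someI_ex[OF this] show ?thesis unfolding slice_def by blast
qed

lemma slice_mult_left: "slice b b' (tensor_op t x 1 * c) = x * slice b b' c"
proof (rule bop_eqI_cinner)
  fix a a'
  have "cinner a (app (x * slice b b' c) a') = cinner (app (adj x) a) (app (slice b b' c) a')"
    by (simp add: cinner_adj)
  also have "\<dots> = cinner (app (adj (tensor_op t x 1)) (t a b)) (app c (t a' b'))"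
    by (simp add: cinner_slice tensor_op_adj app_tensor_op)
  also have "\<dots> = cinner (t a b) (app (tensor_op t x 1 * c) (t a' b'))"
    by (simp only: cinner_adj app_times)
  finally show "cinner a (app (slice b b' (tensor_op t x 1 * c)) a') = cinner a (app (x * slice b b' c) a')"
    by (simp only: cinner_slice)
qed

lemma slice_mult_right: "slice b b' (c * tensor_op t x 1) = slice b b' c * x"
  by (rule bop_eqI_cinner) (simp add: cinner_slice app_tensor_op)

lemma slice_tensor: "slice b b' (tensor_op t x y) = scaleOp (cinner b (app y b')) x"
  by (rule bop_eqI_cinner) (simp add: cinner_slice app_tensor_op cinner_t cinner_scaleC_right mult.commute)

lemma slice_eq_0: "(\<And>b b'. slice b b' c = 0) \<Longrightarrow> c = 0"
proof (rule bop_ext_cinner_t)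
  fix a b a' b' assume *: "\<And>b b'. slice b b' c = 0"
  show "cinner (t a b) (app c (t a' b')) = cinner (t a b) (app 0 (t a' b'))"
    using cinner_slice[of a b b' c a'] by (simp add: *)
qed

text \<open>For m in the commutant of M the operator m \<otimes> 1 commutes with the generators,
  hence with c. The module property of the slice turns this into commutation of the slice with
  m.\<close>

lemma slice_mem:
  assumes "commutant (commutant M) = M" "\<And>x. x \<in> M \<Longrightarrow> adj x \<in> M" "c \<in> vn_tensor t M N"
  shows "slice b b' c \<in> M"
proof -
  let ?G = "{tensor_op t x y | x y. x \<in> M \<and> y \<in> N}"
  have "slice b b' c \<in> commutant (commutant M)" unfolding commutant_def[of "commutant M"]
  proof (intro CollectI ballI)
    fix m assume m: "m \<in> commutant M"
    have "tensor_op t m 1 \<in> commutant (?G \<union> adj ` ?G)"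
      unfolding commutant_def
    proof (intro CollectI ballI)
      fix z assume "z \<in> ?G \<union> adj ` ?G"
      then have "\<exists>x y. x \<in> M \<and> z = tensor_op t x y" using assms(2) by (fastforce simp: tensor_op_adj)
      then obtain x y where "x \<in> M" "z = tensor_op t x y" by blast
      then show "tensor_op t m 1 * z = z * tensor_op t m 1" using m by (simp add: tensor_op_mult commutant_def)
    qed
    then have "c * tensor_op t m 1 = tensor_op t m 1 * c"
      using assms(3) by (auto simp: vn_tensor_def vn_generated_def commutant_def)
    then show "slice b b' c * m = m * slice b b' c"
      by (simp flip: slice_mult_left slice_mult_right)
  qed
  then show ?thesis using assms(1) by simp
qed

text \<open>Scalar slices mean that the matrix coefficients of c split off the factor <a, a'> of the
  first leg; what remains is read off as a slice of the second kind at a unit vector.\<close>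

lemma tensor_of_scalar_slices:
  assumes "\<And>b b'. \<exists>k. slice b b' c = scaleOp k 1" and a0: "norm a0 = 1"
  shows "c = tensor_op t 1 (htensor.slice (\<lambda>b a. t a b) a0 a0 c)"
proof -
  interpret S: htensor "\<lambda>b a. t a b" by (rule swap)
  obtain k where k: "\<And>b b'. slice b b' c = scaleOp (k b b') 1" using assms(1) by metis
  have eq: "cinner (t a b) (app c (t a' b')) = k b b' * cinner a a'" for a b a' b'
    using cinner_slice[of a b b' c a'] by (simp add: k cinner_scaleC_right)
  have "cinner a0 a0 = 1" using a0 by (simp add: cinner_self)
  then have "cinner b (app (S.slice a0 a0 c) b') = k b b'" for b b' by (simp add: S.cinner_slice eq)
  then show ?thesis by (intro bop_ext_cinner_t) (simp add: eq app_tensor_op cinner_t)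
qed

end

section \<open>Projections and isometries\<close>

lemma polarization_zero:
  assumes "\<And>a. cinner a (app x a) = 0" shows "x = 0"
proof (rule bop_eqI_cinner)
  fix a b
  have 1: "cinner a (app x b) + cinner b (app x a) = 0"
    using assms[of "a + b"] assms[of a] assms[of b]
    by (simp add: app_add cinner_add_left cinner_add_right add.commute)
  have "- \<i> * cinner b (app x a) + \<i> * cinner a (app x b) = 0"
    using assms[of "a + \<i> *\<^sub>C b"] assms[of a] assms[of b]
    by (simp add: app_add app_scaleC cinner_add_left cinner_add_right cinner_scaleC_left cinner_scaleC_right)
  then have "\<i> * (cinner a (app x b) - cinner b (app x a)) = 0" by (simp add: algebra_simps)
  then have "cinner a (app x b) = cinner b (app x a)" by simp
  then show "cinner a (app x b) = cinner a (app 0 b)" using 1 by simp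
qed

lemma projection_norm_le:
  assumes "adj p = p" "p * p = p" shows "norm (app p a) \<le> norm a"
proof (cases "app p a = 0")
  case False
  have "(norm (app p a))\<^sup>2 = cmod (cinner (app p a) (app p a))" by (simp add: cinner_self norm_power)
  also have "cinner (app p a) (app p a) = cinner (app p a) a"
    by (metis assms app_times cinner_adj cinner_adj')
  also have "cmod \<dots> \<le> norm (app p a) * norm a" by (rule cmod_cinner_le)
  finally show ?thesis using False by (simp add: power2_eq_square)
qed simp

lemma projection_sum:
  assumes "finite F" "\<And>k. k \<in> F \<Longrightarrow> adj (p k) = p k \<and> p k * p k = p k"
    "\<And>k l. k \<in> F \<Longrightarrow> l \<in> F \<Longrightarrow> k \<noteq> l \<Longrightarrow> p k * p l = 0"
  shows "adj (sum p F) = sum p F \<and> sum p F * sum p F = sum p F"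
proof
  show "adj (sum p F) = sum p F" unfolding adj_sum by (rule sum.cong) (use assms in auto)
  have "sum p F * sum p F = (\<Sum>k\<in>F. \<Sum>l\<in>F. p k * p l)" by (rule sum_product)
  also have "\<dots> = (\<Sum>k\<in>F. p k)"
  proof (rule sum.cong[OF refl])
    fix k assume k: "k \<in> F"
    have "(\<Sum>l\<in>F. p k * p l) = (\<Sum>l\<in>F. if l = k then p k else 0)"
      by (rule sum.cong[OF refl]) (use assms k in auto)
    then show "(\<Sum>l\<in>F. p k * p l) = p k" using assms(1) k by (simp add: sum.delta)
  qed
  finally show "sum p F * sum p F = sum p F" .
qed

lemma projections_strong_sum:
  assumes p: "\<And>k. k \<in> K \<Longrightarrow> adj (p k) = p k \<and> p k * p k = p k"
    "\<And>k l. k \<in> K \<Longrightarrow> l \<in> K \<Longrightarrow> k \<noteq> l \<Longrightarrow> p k * p l = 0"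
  shows "\<exists>r. strong_sum p K r \<and> adj r = r \<and> r * r = r \<and> (\<forall>k\<in>K. r * p k = p k \<and> p k * r = p k)"
proof -
  have "\<exists>r. strong_sum p K r"
  proof (rule strong_sum_orthogonal)
    show "adj (p k) * p l = 0" if "k \<in> K" "l \<in> K" "k \<noteq> l" for k l using p that by simp
    fix F a assume F: "finite F" "F \<subseteq> K"
    have "(\<Sum>k\<in>F. (norm (app (p k) a))\<^sup>2) = (norm (app (sum p F) a))\<^sup>2"
      by (rule norm_sum_orthogonal_ops[symmetric]) (use F p subsetD[OF F(2)] in auto)
    also have "\<dots> \<le> (norm a)\<^sup>2"
      using projection_sum[of F p] F p by (intro power_mono projection_norm_le) (auto simp: subset_iff)
    finally show "(\<Sum>k\<in>F. (norm (app (p k) a))\<^sup>2) \<le> (norm a)\<^sup>2" .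
  qed
  then obtain r where r: "strong_sum p K r" by blast
  have rp: "r * p k = p k" if "k \<in> K" for k
  proof -
    have "strong_sum (\<lambda>l. if l = k then p k else 0) K (r * p k)"
      using strong_sum_mult_right[OF r, of "p k"] strong_sum_cong[of K "\<lambda>l. p l * p k" "\<lambda>l. if l = k then p k else 0"]
        p that by auto
    moreover have "strong_sum (\<lambda>l. if l = k then p k else 0) K (p k)"
      unfolding strong_sum_def
    proof
      fix a
      show "((\<lambda>l. app (if l = k then p k else 0) a) has_sum app (p k) a) K"
        by (rule has_sum_finite_neutralI[of "{k}"]) (use that in auto)
    qed
    ultimately show ?thesis by (rule strong_sum_unique)
  qed
  \<comment> \<open>The adjoint is not continuous for strong convergence, so self-adjointness is
    obtained from matrix coefficients.\<close>
  have adjr: "adj r = r"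
  proof (rule bop_eqI_cinner)
    fix a b
    have "((\<lambda>k. cinner a (app (p k) b)) has_sum cinner a (app r b)) K"
      using has_sum_bounded_linear[OF bounded_linear_cinner_right[of a], where f = "\<lambda>k. app (p k) b" and S = "app r b" and A = K] r
      by (simp add: strong_sum_def)
    moreover have "((\<lambda>k. cinner (app (p k) a) b) has_sum cinner (app r a) b) K"
      using has_sum_bounded_linear[OF bounded_linear_cinner_left[of b], where f = "\<lambda>k. app (p k) a" and S = "app r a" and A = K] r
      by (simp add: strong_sum_def)
    moreover have "cinner (app (p k) a) b = cinner a (app (p k) b)" if "k \<in> K" for k
      using p(1)[OF that] cinner_adj by metis
    ultimately have "cinner (app r a) b = cinner a (app r b)" by (metis (no_types, lifting) has_sum_cong has_sum_unique)
    then show "cinner a (app (adj r) b) = cinner a (app r b)" by (simp add: cinner_adj')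
  qed
  have pr: "p k * r = p k" if "k \<in> K" for k
  proof -
    have "adj (r * p k) = adj (p k)" using rp[OF that] by simp
    then show ?thesis using adjr p(1)[OF that] by simp
  qed
  have "strong_sum p K (r * r)"
    using strong_sum_mult_right[OF r, of r] strong_sum_cong[of K "\<lambda>k. p k * r" p] pr by simp
  then have "r * r = r" using r strong_sum_unique by blast
  then show ?thesis using r adjr rp pr by blast
qed

lemma isometry_projection: "adj w * w = 1 \<Longrightarrow> adj (w * adj w) = w * adj w \<and> (w * adj w) * (w * adj w) = w * adj w"
  by (metis adj_adj adj_mult mult.assoc mult_1_right)

lemma isometry_norm: "adj w * w = 1 \<Longrightarrow> norm (app w a) = norm a"
proof -
  assume "adj w * w = 1"
  then have "cinner (app w a) (app w a) = cinner a a" unfolding cinner_app_self by simp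
  then have "complex_of_real ((norm (app w a))\<^sup>2) = complex_of_real ((norm a)\<^sup>2)" by (simp only: cinner_self)
  then have "(norm (app w a))\<^sup>2 = (norm a)\<^sup>2" by (simp only: of_real_eq_iff)
  then show ?thesis by (simp add: power2_eq_iff_nonneg)
qed

text \<open>A Schroeder-Bernstein argument: with \<open>q = 1 - p\<close> and \<open>r = \<Sum>\<^sub>n w\<^sup>n q w\<^sup>*\<^sup>n\<close>, the operator
  \<open>w r + (1 - r)\<close> is an isometry with range projection \<open>p\<close>.\<close>

lemma isometry_onto_projection:
  assumes iso: "adj w * w = 1" and p: "adj p = p" "p * p = p" and pw: "p * w = w"
    and M: "w \<in> commutant S" "p \<in> commutant S" "\<And>y. y \<in> S \<Longrightarrow> adj y \<in> S"
  shows "\<exists>u\<in>commutant S. adj u * u = 1 \<and> u * adj u = p"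
proof -
  define q where "q = 1 - p"
  have q: "adj q = q" "q * q = q" "q * w = 0" by (simp_all add: q_def p pw algebra_simps)
  have wq: "adj w * q = 0" using arg_cong[OF q(3), of adj] unfolding adj_mult q(1) by simp
  define f where "f n = w ^ n * q * adj (w ^ n)" for n :: nat
  have isop: "adj (w ^ n) * w ^ n = 1" for n
  proof (induction n)
    case (Suc n)
    have "adj (w ^ Suc n) * w ^ Suc n = adj (w ^ n) * (adj w * w) * w ^ n" by (simp add: mult.assoc)
    then show ?case using Suc iso by simp
  qed simp
  have f0: "f m * f n = 0" if mn: "m < n" for m n
  proof -
    obtain d where d: "n = m + Suc d" using mn less_iff_Suc_add by auto
    have "adj (w ^ m) * w ^ n = w ^ Suc d"
      unfolding d power_add using isop[of m] by (simp add: mult.assoc[symmetric])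
    then have "f m * f n = w ^ m * (q * w) * w ^ d * q * adj (w ^ n)"
      unfolding f_def by (simp add: mult.assoc) (metis mult.assoc)
    then show ?thesis by (simp add: q)
  qed
  have fadj: "adj (f n) = f n" for n by (simp add: f_def q mult.assoc)
  have f0': "f m * f n = 0" if "m \<noteq> n" for m n
  proof (cases "m < n")
    case False
    then have "f n * f m = 0" using that f0 by simp
    then have "adj (f n * f m) = 0" by simp
    then show ?thesis by (simp add: fadj)
  qed (rule f0)
  have fp: "f n * f n = f n" for n
  proof -
    have "f n * f n = w ^ n * q * (adj (w ^ n) * w ^ n) * q * adj (w ^ n)" by (simp add: f_def mult.assoc)
    then show ?thesis unfolding isop f_def using q(2) by (simp add: mult.assoc)
  qed
  obtain r where r: "strong_sum f UNIV r" "adj r = r" "r * r = r" "\<And>n. r * f n = f n"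
    using projections_strong_sum[of UNIV f] f0' fadj fp by blast
  have rq: "r * q = q" using r(4)[of 0] by (simp add: f_def)
  have wrw: "w * r * adj w = r - q"
  proof -
    have "strong_sum (\<lambda>n. f (Suc n)) UNIV (w * r * adj w)"
      using strong_sum_mult_right[OF strong_sum_mult_left[OF r(1), of w], of "adj w"]
      by (simp add: f_def mult.assoc power_Suc)
    then have s: "strong_sum f (range Suc) (w * r * adj w)"
      unfolding strong_sum_def by (subst has_sum_reindex) (auto simp: o_def)
    have "strong_sum f (insert 0 (range Suc)) (f 0 + w * r * adj w)"
      using s unfolding strong_sum_def by (auto intro: has_sum_insert)
    moreover have "insert 0 (range Suc) = UNIV" using not0_implies_Suc by auto
    ultimately have "r = f 0 + w * r * adj w" using r(1) strong_sum_unique by metis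
    then show ?thesis by (simp add: f_def algebra_simps)
  qed
  have wr: "w * r = (r - q) * w"
  proof -
    have "w * r = w * r * (adj w * w)" by (simp add: iso)
    then show ?thesis using wrw by (metis mult.assoc)
  qed
  have z: "(1 - r) * (w * r) = 0" unfolding wr using rq r(3) by (simp add: algebra_simps flip: mult.assoc)
  have z': "r * adj w * (1 - r) = 0" using arg_cong[OF z, of adj] by (simp add: r(2) mult.assoc)
  define u where "u = w * r + (1 - r)"
  have au: "adj u = r * adj w + (1 - r)" by (simp add: u_def r(2))
  have e1: "r * adj w * (w * r) = r"
  proof -
    have "r * adj w * (w * r) = r * (adj w * w) * r" by (simp only: mult.assoc)
    then show ?thesis by (simp add: iso r(3))
  qed
  have rr: "(1 - r) * (1 - r) = 1 - r" "r * (1 - r) = 0" "(1 - r) * r = 0" by (simp_all add: algebra_simps r(3))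
  have "adj u * u = r * adj w * (w * r) + r * adj w * (1 - r) + ((1 - r) * (w * r) + (1 - r) * (1 - r))"
    unfolding au unfolding u_def by (simp only: distrib_left distrib_right add.assoc add.left_commute)
  then have 1: "adj u * u = 1" unfolding e1 z z' rr by simp
  have "u * adj u = w * (r * r) * adj w + w * (r * (1 - r)) + ((1 - r) * r * adj w + (1 - r) * (1 - r))"
    unfolding au unfolding u_def by (simp only: distrib_left distrib_right mult.assoc add.assoc add.left_commute)
  then have "u * adj u = (r - q) + (1 - r)" unfolding rr r(3) wrw by simp
  then have 2: "u * adj u = p" by (simp add: q_def)
  have qS: "q \<in> commutant S" unfolding q_def by (intro commutant_diff commutant_one M)
  have wS: "w ^ n \<in> commutant S" for n by (induction n) (auto intro: commutant_one commutant_mult M)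
  have "f n \<in> commutant S" for n
    unfolding f_def by (intro commutant_mult wS qS commutant_adj[OF M(3)])
  then have "r \<in> commutant S" using commutant_strong_sum[OF r(1)] by blast
  then have "u \<in> commutant S" unfolding u_def
    by (intro commutant_add commutant_diff commutant_mult commutant_one M)
  then show ?thesis using 1 2 by blast
qed

text \<open>For v in the range of \<open>w l\<close>, the squared norms of all
  \<open>app (adj (w m)) v\<close> add up to that of v, and the term m = l already exhausts
  it.\<close>

lemma isometries_orthogonal:
  assumes iso: "\<And>k. k \<in> K \<Longrightarrow> adj (w k) * w k = 1"
    and sum: "strong_sum (\<lambda>k. w k * adj (w k)) K 1" and kl: "k \<in> K" "l \<in> K" "k \<noteq> l"
  shows "adj (w k) * w l = 0"
proof (rule bop_eqI)
  fix a
  let ?v = "app (w l) a"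
  have n: "norm (app (adj (w m)) b) = norm (app (w m * adj (w m)) b)" if "m \<in> K" for m b
  proof -
    have "cinner (app (w m) c) (app (w m) c) = cinner c c" for c
      using iso[OF that] by (metis app_times app_one cinner_adj')
    then have "complex_of_real ((norm (app (w m) c))\<^sup>2) = complex_of_real ((norm c)\<^sup>2)" for c by (simp add: cinner_self)
    then have "norm (app (w m) c) = norm c" for c by (simp only: of_real_eq_iff) (simp add: power2_eq_iff_nonneg)
    then show ?thesis by simp
  qed
  have "((\<lambda>m. cinner ?v (app (w m * adj (w m)) ?v)) has_sum cinner ?v ?v) K"
    using has_sum_bounded_linear[OF bounded_linear_cinner_right] sum unfolding strong_sum_def by fastforce
  moreover have "cinner ?v (app (w m * adj (w m)) ?v) = complex_of_real ((norm (app (adj (w m)) ?v))\<^sup>2)" for m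
    by (simp only: app_times, rule trans[OF cinner_adj[symmetric] cinner_self])
  ultimately have "((\<lambda>m. (norm (app (adj (w m)) ?v))\<^sup>2) has_sum (norm ?v)\<^sup>2) K"
    by (simp only: cinner_self has_sum_of_real_iff)
  then have "(\<Sum>m\<in>{k, l}. (norm (app (adj (w m)) ?v))\<^sup>2) \<le> (norm ?v)\<^sup>2"
    by (rule finite_sum_le_has_sum) (use kl in auto)
  moreover have "norm (app (adj (w l)) ?v) = norm ?v"
    using n[OF kl(2), of ?v] iso[OF kl(2)] by (metis app_times app_one)
  ultimately have "(norm (app (adj (w k)) ?v))\<^sup>2 \<le> 0" using kl(3) by simp
  then show "app (adj (w k) * w l) a = app 0 a" by simp
qed

lemma strong_sum_total:
  assumes "strong_sum (\<lambda>k. w k * adj (w k)) K 1" "\<And>k. k \<in> K \<Longrightarrow> y * w k = 0"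
  shows "y = 0"
proof -
  have "strong_sum (\<lambda>k. y * (w k * adj (w k))) K (y * 1)" by (rule strong_sum_mult_left[OF assms(1)])
  moreover have "strong_sum (\<lambda>k. y * (w k * adj (w k))) K 0"
    by (subst strong_sum_cong[of K _ "\<lambda>k. 0"]) (simp_all add: assms(2) strong_sum_def flip: mult.assoc)
  ultimately show ?thesis using strong_sum_unique by fastforce
qed

text \<open>The k-th term is a partial isometry from the range of \<open>q k\<close> onto that of
  \<open>p k\<close>. In this form the series for V of an infinite direct sum converges to a
  unitary.\<close>

lemma strong_sum_isometries:
  assumes p: "\<And>k. k \<in> K \<Longrightarrow> adj (p k) * p k = 1" "strong_sum (\<lambda>k. p k * adj (p k)) K 1"
    and q: "\<And>k. k \<in> K \<Longrightarrow> adj (q k) * q k = 1" "strong_sum (\<lambda>k. q k * adj (q k)) K 1"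
  shows "\<exists>s. strong_sum (\<lambda>k. p k * adj (q k)) K s \<and> adj s * s = 1 \<and> s * adj s = 1 \<and> (\<forall>k\<in>K. s * q k = p k)"
proof -
  have po: "adj (p k) * p l = 0" and qo: "adj (q k) * q l = 0" if "k \<in> K" "l \<in> K" "k \<noteq> l" for k l
    using isometries_orthogonal[of K p, OF p that] isometries_orthogonal[of K q, OF q that] by simp_all
  have ex: "\<exists>s. strong_sum (\<lambda>k. p k * adj (q k)) K s"
  proof (rule strong_sum_orthogonal)
    fix k l assume "k \<in> K" "l \<in> K" "k \<noteq> l"
    from po[OF this] have "q k * (adj (p k) * p l) * adj (q l) = 0" by simp
    then show "adj (p k * adj (q k)) * (p l * adj (q l)) = 0" by (simp add: mult.assoc)
  next
    fix F a assume F: "finite F" "F \<subseteq> K"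
    let ?e = "\<lambda>k. q k * adj (q k)"
    have pr: "adj (?e k) = ?e k \<and> ?e k * ?e k = ?e k" if "k \<in> F" for k
      using isometry_projection[OF q(1)] that F by blast
    have orth: "?e k * ?e l = 0" if "k \<in> F" "l \<in> F" "k \<noteq> l" for k l
    proof -
      have "q k * (adj (q k) * q l) * adj (q l) = 0" using qo[OF subsetD[OF F(2)] subsetD[OF F(2)]] that by simp
      then show ?thesis by (simp add: mult.assoc)
    qed
    have "(\<Sum>k\<in>F. (norm (app (p k * adj (q k)) a))\<^sup>2) = (\<Sum>k\<in>F. (norm (app (?e k) a))\<^sup>2)"
    proof (rule sum.cong[OF refl])
      fix k assume "k \<in> F"
      then have "k \<in> K" using F by blast
      then show "(norm (app (p k * adj (q k)) a))\<^sup>2 = (norm (app (?e k) a))\<^sup>2"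
        using isometry_norm[OF p(1)] isometry_norm[OF q(1)] by simp
    qed
    also have "\<dots> = (norm (app (sum ?e F) a))\<^sup>2"
      by (rule norm_sum_orthogonal_ops[symmetric]) (use F pr orth in auto)
    also have "\<dots> \<le> (norm a)\<^sup>2"
      using projection_sum[OF F(1) pr orth] by (intro power_mono projection_norm_le) auto
    finally show "(\<Sum>k\<in>F. (norm (app (p k * adj (q k)) a))\<^sup>2) \<le> (norm a)\<^sup>2" .
  qed
  then obtain s where s: "strong_sum (\<lambda>k. p k * adj (q k)) K s" by blast
  have sq: "s * q k = p k" if k: "k \<in> K" for k
  proof -
    have "strong_sum (\<lambda>l. if l = k then p k else 0) K (s * q k)"
      by (rule strong_sum_eq[OF strong_sum_mult_right[OF s]]) (use qo k q in \<open>simp add: mult.assoc\<close>)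
    then show ?thesis using strong_sum_single[OF k] strong_sum_unique by blast
  qed
  have ps: "adj (p k) * s = adj (q k)" if k: "k \<in> K" for k
  proof -
    have "adj (p k) * (p l * adj (q l)) = (if l = k then adj (q k) else 0)" if "l \<in> K" for l
      using po[OF k that] p(1)[OF that] by (cases "l = k") (simp_all flip: mult.assoc)
    then have "strong_sum (\<lambda>l. if l = k then adj (q k) else 0) K (adj (p k) * s)"
      by (rule strong_sum_eq[OF strong_sum_mult_left[OF s]])
    then show ?thesis using strong_sum_single[OF k] strong_sum_unique by blast
  qed
  have sp: "adj s * p k = q k" if k: "k \<in> K" for k using arg_cong[OF ps[OF k], of adj] by simp
  have "adj s * s - 1 = 0" by (rule strong_sum_total[OF q(2)]) (simp add: left_diff_distrib mult.assoc sq sp)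
  moreover have "s * adj s - 1 = 0" by (rule strong_sum_total[OF p(2)]) (simp add: left_diff_distrib mult.assoc sq sp)
  ultimately show ?thesis using s sq by (intro exI[of _ s]) auto
qed

section \<open>Endomorphisms of von Neumann algebras\<close>

lemma hom_mem: "\<phi> \<in> normal_homs M N \<Longrightarrow> x \<in> M \<Longrightarrow> \<phi> x \<in> N" by (auto simp: normal_homs_def)
lemma hom_add: "\<phi> \<in> normal_homs M N \<Longrightarrow> x \<in> M \<Longrightarrow> y \<in> M \<Longrightarrow> \<phi> (x + y) = \<phi> x + \<phi> y" by (simp add: normal_homs_def)
lemma hom_scale: "\<phi> \<in> normal_homs M N \<Longrightarrow> x \<in> M \<Longrightarrow> \<phi> (scaleOp c x) = scaleOp c (\<phi> x)" by (simp add: normal_homs_def)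
lemma hom_mult: "\<phi> \<in> normal_homs M N \<Longrightarrow> x \<in> M \<Longrightarrow> y \<in> M \<Longrightarrow> \<phi> (x * y) = \<phi> x * \<phi> y" by (simp add: normal_homs_def)
lemma hom_adj: "\<phi> \<in> normal_homs M N \<Longrightarrow> x \<in> M \<Longrightarrow> \<phi> (adj x) = adj (\<phi> x)" by (simp add: normal_homs_def)
lemma hom_one: "\<phi> \<in> normal_homs M N \<Longrightarrow> \<phi> 1 = 1" by (simp add: normal_homs_def)
lemma hom_ext: "\<phi> \<in> normal_homs M N \<Longrightarrow> \<phi> \<in> extensional M" by (simp add: normal_homs_def PiE_def)
lemma hom_cont: "\<phi> \<in> normal_homs M N \<Longrightarrow> continuous_map (subtopology sigma_weak M) sigma_weak \<phi>"
  by (auto simp: normal_homs_def intro: continuous_map_into_fulltopology)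

lemma normal_homsI:
  assumes "\<phi> \<in> extensional M" "\<And>x. x \<in> M \<Longrightarrow> \<phi> x \<in> N" "\<And>x y. x \<in> M \<Longrightarrow> y \<in> M \<Longrightarrow> \<phi> (x + y) = \<phi> x + \<phi> y"
    "\<And>c x. x \<in> M \<Longrightarrow> \<phi> (scaleOp c x) = scaleOp c (\<phi> x)" "\<And>x y. x \<in> M \<Longrightarrow> y \<in> M \<Longrightarrow> \<phi> (x * y) = \<phi> x * \<phi> y"
    "\<And>x. x \<in> M \<Longrightarrow> \<phi> (adj x) = adj (\<phi> x)" "\<phi> 1 = 1" "continuous_map (subtopology sigma_weak M) sigma_weak \<phi>"
  shows "\<phi> \<in> normal_homs M N"
  using assms by (auto simp: normal_homs_def PiE_def continuous_map_in_subtopology)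

lemma hom_zero: "\<phi> \<in> normal_homs M N \<Longrightarrow> 1 \<in> M \<Longrightarrow> \<phi> 0 = 0"
  using hom_scale[of \<phi> M N 1 0] by simp

lemma hom_eqI: "\<phi> \<in> normal_homs M N \<Longrightarrow> \<psi> \<in> normal_homs M N' \<Longrightarrow> (\<And>x. x \<in> M \<Longrightarrow> \<phi> x = \<psi> x) \<Longrightarrow> \<phi> = \<psi>"
  by (meson extensionalityI hom_ext)

lemma hom_compose:
  assumes "\<phi> \<in> normal_homs M N" "\<psi> \<in> normal_homs N L" "1 \<in> M"
    "\<And>x y. x \<in> M \<Longrightarrow> y \<in> M \<Longrightarrow> x + y \<in> M" "\<And>x y. x \<in> M \<Longrightarrow> y \<in> M \<Longrightarrow> x * y \<in> M"
    "\<And>c x. x \<in> M \<Longrightarrow> scaleOp c x \<in> M" "\<And>x. x \<in> M \<Longrightarrow> adj x \<in> M"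
  shows "compose M \<psi> \<phi> \<in> normal_homs M L"
proof (rule normal_homsI)
  have "continuous_map (subtopology sigma_weak M) (subtopology sigma_weak N) \<phi>" using assms(1) by (simp add: normal_homs_def)
  from continuous_map_compose[OF this hom_cont[OF assms(2)]]
  have "continuous_map (subtopology sigma_weak M) sigma_weak (\<psi> \<circ> \<phi>)" .
  then show "continuous_map (subtopology sigma_weak M) sigma_weak (compose M \<psi> \<phi>)"
    by (rule continuous_map_eq) (simp add: compose_def)
qed (use assms in \<open>auto simp: compose_def hom_mem hom_add[OF assms(1)] hom_add[OF assms(2)]
    hom_scale[OF assms(1)] hom_scale[OF assms(2)] hom_mult[OF assms(1)] hom_mult[OF assms(2)]
    hom_adj[OF assms(1)] hom_adj[OF assms(2)] hom_one[OF assms(1)] hom_one[OF assms(2)]\<close>)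

locale vn =
  fixes M :: "'h::chilbert bop set"
  assumes vn: "von_neumann_algebra M"
begin

lemma bicomm [simp]: "commutant (commutant M) = M" using vn by (simp add: von_neumann_algebra_def)
lemma one_mem [simp]: "1 \<in> M" using commutant_one[of "commutant M"] by simp
lemma zero_mem [simp]: "0 \<in> M" using commutant_zero[of "commutant M"] by simp
lemma adj_mem [simp]: "x \<in> M \<Longrightarrow> adj x \<in> M" using vn by (simp add: von_neumann_algebra_def)
lemma add_mem [simp]: "x \<in> M \<Longrightarrow> y \<in> M \<Longrightarrow> x + y \<in> M" using commutant_add[of x "commutant M" y] by simp
lemma diff_mem [simp]: "x \<in> M \<Longrightarrow> y \<in> M \<Longrightarrow> x - y \<in> M" using commutant_diff[of x "commutant M" y] by simp
lemma mult_mem [simp]: "x \<in> M \<Longrightarrow> y \<in> M \<Longrightarrow> x * y \<in> M" using commutant_mult[of x "commutant M" y] by simp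
lemma scale_mem [simp]: "x \<in> M \<Longrightarrow> scaleOp c x \<in> M" using commutant_scale[of x "commutant M" c] by simp
lemma minus_mem [simp]: "x \<in> M \<Longrightarrow> - x \<in> M" using diff_mem[of 0 x] by simp
lemma sum_mem: "(\<And>k. k \<in> F \<Longrightarrow> f k \<in> M) \<Longrightarrow> sum f F \<in> M"
  by (induction F rule: infinite_finite_induct) auto
lemma closedin: "closedin sigma_weak M" using closedin_commutant[of "commutant M"] by simp
lemma strong_sum_mem: "strong_sum f K s \<Longrightarrow> (\<And>k. k \<in> K \<Longrightarrow> f k \<in> M) \<Longrightarrow> s \<in> M"
  using commutant_strong_sum[of f K s "commutant M"] by simp

lemma comp_End: "\<phi> \<in> End M \<Longrightarrow> \<psi> \<in> End M \<Longrightarrow> compose M \<psi> \<phi> \<in> End M"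
  by (rule hom_compose) auto

lemma id_End: "id_on M \<in> End M"
proof (rule normal_homsI)
  show "continuous_map (subtopology sigma_weak M) sigma_weak (id_on M)"
    by (rule continuous_map_eq[OF continuous_map_from_subtopology[OF continuous_map_id]]) simp
qed auto

lemma hom_sum: "\<phi> \<in> normal_homs M N \<Longrightarrow> (\<And>k. k \<in> F \<Longrightarrow> f k \<in> M) \<Longrightarrow> \<phi> (sum f F) = (\<Sum>k\<in>F. \<phi> (f k))"
proof (induction F rule: infinite_finite_induct)
  case (insert k F)
  then show ?case using hom_add[of \<phi> M N "f k" "sum f F"] sum_mem[of F f] by simp
qed (auto simp: hom_zero)

section \<open>Intertwiners and a criterion for irreducibility\<close>

lemma intertwinersI: "T \<in> M \<Longrightarrow> (\<And>x. x \<in> M \<Longrightarrow> T * \<rho> x = \<sigma> x * T) \<Longrightarrow> T \<in> intertwiners M \<rho> \<sigma>"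
  by (simp add: intertwiners_def)
lemma int_mem: "T \<in> intertwiners M \<rho> \<sigma> \<Longrightarrow> T \<in> M" by (simp add: intertwiners_def)
lemma int_eq: "T \<in> intertwiners M \<rho> \<sigma> \<Longrightarrow> x \<in> M \<Longrightarrow> T * \<rho> x = \<sigma> x * T" by (simp add: intertwiners_def)
lemma int_mult:
  assumes "T \<in> intertwiners M \<sigma> \<tau>" "S \<in> intertwiners M \<rho> \<sigma>" shows "T * S \<in> intertwiners M \<rho> \<tau>"
proof (rule intertwinersI)
  fix x assume "x \<in> M"
  then have "T * (S * \<rho> x) = T * (\<sigma> x * S)" "T * \<sigma> x * S = \<tau> x * T * S" using int_eq assms by metis+
  then show "T * S * \<rho> x = \<tau> x * (T * S)" by (simp add: mult.assoc)
qed (use assms in \<open>auto simp: int_mem\<close>)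
lemma int_adj:
  assumes "T \<in> intertwiners M \<rho> \<sigma>" "\<rho> \<in> End M" "\<sigma> \<in> End M" shows "adj T \<in> intertwiners M \<sigma> \<rho>"
proof (rule intertwinersI)
  fix x assume x: "x \<in> M"
  then have "adj (T * \<rho> (adj x)) = adj (\<sigma> (adj x) * T)" using int_eq[OF assms(1), of "adj x"] by simp
  then show "adj T * \<sigma> x = \<rho> x * adj T" using hom_adj[OF assms(2), of x] hom_adj[OF assms(3), of x] x by simp
qed (use assms in \<open>auto simp: int_mem\<close>)
lemma int_scale: "T \<in> intertwiners M \<rho> \<sigma> \<Longrightarrow> scaleOp c T \<in> intertwiners M \<rho> \<sigma>" by (simp add: intertwiners_def)
lemma int_diff: "T \<in> intertwiners M \<rho> \<sigma> \<Longrightarrow> S \<in> intertwiners M \<rho> \<sigma> \<Longrightarrow> T - S \<in> intertwiners M \<rho> \<sigma>"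
  by (simp add: intertwiners_def left_diff_distrib right_diff_distrib)
lemma int_add: "T \<in> intertwiners M \<rho> \<sigma> \<Longrightarrow> S \<in> intertwiners M \<rho> \<sigma> \<Longrightarrow> T + S \<in> intertwiners M \<rho> \<sigma>"
  by (simp add: intertwiners_def distrib_left distrib_right)
lemma int_one: "1 \<in> intertwiners M \<rho> \<rho>" by (simp add: intertwiners_def)
lemma int_hom:
  assumes "T \<in> intertwiners M \<rho> \<sigma>" "\<zeta> \<in> End M" "\<rho> \<in> End M" "\<sigma> \<in> End M"
  shows "\<zeta> T \<in> intertwiners M (compose M \<zeta> \<rho>) (compose M \<zeta> \<sigma>)"
  using assms int_mem[OF assms(1)] int_eq[OF assms(1)] by (auto intro!: intertwinersI simp: compose_def hom_mem simp flip: hom_mult)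
lemma int_right:
  assumes "T \<in> intertwiners M \<rho> \<sigma>" "\<zeta> \<in> End M"
  shows "T \<in> intertwiners M (compose M \<rho> \<zeta>) (compose M \<sigma> \<zeta>)"
  using assms by (auto simp: intertwiners_def compose_def hom_mem)

text \<open>Writing self-intertwiners as the commutant of a self-adjoint set makes range
  projections, strong sums and square roots available inside them.\<close>

lemma End_intertwiners_commutant:
  assumes "\<sigma> \<in> End M" shows "intertwiners M \<sigma> \<sigma> = commutant (commutant M \<union> \<sigma> ` M)"
proof -
  have "T \<in> M \<longleftrightarrow> T \<in> commutant (commutant M)" for T by simp
  then show ?thesis unfolding intertwiners_def by (simp only: commutant_def) blast
qed

lemma adj_commutant_image:
  assumes "\<sigma> \<in> End M" "y \<in> commutant M \<union> \<sigma> ` M" shows "adj y \<in> commutant M \<union> \<sigma> ` M"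
  using assms commutant_adj[of M y] by (auto simp flip: hom_adj)

lemma End_range_projection:
  assumes "\<sigma> \<in> End M" "x \<in> intertwiners M \<sigma> \<sigma>"
  shows "\<exists>e. e \<in> intertwiners M \<sigma> \<sigma> \<and> adj e = e \<and> e * e = e \<and> e * x = x \<and> (\<forall>y. y * x = 0 \<longrightarrow> y * e = 0)"
  using range_projection[of "commutant M \<union> \<sigma> ` M" x] assms adj_commutant_image[OF assms(1)]
  by (simp add: End_intertwiners_commutant[OF assms(1)])

text \<open>Let z be the absolute value of S, so that (z - S)(z + S) = 0. The range projection of z
  + S is 0 or 1, which means S = -z or S = z.\<close>

lemma signed_of_no_projection:
  assumes \<sigma>: "\<sigma> \<in> End M" and np: "\<And>e. e \<in> intertwiners M \<sigma> \<sigma> \<Longrightarrow> adj e = e \<Longrightarrow> e * e = e \<Longrightarrow> e = 0 \<or> e = 1"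
    and S: "S \<in> intertwiners M \<sigma> \<sigma>" "adj S = S"
  shows "(\<forall>a. 0 \<le> Re (cinner a (app S a))) \<or> (\<forall>a. Re (cinner a (app S a)) \<le> 0)"
proof -
  obtain c where c: "c > 0" "\<And>a. norm (app S a) \<le> c * norm a" using app_bound by blast
  let ?c = "complex_of_real c"
  \<comment> \<open>Dividing by the norm bound c makes k a contraction, as \<open>op_sqrt\<close>
    demands; the square root of 1 - k is then the absolute value of S divided by c.\<close>
  define k where "k = 1 - scaleOp (1 / ?c\<^sup>2) (S * S)"
  have k: "adj k = k" by (simp add: k_def S)
  have kb: "norm (app k a) \<le> norm a" for a
  proof -
    let ?v = "app (S * S) a"
    have SS: "cinner a ?v = complex_of_real ((norm (app S a))\<^sup>2)"
      by (metis S(2) app_times cinner_adj cinner_self)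
    then have SS': "cinner ?v a = complex_of_real ((norm (app S a))\<^sup>2)" by (metis cinner_commute complex_cnj_complex_of_real)
    have eq: "app k a = a - (1 / ?c\<^sup>2) *\<^sub>C ?v" by (simp add: k_def)
    have "cinner (app k a) (app k a) = cinner a a - (1 / ?c\<^sup>2) * cinner a ?v - (1 / ?c\<^sup>2) * cinner ?v a
        + (1 / ?c\<^sup>2) * ((1 / ?c\<^sup>2) * cinner ?v ?v)"
      unfolding eq by (simp add: cinner_diff_left cinner_diff_right cinner_scaleC_left cinner_scaleC_right algebra_simps)
    then have "complex_of_real ((norm (app k a))\<^sup>2) = complex_of_real ((norm a)\<^sup>2 - 2 * (norm (app S a))\<^sup>2 / c\<^sup>2 + (norm ?v)\<^sup>2 / c\<^sup>2 / c\<^sup>2)"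
      unfolding SS SS' by (simp add: cinner_self)
    then have "(norm (app k a))\<^sup>2 = (norm a)\<^sup>2 - 2 * (norm (app S a))\<^sup>2 / c\<^sup>2 + (norm ?v)\<^sup>2 / c\<^sup>2 / c\<^sup>2"
      by (simp only: of_real_eq_iff)
    moreover have "(norm ?v)\<^sup>2 / c\<^sup>2 \<le> (norm (app S a))\<^sup>2"
    proof -
      have "(norm ?v)\<^sup>2 \<le> (c * norm (app S a))\<^sup>2" using c(2)[of "app S a"] by (intro power_mono) auto
      then show ?thesis using c(1) by (simp add: power_mult_distrib divide_le_eq mult.commute)
    qed
    then have "(norm ?v)\<^sup>2 / c\<^sup>2 / c\<^sup>2 \<le> (norm (app S a))\<^sup>2 / c\<^sup>2" by (intro divide_right_mono) auto
    moreover have "0 \<le> (norm (app S a))\<^sup>2 / c\<^sup>2" by simp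
    ultimately have "(norm (app k a))\<^sup>2 \<le> (norm a)\<^sup>2" by linarith
    then show ?thesis by (rule power2_le_imp_le) simp
  qed
  obtain s where s: "s * s = 1 - k" "\<And>a. 0 \<le> Re (cinner a (app s a))" "\<And>y. y * k = k * y \<Longrightarrow> y * s = s * y"
    using op_sqrt[OF k kb] by blast
  have Ssk: "y * k = k * y" if "y * S = S * y" for y
  proof -
    have "y * (S * S) = S * S * y" using that by (metis mult.assoc)
    then show ?thesis by (simp add: k_def left_diff_distrib right_diff_distrib)
  qed
  define z where "z = scaleOp ?c s"
  have "y * S = S * y" if "y \<in> commutant M \<union> \<sigma> ` M" for y
    using S(1) that unfolding End_intertwiners_commutant[OF \<sigma>] commutant_def by auto
  then have sint: "z \<in> intertwiners M \<sigma> \<sigma>"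
    unfolding End_intertwiners_commutant[OF \<sigma>] z_def
    by (intro commutant_scale) (use s(3) Ssk in \<open>auto simp: commutant_def[of "_ \<union> _"]\<close>)
  have Ss: "S * z = z * S" using s(3)[OF Ssk[of S]] by (simp add: z_def)
  have "z * z = S * S" using c(1) by (simp add: z_def s(1) k_def power2_eq_square)
  then have "(z - S) * (z + S) = 0" using Ss by (simp add: algebra_simps)
  moreover obtain e where e: "e \<in> intertwiners M \<sigma> \<sigma>" "adj e = e" "e * e = e" "e * (z + S) = z + S"
    "\<And>y. y * (z + S) = 0 \<Longrightarrow> y * e = 0"
    using End_range_projection[OF \<sigma> int_add[OF sint S(1)]] by blast
  ultimately have ze: "(z - S) * e = 0" by blast
  have zp: "0 \<le> Re (cinner a (app z a))" for a
    using s(2)[of a] c(1) by (simp add: z_def cinner_scaleC_right)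
  from np[OF e(1-3)] show ?thesis
  proof
    assume "e = 0"
    then have "z + S = 0" using e(4) by simp
    then have "S = - z" by (simp add: eq_neg_iff_add_eq_0 add.commute)
    then show ?thesis using zp by (simp add: cinner_minus_right)
  next
    assume "e = 1"
    then have "S = z" using ze by simp
    then show ?thesis using zp by simp
  qed
qed

text \<open>For self-adjoint T every difference T - t has one sign, so T equals the supremum of the
  numbers t below it. A general T is treated through its real and imaginary parts.\<close>

lemma irreducible_of_no_projection:
  assumes \<sigma>: "\<sigma> \<in> End M" and np: "\<And>e. e \<in> intertwiners M \<sigma> \<sigma> \<Longrightarrow> adj e = e \<Longrightarrow> e * e = e \<Longrightarrow> e = 0 \<or> e = 1"
    and nz: "(1 :: 'h bop) \<noteq> 0"
  shows "irreducible_endo M \<sigma>"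
proof -
  let ?I = "intertwiners M \<sigma> \<sigma>"
  have sa: "\<exists>c. T = scaleOp c 1" if T: "T \<in> ?I" "adj T = T" for T
  proof -
    define q where "q a = Re (cinner a (app T a))" for a
    have dich: "(\<forall>a. t * (norm a)\<^sup>2 \<le> q a) \<or> (\<forall>a. q a \<le> t * (norm a)\<^sup>2)" for t
    proof -
      let ?S = "T - scaleOp (complex_of_real t) 1"
      have "?S \<in> ?I" by (intro int_diff T int_scale int_one)
      moreover have "adj ?S = ?S" by (simp add: T)
      ultimately have "(\<forall>a. 0 \<le> Re (cinner a (app ?S a))) \<or> (\<forall>a. Re (cinner a (app ?S a)) \<le> 0)"
        by (intro signed_of_no_projection[OF \<sigma>] np)
      moreover have "Re (cinner a (app ?S a)) = q a - t * (norm a)\<^sup>2" for a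
        by (simp add: q_def cinner_diff_right cinner_scaleC_right cinner_self)
      ultimately show ?thesis by simp
    qed
    obtain c where c: "c > 0" "\<And>a. norm (app T a) \<le> c * norm a" using app_bound by blast
    have qb: "\<bar>q a\<bar> \<le> c * (norm a)\<^sup>2" for a
    proof -
      have "\<bar>q a\<bar> \<le> norm a * norm (app T a)" unfolding q_def using abs_Re_le_cmod cmod_cinner_le order_trans by blast
      also have "\<dots> \<le> norm a * (c * norm a)" by (intro mult_left_mono c) simp
      finally show ?thesis by (simp add: power2_eq_square mult_ac)
    qed
    obtain a0 :: 'h where a0: "a0 \<noteq> 0" using nz by (metis app_one app_zero_op bop_eqI)
    define X where "X = {t. \<forall>a. t * (norm a)\<^sup>2 \<le> q a}"
    have "- c \<in> X" unfolding X_def using qb by (auto simp: abs_le_iff minus_le_iff)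
    have "bdd_above X"
    proof (rule bdd_aboveI)
      fix t assume "t \<in> X"
      then have "t * (norm a0)\<^sup>2 \<le> c * (norm a0)\<^sup>2" using qb[of a0] unfolding X_def by (auto simp: abs_le_iff intro: order_trans)
      then show "t \<le> c" using a0 by simp
    qed
    define t0 where "t0 = Sup X"
    have "q a = t0 * (norm a)\<^sup>2" for a
    proof (rule antisym)
      show "q a \<le> t0 * (norm a)\<^sup>2"
      proof (rule field_le_epsilon)
        fix e :: real assume "e > 0"
        \<comment> \<open>The increment is chosen so that multiplication by the square of
          \<open>norm a\<close> costs at most e, including the case a = 0.\<close>
        define t where "t = t0 + e / ((norm a)\<^sup>2 + 1)"
        have "e / ((norm a)\<^sup>2 + 1) > 0" using \<open>e > 0\<close> by (simp add: add_nonneg_pos)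
        then have "t \<notin> X" using cSup_upper[OF _ \<open>bdd_above X\<close>, of t] unfolding t0_def[symmetric] t_def by auto
        then have "q a \<le> t * (norm a)\<^sup>2" using dich[of t] by (auto simp: X_def)
        also have "\<dots> = t0 * (norm a)\<^sup>2 + e * ((norm a)\<^sup>2 / ((norm a)\<^sup>2 + 1))" by (simp add: t_def distrib_right)
        also have "\<dots> \<le> t0 * (norm a)\<^sup>2 + e * 1"
          using \<open>e > 0\<close> by (intro add_left_mono mult_left_mono) (auto simp: divide_le_eq add_nonneg_pos)
        finally show "q a \<le> t0 * (norm a)\<^sup>2 + e" by simp
      qed
      show "t0 * (norm a)\<^sup>2 \<le> q a"
      proof (cases "a = 0")
        case False
        have "t0 \<le> q a / (norm a)\<^sup>2" unfolding t0_def
        proof (rule cSup_least)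
          show "X \<noteq> {}" using \<open>- c \<in> X\<close> by blast
          show "t \<le> q a / (norm a)\<^sup>2" if "t \<in> X" for t
            using that False by (simp add: X_def pos_le_divide_eq)
        qed
        then show ?thesis using False by (simp add: pos_le_divide_eq)
      qed (simp add: q_def)
    qed
    moreover have "Im (cinner a (app T a)) = 0" for a
    proof -
      have "cinner a (app T a) = cnj (cinner a (app T a))" by (metis T(2) cinner_adj cinner_commute)
      then show ?thesis by (metis Reals_cnj_iff complex_is_Real_iff)
    qed
    ultimately have "T - scaleOp (complex_of_real t0) 1 = 0"
      by (intro polarization_zero)
        (simp add: q_def cinner_diff_right cinner_scaleC_right cinner_self complex_eq_iff)
    then show ?thesis by auto
  qed
  have "\<exists>c. T = scaleOp c 1" if T: "T \<in> ?I" for T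
  proof -
    have aT: "adj T \<in> ?I" using int_adj[OF T \<sigma> \<sigma>] .
    obtain c where c: "T + adj T = scaleOp c 1" using sa[OF int_add[OF T aT]] by (auto simp: add.commute)
    have neg: "scaleOp (- \<i>) y = - scaleOp \<i> y" for y :: "'h bop"
      using scaleOp_minus_one[of "scaleOp \<i> y"] by simp
    have "adj (scaleOp \<i> (T - adj T)) = scaleOp \<i> (T - adj T)"
      by (simp add: scaleOp_diff neg)
    then obtain d where d: "scaleOp \<i> (T - adj T) = scaleOp d 1" using sa[OF int_scale[OF int_diff[OF T aT]]] by blast
    have "T - adj T = scaleOp (- \<i>) (scaleOp \<i> (T - adj T))" by simp
    then have d': "T - adj T = scaleOp (- \<i> * d) 1" by (simp add: d)
    have "scaleOp 2 T = (T + adj T) + (T - adj T)" using scaleOp_add_left[of 1 1 T] by simp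
    also have "\<dots> = scaleOp (c - \<i> * d) 1" unfolding c d' by (simp flip: scaleOp_add_left)
    finally have "scaleOp (1/2) (scaleOp 2 T) = scaleOp ((c - \<i> * d) / 2) 1" by simp
    then show ?thesis by auto
  qed
  moreover have "scaleOp c 1 \<in> ?I" for c by (intro int_scale int_one)
  ultimately show ?thesis unfolding irreducible_endo_def by auto
qed

end

section \<open>Decomposition of endomorphisms of a factor\<close>

lemma adj_mult_scalar:
  assumes "adj t * t = scaleOp c 1" "t \<noteq> 0"
  shows "\<exists>r>0. c = complex_of_real r"
proof -
  obtain a where a: "app t a \<noteq> 0" using assms(2) by (metis bop_eqI app_zero_op)
  have a0: "a \<noteq> 0" using a by auto
  have "cinner (app t a) (app t a) = c * cinner a a"
    unfolding cinner_app_self assms(1) by (simp add: cinner_scaleC_right)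
  then have c: "c = complex_of_real ((norm (app t a))\<^sup>2 / (norm a)\<^sup>2)"
    using a0 by (simp add: cinner_self field_simps)
  then show ?thesis using a a0 by (intro exI[of _ "(norm (app t a))\<^sup>2 / (norm a)\<^sup>2"]) simp
qed

lemma normalize_isometry:
  assumes "adj t * t = scaleOp (complex_of_real r) 1" "r > 0"
  shows "adj (scaleOp (complex_of_real (1 / sqrt r)) t) * scaleOp (complex_of_real (1 / sqrt r)) t = 1"
proof -
  have "1 / sqrt r * (1 / sqrt r) * r = 1" using assms(2) by (simp add: field_simps)
  then have "complex_of_real (1 / sqrt r) * complex_of_real (1 / sqrt r) * complex_of_real r = 1"
    by (metis of_real_1 of_real_mult)
  then show ?thesis using assms(1) by (simp add: mult.assoc)
qed

text \<open>For \<open>S\<close> consisting of irreducible endomorphisms this says that \<open>\<mu>\<close> is a countable direct sum of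
  elements of \<open>S\<close>, in a form that is easily checked for compositions.\<close>

definition generated_by :: "'h::chilbert bop set \<Rightarrow> 'h endo set \<Rightarrow> 'h endo \<Rightarrow> bool" where
  "generated_by M S \<mu> \<longleftrightarrow> (\<forall>y\<in>M. (\<forall>\<xi>\<in>S. \<forall>t\<in>intertwiners M \<xi> \<mu>. y * t = 0) \<longrightarrow> y = 0)"

lemma generated_byD: "generated_by M S \<mu> \<Longrightarrow> y \<in> M \<Longrightarrow> (\<And>\<xi> t. \<xi> \<in> S \<Longrightarrow> t \<in> intertwiners M \<xi> \<mu> \<Longrightarrow> y * t = 0) \<Longrightarrow> y = 0"
  unfolding generated_by_def by blast

locale factor = vn M for M :: "'h::chilbert bop set" +
  assumes fac: "is_factor M"
begin

lemma one_neq_zero: "(1 :: 'h bop) \<noteq> 0" using fac by (simp add: is_factor_def)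

lemma id_intertwiners: "T \<in> intertwiners M (id_on M) (id_on M) \<Longrightarrow> \<exists>c. T = scaleOp c 1"
proof -
  assume "T \<in> intertwiners M (id_on M) (id_on M)"
  then have "T \<in> M \<inter> commutant M" by (auto simp: intertwiners_def commutant_def)
  then show ?thesis using fac unfolding is_factor_def by blast
qed

lemma irreducible_id: "irreducible_endo M (id_on M)"
  unfolding irreducible_endo_def using id_intertwiners int_scale[OF int_one] by auto

lemma scalar_inject: "scaleOp c (1 :: 'h bop) = scaleOp d 1 \<Longrightarrow> c = d"
proof -
  assume "scaleOp c (1 :: 'h bop) = scaleOp d 1"
  then have "scaleOp (c - d) (1 :: 'h bop) = 0" using scaleOp_add_left[of "c - d" d "1 :: 'h bop"] by simp
  then show ?thesis using one_neq_zero by (simp add: scaleOp_eq_0_iff)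
qed

lemma irreducible_scalar: "irreducible_endo M \<xi> \<Longrightarrow> T \<in> intertwiners M \<xi> \<xi> \<Longrightarrow> \<exists>c. T = scaleOp c 1"
  unfolding irreducible_endo_def by blast

lemma intertwiner_isometry:
  assumes "irreducible_endo M \<xi>" "\<xi> \<in> End M" "\<mu> \<in> End M" "t \<in> intertwiners M \<xi> \<mu>" "t \<noteq> 0"
  shows "\<exists>r>0. adj t * t = scaleOp (complex_of_real r) 1"
  using irreducible_scalar[OF assms(1) int_mult[OF int_adj[OF assms(4,2,3)] assms(4)]]
    adj_mult_scalar[OF _ assms(5)] by metis

text \<open>Schur's lemma: t^* t and t t^* are scalars, and evaluating t t^* t in two ways shows
  that they coincide, so a multiple of t^* is unitary.\<close>

lemma irreducible_equivalent:
  assumes \<xi>: "irreducible_endo M \<xi>" "\<xi> \<in> End M" and \<zeta>: "irreducible_endo M \<zeta>" "\<zeta> \<in> End M"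
    and t: "t \<in> intertwiners M \<xi> \<zeta>" "t \<noteq> 0"
  shows "unitarily_equivalent M \<xi> \<zeta>"
proof -
  obtain r where r: "r > 0" "adj t * t = scaleOp (complex_of_real r) 1"
    using intertwiner_isometry[OF \<xi> \<zeta>(2) t] by blast
  have at: "adj t \<in> intertwiners M \<zeta> \<xi>" using int_adj[OF t(1) \<xi>(2) \<zeta>(2)] .
  obtain s where s: "s > 0" "t * adj t = scaleOp (complex_of_real s) 1"
    using intertwiner_isometry[OF \<zeta> \<xi>(2) at] t(2) by auto
  have "scaleOp (complex_of_real r) t = t * (adj t * t)" by (simp add: r)
  also have "\<dots> = scaleOp (complex_of_real s) t" by (simp add: s flip: mult.assoc)
  finally have "scaleOp (complex_of_real r - complex_of_real s) t = 0"
    using scaleOp_add_left[of "complex_of_real r - complex_of_real s" "complex_of_real s" t] by simp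
  then have rs: "r = s" using t(2) by (simp add: scaleOp_eq_0_iff flip: of_real_diff)
  define u where "u = scaleOp (complex_of_real (1 / sqrt r)) (adj t)"
  have u: "u * adj u = 1" "adj u * u = 1"
    using normalize_isometry[OF r(2,1)] normalize_isometry[of "adj t" r] s rs r(1) by (simp_all add: u_def)
  have uM: "u \<in> intertwiners M \<zeta> \<xi>" unfolding u_def by (intro int_scale at)
  have "\<xi> = Ad M u \<zeta>"
  proof
    fix x show "\<xi> x = Ad M u \<zeta> x"
    proof (cases "x \<in> M")
      case True
      have "u * \<zeta> x * adj u = \<xi> x * (u * adj u)" using int_eq[OF uM True] by (simp add: mult.assoc)
      then show ?thesis using True by (simp add: Ad_def u)
    next
      case False then show ?thesis using hom_ext[OF \<xi>(2)] by (simp add: Ad_def extensional_def)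
    qed
  qed
  then show ?thesis unfolding unitarily_equivalent_def unitaries_def using u int_mem[OF uM] by blast
qed

lemma direct_sum_intertwiner:
  assumes "direct_sum M K w \<xi> \<sigma>" "k \<in> K"
  shows "w k \<in> intertwiners M (\<xi> k) \<sigma>"
proof (rule intertwinersI)
  have iso: "\<And>k. k \<in> K \<Longrightarrow> adj (w k) * w k = 1" and s1: "strong_sum (\<lambda>k. w k * adj (w k)) K 1"
    using assms(1) by (auto simp: direct_sum_def isometry_family_def isometries_def)
  show "w k \<in> M" using assms by (auto simp: direct_sum_def isometry_family_def isometries_def)
  fix x assume x: "x \<in> M"
  have "strong_sum (\<lambda>l. w l * \<xi> l x * adj (w l) * w k) K (\<sigma> x * w k)"
    using assms(1) x by (intro strong_sum_mult_right) (simp add: direct_sum_def)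
  moreover have "w l * \<xi> l x * adj (w l) * w k = (if l = k then w k * \<xi> k x else 0)" if "l \<in> K" for l
    using isometries_orthogonal[OF iso s1 that assms(2)] iso[OF assms(2)] by (simp add: mult.assoc)
  ultimately have "strong_sum (\<lambda>l. if l = k then w k * \<xi> k x else 0) K (\<sigma> x * w k)"
    by (rule strong_sum_eq)
  moreover have "strong_sum (\<lambda>l. if l = k then w k * \<xi> k x else 0) K (w k * \<xi> k x)"
    unfolding strong_sum_def
    by (intro allI has_sum_finite_neutralI[of "{k}"]) (use assms(2) in auto)
  ultimately show "w k * \<xi> k x = \<sigma> x * w k" using strong_sum_unique by blast
qed

lemma direct_sum_generated:
  assumes "direct_sum M K w \<xi> \<sigma>" "\<And>k. k \<in> K \<Longrightarrow> \<xi> k \<in> S"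
  shows "generated_by M S \<sigma>"
  unfolding generated_by_def
proof (intro ballI impI)
  fix y assume y: "\<forall>\<xi>\<in>S. \<forall>t\<in>intertwiners M \<xi> \<sigma>. y * t = 0"
  show "y = 0"
  proof (rule strong_sum_total)
    show "strong_sum (\<lambda>k. w k * adj (w k)) K 1" using assms(1) by (simp add: direct_sum_def isometry_family_def)
    show "y * w k = 0" if "k \<in> K" for k
      using y direct_sum_intertwiner[OF assms(1) that] assms(2)[OF that] by blast
  qed
qed

lemma direct_sumI:
  assumes "\<mu> \<in> End M" "\<And>k. k \<in> K \<Longrightarrow> w k \<in> intertwiners M (\<xi> k) \<mu>" "\<And>k. k \<in> K \<Longrightarrow> adj (w k) * w k = 1"
    "strong_sum (\<lambda>k. w k * adj (w k)) K 1"
  shows "direct_sum M K w \<xi> \<mu>"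
  unfolding direct_sum_def isometry_family_def isometries_def
proof (intro conjI ballI)
  fix x assume x: "x \<in> M"
  have "strong_sum (\<lambda>k. \<mu> x * (w k * adj (w k))) K (\<mu> x * 1)" by (rule strong_sum_mult_left[OF assms(4)])
  moreover have "\<mu> x * (w k * adj (w k)) = w k * \<xi> k x * adj (w k)" if "k \<in> K" for k
    using int_eq[OF assms(2)[OF that] x] by (simp flip: mult.assoc)
  ultimately show "strong_sum (\<lambda>k. w k * \<xi> k x * adj (w k)) K (\<mu> x)"
    using strong_sum_eq by fastforce
qed (use assms int_mem in blast)+

text \<open>A finite sum of the range projections is a projection, so its state is at most 1. Hence
  the states of the range projections are summable, while faithfulness makes each of them nonzero; a
  summable family has only countably many nonzero terms.\<close>

lemma faithful_state_countable:
  assumes \<phi>: "faithful_normal_state M \<phi>" and F: "\<And>w. w \<in> F \<Longrightarrow> w \<in> M \<and> adj w * w = 1"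
    "\<And>w w'. w \<in> F \<Longrightarrow> w' \<in> F \<Longrightarrow> w \<noteq> w' \<Longrightarrow> adj w * w' = 0"
  shows "countable F"
proof -
  define f where "f w = Re (\<phi> (w * adj w))" for w
  have add: "\<phi> (x + y) = \<phi> x + \<phi> y" if "x \<in> M" "y \<in> M" for x y using \<phi> that by (simp add: faithful_normal_state_def)
  have pos: "0 \<le> Re (\<phi> (adj x * x))" if "x \<in> M" for x using \<phi> that by (simp add: faithful_normal_state_def)
  have Im: "Im (\<phi> (adj x * x)) = 0" if "x \<in> M" for x using \<phi> that by (simp add: faithful_normal_state_def)
  have faith: "\<phi> (adj x * x) = 0 \<Longrightarrow> x = 0" if "x \<in> M" for x using \<phi> that by (simp add: faithful_normal_state_def)
  have \<phi>0: "\<phi> 0 = 0" using add[of 0 0] by simp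
  have sum: "\<phi> (\<Sum>w\<in>G. w * adj w) = (\<Sum>w\<in>G. \<phi> (w * adj w))" if "G \<subseteq> F" for G
    using that
  proof (induction G rule: infinite_finite_induct)
    case (insert w G)
    have "(\<Sum>w\<in>G. w * adj w) \<in> M" by (rule sum_mem) (use F(1) insert.prems in auto)
    then show ?case using add[of "w * adj w" "\<Sum>w\<in>G. w * adj w"] F(1) insert by auto
  qed (auto simp: \<phi>0)
  have nonneg: "0 \<le> f w" if "w \<in> F" for w using pos[of "adj w"] F(1)[OF that] by (simp add: f_def)
  have "f summable_on F"
  proof (rule nonneg_bdd_above_summable_on[OF nonneg])
    show "bdd_above (sum f ` {G. G \<subseteq> F \<and> finite G})"
    proof (rule bdd_aboveI)
      fix r assume "r \<in> sum f ` {G. G \<subseteq> F \<and> finite G}"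
      then obtain G where G: "G \<subseteq> F" "finite G" "r = sum f G" by blast
      define p where "p = (\<Sum>w\<in>G. w * adj w)"
      have p: "adj p = p \<and> p * p = p" unfolding p_def
      proof (rule projection_sum[OF G(2)])
        show "adj (w * adj w) = w * adj w \<and> (w * adj w) * (w * adj w) = w * adj w" if "w \<in> G" for w
          by (rule isometry_projection) (use F(1) G(1) that in blast)
        show "(w * adj w) * (w' * adj w') = 0" if "w \<in> G" "w' \<in> G" "w \<noteq> w'" for w w'
        proof -
          have "(w * adj w) * (w' * adj w') = w * (adj w * w') * adj w'" by (simp add: mult.assoc)
          moreover have "adj w * w' = 0" by (rule F(2)) (use G(1) that in auto)
          ultimately show ?thesis by simp
        qed
      qed
      have pM: "p \<in> M" unfolding p_def by (rule sum_mem) (use F(1) G(1) in auto)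
      have "0 \<le> Re (\<phi> (adj (1 - p) * (1 - p)))" by (rule pos) (simp add: pM)
      also have "adj (1 - p) * (1 - p) = 1 - p" using p by (simp add: algebra_simps)
      finally have "Re (\<phi> p) \<le> Re (\<phi> 1)" using add[of "1 - p" p] pM by simp
      moreover have "Re (\<phi> p) = r" using sum[OF G(1)] unfolding p_def G(3) f_def by simp
      moreover have "\<phi> 1 = 1" using \<phi> by (simp add: faithful_normal_state_def)
      ultimately show "r \<le> 1" by simp
    qed
  qed
  then have "countable {w \<in> F. f w \<noteq> 0}" by (rule summable_countable_real)
  moreover have "f w \<noteq> 0" if "w \<in> F" for w
  proof
    assume "f w = 0"
    then have "\<phi> (adj (adj w) * adj w) = 0" using Im[of "adj w"] F(1)[OF that] by (simp add: f_def complex_eq_iff)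
    then have "adj w = 0" by (rule faith[rotated]) (use F(1)[OF that] in simp)
    then show False using F(1)[OF that] one_neq_zero by simp
  qed
  then have "{w \<in> F. f w \<noteq> 0} = F" by blast
  ultimately show ?thesis by simp
qed

text \<open>Take a maximal family of isometric intertwiners with orthogonal ranges. If the
  complement p of their ranges were nonzero, some intertwiner t from a member of S would satisfy p t
  \<noteq> 0; being out of an irreducible, p t is a multiple of an isometry and would enlarge the
  family.\<close>

lemma generated_direct_sum:
  assumes \<phi>: "faithful_normal_state M \<phi>" and \<mu>: "\<mu> \<in> End M" and gen: "generated_by M S \<mu>"
    and S: "\<And>\<xi>. \<xi> \<in> S \<Longrightarrow> \<xi> \<in> End M \<and> irreducible_endo M \<xi>"
  shows "\<exists>K w \<xi>. direct_sum M K w \<xi> \<mu> \<and> (\<forall>k\<in>K. \<xi> k \<in> S)"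
proof -
  define W where "W = {w \<in> M. adj w * w = 1 \<and> (\<exists>\<xi>\<in>S. w \<in> intertwiners M \<xi> \<mu>)}"
  define \<A> where "\<A> = {F. F \<subseteq> W \<and> (\<forall>w\<in>F. \<forall>w'\<in>F. w \<noteq> w' \<longrightarrow> adj w * w' = 0)}"
  have "\<exists>F\<in>\<A>. \<forall>X\<in>\<A>. F \<subseteq> X \<longrightarrow> X = F"
  proof (rule subset_Zorn_nonempty)
    have "{} \<in> \<A>" by (simp add: \<A>_def)
    then show "\<A> \<noteq> {}" by blast
    fix \<C> assume "\<C> \<noteq> {}" and ch: "subset.chain \<A> \<C>"
    have C: "\<C> \<subseteq> \<A>" "\<And>X Y. X \<in> \<C> \<Longrightarrow> Y \<in> \<C> \<Longrightarrow> X \<subseteq> Y \<or> Y \<subseteq> X"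
      using ch unfolding subset_chain_def by auto
    have "adj w * w' = 0" if w: "w \<in> \<Union>\<C>" "w' \<in> \<Union>\<C>" "w \<noteq> w'" for w w'
    proof -
      obtain X Y where XY: "X \<in> \<C>" "w \<in> X" "Y \<in> \<C>" "w' \<in> Y" using w by blast
      then obtain Z where "Z \<in> \<C>" "w \<in> Z" "w' \<in> Z" using C(2)[of X Y] by blast
      then show ?thesis using C(1) w(3) unfolding \<A>_def by blast
    qed
    then show "\<Union>\<C> \<in> \<A>" using C(1) unfolding \<A>_def by blast
  qed
  then obtain F where F: "F \<in> \<A>" and max: "\<And>X. X \<in> \<A> \<Longrightarrow> F \<subseteq> X \<Longrightarrow> X = F" by blast
  have FW: "w \<in> W" if "w \<in> F" for w using F that by (auto simp: \<A>_def)
  have Forth: "adj w * w' = 0" if "w \<in> F" "w' \<in> F" "w \<noteq> w'" for w w' using F that by (auto simp: \<A>_def)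
  have "countable F" by (rule faithful_state_countable[OF \<phi>]) (use FW Forth in \<open>auto simp: W_def\<close>)
  then obtain f :: "'h bop \<Rightarrow> nat" where f: "inj_on f F" by (auto simp: countable_def)
  define K where "K = f ` F"
  define w where "w = inv_into F f"
  have wF: "w k \<in> F" if "k \<in> K" for k using that unfolding K_def w_def by (rule inv_into_into)
  have winj: "w k \<noteq> w l" if "k \<in> K" "l \<in> K" "k \<noteq> l" for k l
    using that unfolding K_def w_def by (auto simp: inv_into_f_f[OF f])
  have wrange: "\<exists>k\<in>K. w k = v" if "v \<in> F" for v
    using that unfolding K_def w_def by (auto simp: inv_into_f_f[OF f])
  obtain \<xi> where \<xi>: "\<And>k. k \<in> K \<Longrightarrow> \<xi> k \<in> S \<and> w k \<in> intertwiners M (\<xi> k) \<mu>"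
    using FW[OF wF] unfolding W_def by (simp add: Bex_def) metis
  have iso: "adj (w k) * w k = 1" if "k \<in> K" for k using FW[OF wF[OF that]] by (simp add: W_def)
  have orth: "adj (w k) * w l = 0" if "k \<in> K" "l \<in> K" "k \<noteq> l" for k l using Forth[OF wF wF winj] that by blast
  obtain r where r: "strong_sum (\<lambda>k. w k * adj (w k)) K r" "adj r = r" "r * r = r"
    "\<And>k. k \<in> K \<Longrightarrow> r * (w k * adj (w k)) = w k * adj (w k)"
  proof -
    have "adj (w k * adj (w k)) = w k * adj (w k) \<and> (w k * adj (w k)) * (w k * adj (w k)) = w k * adj (w k)" if "k \<in> K" for k
      by (rule isometry_projection) (rule iso[OF that])
    moreover have "(w k * adj (w k)) * (w l * adj (w l)) = 0" if "k \<in> K" "l \<in> K" "k \<noteq> l" for k l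
    proof -
      have "(w k * adj (w k)) * (w l * adj (w l)) = w k * (adj (w k) * w l) * adj (w l)" by (simp add: mult.assoc)
      then show ?thesis by (simp add: orth[OF that])
    qed
    ultimately show ?thesis using projections_strong_sum[of K "\<lambda>k. w k * adj (w k)"] that by blast
  qed
  have rint: "r \<in> intertwiners M \<mu> \<mu>"
    unfolding End_intertwiners_commutant[OF \<mu>]
  proof (rule commutant_strong_sum[OF r(1)])
    fix k assume "k \<in> K"
    then have "w k * adj (w k) \<in> intertwiners M \<mu> \<mu>"
      using int_mult[OF _ int_adj] \<xi> S \<mu> by blast
    then show "w k * adj (w k) \<in> commutant (commutant M \<union> \<mu> ` M)" by (simp add: End_intertwiners_commutant[OF \<mu>])
  qed
  define p where "p = 1 - r"
  have p: "adj p = p" "p * p = p" "p \<in> intertwiners M \<mu> \<mu>"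
    unfolding p_def by (simp_all add: r algebra_simps int_diff int_one rint)
  have pw: "p * w k = 0" if "k \<in> K" for k
  proof -
    have "r * w k = r * (w k * adj (w k)) * w k" using iso[OF that] by (simp add: mult.assoc)
    also have "\<dots> = w k" using r(4)[OF that] iso[OF that] by (simp add: mult.assoc)
    finally show ?thesis by (simp add: p_def left_diff_distrib)
  qed
  have "p = 0"
  proof (rule generated_byD[OF gen])
    show "p \<in> M" using p(3) by (rule int_mem)
    fix \<zeta> t assume \<zeta>: "\<zeta> \<in> S" and t: "t \<in> intertwiners M \<zeta> \<mu>"
    show "p * t = 0"
    proof (rule ccontr)
      assume nz: "p * t \<noteq> 0"
      have pt: "p * t \<in> intertwiners M \<zeta> \<mu>" using int_mult[OF p(3) t] .
      obtain s where s: "s > 0" "adj (p * t) * (p * t) = scaleOp (complex_of_real s) 1"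
        using intertwiner_isometry[OF _ _ \<mu> pt nz] S[OF \<zeta>] by blast
      define v where "v = scaleOp (complex_of_real (1 / sqrt s)) (p * t)"
      have v: "adj v * v = 1" unfolding v_def by (rule normalize_isometry[OF s(2,1)])
      have vi: "v \<in> intertwiners M \<zeta> \<mu>" unfolding v_def by (rule int_scale[OF pt])
      have pv: "p * v = v" unfolding v_def using p(2) by (simp flip: mult.assoc)
      have wv: "adj v * x = 0" if "x \<in> F" for x
      proof -
        obtain k where k: "k \<in> K" "w k = x" using wrange \<open>x \<in> F\<close> by blast
        have "adj v * x = adj (p * v) * x" by (simp add: pv)
        also have "\<dots> = adj v * (p * x)" by (simp add: p(1) mult.assoc)
        finally show ?thesis using pw[OF k(1)] k(2) by simp
      qed
      have vw: "adj x * v = 0" if "x \<in> F" for x using arg_cong[OF wv[OF that], of adj] by simp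
      have "v \<in> W" unfolding W_def using v vi int_mem[OF vi] \<zeta> by blast
      then have "insert v F \<subseteq> W" using FW by blast
      moreover have "\<forall>x\<in>insert v F. \<forall>y\<in>insert v F. x \<noteq> y \<longrightarrow> adj x * y = 0"
        using wv vw Forth by (metis insert_iff)
      ultimately have "insert v F \<in> \<A>" unfolding \<A>_def by (intro CollectI conjI)
      then have "v \<in> F" using max by blast
      then show False using wv v one_neq_zero by fastforce
    qed
  qed
  then have "strong_sum (\<lambda>k. w k * adj (w k)) K 1" using r(1) by (simp add: p_def)
  then have "direct_sum M K w \<xi> \<mu>" using \<xi> iso \<mu> by (intro direct_sumI) auto
  then show ?thesis using \<xi> by blast
qed

end

section \<open>Endomorphisms with a conjugate and their finite decomposition\<close>

locale conjugate_pair = factor M for M :: "'h::chilbert bop set" +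
  fixes \<sigma> \<sigma>' :: "'h endo" and R R' :: "'h bop"
  assumes End: "\<sigma> \<in> End M" "\<sigma>' \<in> End M" and sol: "conjugate_solution M \<sigma> \<sigma>' R R'"
begin

abbreviation "d \<equiv> dimension M \<sigma>"

lemma R_mem: "R \<in> M" "R' \<in> M"
  using sol by (auto simp: conjugate_solution_def int_mem)
lemma R_eq: "x \<in> M \<Longrightarrow> R * x = \<sigma>' (\<sigma> x) * R"
  using sol int_eq[of R "id_on M" "compose M \<sigma>' \<sigma>" x] by (simp add: conjugate_solution_def compose_def)
lemma R'_eq: "x \<in> M \<Longrightarrow> R' * x = \<sigma> (\<sigma>' x) * R'"
  using sol int_eq[of R' "id_on M" "compose M \<sigma> \<sigma>'" x] by (simp add: conjugate_solution_def compose_def)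
lemma aR'_eq: "x \<in> M \<Longrightarrow> adj R' * \<sigma> (\<sigma>' x) = x * adj R'"
proof -
  assume x: "x \<in> M"
  have "adj (R' * adj x) = adj (\<sigma> (\<sigma>' (adj x)) * R')" using R'_eq[of "adj x"] x by simp
  then show ?thesis using x End by (simp add: hom_adj[of _ M M] hom_mem)
qed
lemma R_norm: "adj R * R = scaleOp (complex_of_real d) 1" "adj R' * R' = scaleOp (complex_of_real d) 1"
  using sol by (auto simp: conjugate_solution_def)
lemma zigzag: "adj R * \<sigma>' R' = 1" "adj R' * \<sigma> R = 1" using sol by (auto simp: conjugate_solution_def)
lemma zigzag_adj: "\<sigma>' (adj R') * R = 1" "\<sigma> (adj R) * R' = 1"
proof -
  have "adj (adj R * \<sigma>' R') = 1" "adj (adj R' * \<sigma> R) = 1" by (simp_all add: zigzag)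
  then show "\<sigma>' (adj R') * R = 1" "\<sigma> (adj R) * R' = 1"
    using hom_adj[OF End(2) R_mem(2)] hom_adj[OF End(1) R_mem(1)] by simp_all
qed
lemma d_pos: "d > 0"
proof -
  have "R \<noteq> 0" using zigzag_adj one_neq_zero by auto
  from adj_mult_scalar[OF R_norm(1) this] show ?thesis by (auto simp only: of_real_eq_iff)
qed

text \<open>Frobenius reciprocity: the zigzag identity recovers y as
  \<open>adj R' * \<sigma> (\<sigma>' y * R)\<close>.\<close>

lemma frobenius_zero: "y \<in> M \<Longrightarrow> \<sigma>' y * R = 0 \<Longrightarrow> y = 0"
proof -
  assume y: "y \<in> M" and z: "\<sigma>' y * R = 0"
  have "y = y * (adj R' * \<sigma> R)" by (simp add: zigzag)
  also have "\<dots> = adj R' * \<sigma> (\<sigma>' y) * \<sigma> R" using aR'_eq[OF y] by (simp add: mult.assoc)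
  also have "\<dots> = adj R' * \<sigma> (\<sigma>' y * R)"
    using y R_mem by (simp add: hom_mult[OF End(1)] hom_mem[OF End(2)] mult.assoc)
  finally show ?thesis using z hom_zero[OF End(1)] by simp
qed

lemma projection_isometry:
  assumes p: "p \<in> intertwiners M \<sigma> \<sigma>" "adj p = p" "p * p = p" "p \<noteq> 0"
  shows "\<exists>w\<in>M. adj w * w = 1 \<and> w * adj w = p"
proof -
  have pM: "p \<in> M" using p(1) by (rule int_mem)
  have pR: "p * R' \<noteq> 0"
  proof
    assume z: "p * R' = 0"
    have "p = p * (\<sigma> (adj R) * R')" by (simp add: zigzag_adj)
    also have "\<dots> = \<sigma> (adj R) * (p * R')" using int_eq[OF p(1), of "adj R"] R_mem by (simp flip: mult.assoc)
    finally show False using z p(4) by simp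
  qed
  have "p * R' \<in> intertwiners M (id_on M) (compose M \<sigma> \<sigma>')"
    using sol int_right[OF p(1) End(2)] by (intro int_mult[of p]) (auto simp: conjugate_solution_def)
  then obtain r where r: "r > 0" "adj (p * R') * (p * R') = scaleOp (complex_of_real r) 1"
    using intertwiner_isometry[OF irreducible_id id_End comp_End[OF End(2,1)] _ pR] by blast
  define w where "w = scaleOp (complex_of_real (1 / sqrt r)) (p * R')"
  have w: "adj w * w = 1" unfolding w_def by (rule normalize_isometry[OF r(2,1)])
  have pw: "p * w = w" unfolding w_def using p(3) by (simp flip: mult.assoc)
  have wM: "w \<in> M" unfolding w_def using pM R_mem by simp
  have "\<exists>u\<in>commutant (commutant M). adj u * u = 1 \<and> u * adj u = p"
    by (rule isometry_onto_projection[OF w p(2,3) pw]) (use wM pM commutant_adj[OF adj_mem] in auto)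
  then show ?thesis by simp
qed

text \<open>The scalars R^* \<sigma>'(p) R add up to R^* R = d, and each is at least 1/d. The lower
  bound comes from p = R'^* \<sigma>(\<sigma>'(p) R): a nonzero projection has norm 1, while the two
  factors have norms at most the square roots of d and of the scalar.\<close>

lemma partition_bound:
  assumes F: "finite F" "\<And>p. p \<in> F \<Longrightarrow> p \<in> intertwiners M \<sigma> \<sigma> \<and> adj p = p \<and> p * p = p \<and> p \<noteq> 0" "\<Sum>F = 1"
  shows "real (card F) \<le> d\<^sup>2"
proof -
  have "\<exists>c. adj R * \<sigma>' p * R = scaleOp c 1 \<and> 1 / d \<le> Re c" if p: "p \<in> F" for p
  proof -
    have pM: "p \<in> M" using F(2)[OF p] int_mem by blast
    have "\<sigma>' p \<in> intertwiners M (compose M \<sigma>' \<sigma>) (compose M \<sigma>' \<sigma>)" using F(2)[OF p] by (intro int_hom End) blast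
    then have i: "\<sigma>' p * R \<in> intertwiners M (id_on M) (compose M \<sigma>' \<sigma>)"
      by (rule int_mult) (use sol in \<open>simp add: conjugate_solution_def\<close>)
    have nz: "\<sigma>' p * R \<noteq> 0" using frobenius_zero[OF pM] F(2)[OF p] by blast
    obtain r where r: "r > 0" "adj (\<sigma>' p * R) * (\<sigma>' p * R) = scaleOp (complex_of_real r) 1"
      using intertwiner_isometry[OF irreducible_id id_End comp_End[OF End] i nz] by blast
    have "adj (\<sigma>' p * R) * (\<sigma>' p * R) = adj R * (\<sigma>' (adj p) * \<sigma>' p) * R"
      using hom_adj[OF End(2) pM] by (simp add: mult.assoc)
    also have "\<sigma>' (adj p) * \<sigma>' p = \<sigma>' p" using F(2)[OF p] hom_mult[OF End(2) pM pM] by simp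
    finally have eq: "adj R * \<sigma>' p * R = scaleOp (complex_of_real r) 1" using r(2) by simp
    define Y where "Y = \<sigma>' p * R"
    have YM: "Y \<in> M" using R_mem hom_mem[OF End(2) pM] by (simp add: Y_def)
    have pY: "p = adj R' * \<sigma> Y"
    proof -
      have "p = p * (adj R' * \<sigma> R)" by (simp add: zigzag)
      also have "\<dots> = adj R' * \<sigma> (\<sigma>' p) * \<sigma> R" using aR'_eq[OF pM] by (simp add: mult.assoc)
      also have "\<dots> = adj R' * \<sigma> Y"
        using pM R_mem by (simp add: Y_def hom_mult[OF End(1)] hom_mem[OF End(2)] mult.assoc)
      finally show ?thesis .
    qed
    have nY: "norm (app (\<sigma> Y) a) = sqrt r * norm a" for a
    proof -
      have "adj (\<sigma> Y) * \<sigma> Y = \<sigma> (adj Y * Y)"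
        using YM by (simp add: hom_mult[OF End(1)] hom_adj[OF End(1)])
      also have "adj Y * Y = scaleOp (complex_of_real r) 1" unfolding Y_def by (rule r(2))
      also have "\<sigma> (scaleOp (complex_of_real r) 1) = scaleOp (complex_of_real r) 1"
        by (simp add: hom_scale[OF End(1)] hom_one[OF End(1)])
      finally have "cinner (app (\<sigma> Y) a) (app (\<sigma> Y) a) = complex_of_real r * cinner a a"
        unfolding cinner_app_self by (simp add: cinner_scaleC_right)
      then have "complex_of_real ((norm (app (\<sigma> Y) a))\<^sup>2) = complex_of_real (r * (norm a)\<^sup>2)" by (simp add: cinner_self)
      then have "(norm (app (\<sigma> Y) a))\<^sup>2 = (sqrt r * norm a)\<^sup>2"
        using r(1) by (simp only: of_real_eq_iff) (simp add: power_mult_distrib)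
      then show ?thesis using r(1) by (simp add: power2_eq_iff_nonneg)
    qed
    have nR: "norm (app (adj R') v) \<le> sqrt d * norm v" for v
    proof (cases "app (adj R') v = 0")
      case False
      have "norm (app R' b) = sqrt d * norm b" for b
      proof -
        have "cinner (app R' b) (app R' b) = complex_of_real d * cinner b b"
          unfolding cinner_app_self R_norm by (simp add: cinner_scaleC_right)
        then have "complex_of_real ((norm (app R' b))\<^sup>2) = complex_of_real (d * (norm b)\<^sup>2)" by (simp add: cinner_self)
        then have "(norm (app R' b))\<^sup>2 = (sqrt d * norm b)\<^sup>2"
          using d_pos by (simp only: of_real_eq_iff) (simp add: power_mult_distrib)
        then show ?thesis using d_pos by (simp add: power2_eq_iff_nonneg)
      qed
      moreover have "(norm (app (adj R') v))\<^sup>2 = cmod (cinner v (app R' (app (adj R') v)))"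
        by (simp add: cinner_adj[symmetric] cinner_self norm_power)
      moreover have "\<dots> \<le> norm v * norm (app R' (app (adj R') v))" by (rule cmod_cinner_le)
      ultimately have "(norm (app (adj R') v))\<^sup>2 \<le> norm v * (sqrt d * norm (app (adj R') v))" by simp
      then show ?thesis using False by (simp add: power2_eq_square mult_ac)
    qed (use d_pos in simp)
    obtain b where b: "app p b \<noteq> 0" using F(2)[OF p] by (metis bop_eqI app_zero_op)
    define a where "a = app p b"
    have pa: "app p a = a" unfolding a_def using F(2)[OF p] by (metis app_times)
    have "norm a = norm (app (adj R') (app (\<sigma> Y) a))" using pY pa by (metis app_times)
    also have "\<dots> \<le> sqrt d * (sqrt r * norm a)" using nR[of "app (\<sigma> Y) a"] by (simp add: nY)
    finally have "1 \<le> sqrt d * sqrt r" using b by (simp add: a_def)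
    then have "1 \<le> sqrt (d * r)" by (simp add: real_sqrt_mult)
    then have "1 \<le> d * r" by simp
    then show ?thesis using eq d_pos by (intro exI[of _ "complex_of_real r"]) (simp add: divide_le_eq mult.commute)
  qed
  then obtain c where c: "\<And>p. p \<in> F \<Longrightarrow> adj R * \<sigma>' p * R = scaleOp (c p) 1" "\<And>p. p \<in> F \<Longrightarrow> 1 / d \<le> Re (c p)" by metis
  have FM: "\<And>p. p \<in> F \<Longrightarrow> p \<in> M" using F(2) int_mem by blast
  have "scaleOp (complex_of_real d) 1 = adj R * \<sigma>' (\<Sum>F) * R" by (simp add: F(3) hom_one[OF End(2)] R_norm)
  also have "\<dots> = (\<Sum>p\<in>F. adj R * \<sigma>' p * R)"
    using hom_sum[OF End(2), of F "\<lambda>p. p"] FM by (simp add: sum_distrib_left sum_distrib_right)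
  also have "\<dots> = (\<Sum>p\<in>F. scaleOp (c p) 1)" by (rule sum.cong[OF refl c(1)])
  also have "\<dots> = scaleOp (sum c F) 1"
    by (induction F rule: infinite_finite_induct) (auto simp: scaleOp_add_left)
  finally have "complex_of_real d = sum c F" by (rule scalar_inject)
  then have "d = (\<Sum>p\<in>F. Re (c p))" by (metis Re_complex_of_real Re_sum)
  also have "\<dots> \<ge> (\<Sum>p\<in>F. 1 / d)" by (rule sum_mono[OF c(2)])
  finally show ?thesis using d_pos by (simp add: divide_le_eq power2_eq_square)
qed

text \<open>A partition of \<open>1\<close> into the largest possible number of projections consists of minimal
  projections.\<close>

lemma finite_decomposition:
  "\<exists>K w \<xi>. finite K \<and> direct_sum M K w \<xi> \<sigma> \<and> (\<forall>k\<in>K. irreducible_endo M (\<xi> k) \<and> \<xi> k \<in> End M)"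
proof -
  define part where "part F \<longleftrightarrow> finite F \<and> (\<forall>p\<in>F. p \<in> intertwiners M \<sigma> \<sigma> \<and> adj p = p \<and> p * p = p \<and> p \<noteq> 0)
    \<and> (\<forall>p\<in>F. \<forall>q\<in>F. p \<noteq> q \<longrightarrow> p * q = 0) \<and> \<Sum>F = 1" for F
  have "part {1}" unfolding part_def using one_neq_zero int_one by auto
  moreover have "\<forall>F. part F \<longrightarrow> card F < Suc (nat \<lfloor>d\<^sup>2\<rfloor>)"
  proof (intro allI impI)
    fix F assume "part F"
    then have "real (card F) \<le> d\<^sup>2" by (intro partition_bound) (auto simp: part_def)
    then show "card F < Suc (nat \<lfloor>d\<^sup>2\<rfloor>)" by linarith
  qed
  ultimately obtain F where F: "part F" and max: "\<And>G. part G \<Longrightarrow> card G \<le> card F"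
    using ex_has_greatest_nat[of part "{1}" card] by blast
  have Fp: "p \<in> intertwiners M \<sigma> \<sigma>" "adj p = p" "p * p = p" "p \<noteq> 0" if "p \<in> F" for p using F that by (auto simp: part_def)
  have minimal: "e = 0 \<or> e = p" if p: "p \<in> F" and e: "e \<in> intertwiners M \<sigma> \<sigma>" "adj e = e" "e * e = e" "p * e = e" for p e
  proof (rule ccontr)
    assume ne: "\<not> (e = 0 \<or> e = p)"
    have ep: "e * p = e" using arg_cong[OF e(4), of adj] by (simp add: Fp(2)[OF p] e(2))
    have pq: "p * q = 0" "q * p = 0" if "q \<in> F" "q \<noteq> p" for q using F p that by (auto simp: part_def)
    have eq0: "e * q = 0" "q * e = 0" if q: "q \<in> F" "q \<noteq> p" for q
    proof -
      have "e * q = e * (p * q)" using ep by (simp flip: mult.assoc)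
      then show "e * q = 0" using pq[OF q] by simp
      have "q * e = q * p * e" using e(4) by (simp add: mult.assoc)
      then show "q * e = 0" using pq[OF q] by simp
    qed
    \<comment> \<open>Replacing p by its two orthogonal pieces e and p - e gives a partition with
      one more member, against maximality.\<close>
    let ?G = "insert e (insert (p - e) (F - {p}))"
    have 1: "e \<notin> F - {p}" using eq0 e(3) ne by force
    have pe: "(p - e) * (p - e) = p - e" by (simp add: algebra_simps e ep Fp(3)[OF p])
    have 2: "p - e \<notin> F - {p}"
    proof
      assume *: "p - e \<in> F - {p}"
      then have "p * (p - e) = 0" using pq[of "p - e"] by auto
      then have "p - e = 0" by (simp add: right_diff_distrib Fp(3)[OF p] e(4))
      then show False using ne by simp
    qed
    have 3: "e \<noteq> p - e"
    proof
      assume "e = p - e"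
      then have "e * e = e * (p - e)" by simp
      then show False using ne by (simp add: right_diff_distrib e(3) ep)
    qed
    have fin: "finite F" using F by (simp add: part_def)
    have "\<Sum>?G = e + ((p - e) + \<Sum>(F - {p}))" using 1 2 3 fin by simp
    also have "\<dots> = \<Sum>F" using sum.remove[OF fin p, of "\<lambda>x. x"] by simp
    finally have "\<Sum>?G = 1" using F by (simp add: part_def)
    moreover have "q * q' = 0" if "q \<in> ?G" "q' \<in> ?G" "q \<noteq> q'" for q q'
      using that F eq0 pq by (auto simp: part_def left_diff_distrib right_diff_distrib e ep)
    moreover have "q \<in> intertwiners M \<sigma> \<sigma> \<and> adj q = q \<and> q * q = q \<and> q \<noteq> 0" if "q \<in> ?G" for q
      using that Fp e ne pe int_diff[OF Fp(1)[OF p] e(1)] p by auto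
    ultimately have "part ?G" unfolding part_def using fin by blast
    then have "card ?G \<le> card F" by (rule max)
    moreover have "card ?G = Suc (card F)" using 1 2 3 fin card_Suc_Diff1[OF fin p] by simp
    ultimately show False by simp
  qed
  have "\<exists>w\<in>M. adj w * w = 1 \<and> w * adj w = p" if "p \<in> F" for p
    using projection_isometry[OF Fp[OF that]] .
  then obtain v where v: "\<And>p. p \<in> F \<Longrightarrow> v p \<in> M \<and> adj (v p) * v p = 1 \<and> v p * adj (v p) = p" by metis
  obtain f :: "'h bop \<Rightarrow> nat" where f: "inj_on f F"
    using F countable_finite[of F] by (auto simp: countable_def part_def)
  define K where "K = f ` F"
  define p where "p = inv_into F f"
  define w where "w k = v (p k)" for k
  define \<xi> where "\<xi> k = (\<lambda>x\<in>M. adj (w k) * \<sigma> x * w k)" for k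
  have pF: "p k \<in> F" if "k \<in> K" for k using that unfolding K_def p_def by (rule inv_into_into)
  have w: "w k \<in> M" "adj (w k) * w k = 1" "w k * adj (w k) = p k" if "k \<in> K" for k
    using v[OF pF[OF that]] by (auto simp: w_def)
  have finK: "finite K" using F by (simp add: K_def part_def)
  have int: "w k \<in> intertwiners M (\<xi> k) \<sigma>" if k: "k \<in> K" for k
  proof (rule intertwinersI[OF w(1)[OF k]])
    fix x assume x: "x \<in> M"
    have "w k * \<xi> k x = (w k * adj (w k)) * \<sigma> x * w k" using x by (simp add: \<xi>_def mult.assoc)
    also have "\<dots> = \<sigma> x * (w k * adj (w k)) * w k" using int_eq[OF Fp(1)[OF pF[OF k]] x] by (simp add: w[OF k])
    also have "\<dots> = \<sigma> x * w k" by (simp add: mult.assoc w(2)[OF k])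
    finally show "w k * \<xi> k x = \<sigma> x * w k" .
  qed
  have \<xi>End: "\<xi> k \<in> End M" if k: "k \<in> K" for k
  proof (rule normal_homsI)
    show "\<xi> k \<in> extensional M" by (simp add: \<xi>_def)
    show "\<xi> k x \<in> M" if "x \<in> M" for x using that w(1)[OF k] hom_mem[OF End(1)] by (simp add: \<xi>_def)
    show "\<xi> k (x + y) = \<xi> k x + \<xi> k y" if "x \<in> M" "y \<in> M" for x y
      using that by (simp add: \<xi>_def hom_add[OF End(1)] distrib_left distrib_right)
    show "\<xi> k (scaleOp c x) = scaleOp c (\<xi> k x)" if "x \<in> M" for c x
      using that by (simp add: \<xi>_def hom_scale[OF End(1)])
    show "\<xi> k (x * y) = \<xi> k x * \<xi> k y" if "x \<in> M" "y \<in> M" for x y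
    proof -
      have "\<xi> k x * \<xi> k y = adj (w k) * \<sigma> x * (w k * \<xi> k y)" using that by (simp add: \<xi>_def mult.assoc)
      also have "\<dots> = adj (w k) * \<sigma> x * \<sigma> y * w k" using int_eq[OF int[OF k] \<open>y \<in> M\<close>] by (simp add: mult.assoc)
      finally show ?thesis using that by (simp add: \<xi>_def hom_mult[OF End(1)] mult.assoc)
    qed
    show "\<xi> k (adj x) = adj (\<xi> k x)" if "x \<in> M" for x
      using that by (simp add: \<xi>_def hom_adj[OF End(1)] mult.assoc)
    show "\<xi> k 1 = 1" by (simp add: \<xi>_def hom_one[OF End(1)] w(2)[OF k])
    have "continuous_map (subtopology sigma_weak M) sigma_weak (\<lambda>x. adj (w k) * \<sigma> x * w k)"
      using continuous_map_compose[OF continuous_map_compose[OF hom_cont[OF End(1)] continuous_map_sigma_weak_mult_left[of "adj (w k)"]]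
          continuous_map_sigma_weak_mult_right[of "w k"]] by (simp add: o_def)
    then show "continuous_map (subtopology sigma_weak M) sigma_weak (\<xi> k)"
      by (rule continuous_map_eq) (simp add: \<xi>_def)
  qed
  have irr: "irreducible_endo M (\<xi> k)" if k: "k \<in> K" for k
  proof (rule irreducible_of_no_projection[OF \<xi>End[OF k] _ one_neq_zero])
    fix e assume e: "e \<in> intertwiners M (\<xi> k) (\<xi> k)" "adj e = e" "e * e = e"
    let ?e = "w k * e * adj (w k)"
    have "?e \<in> intertwiners M \<sigma> \<sigma>"
      by (rule int_mult[OF int_mult[OF int[OF k] e(1)] int_adj[OF int[OF k] \<xi>End[OF k] End(1)]])
    moreover have "adj ?e = ?e" by (simp add: e mult.assoc)
    moreover have "?e * ?e = ?e"
    proof -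
      have "?e * ?e = w k * e * (adj (w k) * w k) * e * adj (w k)" by (simp only: mult.assoc)
      also have "\<dots> = w k * (e * e) * adj (w k)" by (simp add: w(2)[OF k] mult.assoc)
      finally show ?thesis by (simp add: e(3))
    qed
    moreover have "p k * ?e = ?e"
    proof -
      have "p k * ?e = w k * (adj (w k) * w k) * e * adj (w k)" by (simp only: w(3)[OF k, symmetric] mult.assoc)
      then show ?thesis by (simp add: w(2)[OF k])
    qed
    ultimately have "?e = 0 \<or> ?e = p k" by (rule minimal[OF pF[OF k]])
    moreover have "e = adj (w k) * ?e * w k"
    proof -
      have "adj (w k) * ?e * w k = (adj (w k) * w k) * e * (adj (w k) * w k)" by (simp only: mult.assoc)
      then show ?thesis by (simp add: w(2)[OF k])
    qed
    moreover have "adj (w k) * p k * w k = 1"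
    proof -
      have "adj (w k) * p k * w k = (adj (w k) * w k) * (adj (w k) * w k)" by (simp only: w(3)[OF k, symmetric] mult.assoc)
      then show ?thesis by (simp add: w(2)[OF k])
    qed
    ultimately show "e = 0 \<or> e = 1" by (metis mult_zero_left mult_zero_right)
  qed
  have "(\<Sum>k\<in>K. w k * adj (w k)) = (\<Sum>k\<in>K. p k)" by (rule sum.cong) (simp_all add: w)
  also have "\<dots> = \<Sum>F" unfolding K_def p_def by (simp add: sum.reindex[OF f] inv_into_f_f[OF f])
  finally have "strong_sum (\<lambda>k. w k * adj (w k)) K 1" using F by (simp add: strong_sum_finite[OF finK] part_def)
  then have "direct_sum M K w \<xi> \<sigma>" by (intro direct_sumI End int w(2)) auto
  then show ?thesis using finK irr \<xi>End by blast
qed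

end

section \<open>Compositions of countable direct sums\<close>

context factor
begin

text \<open>Applying \<sigma> to an infinite decomposition of \<rho> is avoided. For an intertwiner
  s from \<zeta> to \<sigma>, Frobenius reciprocity turns y s \<zeta>(r) = 0 into \<zeta>'(y s) R r
  = 0; now r stands alone on the right, so the hypothesis on \<rho> applies and the conjugate can be
  undone.\<close>

lemma generated_compose:
  assumes End: "\<sigma> \<in> End M" "\<rho> \<in> End M" and gen: "generated_by M S1 \<sigma>" "generated_by M S2 \<rho>"
    and S1: "\<And>\<zeta>. \<zeta> \<in> S1 \<Longrightarrow> \<zeta> \<in> End M \<and> (\<exists>\<zeta>'\<in>End M. \<exists>R R'. conjugate_solution M \<zeta> \<zeta>' R R')"
    and S2: "S2 \<subseteq> End M" and S3: "\<And>\<zeta> \<kappa>. \<zeta> \<in> S1 \<Longrightarrow> \<kappa> \<in> S2 \<Longrightarrow> generated_by M S3 (compose M \<zeta> \<kappa>)"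
  shows "generated_by M S3 (compose M \<sigma> \<rho>)"
  unfolding generated_by_def
proof (intro ballI impI)
  fix y assume y: "y \<in> M" "\<forall>\<xi>\<in>S3. \<forall>t\<in>intertwiners M \<xi> (compose M \<sigma> \<rho>). y * t = 0"
  show "y = 0"
  proof (rule generated_byD[OF gen(1) y(1)])
    fix \<zeta> s assume \<zeta>: "\<zeta> \<in> S1" and s: "s \<in> intertwiners M \<zeta> \<sigma>"
    have sM: "s \<in> M" using s by (rule int_mem)
    obtain \<zeta>' R R' where c: "\<zeta> \<in> End M" "\<zeta>' \<in> End M" "conjugate_solution M \<zeta> \<zeta>' R R'" using S1[OF \<zeta>] by blast
    interpret c: conjugate_pair M \<zeta> \<zeta>' R R' by unfold_locales (use c in auto)
    show "y * s = 0"
    proof (rule c.frobenius_zero)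
      show "y * s \<in> M" using y(1) sM by simp
      show "\<zeta>' (y * s) * R = 0"
      proof (rule generated_byD[OF gen(2)])
        show "\<zeta>' (y * s) * R \<in> M" using y(1) sM c.R_mem hom_mem[OF c(2)] by simp
        fix \<kappa> r assume \<kappa>: "\<kappa> \<in> S2" and r: "r \<in> intertwiners M \<kappa> \<rho>"
        have rM: "r \<in> M" using r by (rule int_mem)
        have \<kappa>E: "\<kappa> \<in> End M" using \<kappa> S2 by blast
        have "y * s * \<zeta> r = 0"
        proof (rule generated_byD[OF S3[OF \<zeta> \<kappa>]])
          show "y * s * \<zeta> r \<in> M" using y(1) sM rM hom_mem[OF c(1)] by simp
          fix \<xi> t assume "\<xi> \<in> S3" and t: "t \<in> intertwiners M \<xi> (compose M \<zeta> \<kappa>)"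
          have "s * \<zeta> r \<in> intertwiners M (compose M \<zeta> \<kappa>) (compose M \<sigma> \<rho>)"
            by (rule int_mult[OF int_right[OF s End(2)] int_hom[OF r c(1) \<kappa>E End(2)]])
          then have "s * \<zeta> r * t \<in> intertwiners M \<xi> (compose M \<sigma> \<rho>)" using t by (rule int_mult)
          then show "y * s * \<zeta> r * t = 0" using y(2) \<open>\<xi> \<in> S3\<close> by (simp add: mult.assoc)
        qed
        then have "\<zeta>' (y * s * \<zeta> r) * R = 0" using hom_zero[OF c(2)] by simp
        moreover have "\<zeta>' (y * s * \<zeta> r) = \<zeta>' (y * s) * \<zeta>' (\<zeta> r)"
          by (rule hom_mult[OF c(2)]) (use y(1) sM rM hom_mem[OF c(1)] in auto)
        ultimately show "\<zeta>' (y * s) * R * r = 0" using c.R_eq[OF rM] by (simp add: mult.assoc)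
      qed
    qed
  qed
qed

end

section \<open>The Longo-Rehren algebra\<close>

lemma mult_swap:
  fixes a :: "'a::semigroup_mult"
  assumes "a * x = y * b" "c * y = z * c'" shows "c * a * x = z * (c' * b)"
proof -
  have "c * a * x = c * y * b" by (simp only: mult.assoc assms(1))
  then show ?thesis by (simp only: assms(2) mult.assoc)
qed

lemma vn_generated_vn: "von_neumann_algebra (vn_generated S)"
proof -
  have *: "adj y \<in> S \<union> adj ` S" if "y \<in> S \<union> adj ` S" for y using that by auto
  have "adj x \<in> vn_generated S" if "x \<in> vn_generated S" for x
    using that commutant_adj[OF commutant_adj[OF *]] unfolding vn_generated_def by blast
  then show ?thesis by (simp add: von_neumann_algebra_def vn_generated_def)
qed

lemma vn_of_closed_algebra:
  assumes "1 \<in> A" "\<And>x y. x \<in> A \<Longrightarrow> y \<in> A \<Longrightarrow> x + y \<in> A" "\<And>x y. x \<in> A \<Longrightarrow> y \<in> A \<Longrightarrow> x * y \<in> A"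
    "\<And>c x. x \<in> A \<Longrightarrow> scaleOp c x \<in> A" "\<And>x. x \<in> A \<Longrightarrow> adj x \<in> A" "closedin sigma_weak A"
  shows "von_neumann_algebra A"
proof -
  have "commutant (commutant A) \<subseteq> A" using bicommutant[of A] closure_of_closedin[of sigma_weak A] assms by blast
  then have "commutant (commutant A) = A" using subset_bicommutant by blast
  then show ?thesis using assms by (simp add: von_neumann_algebra_def)
qed

lemma eq_on_closure:
  assumes "continuous_map (subtopology sigma_weak U) sigma_weak f" "continuous_map (subtopology sigma_weak U) sigma_weak g"
    "\<And>x. x \<in> S \<Longrightarrow> f x = g x" "S \<subseteq> U" "y \<in> U" "y \<in> sigma_weak closure_of S"
  shows "f y = g y"
proof (rule forall_in_closure_of_eq[OF _ Hausdorff_sigma_weak assms(1,2)])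
  show "y \<in> subtopology sigma_weak U closure_of S"
    using assms by (simp add: closure_of_subtopology Int_absorb1)
qed (use assms in auto)

locale lr =
  fixes D :: "('h::chilbert, 'h2::chilbert, 'k::chilbert, 'l::chilbert, 'g::group_add) lr_data"
  assumes setting: "lr_setting D"
begin

abbreviation "M \<equiv> algM D"
abbreviation "N \<equiv> algMop D"
abbreviation "j \<equiv> jmap D"
abbreviation "tn \<equiv> tens D"
abbreviation "A \<equiv> algA D"
abbreviation "\<iota> \<equiv> incl D"
abbreviation "B \<equiv> algB D"
abbreviation "C \<equiv> catC D"
abbreviation "Irr \<equiv> irrC D"
abbreviation "gr \<equiv> grC D"
abbreviation "lm \<equiv> lam D"
abbreviation "E \<equiv> expB D"
abbreviation "u \<equiv> ug D"
abbreviation "cj \<equiv> conjC D"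
abbreviation "R \<equiv> solR D"
abbreviation "R' \<equiv> solRbar D"
abbreviation "B0 \<equiv> algBg D 0"

lemma lr: "longo_rehren D" using setting by (simp add: lr_setting_def)

lemma lrD:
  "von_neumann_algebra B" "\<iota> \<in> normal_homs A B" "inj_on \<iota> A" "B = vn_generated (\<iota> ` A \<union> lm ` C)"
  "\<forall>\<pi>\<in>C. \<exists>\<Phi>. is_tensor_endo tn M N \<pi> (op_endo D \<pi>) \<Phi> \<and> (\<forall>a\<in>A. lm \<pi> * \<iota> a = \<iota> (\<Phi> a) * lm \<pi>)"
  "\<forall>\<pi>\<in>C. \<forall>\<rho>\<in>C. lm \<pi> * lm \<rho> = lm (compose M \<pi> \<rho>)"
  "\<forall>\<pi>\<in>C. adj (lm \<pi>) = adj (el D (R \<pi>) (R \<pi>)) * lm (cj \<pi>)"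
  "\<forall>\<pi>\<in>C. \<forall>\<rho>\<in>C. \<forall>T\<in>intertwiners M \<pi> \<rho>. el D T 1 * lm \<pi> = el D 1 (adj T) * lm \<rho>"
  "normal_cond_exp B (\<iota> ` A) E" "faithful_on B E"
  "\<forall>a\<in>A. \<forall>\<pi>\<in>Irr. E (\<iota> a * lm \<pi>) = (if \<pi> = id_on M then \<iota> a else 0)"
  by (insert lr[unfolded longo_rehren_def Let_def]; elim conjE; assumption)+

lemma M_factor: "factor M"
  using setting by unfold_locales (auto simp: lr_setting_def type_III_factor_def is_factor_def)
sublocale M: factor M by (rule M_factor)
sublocale N: vn N using setting by unfold_locales (simp add: lr_setting_def opposite_algebra_def)
sublocale T: htensor tn using setting by unfold_locales (simp add: lr_setting_def)
sublocale A: vn A by unfold_locales (simp add: algA_def vn_tensor_def vn_generated_vn)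
sublocale B: vn B by unfold_locales (rule lrD)

lemma j_opp: "opposite_algebra M N j" using setting by (simp add: lr_setting_def)
lemma j_mem [simp]: "x \<in> M \<Longrightarrow> j x \<in> N" using j_opp by (auto simp: opposite_algebra_def bij_betw_def)
lemma j_surj: "y \<in> N \<Longrightarrow> \<exists>x\<in>M. y = j x" using j_opp by (auto simp: opposite_algebra_def bij_betw_def)
lemma j_inj: "x \<in> M \<Longrightarrow> y \<in> M \<Longrightarrow> j x = j y \<longleftrightarrow> x = y"
  using j_opp by (auto simp: opposite_algebra_def bij_betw_def inj_on_eq_iff)
lemma j_mult: "x \<in> M \<Longrightarrow> y \<in> M \<Longrightarrow> j (x * y) = j x * j y" using j_opp by (simp add: opposite_algebra_def)
lemma j_adj: "x \<in> M \<Longrightarrow> j (adj x) = adj (j x)" using j_opp by (simp add: opposite_algebra_def)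
lemma j_scale: "x \<in> M \<Longrightarrow> j (scaleOp c x) = scaleOp (cnj c) (j x)" using j_opp by (simp add: opposite_algebra_def)
lemma j_one [simp]: "j 1 = 1"
proof -
  obtain x where x: "x \<in> M" "1 = j x" using j_surj[OF N.one_mem] by blast
  then have "j 1 = j 1 * j x" by simp
  also have "\<dots> = j x" using j_mult[of 1 x] x by simp
  finally show ?thesis using x by simp
qed

lemma incl_hom: "\<iota> \<in> normal_homs A B" by (rule lrD)
lemma incl_inj: "a \<in> A \<Longrightarrow> b \<in> A \<Longrightarrow> \<iota> a = \<iota> b \<longleftrightarrow> a = b"
  by (rule inj_on_eq_iff[OF lrD(3)])
lemmas incl_mem [simp] = hom_mem[OF incl_hom]
lemmas incl_mult = hom_mult[OF incl_hom]
lemmas incl_adj = hom_adj[OF incl_hom]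
lemmas incl_add = hom_add[OF incl_hom]
lemmas incl_scale = hom_scale[OF incl_hom]
lemmas incl_one [simp] = hom_one[OF incl_hom]

section \<open>Elementary tensors in the Longo-Rehren algebra\<close>

abbreviation tp where "tp x y \<equiv> tensor_op tn x (j y)"

lemma tensor_mem [simp]: "x \<in> M \<Longrightarrow> y \<in> N \<Longrightarrow> tensor_op tn x y \<in> A"
  unfolding algA_def vn_tensor_def vn_generated_def
  by (rule subset_bicommutant[THEN subsetD]) blast
lemma el_eq: "el D x y = \<iota> (tp x y)" by (simp add: el_def)
lemma el_mem_A [simp]: "x \<in> M \<Longrightarrow> y \<in> M \<Longrightarrow> el D x y \<in> \<iota> ` A" by (simp add: el_eq)
lemma el_mult: "x \<in> M \<Longrightarrow> y \<in> M \<Longrightarrow> x' \<in> M \<Longrightarrow> y' \<in> M \<Longrightarrow> el D x y * el D x' y' = el D (x * x') (y * y')"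
  by (simp add: el_eq j_mult T.tensor_op_mult flip: incl_mult)
lemma el_mult': "x \<in> M \<Longrightarrow> y \<in> M \<Longrightarrow> x' \<in> M \<Longrightarrow> y' \<in> M \<Longrightarrow> el D x y * (el D x' y' * z) = el D (x * x') (y * y') * z"
  by (simp add: el_mult flip: mult.assoc)
lemma el_adj: "x \<in> M \<Longrightarrow> y \<in> M \<Longrightarrow> adj (el D x y) = el D (adj x) (adj y)"
  by (simp add: el_eq j_adj T.tensor_op_adj flip: incl_adj)
lemma el_one [simp]: "el D 1 1 = 1" by (simp add: el_eq)
lemma el_add_left: "x \<in> M \<Longrightarrow> x' \<in> M \<Longrightarrow> y \<in> M \<Longrightarrow> el D (x + x') y = el D x y + el D x' y"
  by (simp add: el_eq T.tensor_op_add_left incl_add)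
lemma el_scale_left: "x \<in> M \<Longrightarrow> y \<in> M \<Longrightarrow> el D (scaleOp c x) y = scaleOp c (el D x y)"
  by (simp add: el_eq T.tensor_op_scale_left incl_scale)
lemma el_zero_left: "y \<in> M \<Longrightarrow> el D 0 y = 0" using el_scale_left[of 0 y 0] by simp
lemma el_sum_left: "(\<And>k. k \<in> F \<Longrightarrow> f k \<in> M) \<Longrightarrow> y \<in> M \<Longrightarrow> el D (sum f F) y = (\<Sum>k\<in>F. el D (f k) y)"
  by (induction F rule: infinite_finite_induct) (auto simp: el_zero_left el_add_left M.sum_mem)

lemma hilbert_nontrivial: "\<exists>a :: 'h. norm a = 1" "\<exists>b :: 'h2. norm b = 1"
proof -
  have *: "\<exists>a :: 'x::chilbert. norm a = 1" if nz: "(1 :: 'x bop) \<noteq> 0"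
  proof -
    obtain a :: 'x where "a \<noteq> 0" using nz by (metis app_one app_zero_op bop_eqI)
    then show ?thesis by (intro exI[of _ "(1 / norm a) *\<^sub>R a"]) simp
  qed
  show "\<exists>a :: 'h. norm a = 1" by (rule *[OF M.one_neq_zero])
  have "j 1 \<noteq> j 0" using j_inj[of 1 0] M.one_neq_zero by simp
  moreover have "j 0 = 0" using j_scale[of 0 0] by simp
  ultimately have "(1 :: 'h2 bop) \<noteq> 0" by simp
  then show "\<exists>b :: 'h2. norm b = 1" by (rule *)
qed

lemma slice_mem: "c \<in> A \<Longrightarrow> T.slice b b' c \<in> M"
  by (rule T.slice_mem) (auto simp: algA_def)

lemma swap_tensor_op: "tensor_op (\<lambda>b a. tn a b) y x = tensor_op tn x y"
proof -
  interpret S: htensor "\<lambda>b a. tn a b" by (rule T.swap)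
  show ?thesis by (rule T.bop_ext_t) (simp add: T.app_tensor_op S.app_tensor_op)
qed

lemma swap_A: "vn_tensor (\<lambda>b a. tn a b) N M = A"
proof -
  have "{tensor_op (\<lambda>b a. tn a b) y x | y x. y \<in> N \<and> x \<in> M} = {tensor_op tn x y | x y. x \<in> M \<and> y \<in> N}"
    unfolding swap_tensor_op by blast
  then show ?thesis by (simp add: algA_def vn_tensor_def)
qed

lemma el_left_inj: "x \<in> M \<Longrightarrow> x' \<in> M \<Longrightarrow> el D x 1 = el D x' 1 \<Longrightarrow> x = x'"
proof -
  assume x: "x \<in> M" "x' \<in> M" and "el D x 1 = el D x' 1"
  then have "tensor_op tn x 1 = tensor_op tn x' 1" using incl_inj by (simp add: el_eq)
  then have "T.slice b b (tensor_op tn x 1) = T.slice b b (tensor_op tn x' 1)" for b by (rule arg_cong)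
  then have "scaleOp (cinner b b) x = scaleOp (cinner b b) x'" for b :: 'h2 by (simp only: T.slice_tensor app_one)
  moreover obtain b :: 'h2 where "norm b = 1" using hilbert_nontrivial(2) by blast
  then have "cinner b b = 1" by (simp add: cinner_self)
  ultimately have "scaleOp 1 x = scaleOp 1 x'" by metis
  then show ?thesis by simp
qed

section \<open>The category, its irreducibles and the grading\<close>

lemma cat: "rigid_tensor_category D" using setting by (simp add: lr_setting_def)
lemma catD:
  "C \<subseteq> End0 M" "id_on M \<in> C" "\<forall>\<rho>\<in>C. \<forall>\<sigma>\<in>C. compose M \<rho> \<sigma> \<in> C"
  "\<forall>\<rho>\<in>C. \<forall>\<sigma>. subobject M \<sigma> \<rho> \<longrightarrow> \<sigma> \<in> C"
  "\<forall>\<rho>\<in>C. cj \<rho> \<in> C \<and> conjugate_solution M \<rho> (cj \<rho>) (R \<rho>) (R' \<rho>)"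
  by (insert cat[unfolded rigid_tensor_category_def Let_def]; elim conjE; assumption)+
lemma C_End: "\<pi> \<in> C \<Longrightarrow> \<pi> \<in> End M" using catD(1) by (auto simp: End0_def)
lemma C_id [simp]: "id_on M \<in> C" by (rule catD)
lemma C_comp [simp]: "\<pi> \<in> C \<Longrightarrow> \<rho> \<in> C \<Longrightarrow> compose M \<pi> \<rho> \<in> C" using catD(3) by blast
lemma C_sub: "\<pi> \<in> C \<Longrightarrow> subobject M \<sigma> \<pi> \<Longrightarrow> \<sigma> \<in> C" using catD(4) by blast
lemma C_conj [simp]: "\<pi> \<in> C \<Longrightarrow> cj \<pi> \<in> C" using catD(5) by blast
lemma C_sol: "\<pi> \<in> C \<Longrightarrow> conjugate_solution M \<pi> (cj \<pi>) (R \<pi>) (R' \<pi>)" using catD(5) by blast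
lemma C_pair: "\<pi> \<in> C \<Longrightarrow> conjugate_pair M \<pi> (cj \<pi>) (R \<pi>) (R' \<pi>)"
  by unfold_locales (auto intro: C_End C_sol)
lemmas C_mem [simp] = hom_mem[OF C_End]
lemmas C_adj = hom_adj[OF C_End]
lemmas C_one [simp] = hom_one[OF C_End]
lemma R_mem [simp]: "\<pi> \<in> C \<Longrightarrow> R \<pi> \<in> M" "\<pi> \<in> C \<Longrightarrow> R' \<pi> \<in> M"
  using conjugate_pair.R_mem[OF C_pair] by auto
lemma comp_app [simp]: "x \<in> M \<Longrightarrow> compose M \<pi> \<rho> x = \<pi> (\<rho> x)" by (simp add: compose_def)

lemma irr_reps: "irreducible_representatives D" using setting by (simp add: lr_setting_def)
lemma Irr_C [simp]: "\<xi> \<in> Irr \<Longrightarrow> \<xi> \<in> C" using irr_reps unfolding irreducible_representatives_def by blast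
lemma Irr_irr: "\<xi> \<in> Irr \<Longrightarrow> irreducible_endo M \<xi>" using irr_reps unfolding irreducible_representatives_def by blast
lemma Irr_id [simp]: "id_on M \<in> Irr" using irr_reps unfolding irreducible_representatives_def by blast
lemma Irr_ex: "\<rho> \<in> C \<Longrightarrow> irreducible_endo M \<rho> \<Longrightarrow> \<exists>!\<xi>. \<xi> \<in> Irr \<and> unitarily_equivalent M \<rho> \<xi>"
  using irr_reps unfolding irreducible_representatives_def by blast
lemma Irr_End: "\<xi> \<in> Irr \<Longrightarrow> \<xi> \<in> End M" by (simp add: C_End)

lemma unitarily_equivalent_refl: "\<rho> \<in> End M \<Longrightarrow> unitarily_equivalent M \<rho> \<rho>"
  unfolding unitarily_equivalent_def unitaries_def Ad_def
  by (intro bexI[of _ 1]) (auto simp: fun_eq_iff dest!: hom_ext simp: extensional_def)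

lemma Irr_eq:
  assumes "\<xi> \<in> Irr" "\<zeta> \<in> Irr" "t \<in> intertwiners M \<xi> \<zeta>" "t \<noteq> 0" shows "\<xi> = \<zeta>"
proof -
  have "unitarily_equivalent M \<xi> \<zeta>"
    using assms by (intro M.irreducible_equivalent[of \<xi> \<zeta> t]) (auto simp: Irr_irr Irr_End)
  moreover have "unitarily_equivalent M \<xi> \<xi>" by (rule unitarily_equivalent_refl[OF Irr_End[OF assms(1)]])
  ultimately show ?thesis using Irr_ex[OF Irr_C Irr_irr, OF assms(1) assms(1)] assms(1,2) by blast
qed

lemma grd: "graded D" using setting by (simp add: lr_setting_def)
lemma gr_C: "\<sigma> \<in> gr g \<Longrightarrow> \<sigma> \<in> C" using grd unfolding graded_def by blast
lemma gr_iff: "\<sigma> \<in> gr g \<longleftrightarrow> \<sigma> \<in> C \<and> (\<forall>\<xi>. irreducible_endo M \<xi> \<and> subobject M \<xi> \<sigma> \<longrightarrow> \<xi> \<in> gr g)"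
  using grd unfolding graded_def by blast
lemma gr_comp: "\<rho> \<in> gr g \<Longrightarrow> \<sigma> \<in> gr h \<Longrightarrow> compose M \<rho> \<sigma> \<in> gr (g + h)"
  using grd unfolding graded_def by blast
lemma gr_conj: "\<rho> \<in> gr g \<Longrightarrow> cj \<rho> \<in> gr (- g)" using grd unfolding graded_def by blast
lemma gr_nonempty: "\<exists>\<xi>. \<xi> \<in> gr g" using grd unfolding graded_def by blast
lemma gr_unique: "\<xi> \<in> C \<Longrightarrow> irreducible_endo M \<xi> \<Longrightarrow> \<xi> \<in> gr g \<Longrightarrow> \<xi> \<in> gr h \<Longrightarrow> g = h"
  using grd unfolding graded_def by metis

lemma id_comp: "compose M (id_on M) (id_on M) = id_on M" by (auto simp: compose_def)

lemma gr_id [simp]: "id_on M \<in> gr 0"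
proof -
  obtain g where g: "id_on M \<in> gr g" using grd C_id M.irreducible_id unfolding graded_def by metis
  then have "id_on M \<in> gr (g + g)" using gr_comp[OF g g] id_comp by simp
  then have "g + g = g" using gr_unique[OF C_id M.irreducible_id] g by blast
  then have "g = 0" using add_right_cancel[of g g 0] by simp
  then show ?thesis using g by simp
qed

lemma subobject_of_intertwiner:
  assumes "irreducible_endo M \<xi>" "\<xi> \<in> End M" "\<sigma> \<in> End M" "t \<in> intertwiners M \<xi> \<sigma>" "t \<noteq> 0"
  shows "subobject M \<xi> \<sigma>"
proof -
  obtain r where r: "r > 0" "adj t * t = scaleOp (complex_of_real r) 1" using M.intertwiner_isometry[OF assms] by blast
  let ?w = "scaleOp (complex_of_real (1 / sqrt r)) t"
  have "?w \<in> intertwiners M \<xi> \<sigma>" by (rule M.int_scale[OF assms(4)])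
  then show ?thesis unfolding subobject_def isometries_def
    using normalize_isometry[OF r(2,1)] M.int_mem assms(2) by blast
qed

lemma gr_sub:
  assumes "\<sigma> \<in> gr g" "irreducible_endo M \<xi>" "\<xi> \<in> End M" "t \<in> intertwiners M \<xi> \<sigma>" "t \<noteq> 0"
  shows "\<xi> \<in> gr g"
  using assms gr_iff[of \<sigma> g] subobject_of_intertwiner[OF assms(2,3) C_End[OF gr_C] assms(4,5), OF assms(1)] by blast

text \<open>The summands provided by \<open>finite_decomposition\<close> are subobjects, hence lie
  in the category; the unitaries relating them to the chosen representatives are absorbed into the
  isometries.\<close>

lemma C_decomposition:
  assumes \<sigma>: "\<sigma> \<in> C"
  shows "\<exists>K w \<xi>. finite K \<and> direct_sum M K w \<xi> \<sigma> \<and> (\<forall>k\<in>K. \<xi> k \<in> Irr)"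
proof -
  interpret c: conjugate_pair M \<sigma> "cj \<sigma>" "R \<sigma>" "R' \<sigma>" by (rule C_pair[OF \<sigma>])
  obtain K w \<xi> where K: "finite K" and ds: "direct_sum M K w \<xi> \<sigma>"
    and irr: "\<And>k. k \<in> K \<Longrightarrow> irreducible_endo M (\<xi> k) \<and> \<xi> k \<in> End M" using c.finite_decomposition by blast
  have w: "w k \<in> M" "adj (w k) * w k = 1" if "k \<in> K" for k
    using ds that by (auto simp: direct_sum_def isometry_family_def isometries_def)
  have wi: "w k \<in> intertwiners M (\<xi> k) \<sigma>" if "k \<in> K" for k using M.direct_sum_intertwiner[OF ds that] .
  have "\<exists>\<zeta> v. \<zeta> \<in> Irr \<and> v \<in> unitaries M \<and> \<xi> k = Ad M v \<zeta>" if k: "k \<in> K" for k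
  proof -
    have "subobject M (\<xi> k) \<sigma>" using w[OF k] wi[OF k] irr[OF k] by (auto simp: subobject_def isometries_def)
    then have "\<xi> k \<in> C" by (rule C_sub[OF \<sigma>])
    then show ?thesis using Irr_ex irr[OF k] unfolding unitarily_equivalent_def by blast
  qed
  then obtain \<zeta> v where \<zeta>: "\<And>k. k \<in> K \<Longrightarrow> \<zeta> k \<in> Irr" and v: "\<And>k. k \<in> K \<Longrightarrow> v k \<in> unitaries M"
    and eq: "\<And>k. k \<in> K \<Longrightarrow> \<xi> k = Ad M (v k) (\<zeta> k)" by metis
  have vu: "v k \<in> M" "adj (v k) * v k = 1" "v k * adj (v k) = 1" if "k \<in> K" for k
    using v[OF that] by (auto simp: unitaries_def)
  have "direct_sum M K (\<lambda>k. w k * v k) \<zeta> \<sigma>"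
  proof (rule M.direct_sumI[OF C_End[OF \<sigma>]])
    fix k assume k: "k \<in> K"
    have "v k \<in> intertwiners M (\<zeta> k) (\<xi> k)"
    proof (rule M.intertwinersI[OF vu(1)[OF k]])
      fix x assume "x \<in> M"
      then show "v k * \<zeta> k x = \<xi> k x * v k" unfolding eq[OF k] by (simp add: Ad_def mult.assoc vu[OF k])
    qed
    then show "w k * v k \<in> intertwiners M (\<zeta> k) \<sigma>" by (rule M.int_mult[OF wi[OF k]])
    have "adj (w k * v k) * (w k * v k) = adj (v k) * (adj (w k) * w k) * v k" by (simp add: mult.assoc)
    then show "adj (w k * v k) * (w k * v k) = 1" using w[OF k] vu[OF k] by simp
  next
    have "w k * v k * adj (w k * v k) = w k * adj (w k)" if "k \<in> K" for k
    proof -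
      have "w k * v k * adj (w k * v k) = w k * (v k * adj (v k)) * adj (w k)" by (simp add: mult.assoc)
      then show ?thesis using vu[OF that] by simp
    qed
    then show "strong_sum (\<lambda>k. w k * v k * adj (w k * v k)) K 1"
      using ds strong_sum_eq[of "\<lambda>k. w k * adj (w k)" K 1] by (simp add: direct_sum_def isometry_family_def)
  qed
  then show ?thesis using K \<zeta> by blast
qed

lemma direct_sum_gr:
  assumes "\<sigma> \<in> gr g" "direct_sum M K w \<xi> \<sigma>" "k \<in> K" "\<xi> k \<in> Irr"
  shows "\<xi> k \<in> gr g"
proof (rule gr_sub[OF assms(1)])
  show "w k \<in> intertwiners M (\<xi> k) \<sigma>" by (rule M.direct_sum_intertwiner[OF assms(2,3)])
  show "w k \<noteq> 0" using assms(2,3) M.one_neq_zero by (auto simp: direct_sum_def isometry_family_def isometries_def)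
qed (use assms in \<open>auto simp: Irr_irr Irr_End\<close>)

lemma C_generated: "\<sigma> \<in> C \<Longrightarrow> generated_by M Irr \<sigma>"
  using C_decomposition M.direct_sum_generated by metis

lemma gr_generated: assumes "\<sigma> \<in> gr g" shows "generated_by M (Irr \<inter> gr g) \<sigma>"
proof -
  obtain K w \<xi> where K: "direct_sum M K w \<xi> \<sigma>" "\<forall>k\<in>K. \<xi> k \<in> Irr" using C_decomposition[OF gr_C[OF assms]] by blast
  show ?thesis by (rule M.direct_sum_generated[OF K(1)]) (use K direct_sum_gr[OF assms K(1)] in auto)
qed

lemma op_endo_j: "y \<in> M \<Longrightarrow> op_endo D \<pi> (j y) = j (\<pi> y)"
proof -
  have "inj_on j M" using j_opp by (auto simp: opposite_algebra_def bij_betw_def)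
  then show "y \<in> M \<Longrightarrow> op_endo D \<pi> (j y) = j (\<pi> y)" by (simp add: op_endo_def inv_into_f_f)
qed

section \<open>The operators \<lambda>, the expectation and the unitaries L\<close>

definition Phi :: "'h endo \<Rightarrow> 'k endo" where
  "Phi \<pi> = (SOME \<Phi>. is_tensor_endo tn M N \<pi> (op_endo D \<pi>) \<Phi> \<and> (\<forall>a\<in>A. lm \<pi> * \<iota> a = \<iota> (\<Phi> a) * lm \<pi>))"

lemma Phi: assumes "\<pi> \<in> C"
  shows "Phi \<pi> \<in> End A" "\<And>a. a \<in> A \<Longrightarrow> lm \<pi> * \<iota> a = \<iota> (Phi \<pi> a) * lm \<pi>"
    "\<And>x y. x \<in> M \<Longrightarrow> y \<in> M \<Longrightarrow> Phi \<pi> (tp x y) = tp (\<pi> x) (\<pi> y)"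
proof -
  have "\<exists>\<Phi>. is_tensor_endo tn M N \<pi> (op_endo D \<pi>) \<Phi> \<and> (\<forall>a\<in>A. lm \<pi> * \<iota> a = \<iota> (\<Phi> a) * lm \<pi>)"
    using lrD(5) assms by blast
  from someI_ex[OF this] have *: "is_tensor_endo tn M N \<pi> (op_endo D \<pi>) (Phi \<pi>)" "\<forall>a\<in>A. lm \<pi> * \<iota> a = \<iota> (Phi \<pi> a) * lm \<pi>"
    unfolding Phi_def by auto
  show "Phi \<pi> \<in> End A" using *(1) by (simp add: is_tensor_endo_def algA_def)
  show "\<And>a. a \<in> A \<Longrightarrow> lm \<pi> * \<iota> a = \<iota> (Phi \<pi> a) * lm \<pi>" using *(2) by blast
  show "Phi \<pi> (tp x y) = tp (\<pi> x) (\<pi> y)" if "x \<in> M" "y \<in> M" for x y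
    using *(1) that op_endo_j by (simp add: is_tensor_endo_def)
qed

lemma lm_el: "\<pi> \<in> C \<Longrightarrow> x \<in> M \<Longrightarrow> y \<in> M \<Longrightarrow> lm \<pi> * el D x y = el D (\<pi> x) (\<pi> y) * lm \<pi>"
  using Phi[of \<pi>] by (simp add: el_eq)
lemma lm_el': "\<pi> \<in> C \<Longrightarrow> x \<in> M \<Longrightarrow> y \<in> M \<Longrightarrow> lm \<pi> * (el D x y * z) = el D (\<pi> x) (\<pi> y) * (lm \<pi> * z)"
  using lm_el by (simp flip: mult.assoc)
lemma lm_mult: "\<pi> \<in> C \<Longrightarrow> \<rho> \<in> C \<Longrightarrow> lm \<pi> * lm \<rho> = lm (compose M \<pi> \<rho>)"
  using lrD(6) by blast
lemma lm_adj: "\<pi> \<in> C \<Longrightarrow> adj (lm \<pi>) = adj (el D (R \<pi>) (R \<pi>)) * lm (cj \<pi>)"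
  using lrD(7) by blast
lemma lm_int: "\<pi> \<in> C \<Longrightarrow> \<rho> \<in> C \<Longrightarrow> S \<in> intertwiners M \<pi> \<rho> \<Longrightarrow> el D S 1 * lm \<pi> = el D 1 (adj S) * lm \<rho>"
  using lrD(8) by blast
lemma lm_mem [simp]: "\<pi> \<in> C \<Longrightarrow> lm \<pi> \<in> B"
  unfolding lrD(4) vn_generated_def by (rule subsetD[OF subset_bicommutant]) simp

lemmas E_cond = lrD(9)
lemma E_mem: "x \<in> B \<Longrightarrow> E x \<in> \<iota> ` A" using E_cond by (auto simp: normal_cond_exp_def)
lemma E_add: "x \<in> B \<Longrightarrow> y \<in> B \<Longrightarrow> E (x + y) = E x + E y" using E_cond by (simp add: normal_cond_exp_def)
lemma E_scale: "x \<in> B \<Longrightarrow> E (scaleOp c x) = scaleOp c (E x)" using E_cond by (simp add: normal_cond_exp_def)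
lemma E_diff: "x \<in> B \<Longrightarrow> y \<in> B \<Longrightarrow> E (x - y) = E x - E y"
  using E_add[of x "scaleOp (-1) y"] E_scale[of y "-1"] by (simp add: scaleOp_minus_one)
lemma E_id: "a \<in> A \<Longrightarrow> E (\<iota> a) = \<iota> a" using E_cond by (simp add: normal_cond_exp_def)
lemma E_bi: "a \<in> A \<Longrightarrow> b \<in> A \<Longrightarrow> x \<in> B \<Longrightarrow> E (\<iota> a * x * \<iota> b) = \<iota> a * E x * \<iota> b"
  using E_cond by (simp add: normal_cond_exp_def)
lemma E_left: "a \<in> A \<Longrightarrow> x \<in> B \<Longrightarrow> E (\<iota> a * x) = \<iota> a * E x" using E_bi[of a 1 x] by simp
lemma E_right: "a \<in> A \<Longrightarrow> x \<in> B \<Longrightarrow> E (x * \<iota> a) = E x * \<iota> a" using E_bi[of 1 a x] by simp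
lemma E_cont: "continuous_map (subtopology sigma_weak B) sigma_weak E"
  using E_cond by (auto simp: normal_cond_exp_def intro: continuous_map_into_fulltopology)
lemma E_faithful: "x \<in> B \<Longrightarrow> E (adj x * x) = 0 \<Longrightarrow> x = 0"
  using lrD(10) unfolding faithful_on_def by blast
lemma E_lm: "\<pi> \<in> Irr \<Longrightarrow> a \<in> A \<Longrightarrow> E (\<iota> a * lm \<pi>) = (if \<pi> = id_on M then \<iota> a else 0)"
  using lrD(11) by blast

lemma zero_A: "\<iota> 0 = 0" by (rule hom_zero[OF incl_hom]) simp
lemma E_zero: "E 0 = 0" using E_id[of 0] by (simp add: zero_A)

lemma lm_adj_mult:
  assumes \<pi>: "\<pi> \<in> C" shows "adj (lm \<pi>) * lm \<pi> = scaleOp (complex_of_real (dimension M \<pi>)) (lm (id_on M))"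
proof -
  interpret c: conjugate_pair M \<pi> "cj \<pi>" "R \<pi>" "R' \<pi>" by (rule C_pair[OF \<pi>])
  have r: "R \<pi> \<in> intertwiners M (id_on M) (compose M (cj \<pi>) \<pi>)" using c.sol by (simp add: conjugate_solution_def)
  have "adj (lm \<pi>) * lm \<pi> = el D (adj (R \<pi>)) 1 * (el D 1 (adj (R \<pi>)) * lm (compose M (cj \<pi>) \<pi>))"
    using \<pi> by (simp add: lm_adj el_adj el_mult' lm_mult mult.assoc)
  also have "\<dots> = el D (adj (R \<pi>)) 1 * (el D (R \<pi>) 1 * lm (id_on M))" using lm_int[OF _ _ r] \<pi> by simp
  also have "\<dots> = scaleOp (complex_of_real (dimension M \<pi>)) (lm (id_on M))"
    using \<pi> by (simp add: el_mult' c.R_norm el_scale_left)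
  finally show ?thesis .
qed

text \<open>The idempotent \<open>lm (id_on M)\<close> is self-adjoint, as
  \<open>lm_adj_mult\<close> makes it a positive multiple of x^* x for x = itself. So its complement
  is a projection with expectation 0, and E is faithful.\<close>

lemma lm_id [simp]: "lm (id_on M) = 1"
proof -
  let ?e = "lm (id_on M)"
  interpret c: conjugate_pair M "id_on M" "cj (id_on M)" "R (id_on M)" "R' (id_on M)" by (rule C_pair) simp
  have ee: "?e * ?e = ?e" using lm_mult[of "id_on M" "id_on M"] id_comp by simp
  have "?e = scaleOp (complex_of_real (1 / c.d)) (adj ?e * ?e)"
    using lm_adj_mult[of "id_on M"] c.d_pos by (simp flip: of_real_mult)
  then have ae: "adj ?e = ?e" by (metis adj_adj adj_mult adj_scaleOp complex_cnj_complex_of_real)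
  have e0: "E (1 - ?e) = 0" using E_diff[of 1 ?e] E_lm[of "id_on M" 1] E_id[of 1] by simp
  have "adj (1 - ?e) * (1 - ?e) = 1 - ?e" using ee by (simp add: ae algebra_simps)
  then have "E (adj (1 - ?e) * (1 - ?e)) = 0" by (simp only: e0)
  then have "1 - ?e = 0" by (rule E_faithful[rotated]) simp
  then show ?thesis by simp
qed

text \<open>The unitaries \<open>L\<^sub>\<pi> = (1 \<otimes> j(R'\<^sub>\<pi>\<^sup>*)) \<lambda>\<^sub>\<pi>\<close>, so that \<open>V\<^sub>\<pi> = L\<^sub>\<pi> u\<^sub>g\<^sup>*\<close>. Conjugation by \<open>L\<^sub>\<pi>\<close> preserves
  \<open>M \<otimes> 1\<close>, and conjugation by \<open>L\<^sub>\<pi>\<^sup>*\<close> preserves \<open>1 \<otimes> M\<^sup>o\<^sup>p\<close>.\<close>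

definition L :: "'h endo \<Rightarrow> 'l bop" where "L \<pi> = el D 1 (adj (R' \<pi>)) * lm \<pi>"

lemma L_adj: assumes \<pi>: "\<pi> \<in> C" shows "adj (L \<pi>) = el D (adj (R \<pi>)) 1 * lm (cj \<pi>)"
proof -
  interpret c: conjugate_pair M \<pi> "cj \<pi>" "R \<pi>" "R' \<pi>" by (rule C_pair[OF \<pi>])
  show ?thesis using \<pi> by (simp add: L_def lm_adj el_adj mult.assoc lm_el el_mult' c.zigzag)
qed

text \<open>After multiplying the two \<lambda>, the relation \<open>lm_int\<close> moves R or R'
  from one tensor leg to the other and leaves \<open>lm (id_on M)\<close>, which is 1. The remaining
  factor is 1 by a zigzag identity.\<close>

lemma L_unitary: assumes \<pi>: "\<pi> \<in> C" shows "L \<pi> * adj (L \<pi>) = 1" "adj (L \<pi>) * L \<pi> = 1"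
proof -
  interpret c: conjugate_pair M \<pi> "cj \<pi>" "R \<pi>" "R' \<pi>" by (rule C_pair[OF \<pi>])
  have r': "R' \<pi> \<in> intertwiners M (id_on M) (compose M \<pi> (cj \<pi>))" using c.sol by (simp add: conjugate_solution_def)
  have "R \<pi> \<in> intertwiners M (id_on M) (compose M (cj \<pi>) \<pi>)" using c.sol by (simp add: conjugate_solution_def)
  then have r: "adj (R \<pi>) \<in> intertwiners M (compose M (cj \<pi>) \<pi>) (id_on M)"
    using \<pi> by (intro M.int_adj) (auto intro: C_End)
  have "L \<pi> * adj (L \<pi>) = el D (\<pi> (adj (R \<pi>))) 1 * (el D 1 (adj (R' \<pi>)) * lm (compose M \<pi> (cj \<pi>)))"
    using \<pi> by (simp add: L_adj) (simp add: L_def mult.assoc lm_el' lm_mult el_mult')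
  also have "el D 1 (adj (R' \<pi>)) * lm (compose M \<pi> (cj \<pi>)) = el D (R' \<pi>) 1"
    using lm_int[OF _ _ r'] \<pi> by simp
  finally show "L \<pi> * adj (L \<pi>) = 1" using \<pi> by (simp add: el_mult c.zigzag_adj)
  have "adj (L \<pi>) * L \<pi> = el D 1 (cj \<pi> (adj (R' \<pi>))) * (el D (adj (R \<pi>)) 1 * lm (compose M (cj \<pi>) \<pi>))"
    using \<pi> by (simp add: L_adj) (simp add: L_def mult.assoc lm_el' lm_mult el_mult')
  also have "el D (adj (R \<pi>)) 1 * lm (compose M (cj \<pi>) \<pi>) = el D 1 (R \<pi>)"
    using lm_int[OF _ _ r] \<pi> by simp
  finally show "adj (L \<pi>) * L \<pi> = 1" using \<pi> by (simp add: el_mult c.zigzag_adj)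
qed

lemma L_left: "\<pi> \<in> C \<Longrightarrow> x \<in> M \<Longrightarrow> L \<pi> * el D x 1 = el D (\<pi> x) 1 * L \<pi>"
  by (simp add: L_def mult.assoc lm_el el_mult')
lemma L_adj_right: "\<pi> \<in> C \<Longrightarrow> y \<in> M \<Longrightarrow> adj (L \<pi>) * el D 1 y = el D 1 (cj \<pi> y) * adj (L \<pi>)"
  by (simp add: L_adj mult.assoc lm_el el_mult')
lemma lm_L: "\<pi> \<in> C \<Longrightarrow> lm \<pi> = L \<pi> * el D 1 (R \<pi>)"
proof -
  assume \<pi>: "\<pi> \<in> C"
  have "adj (lm \<pi>) = el D 1 (adj (R \<pi>)) * adj (L \<pi>)" using \<pi> by (simp add: lm_adj el_adj L_adj el_mult')
  then have "adj (adj (lm \<pi>)) = adj (el D 1 (adj (R \<pi>)) * adj (L \<pi>))" by simp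
  then show ?thesis using \<pi> by (simp add: el_adj)
qed

section \<open>The graded components of the algebra\<close>

definition Sg :: "'g \<Rightarrow> 'l bop set" where
  "Sg g = {\<Sum>\<pi>\<in>F. \<iota> (a \<pi>) * lm \<pi> | F a. finite F \<and> F \<subseteq> Irr \<inter> gr g \<and> (\<forall>\<pi>\<in>F. a \<pi> \<in> A)}"

abbreviation "Bg \<equiv> algBg D"

lemma Bg_eq: "Bg g = sigma_weak closure_of Sg g" by (simp add: algBg_def Sg_def)

lemma Sg_zero: "0 \<in> Sg g" unfolding Sg_def by (rule CollectI, rule exI[of _ "{}"]) auto

lemma Sg_gen: "\<pi> \<in> Irr \<Longrightarrow> \<pi> \<in> gr g \<Longrightarrow> a \<in> A \<Longrightarrow> \<iota> a * lm \<pi> \<in> Sg g"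
  unfolding Sg_def by (rule CollectI, rule exI[of _ "{\<pi>}"], rule exI[of _ "\<lambda>_. a"]) auto

lemma Sg_add:
  assumes "x \<in> Sg g" "y \<in> Sg g" shows "x + y \<in> Sg g"
proof -
  obtain F a where F: "finite F" "F \<subseteq> Irr \<inter> gr g" "\<forall>\<pi>\<in>F. a \<pi> \<in> A" "x = (\<Sum>\<pi>\<in>F. \<iota> (a \<pi>) * lm \<pi>)"
    using assms(1) unfolding Sg_def by blast
  obtain G b where G: "finite G" "G \<subseteq> Irr \<inter> gr g" "\<forall>\<pi>\<in>G. b \<pi> \<in> A" "y = (\<Sum>\<pi>\<in>G. \<iota> (b \<pi>) * lm \<pi>)"
    using assms(2) unfolding Sg_def by blast
  define a' where "a' \<pi> = (if \<pi> \<in> F then a \<pi> else 0)" for \<pi>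
  define b' where "b' \<pi> = (if \<pi> \<in> G then b \<pi> else 0)" for \<pi>
  have A': "a' \<pi> \<in> A" "b' \<pi> \<in> A" for \<pi> using F(3) G(3) by (auto simp: a'_def b'_def)
  have "x = (\<Sum>\<pi>\<in>F \<union> G. \<iota> (a' \<pi>) * lm \<pi>)" unfolding F(4)
    by (rule sum.mono_neutral_cong_left) (use F G in \<open>auto simp: a'_def zero_A\<close>)
  moreover have "y = (\<Sum>\<pi>\<in>F \<union> G. \<iota> (b' \<pi>) * lm \<pi>)" unfolding G(4)
    by (rule sum.mono_neutral_cong_left) (use F G in \<open>auto simp: b'_def zero_A\<close>)
  ultimately have "x + y = (\<Sum>\<pi>\<in>F \<union> G. \<iota> (a' \<pi> + b' \<pi>) * lm \<pi>)"
    using A' by (simp add: sum.distrib incl_add distrib_right)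
  then show ?thesis unfolding Sg_def using F G A'
    by (intro CollectI exI[of _ "F \<union> G"] exI[of _ "\<lambda>\<pi>. a' \<pi> + b' \<pi>"]) auto
qed

lemma Sg_sum: "(\<And>k. k \<in> K \<Longrightarrow> f k \<in> Sg g) \<Longrightarrow> sum f K \<in> Sg g"
  by (induction K rule: infinite_finite_induct) (auto simp: Sg_zero Sg_add)

lemma Sg_induct [consumes 1, case_names zero add gen]:
  assumes "x \<in> Sg g" "P 0" "\<And>x y. P x \<Longrightarrow> P y \<Longrightarrow> P (x + y)"
    "\<And>a \<pi>. a \<in> A \<Longrightarrow> \<pi> \<in> Irr \<Longrightarrow> \<pi> \<in> gr g \<Longrightarrow> P (\<iota> a * lm \<pi>)"
  shows "P x"
proof -
  obtain F a where F: "finite F" "F \<subseteq> Irr \<inter> gr g" "\<forall>\<pi>\<in>F. a \<pi> \<in> A" "x = (\<Sum>\<pi>\<in>F. \<iota> (a \<pi>) * lm \<pi>)"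
    using assms(1) unfolding Sg_def by blast
  have "P (\<Sum>\<pi>\<in>F. \<iota> (a \<pi>) * lm \<pi>)" using F(1-3)
    by (induction F) (use assms(2-4) in auto)
  then show ?thesis using F(4) by simp
qed

lemma Sg_left: "x \<in> Sg g \<Longrightarrow> c \<in> A \<Longrightarrow> \<iota> c * x \<in> Sg g"
proof (induction rule: Sg_induct)
  case (gen a \<pi>)
  then have "\<iota> (c * a) * lm \<pi> \<in> Sg g" by (intro Sg_gen) auto
  then show ?case using gen by (simp add: incl_mult mult.assoc)
qed (auto simp: Sg_zero Sg_add distrib_left)

text \<open>Every \<open>\<lambda>\<^sub>\<sigma>\<close> is a combination of the \<open>\<lambda>\<^sub>\<xi>\<close> with \<open>\<xi>\<close> irreducible, by the decomposition of \<open>\<sigma>\<close>.\<close>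

lemma Sg_lm: assumes \<sigma>: "\<sigma> \<in> gr g" and a: "a \<in> A" shows "\<iota> a * lm \<sigma> \<in> Sg g"
proof -
  have \<sigma>C: "\<sigma> \<in> C" using gr_C[OF \<sigma>] .
  obtain K w \<xi> where K: "finite K" and ds: "direct_sum M K w \<xi> \<sigma>" and irr: "\<And>k. k \<in> K \<Longrightarrow> \<xi> k \<in> Irr"
    using C_decomposition[OF \<sigma>C] by blast
  have wi: "w k \<in> intertwiners M (\<xi> k) \<sigma>" if "k \<in> K" for k using M.direct_sum_intertwiner[OF ds that] .
  have wM: "w k \<in> M" if "k \<in> K" for k using wi[OF that] by (rule M.int_mem)
  have "(\<Sum>k\<in>K. w k * adj (w k)) = 1"
    using ds K by (simp add: direct_sum_def isometry_family_def strong_sum_finite)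
  then have "lm \<sigma> = el D (\<Sum>k\<in>K. w k * adj (w k)) 1 * lm \<sigma>" by simp
  also have "\<dots> = (\<Sum>k\<in>K. el D (w k * adj (w k)) 1 * lm \<sigma>)"
    using wM by (simp add: el_sum_left sum_distrib_right)
  also have "\<dots> = (\<Sum>k\<in>K. el D (w k) (w k) * lm (\<xi> k))"
  proof (rule sum.cong[OF refl])
    fix k assume k: "k \<in> K"
    have "adj (w k) \<in> intertwiners M \<sigma> (\<xi> k)" using M.int_adj[OF wi[OF k] Irr_End[OF irr[OF k]] C_End[OF \<sigma>C]] .
    then have "el D (adj (w k)) 1 * lm \<sigma> = el D 1 (w k) * lm (\<xi> k)" using lm_int[OF \<sigma>C Irr_C[OF irr[OF k]]] by simp
    moreover have "el D (w k * adj (w k)) 1 * lm \<sigma> = el D (w k) 1 * (el D (adj (w k)) 1 * lm \<sigma>)"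
      using wM[OF k] by (simp add: el_mult')
    ultimately show "el D (w k * adj (w k)) 1 * lm \<sigma> = el D (w k) (w k) * lm (\<xi> k)"
      using wM[OF k] by (simp add: el_mult')
  qed
  finally have eq: "\<iota> a * lm \<sigma> = (\<Sum>k\<in>K. \<iota> a * (el D (w k) (w k) * lm (\<xi> k)))" by (simp add: sum_distrib_left)
  have "\<iota> (tp (w k) (w k)) * lm (\<xi> k) \<in> Sg g" if k: "k \<in> K" for k
    by (rule Sg_gen) (use irr[OF k] direct_sum_gr[OF \<sigma> ds k irr[OF k]] wM[OF k] in auto)
  then show ?thesis unfolding eq by (intro Sg_sum Sg_left a) (simp add: el_eq)
qed

lemma Sg_mult: "x \<in> Sg g \<Longrightarrow> y \<in> Sg h \<Longrightarrow> x * y \<in> Sg (g + h)"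
proof (induction rule: Sg_induct)
  case (gen a \<pi>)
  from gen(4) show ?case
  proof (induction rule: Sg_induct)
    case (gen b \<rho>)
    note \<pi> = \<open>\<pi> \<in> Irr\<close> \<open>\<pi> \<in> gr g\<close>
    have m: "a * Phi \<pi> b \<in> A" using hom_mem[OF Phi(1)] \<pi> gen \<open>a \<in> A\<close> by auto
    have "\<iota> a * lm \<pi> * (\<iota> b * lm \<rho>) = \<iota> a * (lm \<pi> * \<iota> b) * lm \<rho>" by (simp add: mult.assoc)
    also have "\<dots> = \<iota> (a * Phi \<pi> b) * lm (compose M \<pi> \<rho>)"
      using Phi(2)[of \<pi> b] lm_mult[of \<pi> \<rho>] gen \<pi> \<open>a \<in> A\<close> hom_mem[OF Phi(1)] by (simp add: incl_mult mult.assoc)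
    also have "\<dots> \<in> Sg (g + h)" by (rule Sg_lm[OF gr_comp m]) (use gen \<pi> in auto)
    finally show ?case .
  qed (auto simp: Sg_zero Sg_add distrib_left)
qed (auto simp: Sg_zero Sg_add distrib_right)

lemma Sg_adj: "x \<in> Sg g \<Longrightarrow> adj x \<in> Sg (- g)"
proof (induction rule: Sg_induct)
  case (gen a \<pi>)
  let ?c = "adj (tp (R \<pi>) (R \<pi>)) * Phi (cj \<pi>) (adj a)"
  have cA: "?c \<in> A" using hom_mem[OF Phi(1)] gen by simp
  have "adj (\<iota> a * lm \<pi>) = adj (el D (R \<pi>) (R \<pi>)) * (lm (cj \<pi>) * \<iota> (adj a))"
    using gen by (simp add: lm_adj incl_adj mult.assoc)
  also have "\<dots> = \<iota> ?c * lm (cj \<pi>)"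
    using gen Phi(2)[of "cj \<pi>" "adj a"] hom_mem[OF Phi(1)] by (simp add: el_eq incl_mult incl_adj mult.assoc)
  also have "\<dots> \<in> Sg (- g)" using Sg_lm[OF gr_conj cA] gen by simp
  finally show ?case .
qed (auto simp: Sg_zero Sg_add)

lemma Sg_B: "x \<in> Sg g \<Longrightarrow> x \<in> B" by (induction rule: Sg_induct) auto
lemma Sg_Bg: "x \<in> Sg g \<Longrightarrow> x \<in> Bg g" unfolding Bg_eq using closure_of_subset[of "Sg g" sigma_weak] by auto
lemma closedin_Bg: "closedin sigma_weak (Bg g)" unfolding Bg_eq by simp

lemma Bg_closure:
  assumes "continuous_map sigma_weak sigma_weak f" "\<And>x. x \<in> Sg g \<Longrightarrow> f x \<in> Bg h" "x \<in> Bg g"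
  shows "f x \<in> Bg h"
proof -
  have "f ` (sigma_weak closure_of Sg g) \<subseteq> sigma_weak closure_of (f ` Sg g)"
    by (rule continuous_map_image_closure_subset[OF assms(1)])
  also have "\<dots> \<subseteq> Bg h" by (rule closure_of_minimal[OF _ closedin_Bg]) (use assms(2) in auto)
  finally show ?thesis using assms(3) by (auto simp: Bg_eq)
qed

lemma Bg_B: "x \<in> Bg g \<Longrightarrow> x \<in> B"
  using closure_of_minimal[of "Sg g" B sigma_weak] Sg_B B.closedin by (auto simp: Bg_eq)

lemma Bg_mult: assumes "x \<in> Bg g" "y \<in> Bg h" shows "x * y \<in> Bg (g + h)"
proof (rule Bg_closure[OF continuous_map_sigma_weak_mult_left _ assms(2)])
  fix y assume y: "y \<in> Sg h"
  show "x * y \<in> Bg (g + h)"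
    by (rule Bg_closure[OF continuous_map_sigma_weak_mult_right _ assms(1)]) (use Sg_mult[OF _ y] Sg_Bg in blast)
qed
lemma Bg_adj: "x \<in> Bg g \<Longrightarrow> adj x \<in> Bg (- g)"
  by (rule Bg_closure[OF continuous_map_sigma_weak_adj]) (auto intro: Sg_adj Sg_Bg)
lemma Bg_add: assumes "x \<in> Bg g" "y \<in> Bg g" shows "x + y \<in> Bg g"
proof -
  have c: "continuous_map sigma_weak sigma_weak (\<lambda>x. x + z)" for z :: "'l bop"
    by (intro continuous_map_sigma_weak_add continuous_map_id[unfolded id_def]) simp
  show ?thesis
  proof (rule Bg_closure[OF c _ assms(1)])
    fix x assume x: "x \<in> Sg g"
    have "y + x \<in> Bg g" by (rule Bg_closure[OF c _ assms(2)]) (use Sg_add[OF _ x] Sg_Bg in blast)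
    then show "x + y \<in> Bg g" by (simp add: add.commute)
  qed
qed
lemma Bg_incl: "a \<in> A \<Longrightarrow> \<iota> a \<in> Bg 0"
  using Sg_Bg[OF Sg_gen[of "id_on M" 0 a]] by simp
lemma Bg_scale: assumes "x \<in> Bg g" shows "scaleOp c x \<in> Bg g"
proof -
  have "\<iota> (scaleOp c 1) * x \<in> Bg (0 + g)" by (rule Bg_mult[OF Bg_incl assms]) simp
  then show ?thesis by (simp add: incl_scale)
qed
lemma lm_Bg: "\<sigma> \<in> gr g \<Longrightarrow> lm \<sigma> \<in> Bg g" using Sg_Bg[OF Sg_lm[of \<sigma> g 1]] by simp

sublocale B0: vn B0
proof
  show "von_neumann_algebra B0"
  proof (rule vn_of_closed_algebra)
    show "1 \<in> B0" using Bg_incl[of 1] by simp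
    show "x * y \<in> B0" if "x \<in> B0" "y \<in> B0" for x y using Bg_mult[OF that] by simp
    show "adj x \<in> B0" if "x \<in> B0" for x using Bg_adj[OF that] by simp
  qed (auto intro: Bg_add Bg_scale closedin_Bg)
qed

lemma el_mem [simp]: "x \<in> M \<Longrightarrow> y \<in> M \<Longrightarrow> el D x y \<in> B0" by (simp add: el_eq Bg_incl)
lemma L_Bg: "\<pi> \<in> gr g \<Longrightarrow> L \<pi> \<in> Bg g"
  using Bg_mult[OF el_mem lm_Bg, of 1 "adj (R' \<pi>)" \<pi> g] gr_C by (simp add: L_def)

lemma Bg_zeroI:
  assumes x: "x \<in> Bg g" and z: "\<And>\<pi>. \<pi> \<in> Irr \<Longrightarrow> \<pi> \<in> gr g \<Longrightarrow> E (x * adj (lm \<pi>)) = 0"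
  shows "x = 0"
proof -
  have xB: "x \<in> B" using Bg_B[OF x] .
  have S: "y \<in> B \<and> E (x * adj y) = 0" if "y \<in> Sg g" for y
    using that
  proof (induction rule: Sg_induct)
    case (gen a \<pi>)
    have "E (x * adj (\<iota> a * lm \<pi>)) = E (x * adj (lm \<pi>) * \<iota> (adj a))" using gen by (simp add: incl_adj mult.assoc)
    also have "\<dots> = E (x * adj (lm \<pi>)) * \<iota> (adj a)" using gen xB by (intro E_right) auto
    finally show ?case using z gen by simp
  next
    case (add y y')
    then show ?case using xB E_add[of "x * adj y" "x * adj y'"] by (simp add: distrib_left)
  qed (simp add: E_zero)
  have "continuous_map (subtopology sigma_weak B) sigma_weak (\<lambda>y. x * adj y)"
    using continuous_map_compose[OF continuous_map_sigma_weak_adj continuous_map_sigma_weak_mult_left[of x]]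
    by (intro continuous_map_from_subtopology) (simp add: o_def)
  then have c1: "continuous_map (subtopology sigma_weak B) (subtopology sigma_weak B) (\<lambda>y. x * adj y)"
    using xB by (auto simp: continuous_map_in_subtopology)
  have c2: "continuous_map (subtopology sigma_weak B) sigma_weak (\<lambda>y. E (x * adj y))"
    using continuous_map_compose[OF c1 E_cont] by (simp add: o_def)
  have "E (x * adj x) = 0"
    by (rule eq_on_closure[OF c2, of "\<lambda>_. 0" "Sg g"]) (use S Sg_B x xB in \<open>auto simp: Bg_eq\<close>)
  then have "E (adj (adj x) * adj x) = 0" by simp
  then have "adj x = 0" by (rule E_faithful[rotated]) (use xB in simp)
  then show ?thesis by simp
qed

section \<open>Relative commutants of the two tensor factors\<close>

lemma adj_lm_el: "\<pi> \<in> C \<Longrightarrow> x \<in> M \<Longrightarrow> y \<in> M \<Longrightarrow> el D x y * adj (lm \<pi>) = adj (lm \<pi>) * el D (\<pi> x) (\<pi> y)"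
proof -
  assume *: "\<pi> \<in> C" "x \<in> M" "y \<in> M"
  then have "adj (lm \<pi> * el D (adj x) (adj y)) = adj (el D (\<pi> (adj x)) (\<pi> (adj y)) * lm \<pi>)" by (simp only: lm_el M.adj_mem)
  then show ?thesis using * by (simp add: el_adj C_adj)
qed

text \<open>As E is a bimodule map over \<A>, commutation of T with one elementary tensor becomes an
  intertwining relation for the coefficient. Taking x or y to be 1 gives a relation in a single leg,
  which slices can test.\<close>

lemma E_adj_lm_commute:
  assumes T: "T \<in> B" "T * el D x y = el D x y * T" and xy: "x \<in> M" "y \<in> M" and \<pi>: "\<pi> \<in> C"
    and c: "c \<in> A" "E (T * adj (lm \<pi>)) = \<iota> c"
  shows "tp x y * c = c * tp (\<pi> x) (\<pi> y)"
proof -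
  have "\<iota> (tp x y * c) = el D x y * E (T * adj (lm \<pi>))" using xy c by (simp add: el_eq incl_mult)
  also have "\<dots> = E (el D x y * (T * adj (lm \<pi>)))" using xy T \<pi> by (simp add: el_eq E_left)
  also have "el D x y * (T * adj (lm \<pi>)) = T * adj (lm \<pi>) * el D (\<pi> x) (\<pi> y)"
    using adj_lm_el[OF \<pi> xy] T(2) by (metis mult.assoc)
  also have "E \<dots> = E (T * adj (lm \<pi>)) * el D (\<pi> x) (\<pi> y)" using xy T \<pi> by (simp add: el_eq E_right)
  also have "\<dots> = \<iota> (c * tp (\<pi> x) (\<pi> y))" using xy c \<pi> by (simp add: el_eq incl_mult)
  finally show ?thesis using incl_inj xy c \<pi> by simp
qed

lemma commute_left_E:
  assumes T: "T \<in> B" "\<And>x. x \<in> M \<Longrightarrow> T * el D x 1 = el D x 1 * T" and \<pi>: "\<pi> \<in> Irr" "\<pi> \<noteq> id_on M"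
  shows "E (T * adj (lm \<pi>)) = 0"
proof -
  obtain c where c: "c \<in> A" "E (T * adj (lm \<pi>)) = \<iota> c" using E_mem[of "T * adj (lm \<pi>)"] T(1) \<pi> by auto
  have "T.slice b b' c = 0" for b b'
  proof (rule ccontr)
    assume nz: "T.slice b b' c \<noteq> 0"
    have "T.slice b b' c \<in> intertwiners M \<pi> (id_on M)"
    proof (rule M.intertwinersI[OF slice_mem[OF c(1)]])
      fix x assume x: "x \<in> M"
      have "tensor_op tn x 1 * c = c * tensor_op tn (\<pi> x) 1"
        using E_adj_lm_commute[OF T(1) T(2)[OF x] x M.one_mem Irr_C[OF \<pi>(1)] c] \<pi> by simp
      then have "T.slice b b' (tensor_op tn x 1 * c) = T.slice b b' (c * tensor_op tn (\<pi> x) 1)" by simp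
      then show "T.slice b b' c * \<pi> x = id_on M x * T.slice b b' c" using x by (simp add: T.slice_mult_left T.slice_mult_right)
    qed
    then show False using Irr_eq[OF \<pi>(1) Irr_id _ nz] \<pi>(2) by blast
  qed
  then have "c = 0" by (rule T.slice_eq_0)
  then show ?thesis using c zero_A by simp
qed

lemma swap_htensor: "htensor (\<lambda>b a. tn a b)" by (rule T.swap)
sublocale S: htensor "\<lambda>b a. tn a b" by (rule swap_htensor)

lemma swap_slice_mem: "c \<in> A \<Longrightarrow> S.slice a a' c \<in> N"
  by (rule S.slice_mem[of N _ M]) (auto simp: swap_A)

lemma commute_right_E:
  assumes T: "T \<in> B" "\<And>y. y \<in> M \<Longrightarrow> T * el D 1 y = el D 1 y * T" and \<pi>: "\<pi> \<in> Irr" "\<pi> \<noteq> id_on M"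
  shows "E (T * adj (lm \<pi>)) = 0"
proof -
  obtain c where c: "c \<in> A" "E (T * adj (lm \<pi>)) = \<iota> c" using E_mem[of "T * adj (lm \<pi>)"] T(1) \<pi> by auto
  have "S.slice a a' c = 0" for a a'
  proof (rule ccontr)
    assume nz: "S.slice a a' c \<noteq> 0"
    obtain s where s: "s \<in> M" "S.slice a a' c = j s" using j_surj[OF swap_slice_mem[OF c(1)]] by blast
    have "s \<in> intertwiners M \<pi> (id_on M)"
    proof (rule M.intertwinersI[OF s(1)])
      fix y assume y: "y \<in> M"
      have "tensor_op tn 1 (j y) * c = c * tensor_op tn 1 (j (\<pi> y))"
        using E_adj_lm_commute[OF T(1) T(2)[OF y] M.one_mem y Irr_C[OF \<pi>(1)] c] \<pi> by simp
      then have "S.slice a a' (tensor_op (\<lambda>b a. tn a b) (j y) 1 * c) = S.slice a a' (c * tensor_op (\<lambda>b a. tn a b) (j (\<pi> y)) 1)"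
        by (simp add: swap_tensor_op)
      then have "j y * j s = j s * j (\<pi> y)" by (simp add: S.slice_mult_left S.slice_mult_right s)
      then have "j (s * \<pi> y) = j (y * s)" using s y \<pi> by (simp add: j_mult)
      then show "s * \<pi> y = id_on M y * s" using j_inj s y \<pi> by simp
    qed
    moreover have "s \<noteq> 0" using nz s j_scale[of 0 0] by auto
    ultimately show False using Irr_eq[OF \<pi>(1) Irr_id] \<pi>(2) by blast
  qed
  then have "c = 0" by (rule S.slice_eq_0)
  then show ?thesis using c zero_A by simp
qed

lemma mem_A_of_coefficients:
  assumes T: "T \<in> B0" and z: "\<And>\<pi>. \<pi> \<in> Irr \<Longrightarrow> \<pi> \<noteq> id_on M \<Longrightarrow> E (T * adj (lm \<pi>)) = 0"
  shows "\<exists>c\<in>A. T = \<iota> c"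
proof -
  have TB: "T \<in> B" using Bg_B[OF T] .
  obtain c where c: "c \<in> A" "E T = \<iota> c" using E_mem[OF TB] by blast
  have "T - \<iota> c = 0"
  proof (rule Bg_zeroI)
    show "T - \<iota> c \<in> B0" using T c Bg_incl by simp
    fix \<pi> assume \<pi>: "\<pi> \<in> Irr" "\<pi> \<in> gr 0"
    have "E ((T - \<iota> c) * adj (lm \<pi>)) = E (T * adj (lm \<pi>)) - \<iota> c * E (adj (lm \<pi>))"
      using TB c \<pi> by (simp add: left_diff_distrib E_diff E_left)
    also have "\<dots> = 0"
    proof (cases "\<pi> = id_on M")
      case True
      then show ?thesis using c E_id[of 1] by simp
    next
      case False
      \<comment> \<open>The lemma \<open>commute_left_E\<close> applied to the operator 1 says that
        \<open>adj (lm \<pi>)\<close> itself has expectation 0.\<close>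
      then show ?thesis using z[OF \<pi>(1) False] commute_left_E[OF B.one_mem _ \<pi>(1) False] by simp
    qed
    finally show "E ((T - \<iota> c) * adj (lm \<pi>)) = 0" .
  qed
  then show ?thesis using c by auto
qed

text \<open>The coefficient argument puts T into \<A>. There its slices into M commute with M, hence
  are scalars because M is a factor, and only the second leg survives.\<close>

lemma commutant_left:
  assumes T: "T \<in> B0" "\<And>x. x \<in> M \<Longrightarrow> T * el D x 1 = el D x 1 * T"
  shows "\<exists>y\<in>M. T = el D 1 y"
proof -
  obtain c where c: "c \<in> A" "T = \<iota> c" using mem_A_of_coefficients[OF T(1) commute_left_E[OF Bg_B[OF T(1)] T(2)]] by blast
  have "\<exists>k. T.slice b b' c = scaleOp k 1" for b b'
  proof (rule M.id_intertwiners, rule M.intertwinersI[OF slice_mem[OF c(1)]])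
    fix x assume x: "x \<in> M"
    have "\<iota> (tensor_op tn x 1 * c) = \<iota> (c * tensor_op tn x 1)"
      using T(2)[OF x] c x by (simp add: el_eq incl_mult)
    then have "tensor_op tn x 1 * c = c * tensor_op tn x 1" using incl_inj c x by simp
    then have "T.slice b b' (tensor_op tn x 1 * c) = T.slice b b' (c * tensor_op tn x 1)" by simp
    then show "T.slice b b' c * id_on M x = id_on M x * T.slice b b' c" using x by (simp add: T.slice_mult_left T.slice_mult_right)
  qed
  moreover obtain a0 :: 'h where "norm a0 = 1" using hilbert_nontrivial(1) by blast
  ultimately have eq: "c = tensor_op tn 1 (S.slice a0 a0 c)" by (rule T.tensor_of_scalar_slices)
  obtain y where y: "y \<in> M" "S.slice a0 a0 c = j y" using j_surj[OF swap_slice_mem[OF c(1)]] by blast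
  have "c = tp 1 y" using eq unfolding y(2) .
  then have "T = el D 1 y" using c(2) by (simp add: el_eq)
  then show ?thesis using y(1) by blast
qed

lemma commutant_right:
  assumes T: "T \<in> B0" "\<And>y. y \<in> M \<Longrightarrow> T * el D 1 y = el D 1 y * T"
  shows "\<exists>x\<in>M. T = el D x 1"
proof -
  obtain c where c: "c \<in> A" "T = \<iota> c" using mem_A_of_coefficients[OF T(1) commute_right_E[OF Bg_B[OF T(1)] T(2)]] by blast
  have "\<exists>k. S.slice a a' c = scaleOp k 1" for a a'
  proof -
    obtain s where s: "s \<in> M" "S.slice a a' c = j s" using j_surj[OF swap_slice_mem[OF c(1)]] by blast
    have "\<exists>k. s = scaleOp k 1"
    proof (rule M.id_intertwiners, rule M.intertwinersI[OF s(1)])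
      fix y assume y: "y \<in> M"
      have "\<iota> (tensor_op tn 1 (j y) * c) = \<iota> (c * tensor_op tn 1 (j y))"
        using T(2)[OF y] c y by (simp add: el_eq incl_mult)
      then have "tensor_op tn 1 (j y) * c = c * tensor_op tn 1 (j y)" using incl_inj c y by simp
      then have "S.slice a a' (tensor_op (\<lambda>b a. tn a b) (j y) 1 * c) = S.slice a a' (c * tensor_op (\<lambda>b a. tn a b) (j y) 1)"
        by (simp add: swap_tensor_op)
      then have "j y * j s = j s * j y" by (simp add: S.slice_mult_left S.slice_mult_right s)
      then have "j (s * y) = j (y * s)" using s y by (simp add: j_mult)
      then show "s * id_on M y = id_on M y * s" using j_inj s y by simp
    qed
    then show ?thesis using s j_scale[of 1] by auto
  qed
  moreover obtain b0 :: 'h2 where "norm b0 = 1" using hilbert_nontrivial(2) by blast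
  ultimately have "c = tensor_op (\<lambda>b a. tn a b) 1 (T.slice b0 b0 c)" by (rule S.tensor_of_scalar_slices)
  then have eq: "c = tensor_op tn (T.slice b0 b0 c) 1" by (simp only: swap_tensor_op)
  then have "T = el D (T.slice b0 b0 c) 1" using c(2) by (simp add: el_eq)
  then show ?thesis using slice_mem[OF c(1)] by blast
qed

text \<open>In a nonzero degree the identity is not among the irreducibles, so no coefficient can
  survive. This is what separates the degrees in \<open>Lrep_degree\<close>.\<close>

lemma commutant_left_graded:
  assumes T: "T \<in> Bg g" "\<And>x. x \<in> M \<Longrightarrow> T * el D x 1 = el D x 1 * T" and g: "g \<noteq> 0"
  shows "T = 0"
proof (rule Bg_zeroI[OF T(1)])
  fix \<pi> assume \<pi>: "\<pi> \<in> Irr" "\<pi> \<in> gr g"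
  have "\<pi> \<noteq> id_on M" using gr_unique[OF C_id M.irreducible_id gr_id] \<pi>(2) g by blast
  then show "E (T * adj (lm \<pi>)) = 0" by (intro commute_left_E T Bg_B[OF T(1)] \<pi>)
qed

text \<open>The *-algebra generated by the elementary tensors is dense in \<A> by the bicommutant
  theorem. Closedness of S is demanded only at points of \<A>, because the maps in its applications
  are continuous on \<A> only.\<close>

lemma A_induct:
  assumes S: "S \<subseteq> A" "1 \<in> S" "\<And>x y. x \<in> M \<Longrightarrow> y \<in> M \<Longrightarrow> tp x y \<in> S"
    "\<And>x y. x \<in> S \<Longrightarrow> y \<in> S \<Longrightarrow> x + y \<in> S" "\<And>x y. x \<in> S \<Longrightarrow> y \<in> S \<Longrightarrow> x * y \<in> S"
    "\<And>c x. x \<in> S \<Longrightarrow> scaleOp c x \<in> S" "\<And>x. x \<in> S \<Longrightarrow> adj x \<in> S"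
    and cl: "\<And>x. x \<in> A \<Longrightarrow> x \<in> sigma_weak closure_of S \<Longrightarrow> x \<in> S" and a: "a \<in> A"
  shows "a \<in> S"
proof (rule cl[OF a])
  let ?G = "{tensor_op tn x y | x y. x \<in> M \<and> y \<in> N}"
  have "?G \<subseteq> S"
  proof clarify
    fix x y assume "x \<in> M" "y \<in> N"
    then show "tensor_op tn x y \<in> S" using j_surj[of y] S(3) by auto
  qed
  then have "?G \<union> adj ` ?G \<subseteq> S" using S(7) by blast
  then have "commutant (commutant (?G \<union> adj ` ?G)) \<subseteq> commutant (commutant S)" by (intro commutant_antimono)
  also have "\<dots> \<subseteq> sigma_weak closure_of S" by (rule bicommutant) (use S in auto)
  finally show "a \<in> sigma_weak closure_of S" using a by (auto simp: algA_def vn_tensor_def vn_generated_def)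
qed

lemma hom_eq_A:
  assumes f: "f \<in> normal_homs A U" "g \<in> normal_homs A U'" and eq: "\<And>x y. x \<in> M \<Longrightarrow> y \<in> M \<Longrightarrow> f (tp x y) = g (tp x y)"
    and a: "a \<in> A"
  shows "f a = g a"
proof -
  have "a \<in> {a \<in> A. f a = g a}"
  proof (rule A_induct[OF _ _ _ _ _ _ _ _ a])
    fix x assume "x \<in> A" "x \<in> sigma_weak closure_of {a \<in> A. f a = g a}"
    then show "x \<in> {a \<in> A. f a = g a}"
      using eq_on_closure[OF hom_cont[OF f(1)] hom_cont[OF f(2)], of "{a \<in> A. f a = g a}" x] by auto
  qed (use eq hom_add[OF f(1)] hom_add[OF f(2)] hom_mult[OF f(1)] hom_mult[OF f(2)] hom_adj[OF f(1)] hom_adj[OF f(2)]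
      hom_scale[OF f(1)] hom_scale[OF f(2)] hom_one[OF f(1)] hom_one[OF f(2)] in auto)
  then show ?thesis by simp
qed

lemma incl_hom0: "\<iota> \<in> normal_homs A B0"
  by (rule normal_homsI) (use incl_hom hom_ext hom_cont in \<open>auto simp: Bg_incl incl_add incl_scale incl_mult incl_adj\<close>)

text \<open>\<open>\<B>\<^sub>0\<close> is generated by \<open>M \<otimes> 1\<close>, \<open>1 \<otimes> M\<^sup>o\<^sup>p\<close> and the unitaries \<open>L\<^sub>\<pi>\<close>.\<close>

lemma hom_eq_B0:
  assumes f: "f \<in> End B0" "g \<in> End B0" and l: "\<And>x. x \<in> M \<Longrightarrow> f (el D x 1) = g (el D x 1)"
    and r: "\<And>y. y \<in> M \<Longrightarrow> f (el D 1 y) = g (el D 1 y)" and L: "\<And>\<pi>. \<pi> \<in> gr 0 \<Longrightarrow> f (L \<pi>) = g (L \<pi>)"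
  shows "f = g"
proof (rule hom_eqI[OF f])
  have el: "f (el D x y) = g (el D x y)" if "x \<in> M" "y \<in> M" for x y
    using el_mult[of x 1 1 y] l[of x] r[of y] that hom_mult[OF f(1), of "el D x 1" "el D 1 y"] hom_mult[OF f(2), of "el D x 1" "el D 1 y"] by simp
  have fi: "compose A h \<iota> \<in> normal_homs A B0" if "h \<in> End B0" for h
    by (rule hom_compose[OF incl_hom0 that]) auto
  have A: "f (\<iota> a) = g (\<iota> a)" if "a \<in> A" for a
    using hom_eq_A[OF fi[OF f(1)] fi[OF f(2)] _ that] that el by (simp add: compose_def el_eq)
  have S: "x \<in> B0 \<and> f x = g x" if "x \<in> Sg 0" for x
    using that
  proof (induction rule: Sg_induct)
    case zero then show ?case using hom_zero[OF f(1)] hom_zero[OF f(2)] by simp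
  next
    case (add x y) then show ?case using hom_add[OF f(1)] hom_add[OF f(2)] by simp
  next
    case (gen a \<pi>)
    have m: "L \<pi> \<in> B0" "\<iota> a \<in> B0" using L_Bg Bg_incl gen by auto
    have "\<iota> a * lm \<pi> = \<iota> a * L \<pi> * el D 1 (R \<pi>)" using lm_L[of \<pi>] gen by (simp add: mult.assoc)
    then show ?case using m A[OF gen(1)] r[of "R \<pi>"] L[OF gen(3)] gen
      by (simp add: hom_mult[OF f(1)] hom_mult[OF f(2)])
  qed
  fix x assume "x \<in> B0"
  then show "f x = g x"
    using eq_on_closure[OF hom_cont[OF f(1)] hom_cont[OF f(2)], of "Sg 0" x] S by (auto simp: Bg_eq)
qed

end

section \<open>The braiding of left and right endomorphisms\<close>

context lr
begin

section \<open>The action of the group on the degree zero part\<close>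

lemma u_mem: "u g \<in> Bg g" and u_un: "u g * adj (u g) = 1" "adj (u g) * u g = 1" and u_mult: "u g * u h = u (g + h)"
  using setting by (auto simp: lr_setting_def unitaries_def)
lemma u_zero [simp]: "u 0 = 1"
proof -
  have "adj (u 0) * (u 0 * u 0) = adj (u 0) * u 0" by (simp add: u_mult)
  then show ?thesis using u_un(2)[of 0] by (simp flip: mult.assoc)
qed
lemma u_adj: "adj (u g) = u (- g)"
proof -
  have "adj (u g) = adj (u g) * (u g * u (- g))" by (simp add: u_mult)
  then show ?thesis by (simp add: u_un flip: mult.assoc)
qed
lemma u_mult': "u g * (u h * x) = u (g + h) * x" by (simp add: u_mult flip: mult.assoc)

lemma beta_eq: "x \<in> B0 \<Longrightarrow> beta D g x = u g * x * u (- g)" by (simp add: beta_def u_adj)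
lemma beta_mem [simp]: "x \<in> B0 \<Longrightarrow> beta D g x \<in> B0"
  using Bg_mult[OF Bg_mult[OF u_mem[of g]] u_mem[of "- g"], of x 0] by (simp add: beta_eq)
lemma beta_End: "beta D g \<in> End B0"
proof (rule normal_homsI)
  show "beta D g \<in> extensional B0" by (simp add: beta_def)
  show "continuous_map (subtopology sigma_weak B0) sigma_weak (beta D g)"
  proof (rule continuous_map_eq)
    show "continuous_map (subtopology sigma_weak B0) sigma_weak (\<lambda>x. u g * x * u (- g))"
      using continuous_map_compose[OF continuous_map_sigma_weak_mult_left[of "u g"] continuous_map_sigma_weak_mult_right[of "u (- g)"]]
      by (intro continuous_map_from_subtopology) (simp add: o_def)
  qed (simp add: beta_eq)
  show "beta D g x \<in> B0" if "x \<in> B0" for x using that by simp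
qed (simp_all add: beta_eq distrib_left distrib_right mult.assoc u_mult u_mult' u_adj)
lemma beta_beta [simp]: "x \<in> B0 \<Longrightarrow> beta D g (beta D h x) = beta D (g + h) x"
  by (subst beta_eq, simp) (simp add: beta_eq mult.assoc u_mult u_mult' minus_add)
lemma beta_zero [simp]: "x \<in> B0 \<Longrightarrow> beta D 0 x = x" by (simp add: beta_eq)
lemmas beta_simps = hom_mult[OF beta_End] hom_adj[OF beta_End] hom_one[OF beta_End]

lemma beta_inj: "x \<in> B0 \<Longrightarrow> y \<in> B0 \<Longrightarrow> beta D g x = beta D g y \<Longrightarrow> x = y"
  by (metis beta_beta beta_zero left_minus)

lemma gact_app [simp]: "x \<in> B0 \<Longrightarrow> gact D g \<theta> x = beta D g (\<theta> (beta D (- g) x))" by (simp add: gact_def)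
lemma gact_compose: "\<theta> \<in> End B0 \<Longrightarrow> gact D g \<theta> = compose B0 (beta D g) (compose B0 \<theta> (beta D (- g)))"
  by (rule ext) (simp add: gact_def compose_def hom_mem)
lemma gact_End: "\<theta> \<in> End B0 \<Longrightarrow> gact D g \<theta> \<in> End B0"
  by (simp add: gact_compose B0.comp_End beta_End)

lemma un: "v \<in> unitaries B0 \<Longrightarrow> v \<in> B0" "v \<in> unitaries B0 \<Longrightarrow> adj v * v = 1" "v \<in> unitaries B0 \<Longrightarrow> v * adj v = 1"
  "v \<in> unitaries B0 \<Longrightarrow> adj v * (v * z) = z" "v \<in> unitaries B0 \<Longrightarrow> v * (adj v * z) = z"
  by (auto simp: unitaries_def simp flip: mult.assoc)
lemma un_adj: "v \<in> unitaries B0 \<Longrightarrow> adj v \<in> unitaries B0" by (auto simp: unitaries_def)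
lemma un_one: "1 \<in> unitaries B0" by (simp add: unitaries_def)
lemma un_mult: "v \<in> unitaries B0 \<Longrightarrow> w \<in> unitaries B0 \<Longrightarrow> v * w \<in> unitaries B0"
  by (auto simp: unitaries_def mult.assoc) (metis mult.assoc mult_1_left)+
lemma un_hom: "\<phi> \<in> End B0 \<Longrightarrow> v \<in> unitaries B0 \<Longrightarrow> \<phi> v \<in> unitaries B0"
  using hom_mult[of \<phi> B0 B0 "adj v" v] hom_mult[of \<phi> B0 B0 v "adj v"]
  by (auto simp: unitaries_def hom_mem hom_adj hom_one)
lemma un_beta: "v \<in> unitaries B0 \<Longrightarrow> beta D g v \<in> unitaries B0" by (rule un_hom[OF beta_End])
lemma Ad_End: "\<theta> \<in> End B0 \<Longrightarrow> v \<in> unitaries B0 \<Longrightarrow> Ad B0 v \<theta> \<in> End B0"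
proof (rule normal_homsI)
  assume \<theta>: "\<theta> \<in> End B0" and v: "v \<in> unitaries B0"
  note h = hom_mem[OF \<theta>] hom_add[OF \<theta>] hom_mult[OF \<theta>] hom_scale[OF \<theta>] hom_adj[OF \<theta>] hom_one[OF \<theta>]
  show "Ad B0 v \<theta> \<in> extensional B0" by (simp add: Ad_def)
  show "Ad B0 v \<theta> x \<in> B0" if "x \<in> B0" for x using that h v un by (simp add: Ad_def)
  show "Ad B0 v \<theta> (x + y) = Ad B0 v \<theta> x + Ad B0 v \<theta> y" if "x \<in> B0" "y \<in> B0" for x y
    using that by (simp add: Ad_def h distrib_left distrib_right)
  show "Ad B0 v \<theta> (scaleOp c x) = scaleOp c (Ad B0 v \<theta> x)" if "x \<in> B0" for c x using that by (simp add: Ad_def h)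
  show "Ad B0 v \<theta> (x * y) = Ad B0 v \<theta> x * Ad B0 v \<theta> y" if "x \<in> B0" "y \<in> B0" for x y
    using that v by (simp add: Ad_def h mult.assoc un)
  show "Ad B0 v \<theta> (adj x) = adj (Ad B0 v \<theta> x)" if "x \<in> B0" for x using that by (simp add: Ad_def h mult.assoc)
  show "Ad B0 v \<theta> 1 = 1" using v by (simp add: Ad_def h un)
  show "continuous_map (subtopology sigma_weak B0) sigma_weak (Ad B0 v \<theta>)"
  proof (rule continuous_map_eq)
    show "continuous_map (subtopology sigma_weak B0) sigma_weak (\<lambda>x. v * \<theta> x * adj v)"
      using continuous_map_compose[OF continuous_map_compose[OF hom_cont[OF \<theta>] continuous_map_sigma_weak_mult_left[of v]]
          continuous_map_sigma_weak_mult_right[of "adj v"]] by (simp add: o_def)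
  qed (simp add: Ad_def)
qed
lemma Ad_app: "x \<in> B0 \<Longrightarrow> Ad B0 v \<theta> x = v * \<theta> x * adj v" by (simp add: Ad_def)

section \<open>Endomorphisms that fix one tensor factor\<close>

lemma el_commute: "x \<in> M \<Longrightarrow> y \<in> M \<Longrightarrow> el D x 1 * el D 1 y = el D 1 y * el D x 1" by (simp add: el_mult)

definition fixes_left where "fixes_left \<alpha> \<longleftrightarrow> \<alpha> \<in> End B0 \<and> (\<forall>x\<in>M. \<alpha> (el D x 1) = el D x 1)"
definition fixes_right where "fixes_right \<rho> \<longleftrightarrow> \<rho> \<in> End B0 \<and> (\<forall>y\<in>M. \<rho> (el D 1 y) = el D 1 y)"

lemma fixes_left_right:
  assumes "fixes_left \<alpha>" "y \<in> M" shows "\<exists>y'\<in>M. \<alpha> (el D 1 y) = el D 1 y'"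
proof (rule commutant_left)
  have \<alpha>: "\<alpha> \<in> End B0" using assms by (simp add: fixes_left_def)
  show "\<alpha> (el D 1 y) \<in> B0" using hom_mem[OF \<alpha>] assms by simp
  fix x assume x: "x \<in> M"
  have "\<alpha> (el D 1 y * el D x 1) = \<alpha> (el D x 1 * el D 1 y)" using x assms by (simp add: el_commute)
  then show "\<alpha> (el D 1 y) * el D x 1 = el D x 1 * \<alpha> (el D 1 y)"
    using x assms by (simp add: hom_mult[OF \<alpha>] fixes_left_def)
qed

lemma fixes_right_left:
  assumes "fixes_right \<rho>" "x \<in> M" shows "\<exists>x'\<in>M. \<rho> (el D x 1) = el D x' 1"
proof (rule commutant_right)
  have \<rho>: "\<rho> \<in> End B0" using assms by (simp add: fixes_right_def)
  show "\<rho> (el D x 1) \<in> B0" using hom_mem[OF \<rho>] assms by simp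
  fix y assume y: "y \<in> M"
  have "\<rho> (el D x 1 * el D 1 y) = \<rho> (el D 1 y * el D x 1)" using y assms by (simp add: el_commute)
  then show "\<rho> (el D x 1) * el D 1 y = el D 1 y * \<rho> (el D x 1)"
    using y assms by (simp add: hom_mult[OF \<rho>] fixes_right_def)
qed

text \<open>The operator W moves 1 \<otimes> M^op through itself by f, and applying \<rho> shows
  that \<rho>(W) does so by the same f. Hence \<rho>(W) W^* commutes with 1 \<otimes> M^op.\<close>

lemma fixes_right_mult:
  assumes \<rho>: "fixes_right \<rho>" and W: "W \<in> unitaries B0" and f: "\<And>y. y \<in> M \<Longrightarrow> f y \<in> M \<and> el D 1 y * W = W * el D 1 (f y)"
  shows "\<exists>x\<in>M. \<rho> W * adj W = el D x 1"
proof (rule commutant_right)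
  have \<rho>E: "\<rho> \<in> End B0" and \<rho>r: "\<And>y. y \<in> M \<Longrightarrow> \<rho> (el D 1 y) = el D 1 y" using \<rho> by (auto simp: fixes_right_def)
  note h = hom_mem[OF \<rho>E] hom_mult[OF \<rho>E]
  show "\<rho> W * adj W \<in> B0" using W un h by simp
  fix y assume y: "y \<in> M"
  have 1: "adj W * el D 1 y = el D 1 (f y) * adj W"
  proof -
    have "adj W * el D 1 y = adj W * (el D 1 y * W) * adj W" using W by (simp add: mult.assoc un)
    also have "\<dots> = el D 1 (f y) * adj W" using f[OF y] W by (simp add: un flip: mult.assoc)
    finally show ?thesis .
  qed
  have "\<rho> (el D 1 y * W) = \<rho> (W * el D 1 (f y))" using f[OF y] by simp
  then have 2: "el D 1 y * \<rho> W = \<rho> W * el D 1 (f y)"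
    using h(2)[of "el D 1 y" W] h(2)[of W "el D 1 (f y)"] un(1)[OF W] y f[OF y] \<rho>r[of "f y"] by (simp add: \<rho>r)
  have "\<rho> W * adj W * el D 1 y = \<rho> W * el D 1 (f y) * adj W" using 1 by (simp add: mult.assoc)
  also have "\<dots> = el D 1 y * (\<rho> W * adj W)" by (simp add: mult.assoc flip: 2)
  finally show "\<rho> W * adj W * el D 1 y = el D 1 y * (\<rho> W * adj W)" .
qed

lemma L_unitaries: "\<pi> \<in> gr 0 \<Longrightarrow> L \<pi> \<in> unitaries B0"
  using L_Bg[of \<pi> 0] L_unitary[OF gr_C] by (auto simp: unitaries_def)

lemma L_right: "\<pi> \<in> C \<Longrightarrow> y \<in> M \<Longrightarrow> el D 1 y * L \<pi> = L \<pi> * el D 1 (cj \<pi> y)"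
proof -
  assume *: "\<pi> \<in> C" "y \<in> M"
  have "el D 1 y * L \<pi> = L \<pi> * (adj (L \<pi>) * el D 1 y) * L \<pi>" using L_unitary[OF *(1)] by (simp flip: mult.assoc)
  also have "\<dots> = L \<pi> * el D 1 (cj \<pi> y)" using L_unitary[OF *(1)] * by (simp add: L_adj_right mult.assoc)
  finally show ?thesis .
qed

text \<open>For \<open>\<alpha>\<close> fixing \<open>M \<otimes> 1\<close> and \<open>\<rho>\<close> fixing \<open>1 \<otimes> M\<^sup>o\<^sup>p\<close> we have \<open>\<alpha>(L\<^sub>\<pi>) \<in> L\<^sub>\<pi> (1 \<otimes> M\<^sup>o\<^sup>p)\<close> and
  \<open>\<rho>(L\<^sub>\<pi>) \<in> (M \<otimes> 1) L\<^sub>\<pi>\<close>, as \<open>1 \<otimes> M\<^sup>o\<^sup>p\<close> and \<open>M \<otimes> 1\<close> are relative commutants of each other.\<close>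

lemma fixes_commute:
  assumes \<alpha>: "fixes_left \<alpha>" and \<rho>: "fixes_right \<rho>" and x: "x \<in> B0"
  shows "\<rho> (\<alpha> x) = \<alpha> (\<rho> x)"
proof -
  have \<alpha>E: "\<alpha> \<in> End B0" and \<alpha>l: "\<And>x. x \<in> M \<Longrightarrow> \<alpha> (el D x 1) = el D x 1" using \<alpha> by (auto simp: fixes_left_def)
  have \<rho>E: "\<rho> \<in> End B0" and \<rho>r: "\<And>y. y \<in> M \<Longrightarrow> \<rho> (el D 1 y) = el D 1 y" using \<rho> by (auto simp: fixes_right_def)
  note h = hom_mem[OF \<alpha>E] hom_mult[OF \<alpha>E] hom_mem[OF \<rho>E] hom_mult[OF \<rho>E]
  have "compose B0 \<rho> \<alpha> = compose B0 \<alpha> \<rho>"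
  proof (rule hom_eq_B0[OF B0.comp_End[OF \<alpha>E \<rho>E] B0.comp_End[OF \<rho>E \<alpha>E]])
    fix x assume x: "x \<in> M"
    obtain x' where "x' \<in> M" "\<rho> (el D x 1) = el D x' 1" using fixes_right_left[OF \<rho> x] by blast
    then show "compose B0 \<rho> \<alpha> (el D x 1) = compose B0 \<alpha> \<rho> (el D x 1)" using x by (simp add: compose_def \<alpha>l)
  next
    fix y assume y: "y \<in> M"
    obtain y' where "y' \<in> M" "\<alpha> (el D 1 y) = el D 1 y'" using fixes_left_right[OF \<alpha> y] by blast
    then show "compose B0 \<rho> \<alpha> (el D 1 y) = compose B0 \<alpha> \<rho> (el D 1 y)" using y by (simp add: compose_def \<rho>r)
  next
    fix \<pi> assume \<pi>: "\<pi> \<in> gr 0"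
    note C = gr_C[OF \<pi>] and U = L_unitaries[OF \<pi>]
    obtain m where m: "m \<in> M" "\<rho> (L \<pi>) * adj (L \<pi>) = el D m 1"
      using fixes_right_mult[OF \<rho> U, of "cj \<pi>"] L_right[OF C] C by auto
    then have \<rho>L: "\<rho> (L \<pi>) = el D m 1 * L \<pi>" using un[OF U] by (metis mult.assoc mult_1_right)
    have "\<exists>y\<in>M. adj (L \<pi>) * \<alpha> (L \<pi>) = el D 1 y"
    proof (rule commutant_left)
      show "adj (L \<pi>) * \<alpha> (L \<pi>) \<in> B0" using un[OF U] h by simp
      fix x assume x: "x \<in> M"
      have "\<alpha> (L \<pi> * el D x 1) = \<alpha> (el D (\<pi> x) 1 * L \<pi>)" using L_left[OF C x] by simp
      then have 1: "\<alpha> (L \<pi>) * el D x 1 = el D (\<pi> x) 1 * \<alpha> (L \<pi>)" using x C un[OF U] by (simp add: h \<alpha>l)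
      have 2: "adj (L \<pi>) * el D (\<pi> x) 1 = el D x 1 * adj (L \<pi>)"
      proof -
        have "adj (L \<pi>) * el D (\<pi> x) 1 = adj (L \<pi>) * (el D (\<pi> x) 1 * L \<pi>) * adj (L \<pi>)" by (simp add: mult.assoc un[OF U])
        also have "\<dots> = el D x 1 * adj (L \<pi>)" by (simp add: un[OF U] flip: L_left[OF C x] mult.assoc)
        finally show ?thesis .
      qed
      show "adj (L \<pi>) * \<alpha> (L \<pi>) * el D x 1 = el D x 1 * (adj (L \<pi>) * \<alpha> (L \<pi>))"
        by (rule mult_swap[OF 1 2])
    qed
    then obtain y where y: "y \<in> M" "adj (L \<pi>) * \<alpha> (L \<pi>) = el D 1 y" by blast
    then have \<alpha>L: "\<alpha> (L \<pi>) = L \<pi> * el D 1 y" using un(5)[OF U, of "\<alpha> (L \<pi>)"] by simp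
    show "compose B0 \<rho> \<alpha> (L \<pi>) = compose B0 \<alpha> \<rho> (L \<pi>)"
      using m y un[OF U] by (simp add: compose_def \<alpha>L \<rho>L h \<alpha>l \<rho>r mult.assoc)
  qed
  from fun_cong[OF this, of x] show ?thesis using x by (simp add: compose_def)
qed

section \<open>Left and right presentations and their braiding operator\<close>

definition Lrep where "Lrep g \<theta> X \<alpha> \<longleftrightarrow> \<theta> \<in> End B0 \<and> X \<in> unitaries B0 \<and> fixes_left \<alpha> \<and>
  (\<forall>x\<in>B0. \<theta> x = beta D g (X * \<alpha> x * adj X))"
definition Rrep where "Rrep \<theta> v \<rho> \<longleftrightarrow> \<theta> \<in> End B0 \<and> v \<in> unitaries B0 \<and> fixes_right \<rho> \<and>
  (\<forall>x\<in>B0. \<theta> x = v * \<rho> x * adj v)"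

text \<open>With \<open>\<theta>\<^sub>1 = \<beta>\<^sub>g Ad X \<alpha>\<close> and \<open>\<theta>\<^sub>2 = Ad v \<rho>\<close>, the operator \<open>eps X \<alpha> v \<rho>\<close> carries
  \<open>Ad X \<alpha> \<theta>\<^sub>2 = Ad (X \<alpha>(v)) \<alpha>\<rho>\<close> into \<open>\<theta>\<^sub>2 Ad X \<alpha> = Ad (v \<rho>(X)) \<rho>\<alpha>\<close>.\<close>

definition eps where "eps X \<alpha> v \<rho> = v * \<rho> X * \<alpha> (adj v) * adj X"

lemma LrepD:
  assumes "Lrep g \<theta> X \<alpha>"
  shows "\<theta> \<in> End B0" "X \<in> unitaries B0" "\<alpha> \<in> End B0" "fixes_left \<alpha>" "\<And>x. x \<in> M \<Longrightarrow> \<alpha> (el D x 1) = el D x 1"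
    "\<And>x. x \<in> B0 \<Longrightarrow> \<theta> x = beta D g (X * \<alpha> x * adj X)"
  using assms by (auto simp: Lrep_def fixes_left_def)
lemma RrepD:
  assumes "Rrep \<theta> v \<rho>"
  shows "\<theta> \<in> End B0" "v \<in> unitaries B0" "\<rho> \<in> End B0" "fixes_right \<rho>" "\<And>y. y \<in> M \<Longrightarrow> \<rho> (el D 1 y) = el D 1 y"
    "\<And>x. x \<in> B0 \<Longrightarrow> \<theta> x = v * \<rho> x * adj v"
  using assms by (auto simp: Rrep_def fixes_right_def)

lemma eps_unitary: "Lrep g \<theta> X \<alpha> \<Longrightarrow> Rrep \<theta>' v \<rho> \<Longrightarrow> eps X \<alpha> v \<rho> \<in> unitaries B0"
  unfolding eps_def by (intro un_mult un_adj un_hom[of \<rho>] un_hom[of \<alpha>]) (auto dest: LrepD RrepD)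

lemma eps_BF0:
  assumes l: "Lrep g \<theta> X \<alpha>" and r: "Rrep \<theta>' v \<rho>" and x: "x \<in> B0"
  shows "eps X \<alpha> v \<rho> * (X * \<alpha> (\<theta>' x) * adj X) = \<theta>' (X * \<alpha> x * adj X) * eps X \<alpha> v \<rho>"
proof -
  note L = LrepD[OF l] and R = RrepD[OF r]
  note h = hom_mem[OF L(3)] hom_mult[OF L(3)] hom_adj[OF L(3)] hom_mem[OF R(3)] hom_mult[OF R(3)] hom_adj[OF R(3)]
    un_hom[OF L(3)] un_hom[OF R(3)] L(2) R(2)
  show ?thesis using x by (simp add: eps_def R(6) h un fixes_commute[OF L(4) R(4)] mult.assoc)
qed

lemma Rrep_compose:
  assumes r: "Rrep \<theta> v \<rho>" and r': "Rrep \<theta>' v' \<rho>'"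
  shows "Rrep (compose B0 \<theta> \<theta>') (v * \<rho> v') (compose B0 \<rho> \<rho>')"
proof -
  note R = RrepD[OF r] and R' = RrepD[OF r']
  note h = hom_mem[OF R(3)] hom_mult[OF R(3)] hom_adj[OF R(3)] hom_mem[OF R'(3)] R(2) R'(2)
  show ?thesis unfolding Rrep_def fixes_right_def
    using B0.comp_End[OF R'(1) R(1)] B0.comp_End[OF R'(3) R(3)]
    by (auto intro: un_mult[OF R(2) un_hom[OF R(3) R'(2)]] simp: compose_eq R R'(5,6) h un mult.assoc)
qed

lemma eps_BF1:
  assumes l: "Lrep g \<theta> X \<alpha>" and r: "Rrep \<xi> v \<rho>" and r': "Rrep \<xi>' v' \<rho>'"
  shows "\<xi> (eps X \<alpha> v' \<rho>') * eps X \<alpha> v \<rho> = eps X \<alpha> (v * \<rho> v') (compose B0 \<rho> \<rho>')"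
proof -
  note L = LrepD[OF l] and R = RrepD[OF r] and R' = RrepD[OF r']
  note h = hom_mem[OF L(3)] hom_mult[OF L(3)] hom_adj[OF L(3)] hom_mem[OF R(3)] hom_mult[OF R(3)] hom_adj[OF R(3)]
    hom_mem[OF R'(3)] hom_mult[OF R'(3)] hom_adj[OF R'(3)]
    un_hom[OF L(3)] un_hom[OF R(3)] un_hom[OF R'(3)] L(2) R(2) R'(2)
  show ?thesis by (simp add: eps_def R(6) h un fixes_commute[OF L(4) R(4)] mult.assoc compose_def)
qed

text \<open>Transported to \<rho> and \<rho>', the intertwiner T becomes p = v'^* T v. As \<rho> and
  \<rho>' agree on 1 \<otimes> M^op, p lies in M \<otimes> 1, where \<alpha> acts trivially, so p
  can pass from one end of the product to the other.\<close>

lemma eps_natural_right: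
  assumes l: "Lrep g \<theta> X \<alpha>" and r: "Rrep \<xi> v \<rho>" and r': "Rrep \<xi>' v' \<rho>'" and T: "T \<in> intertwiners B0 \<xi> \<xi>'"
  shows "T * eps X \<alpha> v \<rho> = eps X \<alpha> v' \<rho>' * (X * \<alpha> T * adj X)"
proof -
  note L = LrepD[OF l] and R = RrepD[OF r] and R' = RrepD[OF r']
  note h = hom_mem[OF L(3)] hom_mult[OF L(3)] hom_adj[OF L(3)] hom_mem[OF R(3)] hom_mem[OF R'(3)]
    un_hom[OF L(3)] un_hom[OF R(3)] un_hom[OF R'(3)] L(2) R(2) R'(2)
  have TB: "T \<in> B0" using T by (rule B0.int_mem)
  define p where "p = adj v' * T * v"
  have pB: "p \<in> B0" using TB h un by (simp add: p_def)
  have p: "p * \<rho> x = \<rho>' x * p" if x: "x \<in> B0" for x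
  proof -
    have "adj v' * (T * \<xi> x) * v = adj v' * (\<xi>' x * T) * v" using B0.int_eq[OF T x] by simp
    then show ?thesis using x by (simp add: p_def R(6) R'(6) mult.assoc un h)
  qed
  obtain z where z: "z \<in> M" "p = el D z 1"
    using commutant_right[OF pB] p[OF el_mem[OF M.one_mem]] R(5) R'(5) by fastforce
  have \<alpha>p: "\<alpha> p = p" using L(5) z by simp
  have 1: "T * v = v' * p" unfolding p_def by (simp add: mult.assoc un h)
  have 2: "p * adj v = adj v' * T" unfolding p_def by (simp add: mult.assoc un h)
  have "T * eps X \<alpha> v \<rho> = (T * v) * \<rho> X * \<alpha> (adj v) * adj X" by (simp add: eps_def mult.assoc)
  also have "\<dots> = v' * (p * \<rho> X) * \<alpha> (adj v) * adj X" unfolding 1 by (simp add: mult.assoc)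
  also have "\<dots> = v' * \<rho>' X * (p * \<alpha> (adj v)) * adj X" using p[of X] un h by (simp add: mult.assoc)
  also have "p * \<alpha> (adj v) = \<alpha> (p * adj v)" using pB un h by (simp add: \<alpha>p)
  also have "\<dots> = \<alpha> (adj v' * T)" unfolding 2 ..
  finally show ?thesis using TB by (simp add: eps_def h un mult.assoc)
qed

text \<open>The mirror image: q = X'^* S X intertwines \<alpha> and \<alpha>', hence lies in 1
  \<otimes> M^op and is fixed by \<rho>. The hypothesis concerns \<open>beta D g S\<close> because
  \<beta> stands outermost in a left presentation.\<close>

lemma eps_natural_left:
  assumes l: "Lrep g \<theta> X \<alpha>" and l': "Lrep g \<theta>' X' \<alpha>'" and r: "Rrep \<xi> v \<rho>" and T: "beta D g S \<in> intertwiners B0 \<theta> \<theta>'" and SB: "S \<in> B0"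
  shows "\<xi> S * eps X \<alpha> v \<rho> = eps X' \<alpha>' v \<rho> * S"
proof -
  note L = LrepD[OF l] and L' = LrepD[OF l'] and R = RrepD[OF r]
  note h = hom_mem[OF L(3)] hom_mem[OF L'(3)] hom_mem[OF R(3)] hom_mult[OF R(3)] hom_adj[OF R(3)]
    un_hom[OF L(3)] un_hom[OF L'(3)] un_hom[OF R(3)] L(2) L'(2) R(2)
  define q where "q = adj X' * S * X"
  have qB: "q \<in> B0" using SB h un by (simp add: q_def)
  have q: "q * \<alpha> x = \<alpha>' x * q" if x: "x \<in> B0" for x
  proof -
    have "beta D g (S * (X * \<alpha> x * adj X)) = beta D g (X' * \<alpha>' x * adj X' * S)"
      using B0.int_eq[OF T x] x SB by (simp add: L(6) L'(6) hom_mult[OF beta_End] h un)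
    then have "S * (X * \<alpha> x * adj X) = X' * \<alpha>' x * adj X' * S"
      by (rule beta_inj[rotated 2]) (use SB x h un in auto)
    then have "adj X' * (S * (X * \<alpha> x * adj X)) * X = adj X' * (X' * \<alpha>' x * adj X' * S) * X" by simp
    then show ?thesis by (simp add: q_def mult.assoc un h)
  qed
  obtain y where y: "y \<in> M" "q = el D 1 y"
    using commutant_left[OF qB] q[OF el_mem[OF _ M.one_mem]] L(5) L'(5) by fastforce
  have \<rho>q: "\<rho> q = q" using R(5) y by simp
  have 1: "S * X = X' * q" unfolding q_def by (simp add: mult.assoc un h)
  have 2: "q * adj X = adj X' * S" unfolding q_def by (simp add: mult.assoc un h)
  have "\<xi> S * eps X \<alpha> v \<rho> = v * \<rho> (S * X) * \<alpha> (adj v) * adj X"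
    using SB by (simp add: eps_def R(6) h un mult.assoc)
  also have "\<dots> = v * \<rho> X' * (q * \<alpha> (adj v)) * adj X" unfolding 1 using qB by (simp add: h un \<rho>q mult.assoc)
  also have "\<dots> = v * \<rho> X' * \<alpha>' (adj v) * (q * adj X)" using q[of "adj v"] un h by (simp add: mult.assoc)
  finally show ?thesis unfolding 2 by (simp add: eps_def mult.assoc)
qed

text \<open>Two presentations of \<theta> give two operators that implement it on M \<otimes> 1. The
  quotient \<open>?T\<close> has degree -g' + g and commutes with M \<otimes> 1; if this degree is
  nonzero it vanishes, although it is invertible.\<close>

lemma Lrep_degree:
  assumes l: "Lrep g \<theta> X \<alpha>" and l': "Lrep g' \<theta> X' \<alpha>'"
  shows "g = g'"
proof (rule ccontr)
  assume ne: "g \<noteq> g'"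
  note L = LrepD[OF l] and L' = LrepD[OF l']
  let ?T = "adj X' * u (- g' + g) * X"
  have "?T \<in> Bg (0 + (- g' + g) + 0)"
    by (intro Bg_mult u_mem) (use L(2) L'(2) un B0.adj_mem in auto)
  then have TB: "?T \<in> Bg (- g' + g)" by simp
  have "?T = 0"
  proof (rule commutant_left_graded[OF TB])
    fix x assume x: "x \<in> M"
    let ?x = "el D x 1"
    have "u g * (X * ?x * adj X) * u (- g) = u g' * (X' * ?x * adj X') * u (- g')"
      using L(6)[of ?x] L'(6)[of ?x] x L(5) L'(5) by (simp add: beta_eq un L(2) L'(2))
    then have "adj X' * (u (- g') * (u g * (X * ?x * adj X) * u (- g)) * u g) * X
        = adj X' * (u (- g') * (u g' * (X' * ?x * adj X') * u (- g')) * u g) * X" by simp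
    then show "?T * ?x = ?x * ?T" by (simp add: mult.assoc u_mult u_mult' un L(2) L'(2))
  next
    show "- g' + g \<noteq> 0" using ne by (metis add.right_neutral add_minus_cancel)
  qed
  moreover have "X' * ?T * adj X = u (- g' + g)" by (simp add: mult.assoc un L(2) L'(2))
  ultimately have "u (- g' + g) = 0" by simp
  then have "(1 :: 'l bop) = 0" using u_un(1)[of "- g' + g"] by simp
  then have "el D 1 1 = el D 0 1" by (simp add: el_zero_left)
  then show False using el_left_inj[of 1 0] M.one_neq_zero by simp
qed

text \<open>Naturality for the intertwiner 1 exchanges first the left and then the right
  presentation.\<close>

lemma eps_independent:
  assumes "Lrep g \<theta> X \<alpha>" "Lrep g' \<theta> X' \<alpha>'" "Rrep \<xi> v \<rho>" "Rrep \<xi> v' \<rho>'"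
  shows "beta D g (eps X \<alpha> v \<rho>) = beta D g' (eps X' \<alpha>' v' \<rho>')"
proof -
  have g: "g = g'" using Lrep_degree assms by blast
  have "\<xi> 1 * eps X \<alpha> v \<rho> = eps X' \<alpha>' v \<rho> * 1"
    by (rule eps_natural_left[of g \<theta> _ _ \<theta>]) (use assms g LrepD(1) in \<open>auto simp: hom_one[OF beta_End] intro: B0.int_one\<close>)
  then have 1: "eps X \<alpha> v \<rho> = eps X' \<alpha>' v \<rho>" using RrepD(1)[OF assms(3)] by (simp add: hom_one)
  have "1 * eps X' \<alpha>' v \<rho> = eps X' \<alpha>' v' \<rho>' * (X' * \<alpha>' 1 * adj X')"
    by (rule eps_natural_right[OF assms(2-4) B0.int_one])
  then have "eps X' \<alpha>' v \<rho> = eps X' \<alpha>' v' \<rho>'" using LrepD[OF assms(2)] by (simp add: hom_one un)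
  then show ?thesis using 1 g by simp
qed

text \<open>This is \<open>Vfin\<close>, the operator V of an object of degree h. It serves both as
  the V of the braiding and, for an arbitrary object of that degree, as the correction for
  \<open>beta D h\<close>.\<close>

definition deg_unitary where "deg_unitary h \<xi> = L \<xi> * u (- h)"

lemma deg_unitary:
  assumes \<xi>: "\<xi> \<in> gr h"
  shows "deg_unitary h \<xi> \<in> unitaries B0"
    "\<And>x. x \<in> M \<Longrightarrow> deg_unitary h \<xi> * beta D h (el D x 1) = el D (\<xi> x) 1 * deg_unitary h \<xi>"
    "\<And>y. y \<in> M \<Longrightarrow> el D 1 y * deg_unitary h \<xi> = deg_unitary h \<xi> * beta D h (el D 1 (cj \<xi> y))"
proof -
  note C = gr_C[OF \<xi>]
  have "deg_unitary h \<xi> \<in> Bg (h + - h)" unfolding deg_unitary_def by (rule Bg_mult[OF L_Bg[OF \<xi>] u_mem])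
  moreover have "deg_unitary h \<xi> * adj (deg_unitary h \<xi>) = 1" "adj (deg_unitary h \<xi>) * deg_unitary h \<xi> = 1"
    using L_unitary[OF C] by (auto simp: deg_unitary_def u_adj mult.assoc u_mult u_mult') (simp flip: mult.assoc, simp add: mult.assoc u_mult)
  ultimately show "deg_unitary h \<xi> \<in> unitaries B0" by (simp add: unitaries_def)
  show "deg_unitary h \<xi> * beta D h (el D x 1) = el D (\<xi> x) 1 * deg_unitary h \<xi>" if "x \<in> M" for x
    using that L_left[OF C that] by (simp add: deg_unitary_def beta_eq mult.assoc u_mult') (simp flip: mult.assoc)
  show "el D 1 y * deg_unitary h \<xi> = deg_unitary h \<xi> * beta D h (el D 1 (cj \<xi> y))" if "y \<in> M" for y
    using that L_right[OF C that] C by (simp add: deg_unitary_def beta_eq mult.assoc u_mult') (simp flip: mult.assoc)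
qed

text \<open>Moving \<open>\<beta>\<^sub>h\<close> past \<open>\<alpha>\<close> in a product of left endomorphisms: \<open>\<beta>\<^sub>-\<^sub>h \<alpha> \<beta>\<^sub>h\<close> does not fix \<open>M \<otimes> 1\<close>, but it does
  so after conjugation by the coboundary \<open>\<alpha>(V\<^sup>*) V\<close>, because \<open>Ad V\<close> undoes \<open>\<beta>\<^sub>h\<close> on \<open>M \<otimes> 1\<close> up to an
  endomorphism of \<open>M\<close>.\<close>

definition cocyc where "cocyc \<alpha> V = \<alpha> (adj V) * V"
definition tw where "tw h \<alpha> V = (\<lambda>x\<in>B0. beta D (- h) (adj (cocyc \<alpha> V) * \<alpha> (beta D h x) * cocyc \<alpha> V))"

lemma cocyc_unitary: "\<alpha> \<in> End B0 \<Longrightarrow> V \<in> unitaries B0 \<Longrightarrow> cocyc \<alpha> V \<in> unitaries B0"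
  unfolding cocyc_def by (rule un_mult[OF un_hom[OF _ un_adj]])

lemma tw_fixes_left:
  assumes \<alpha>: "fixes_left \<alpha>" and \<xi>: "\<xi> \<in> gr h"
  shows "fixes_left (tw h \<alpha> (deg_unitary h \<xi>))"
proof -
  let ?V = "deg_unitary h \<xi>"
  note V = deg_unitary[OF \<xi>]
  have \<alpha>E: "\<alpha> \<in> End B0" and \<alpha>l: "\<And>x. x \<in> M \<Longrightarrow> \<alpha> (el D x 1) = el D x 1" using \<alpha> by (auto simp: fixes_left_def)
  note h = hom_mem[OF \<alpha>E] hom_mult[OF \<alpha>E] hom_adj[OF \<alpha>E] un_hom[OF \<alpha>E]
  have c: "cocyc \<alpha> ?V \<in> unitaries B0" by (rule cocyc_unitary[OF \<alpha>E V(1)])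
  have eq: "tw h \<alpha> ?V = compose B0 (beta D (- h)) (compose B0 (Ad B0 (adj (cocyc \<alpha> ?V)) \<alpha>) (beta D h))"
    by (rule ext) (simp add: tw_def compose_def Ad_def)
  have "tw h \<alpha> ?V \<in> End B0" unfolding eq by (intro B0.comp_End Ad_End beta_End \<alpha>E un_adj c)
  moreover have "tw h \<alpha> ?V (el D x 1) = el D x 1" if x: "x \<in> M" for x
  proof -
    have 1: "beta D h (el D x 1) = adj ?V * el D (\<xi> x) 1 * ?V" using V(2)[OF x] V(1) by (simp add: mult.assoc un flip: V(2)[OF x])
    have "adj (cocyc \<alpha> ?V) * \<alpha> (beta D h (el D x 1)) * cocyc \<alpha> ?V = beta D h (el D x 1)"
      unfolding 1 cocyc_def using V(1) x C_mem[OF gr_C[OF \<xi>] x] by (simp add: h un un_adj \<alpha>l mult.assoc)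
    then show ?thesis using x by (simp add: tw_def)
  qed
  ultimately show ?thesis by (simp add: fixes_left_def)
qed

lemma tw_eq:
  assumes "\<alpha> \<in> End B0" "V \<in> unitaries B0" "x \<in> B0"
  shows "beta D h (tw h \<alpha> V x) = adj (cocyc \<alpha> V) * \<alpha> (beta D h x) * cocyc \<alpha> V"
  using assms cocyc_unitary[OF assms(1,2)] hom_mem[OF assms(1)] by (simp add: tw_def un)

text \<open>By \<open>tw_eq\<close>, \<alpha> \<circ> \<open>\<beta>\<^sub>h\<close> = Ad c \<circ>
  \<open>\<beta>\<^sub>h\<close> \<circ> \<open>tw\<close> with the coboundary c. Moving
  \<open>\<beta>\<^sub>h\<close> to the left in the product of the two presentations therefore
  leaves X \<alpha>(\<open>\<beta>\<^sub>h\<close>(Y)) c as the implementing unitary, transported by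
  the inverse of \<open>\<beta>\<^sub>h\<close>.\<close>

lemma Lrep_compose:
  assumes l: "Lrep g \<theta> X \<alpha>" and l': "Lrep h \<theta>' Y \<alpha>'" and \<xi>: "\<xi> \<in> gr h"
  shows "Lrep (g + h) (compose B0 \<theta> \<theta>') (beta D (- h) (X * \<alpha> (beta D h Y) * cocyc \<alpha> (deg_unitary h \<xi>)))
    (compose B0 (tw h \<alpha> (deg_unitary h \<xi>)) \<alpha>')"
proof -
  let ?V = "deg_unitary h \<xi>" let ?c = "cocyc \<alpha> ?V"
  note V = deg_unitary[OF \<xi>]
  note L = LrepD[OF l] and L' = LrepD[OF l']
  note c = cocyc_unitary[OF L(3) V(1)]
  note h = hom_mem[OF L(3)] hom_mult[OF L(3)] hom_adj[OF L(3)] hom_mem[OF L'(3)] un_hom[OF L(3)] L(2) L'(2) c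
  have tE: "tw h \<alpha> ?V \<in> End B0" using tw_fixes_left[OF L(4) \<xi>] by (simp add: fixes_left_def)
  have X: "X * \<alpha> (beta D h Y) * ?c \<in> unitaries B0" by (intro un_mult h un_beta)
  have "compose B0 \<theta> \<theta>' x = beta D (g + h) (beta D (- h) (X * \<alpha> (beta D h Y) * ?c) *
      compose B0 (tw h \<alpha> ?V) \<alpha>' x * adj (beta D (- h) (X * \<alpha> (beta D h Y) * ?c)))" if x: "x \<in> B0" for x
  proof -
    have x': "\<alpha>' x \<in> B0" using h x by simp
    have t: "tw h \<alpha> ?V (\<alpha>' x) \<in> B0" using hom_mem[OF tE] x' by simp
    let ?Z = "X * \<alpha> (beta D h Y) * ?c"
    have "beta D (g + h) (beta D (- h) ?Z * tw h \<alpha> ?V (\<alpha>' x) * adj (beta D (- h) ?Z))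
        = beta D g (beta D h (beta D (- h) ?Z * tw h \<alpha> ?V (\<alpha>' x) * adj (beta D (- h) ?Z)))"
      using X t by (simp add: un)
    also have "\<dots> = beta D g (?Z * beta D h (tw h \<alpha> ?V (\<alpha>' x)) * adj ?Z)"
      using X t by (simp add: un beta_simps del: adj_mult)
    also have "\<dots> = beta D g (X * \<alpha> (beta D h (Y * \<alpha>' x * adj Y)) * adj X)"
      unfolding tw_eq[OF L(3) V(1) x'] using x' by (simp add: h un un_beta beta_simps mult.assoc)
    also have "\<dots> = \<theta> (\<theta>' x)" using x x' by (simp add: L(6) L'(6) h un)
    finally show ?thesis using x by (simp add: compose_def)
  qed
  moreover have "fixes_left (compose B0 (tw h \<alpha> ?V) \<alpha>')"
    using tw_fixes_left[OF L(4) \<xi>] L'(5) B0.comp_End[OF L'(3) tE] by (simp add: fixes_left_def compose_eq)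
  ultimately show ?thesis unfolding Lrep_def using B0.comp_End[OF L'(1) L(1)] un_beta[OF X] by blast
qed

text \<open>The same exchange as for products, now with the rightmost factor
  \<open>beta D (- k)\<close> of the translated endomorphism, followed by the outer
  \<open>beta D k\<close>.\<close>

lemma Lrep_gact:
  assumes l: "Lrep g \<theta> X \<alpha>" and \<xi>: "\<xi> \<in> gr (- k)"
  shows "Lrep (k + g - k) (gact D k \<theta>) (beta D k (X * cocyc \<alpha> (deg_unitary (- k) \<xi>))) (tw (- k) \<alpha> (deg_unitary (- k) \<xi>))"
proof -
  let ?V = "deg_unitary (- k) \<xi>" let ?c = "cocyc \<alpha> ?V"
  note V = deg_unitary[OF \<xi>]
  note L = LrepD[OF l]
  note c = cocyc_unitary[OF L(3) V(1)]
  note h = hom_mem[OF L(3)] hom_mult[OF L(3)] hom_adj[OF L(3)] un_hom[OF L(3)] L(2) c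
  have X: "X * ?c \<in> unitaries B0" by (intro un_mult h)
  have tE: "tw (- k) \<alpha> ?V \<in> End B0" using tw_fixes_left[OF L(4) \<xi>] by (simp add: fixes_left_def)
  have "gact D k \<theta> x = beta D (k + g - k) (beta D k (X * ?c) * tw (- k) \<alpha> ?V x * adj (beta D k (X * ?c)))" if x: "x \<in> B0" for x
  proof -
    have t: "tw (- k) \<alpha> ?V x \<in> B0" using hom_mem[OF tE x] .
    have "beta D (k + g - k) (beta D k (X * ?c) * tw (- k) \<alpha> ?V x * adj (beta D k (X * ?c)))
      = beta D (k + g) (beta D (- k) (beta D k (X * ?c) * tw (- k) \<alpha> ?V x * adj (beta D k (X * ?c))))"
      using X t by (simp add: un diff_conv_add_uminus add.assoc del: add_uminus_conv_diff)
    also have "\<dots> = beta D (k + g) (X * ?c * beta D (- k) (tw (- k) \<alpha> ?V x) * adj (X * ?c))"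
      using X t by (simp add: un beta_simps del: adj_mult)
    also have "\<dots> = beta D (k + g) (X * \<alpha> (beta D (- k) x) * adj X)"
      unfolding tw_eq[OF L(3) V(1) x] using x by (simp add: h un mult.assoc)
    also have "\<dots> = gact D k \<theta> x" using x by (simp add: L(6) h un)
    finally show ?thesis by simp
  qed
  then show ?thesis unfolding Lrep_def using gact_End[OF L(1)] un_beta[OF X] tw_fixes_left[OF L(4) \<xi>] by blast
qed

text \<open>\<open>h[\<rho>]\<close> is inner on \<open>1 \<otimes> M\<^sup>o\<^sup>p\<close>, implemented by the value of the braiding of the unitary of
  degree \<open>h\<close> with \<open>\<rho>\<close>.\<close>

definition gv where "gv h \<rho> V = gact D h \<rho> V * adj V"

lemma gv_unitary: "\<rho> \<in> End B0 \<Longrightarrow> V \<in> unitaries B0 \<Longrightarrow> gv h \<rho> V \<in> unitaries B0"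
  unfolding gv_def by (intro un_mult un_adj un_hom[OF gact_End])

lemma gact_fixes_right:
  assumes \<rho>: "fixes_right \<rho>" and \<xi>: "\<xi> \<in> gr h"
  shows "fixes_right (Ad B0 (adj (gv h \<rho> (deg_unitary h \<xi>))) (gact D h \<rho>))"
proof -
  let ?V = "deg_unitary h \<xi>" let ?w = "gv h \<rho> ?V"
  note V = deg_unitary[OF \<xi>]
  have \<rho>E: "\<rho> \<in> End B0" and \<rho>r: "\<And>y. y \<in> M \<Longrightarrow> \<rho> (el D 1 y) = el D 1 y" using \<rho> by (auto simp: fixes_right_def)
  note gE = gact_End[OF \<rho>E, of h]
  note w = gv_unitary[OF \<rho>E V(1), of h]
  note g = hom_mem[OF gE] hom_mult[OF gE] hom_adj[OF gE] un_hom[OF gE]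
  have "Ad B0 (adj ?w) (gact D h \<rho>) (el D 1 y) = el D 1 y" if y: "y \<in> M" for y
  proof -
    have cy: "cj \<xi> y \<in> M" using gr_C[OF \<xi>] y by simp
    \<comment> \<open>The translate h[\<rho>] fixes \<open>\<beta>\<^sub>h\<close>(1 \<otimes>
      M^op), and V moves 1 \<otimes> M^op into this algebra. So the relation between V and 1
      \<otimes> M^op is carried by h[\<rho>] to one that differs only in V and in the left
      factor.\<close>
    have fx: "gact D h \<rho> (beta D h (el D 1 (cj \<xi> y))) = beta D h (el D 1 (cj \<xi> y))" using cy by (simp add: \<rho>r)
    have "gact D h \<rho> (el D 1 y * ?V) = gact D h \<rho> (?V * beta D h (el D 1 (cj \<xi> y)))" using V(3)[OF y] by simp
    then have "gact D h \<rho> (el D 1 y) * gact D h \<rho> ?V = gact D h \<rho> ?V * beta D h (el D 1 (cj \<xi> y))"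
      using V(1) y cy fx un(1)[OF V(1)] by (simp add: g del: gact_app)
    moreover have "beta D h (el D 1 (cj \<xi> y)) * adj ?V = adj ?V * el D 1 y"
    proof -
      have "adj ?V * (el D 1 y * ?V) * adj ?V = adj ?V * (?V * beta D h (el D 1 (cj \<xi> y))) * adj ?V" using V(3)[OF y] by simp
      then show ?thesis using V(1) by (simp add: mult.assoc un)
    qed
    ultimately have "gact D h \<rho> (el D 1 y) * ?w = ?w * el D 1 y" unfolding gv_def by (intro mult_swap[symmetric]) (erule sym)+
    then have "adj ?w * (gact D h \<rho> (el D 1 y) * ?w) = el D 1 y" using w by (simp add: un del: gact_app)
    then show ?thesis using y by (simp add: Ad_app mult.assoc del: gact_app)
  qed
  then show ?thesis unfolding fixes_right_def using Ad_End[OF gE un_adj[OF w]] by blast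
qed

lemma Rrep_gact:
  assumes r: "Rrep \<theta> v \<rho>" and \<xi>: "\<xi> \<in> gr h"
  shows "Rrep (gact D h \<theta>) (beta D h v * gv h \<rho> (deg_unitary h \<xi>)) (Ad B0 (adj (gv h \<rho> (deg_unitary h \<xi>))) (gact D h \<rho>))"
proof -
  let ?w = "gv h \<rho> (deg_unitary h \<xi>)"
  note R = RrepD[OF r]
  have w: "?w \<in> unitaries B0" by (rule gv_unitary[OF R(3) deg_unitary(1)[OF \<xi>]])
  have "gact D h \<theta> x = beta D h v * ?w * Ad B0 (adj ?w) (gact D h \<rho>) x * adj (beta D h v * ?w)" if x: "x \<in> B0" for x
    using x w R(2) by (simp add: Ad_app R(6) beta_simps un hom_mem[OF R(3)] mult.assoc)
  then show ?thesis unfolding Rrep_def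
    using gact_End[OF R(1)] un_mult[OF un_beta[OF R(2)] w] gact_fixes_right[OF R(4) \<xi>] by blast
qed

lemma eps_BF2:
  assumes l: "Lrep g \<theta> X \<alpha>" and l': "Lrep h \<theta>' Y \<alpha>'" and r: "Rrep \<eta> v \<rho>" and \<xi>: "\<xi> \<in> gr h"
  defines "V \<equiv> deg_unitary h \<xi>"
  shows "beta D g (eps X \<alpha> (beta D h v * gv h \<rho> V) (Ad B0 (adj (gv h \<rho> V)) (gact D h \<rho>))) * \<theta> (beta D h (eps Y \<alpha>' v \<rho>))
    = beta D (g + h) (eps (beta D (- h) (X * \<alpha> (beta D h Y) * cocyc \<alpha> V)) (compose B0 (tw h \<alpha> V) \<alpha>') v \<rho>)"
proof -
  note V = deg_unitary[OF \<xi>, folded V_def]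
  note L = LrepD[OF l] and L' = LrepD[OF l'] and R = RrepD[OF r]
  let ?c = "cocyc \<alpha> V" let ?w = "gv h \<rho> V"
  define \<tau> where "\<tau> = Ad B0 (adj ?w) (gact D h \<rho>)"
  have fr: "fixes_right \<tau>" unfolding \<tau>_def V_def by (rule gact_fixes_right[OF R(4) \<xi>])
  have \<tau>E: "\<tau> \<in> End B0" using fr by (simp add: fixes_right_def)
  have w: "?w \<in> unitaries B0" by (rule gv_unitary[OF R(3) V(1)])
  have c: "?c \<in> unitaries B0" by (rule cocyc_unitary[OF L(3) V(1)])
  have gr\<tau>: "gact D h \<rho> x = ?w * \<tau> x * adj ?w" if "x \<in> B0" for x
    unfolding \<tau>_def using that w by (simp add: Ad_app mult.assoc un del: gact_app)
  have \<rho>\<tau>: "beta D h (\<rho> x) = ?w * \<tau> (beta D h x) * adj ?w" if "x \<in> B0" for x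
    using gr\<tau>[of "beta D h x"] that by simp
  note h = hom_mem[OF L(3)] hom_mult[OF L(3)] hom_adj[OF L(3)] hom_mem[OF L'(3)] hom_adj[OF L'(3)] hom_mem[OF R(3)]
    hom_mem[OF \<tau>E] hom_mult[OF \<tau>E] hom_adj[OF \<tau>E] un_hom[OF L(3)] un_hom[OF L'(3)] un_hom[OF R(3)] un_hom[OF \<tau>E]
    L(2) L'(2) R(2) c w V(1)
  have \<tau>V: "\<tau> V = V * ?w"
  proof -
    have "?w * V = gact D h \<rho> V" using V(1) by (simp add: gv_def mult.assoc un del: gact_app)
    also have "\<dots> = ?w * \<tau> V * adj ?w" by (rule gr\<tau>[OF un(1)[OF V(1)]])
    finally have "adj ?w * (?w * V) * ?w = adj ?w * (?w * \<tau> V * adj ?w) * ?w" by simp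
    then show ?thesis using w by (simp add: mult.assoc un)
  qed
  have key: "\<tau> ?c * adj ?w * adj ?c = \<alpha> (adj ?w)"
  proof -
    have "\<tau> ?c = \<alpha> (adj (\<tau> V)) * \<tau> V"
      unfolding cocyc_def using V(1) by (simp add: h un un_adj fixes_commute[OF L(4) fr])
    then show ?thesis unfolding \<tau>V cocyc_def using V(1) w by (simp add: h un un_adj mult.assoc)
  qed
  have "beta D g (eps X \<alpha> (beta D h v * ?w) \<tau>) * \<theta> (beta D h (eps Y \<alpha>' v \<rho>))
      = beta D g (eps X \<alpha> (beta D h v * ?w) \<tau> * (X * \<alpha> (beta D h (eps Y \<alpha>' v \<rho>)) * adj X))"
  proof -
    have "eps Y \<alpha>' v \<rho> \<in> B0" using eps_unitary[OF l' r] un by blast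
    moreover have "eps X \<alpha> (beta D h v * ?w) \<tau> \<in> B0" unfolding eps_def using h un un_beta by simp
    ultimately show ?thesis using L(6) by (simp add: beta_simps h un)
  qed
  also have "eps X \<alpha> (beta D h v * ?w) \<tau> * (X * \<alpha> (beta D h (eps Y \<alpha>' v \<rho>)) * adj X)
      = beta D h v * ?w * \<tau> X * \<alpha> (\<tau> (beta D h Y)) * \<alpha> (adj ?w) * \<alpha> (beta D h (\<alpha>' (adj v))) * \<alpha> (beta D h (adj Y)) * adj X"
    unfolding eps_def by (simp add: h un un_adj un_beta beta_simps \<rho>\<tau> mult.assoc)
  also have "\<dots> = beta D h (eps (beta D (- h) (X * \<alpha> (beta D h Y) * ?c)) (compose B0 (tw h \<alpha> V) \<alpha>') v \<rho>)"
  proof -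
    let ?Z = "X * \<alpha> (beta D h Y) * ?c"
    have Z: "?Z \<in> unitaries B0" by (intro un_mult h un_beta)
    have twE: "tw h \<alpha> V \<in> End B0" using tw_fixes_left[OF L(4) \<xi>] by (simp add: fixes_left_def V_def)
    have av: "\<alpha>' (adj v) \<in> B0" using h un by simp
    have "beta D h (eps (beta D (- h) ?Z) (compose B0 (tw h \<alpha> V) \<alpha>') v \<rho>)
      = beta D h v * beta D h (\<rho> (beta D (- h) ?Z)) * beta D h (tw h \<alpha> V (\<alpha>' (adj v))) * beta D h (adj (beta D (- h) ?Z))"
      unfolding eps_def using Z av hom_mem[OF twE av] by (simp add: beta_simps h un un_beta compose_def mult.assoc del: adj_mult)
    also have "beta D h (\<rho> (beta D (- h) ?Z)) = ?w * \<tau> ?Z * adj ?w"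
      using \<rho>\<tau>[of "beta D (- h) ?Z"] Z by (simp add: un del: adj_mult)
    also have "beta D h (tw h \<alpha> V (\<alpha>' (adj v))) = adj ?c * \<alpha> (beta D h (\<alpha>' (adj v))) * ?c"
      by (rule tw_eq[OF L(3) V(1) av])
    also have "beta D h (adj (beta D (- h) ?Z)) = adj ?Z" using Z by (simp add: beta_simps un del: adj_mult)
    finally have "beta D h (eps (beta D (- h) ?Z) (compose B0 (tw h \<alpha> V) \<alpha>') v \<rho>)
      = beta D h v * ?w * \<tau> X * \<alpha> (\<tau> (beta D h Y)) * (\<tau> ?c * adj ?w * adj ?c) * \<alpha> (beta D h (\<alpha>' (adj v))) * \<alpha> (beta D h (adj Y)) * adj X"
      using av by (simp add: h un un_adj un_beta beta_simps fixes_commute[OF L(4) fr] mult.assoc)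
    then show ?thesis unfolding key by simp
  qed
  finally have "beta D g (eps X \<alpha> (beta D h v * ?w) \<tau>) * \<theta> (beta D h (eps Y \<alpha>' v \<rho>))
      = beta D g (beta D h (eps (beta D (- h) (X * \<alpha> (beta D h Y) * ?c)) (compose B0 (tw h \<alpha> V) \<alpha>') v \<rho>))" .
  moreover have "eps (beta D (- h) (X * \<alpha> (beta D h Y) * ?c)) (compose B0 (tw h \<alpha> V) \<alpha>') v \<rho> \<in> B0"
    using eps_unitary[OF Lrep_compose[OF l l' \<xi>] r] un(1) unfolding V_def by blast
  ultimately show ?thesis unfolding \<tau>_def by simp
qed

text \<open>The translates use two auxiliary objects, of degrees -k and k, and their contributions
  must cancel. With W' = \<open>beta D (- k) W\<close> the product V W' equals
  \<open>L \<xi> * L \<zeta>\<close>, which moves 1 \<otimes> M^op into itself. Hence z = \<rho>(V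
  W')(V W')^* lies in M \<otimes> 1 and is fixed by \<alpha>; this is the identity
  \<open>key\<close> that removes both corrections.\<close>

lemma eps_BF3:
  assumes l: "Lrep g \<theta> X \<alpha>" and r: "Rrep \<eta> v \<rho>" and \<xi>: "\<xi> \<in> gr (- k)" and \<zeta>: "\<zeta> \<in> gr k"
  defines "V \<equiv> deg_unitary (- k) \<xi>" and "W \<equiv> deg_unitary k \<zeta>"
  shows "beta D (k + g - k) (eps (beta D k (X * cocyc \<alpha> V)) (tw (- k) \<alpha> V)
      (beta D k v * gv k \<rho> W) (Ad B0 (adj (gv k \<rho> W)) (gact D k \<rho>))) = beta D k (beta D g (eps X \<alpha> v \<rho>))"
proof -
  note V = deg_unitary[OF \<xi>, folded V_def] and W = deg_unitary[OF \<zeta>, folded W_def]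
  note L = LrepD[OF l] and R = RrepD[OF r]
  let ?c = "cocyc \<alpha> V" let ?w = "gv k \<rho> W" let ?W = "beta D (- k) W"
  define y where "y = \<rho> ?W * adj ?W"
  have c: "?c \<in> unitaries B0" by (rule cocyc_unitary[OF L(3) V(1)])
  have w: "?w \<in> unitaries B0" by (rule gv_unitary[OF R(3) W(1)])
  note h = hom_mem[OF L(3)] hom_mult[OF L(3)] hom_adj[OF L(3)] hom_mem[OF R(3)] hom_mult[OF R(3)] hom_adj[OF R(3)]
    un_hom[OF L(3)] un_hom[OF R(3)] L(2) R(2) c w V(1) W(1)
  have y: "y \<in> unitaries B0" unfolding y_def by (intro un_mult un_hom[OF R(3)] un_adj un_beta W(1))
  have yw: "beta D (- k) ?w = y" unfolding gv_def y_def using W(1) by (simp add: beta_simps h un un_beta)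
  have "\<exists>x\<in>M. \<rho> (V * ?W) * adj (V * ?W) = el D x 1"
  proof (rule fixes_right_mult[OF R(4)])
    show "V * ?W \<in> unitaries B0" by (intro un_mult un_beta h)
    fix z assume z: "z \<in> M"
    have VW: "V * ?W = L \<xi> * L \<zeta>"
      using un(1)[OF W(1)] unfolding V_def W_def by (simp add: deg_unitary_def beta_eq mult.assoc u_mult u_mult')
    have C: "\<xi> \<in> C" "\<zeta> \<in> C" using gr_C \<xi> \<zeta> by auto
    have "el D 1 z * (L \<xi> * L \<zeta>) = L \<xi> * L \<zeta> * el D 1 (cj \<zeta> (cj \<xi> z))"
      by (rule mult_swap[OF L_right[OF C(2), symmetric] L_right[OF C(1) z, symmetric], symmetric]) (use z C in simp)
    then show "cj \<zeta> (cj \<xi> z) \<in> M \<and> el D 1 z * (V * ?W) = V * ?W * el D 1 (cj \<zeta> (cj \<xi> z))" using VW z C by simp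
  qed
  then obtain x where x: "x \<in> M" "\<rho> (V * ?W) * adj (V * ?W) = el D x 1" by blast
  define z where "z = \<rho> (V * ?W) * adj (V * ?W)"
  have \<alpha>z: "\<alpha> z = z" using L(5) x by (simp add: z_def)
  have zB: "z \<in> B0" using x by (simp add: z_def)
  have z: "z = \<rho> V * y * adj V" unfolding z_def y_def by (simp add: h un un_beta mult.assoc)
  have key: "\<rho> ?c * y * adj ?c * \<alpha> (adj y) = 1"
  proof -
    have "\<rho> ?c * y * adj ?c * \<alpha> (adj y) = \<alpha> (adj (\<rho> V)) * z * \<alpha> (V * adj y)"
      unfolding z cocyc_def using y by (simp add: h un un_adj fixes_commute[OF L(4) R(4), symmetric] mult.assoc)
    also have "\<dots> = \<alpha> (adj (\<rho> V) * z * (V * adj y))"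
      using zB y by (simp add: h un un_adj \<alpha>z)
    also have "adj (\<rho> V) * z * (V * adj y) = 1" unfolding z using y by (simp add: h un mult.assoc)
    finally show ?thesis by (simp add: hom_one[OF L(3)])
  qed
  let ?e = "eps (beta D k (X * ?c)) (tw (- k) \<alpha> V) (beta D k v * ?w) (Ad B0 (adj ?w) (gact D k \<rho>))"
  have vw: "beta D k v * ?w \<in> unitaries B0" by (intro un_mult un_beta h)
  have Xc: "X * ?c \<in> unitaries B0" by (intro un_mult h)
  have eu: "?e \<in> unitaries B0"
    using eps_unitary[OF Lrep_gact[OF l \<xi>] Rrep_gact[OF r \<zeta>]] unfolding V_def W_def .
  have twE: "tw (- k) \<alpha> V \<in> End B0" using tw_fixes_left[OF L(4) \<xi>] by (simp add: fixes_left_def V_def)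
  have 1: "beta D k v * ?w * Ad B0 (adj ?w) (gact D k \<rho>) (beta D k (X * ?c)) = beta D k (v * \<rho> (X * ?c)) * ?w"
    using Xc w by (simp add: Ad_app un h beta_simps mult.assoc)
  have 2: "beta D (- k) (tw (- k) \<alpha> V (adj (beta D k v * ?w))) = adj ?c * \<alpha> (adj y * adj v) * ?c"
    unfolding tw_eq[OF L(3) V(1) un(1)[OF un_adj[OF vw]]] using w by (simp add: beta_simps un un_adj h un_beta yw)
  have "beta D (- k) ?e = v * \<rho> (X * ?c) * y * (adj ?c * \<alpha> (adj y * adj v) * ?c) * adj (X * ?c)"
  proof -
    have "?e = beta D k (v * \<rho> (X * ?c)) * ?w * tw (- k) \<alpha> V (adj (beta D k v * ?w)) * adj (beta D k (X * ?c))"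
      unfolding eps_def 1 ..
    moreover have "tw (- k) \<alpha> V (adj (beta D k v * ?w)) \<in> B0" using hom_mem[OF twE] un_adj[OF vw] un(1) by blast
    moreover have "v * \<rho> (X * ?c) \<in> B0" using Xc h un by simp
    ultimately show ?thesis using Xc w 2 by (simp add: hom_mult[OF beta_End] hom_adj[OF beta_End, symmetric] un yw del: adj_mult)
  qed
  also have "\<dots> = v * \<rho> X * (\<rho> ?c * y * adj ?c * \<alpha> (adj y)) * \<alpha> (adj v) * adj X"
    using y by (simp add: h un un_adj mult.assoc)
  finally have e: "beta D (- k) ?e = eps X \<alpha> v \<rho>" unfolding key eps_def by (simp add: mult.assoc)
  have "beta D (k + g - k) ?e = beta D k (beta D g (beta D (- k) ?e))"
    using eu by (simp add: un diff_conv_add_uminus add.assoc del: add_uminus_conv_diff)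
  then show ?thesis unfolding e .
qed

lemma el_right_inj: "y \<in> M \<Longrightarrow> y' \<in> M \<Longrightarrow> el D 1 y = el D 1 y' \<Longrightarrow> y = y'"
proof -
  assume y: "y \<in> M" "y' \<in> M" and "el D 1 y = el D 1 y'"
  then have "tensor_op (\<lambda>b a. tn a b) (j y) 1 = tensor_op (\<lambda>b a. tn a b) (j y') 1" using incl_inj by (simp add: el_eq swap_tensor_op)
  then have "S.slice a a (tensor_op (\<lambda>b a. tn a b) (j y) 1) = S.slice a a (tensor_op (\<lambda>b a. tn a b) (j y') 1)" for a by (rule arg_cong)
  then have "scaleOp (cinner a a) (j y) = scaleOp (cinner a a) (j y')" for a :: 'h by (simp only: S.slice_tensor app_one)
  moreover obtain a :: 'h where "norm a = 1" using hilbert_nontrivial(1) by blast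
  then have "cinner a a = 1" by (simp add: cinner_self)
  ultimately have "scaleOp 1 (j y) = scaleOp 1 (j y')" by metis
  then show ?thesis using j_inj[OF y] by simp
qed

section \<open>The unitaries \<open>V\<^sub>\<sigma>\<close>\<close>

text \<open>The sum is a projection commuting with \<open>1 \<otimes> M\<^sup>o\<^sup>p\<close>, hence of the form \<open>x \<otimes> 1\<close>, and \<open>x w\<^sub>k = w\<^sub>k\<close> for
  all \<open>k\<close>. This avoids the \<open>\<sigma>\<close>-weak continuity of \<open>x \<mapsto> x \<otimes> 1\<close>.\<close>

lemma isometry_family_el_left:
  assumes "isometry_family M K w"
  shows "strong_sum (\<lambda>k. el D (w k) 1 * adj (el D (w k) 1)) K 1"
proof -
  have w: "\<And>k. k \<in> K \<Longrightarrow> w k \<in> M" "\<And>k. k \<in> K \<Longrightarrow> adj (w k) * w k = 1" "strong_sum (\<lambda>k. w k * adj (w k)) K 1"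
    using assms by (auto simp: isometry_family_def isometries_def)
  let ?f = "\<lambda>k. el D (w k) 1 * adj (el D (w k) 1)"
  have iso: "adj (el D (w k) 1) * el D (w k) 1 = 1" if "k \<in> K" for k using w(1,2)[OF that] by (simp add: el_adj el_mult)
  have "\<exists>r. strong_sum ?f K r \<and> adj r = r \<and> r * r = r \<and> (\<forall>k\<in>K. r * ?f k = ?f k \<and> ?f k * r = ?f k)"
  proof (rule projections_strong_sum)
    show "adj (?f k) = ?f k \<and> ?f k * ?f k = ?f k" if "k \<in> K" for k by (rule isometry_projection[OF iso[OF that]])
    fix k l assume kl: "k \<in> K" "l \<in> K" "k \<noteq> l"
    then show "?f k * ?f l = 0" using isometries_orthogonal[OF w(2,3) kl] w(1)
      by (simp add: el_adj el_mult mult.assoc) (simp add: el_zero_left flip: mult.assoc)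
  qed
  then obtain r where r: "strong_sum ?f K r" "\<And>k. k \<in> K \<Longrightarrow> r * ?f k = ?f k" by blast
  have "\<exists>x\<in>M. r = el D x 1"
  proof (rule commutant_right)
    show "r \<in> B0" by (rule B0.strong_sum_mem[OF r(1)]) (simp add: w)
    fix y assume y: "y \<in> M"
    have "r \<in> commutant {el D 1 y}"
      by (rule commutant_strong_sum[OF r(1)]) (use y w(1) in \<open>simp add: commutant_def el_adj el_mult\<close>)
    then show "r * el D 1 y = el D 1 y * r" by (simp add: commutant_def)
  qed
  then obtain x where x: "x \<in> M" "r = el D x 1" by blast
  have "(x - 1) * w k = 0" if k: "k \<in> K" for k
  proof -
    have "r * el D (w k) 1 = r * ?f k * el D (w k) 1" by (simp add: mult.assoc iso[OF k])
    also have "\<dots> = el D (w k) 1" using r(2)[OF k] by (simp add: mult.assoc iso[OF k])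
    finally have "el D (x * w k) 1 = el D (w k) 1" using x w(1)[OF k] by (simp add: el_mult)
    then show ?thesis using el_left_inj[of "x * w k" "w k"] x w(1)[OF k] by (simp add: left_diff_distrib)
  qed
  then have "x - 1 = 0" by (rule strong_sum_total[OF w(3)])
  then show ?thesis using r(1) x by simp
qed

lemma isometry_family_el_right:
  assumes "isometry_family M K w"
  shows "strong_sum (\<lambda>k. el D 1 (w k) * adj (el D 1 (w k))) K 1"
proof -
  have w: "\<And>k. k \<in> K \<Longrightarrow> w k \<in> M" "\<And>k. k \<in> K \<Longrightarrow> adj (w k) * w k = 1" "strong_sum (\<lambda>k. w k * adj (w k)) K 1"
    using assms by (auto simp: isometry_family_def isometries_def)
  let ?f = "\<lambda>k. el D 1 (w k) * adj (el D 1 (w k))"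
  have iso: "adj (el D 1 (w k)) * el D 1 (w k) = 1" if "k \<in> K" for k using w(1,2)[OF that] by (simp add: el_adj el_mult)
  have "j 0 = 0" using j_scale[of 0 0] by simp
  then have el0: "el D 1 0 = 0" using S.tensor_op_scale_left[of 0 0 1] zero_A by (simp add: el_eq flip: swap_tensor_op)
  have "\<exists>r. strong_sum ?f K r \<and> adj r = r \<and> r * r = r \<and> (\<forall>k\<in>K. r * ?f k = ?f k \<and> ?f k * r = ?f k)"
  proof (rule projections_strong_sum)
    show "adj (?f k) = ?f k \<and> ?f k * ?f k = ?f k" if "k \<in> K" for k by (rule isometry_projection[OF iso[OF that]])
    fix k l assume kl: "k \<in> K" "l \<in> K" "k \<noteq> l"
    then show "?f k * ?f l = 0" using isometries_orthogonal[OF w(2,3) kl] w(1)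
      by (simp add: el_adj el_mult mult.assoc) (simp add: el0 flip: mult.assoc)
  qed
  then obtain r where r: "strong_sum ?f K r" "\<And>k. k \<in> K \<Longrightarrow> r * ?f k = ?f k" by blast
  have "\<exists>y\<in>M. r = el D 1 y"
  proof (rule commutant_left)
    show "r \<in> B0" by (rule B0.strong_sum_mem[OF r(1)]) (simp add: w)
    fix x assume x: "x \<in> M"
    have "r \<in> commutant {el D x 1}"
      by (rule commutant_strong_sum[OF r(1)]) (use x w(1) in \<open>simp add: commutant_def el_adj el_mult\<close>)
    then show "r * el D x 1 = el D x 1 * r" by (simp add: commutant_def)
  qed
  then obtain y where y: "y \<in> M" "r = el D 1 y" by blast
  have "(y - 1) * w k = 0" if k: "k \<in> K" for k
  proof -
    have "r * el D 1 (w k) = r * ?f k * el D 1 (w k)" by (simp add: mult.assoc iso[OF k])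
    also have "\<dots> = el D 1 (w k)" using r(2)[OF k] by (simp add: mult.assoc iso[OF k])
    finally have "el D 1 (y * w k) = el D 1 (w k)" using y w(1)[OF k] by (simp add: el_mult)
    then show ?thesis using el_right_inj[of "y * w k" "w k"] y w(1)[OF k] by (simp add: left_diff_distrib)
  qed
  then have "y - 1 = 0" by (rule strong_sum_total[OF w(3)])
  then show ?thesis using r(1) y by simp
qed

lemma Vfin_eq: "Vfin D g \<sigma> = deg_unitary g \<sigma>"
  by (simp add: Vfin_def deg_unitary_def L_def u_adj mult.assoc)

definition implements where "implements g \<sigma> V \<longleftrightarrow> V \<in> unitaries B0 \<and>
  (\<forall>x\<in>M. V * beta D g (el D x 1) = el D (\<sigma> x) 1 * V)"

lemma implements_deg_unitary: "\<sigma> \<in> gr g \<Longrightarrow> implements g \<sigma> (deg_unitary g \<sigma>)"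
  by (simp add: implements_def deg_unitary)

text \<open>Each term is \<open>p k * adj (q k)\<close> for two complete orthogonal families of
  isometries, so \<open>strong_sum_isometries\<close> applies. The intertwining relation is tested
  on the \<open>q k\<close>, which commute with \<open>\<beta>\<^sub>g\<close>(M \<otimes> 1); there
  it reduces to the relation for a single \<xi>.\<close>

lemma direct_sum_V:
  assumes ds: "direct_sum M K w \<xi> \<sigma>" and \<xi>: "\<And>k. k \<in> K \<Longrightarrow> \<xi> k \<in> gr g" and v: "isometry_family M K v"
  shows "\<exists>V. strong_sum (\<lambda>k. el D (w k) 1 * Vfin D g (\<xi> k) * beta D g (el D 1 (adj (v k)))) K V \<and> implements g \<sigma> V"
proof -
  have w: "isometry_family M K w" and \<sigma>: "\<sigma> \<in> End M" using ds by (auto simp: direct_sum_def)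
  have wM: "\<And>k. k \<in> K \<Longrightarrow> w k \<in> M" "\<And>k. k \<in> K \<Longrightarrow> adj (w k) * w k = 1"
    and vM: "\<And>k. k \<in> K \<Longrightarrow> v k \<in> M" "\<And>k. k \<in> K \<Longrightarrow> adj (v k) * v k = 1"
    using w v by (auto simp: isometry_family_def isometries_def)
  define p where "p k = el D (w k) 1 * deg_unitary g (\<xi> k)" for k
  define q where "q k = beta D g (el D 1 (v k))" for k
  note dV = deg_unitary[OF \<xi>]
  have p1: "adj (p k) * p k = 1" if "k \<in> K" for k
    using wM[OF that] dV(1)[OF that] by (simp add: p_def mult.assoc) (simp add: el_adj el_mult' un)
  have p2: "strong_sum (\<lambda>k. p k * adj (p k)) K 1"
    by (rule strong_sum_eq[OF isometry_family_el_left[OF w]]) (simp add: p_def mult.assoc un[OF dV(1)])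
  have q1: "adj (q k) * q k = 1" if "k \<in> K" for k
    using vM[OF that] by (simp add: q_def el_adj el_mult beta_simps(3) flip: beta_simps(1,2))
  have q2: "strong_sum (\<lambda>k. q k * adj (q k)) K 1"
  proof (rule strong_sum_eq)
    show "strong_sum (\<lambda>k. u g * (el D 1 (v k) * adj (el D 1 (v k))) * u (- g)) K 1"
      using strong_sum_mult_right[OF strong_sum_mult_left[OF isometry_family_el_right[OF v], of "u g"], of "u (- g)"] by (simp add: u_mult)
    show "u g * (el D 1 (v k) * adj (el D 1 (v k))) * u (- g) = q k * adj (q k)" if "k \<in> K" for k
      using vM[OF that] by (simp add: q_def beta_eq u_adj mult.assoc u_mult u_mult')
  qed
  obtain s where s: "strong_sum (\<lambda>k. p k * adj (q k)) K s" "adj s * s = 1" "s * adj s = 1" "\<And>k. k \<in> K \<Longrightarrow> s * q k = p k"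
    using strong_sum_isometries[of K p q, OF p1 p2 q1 q2] by blast
  have pB: "p k \<in> B0" if "k \<in> K" for k using wM[OF that] un(1)[OF dV(1)[OF that]] by (simp add: p_def)
  have qB: "q k \<in> B0" if "k \<in> K" for k using vM[OF that] by (simp add: q_def)
  have sB: "s \<in> B0" by (rule B0.strong_sum_mem[OF s(1)]) (simp add: pB qB)
  have "s * beta D g (el D x 1) = el D (\<sigma> x) 1 * s" if x: "x \<in> M" for x
  proof -
    have "(s * beta D g (el D x 1) - el D (\<sigma> x) 1 * s) * q k = 0" if k: "k \<in> K" for k
    proof -
      have 1: "beta D g (el D x 1) * q k = q k * beta D g (el D x 1)"
        using x vM(1)[OF k] by (simp add: q_def el_mult flip: beta_simps(1,2))
      have "w k * \<xi> k x = \<sigma> x * w k"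
        using M.int_eq[OF M.direct_sum_intertwiner[OF ds k] x] .
      then have 2: "p k * beta D g (el D x 1) = el D (\<sigma> x) 1 * p k"
        using x wM(1)[OF k] dV(2)[OF k x] hom_mem[OF \<sigma> x] C_mem[OF gr_C[OF \<xi>[OF k]] x]
        by (simp add: p_def mult.assoc) (simp add: el_mult flip: mult.assoc)
      have "s * beta D g (el D x 1) * q k = s * q k * beta D g (el D x 1)" by (simp add: mult.assoc 1)
      also have "\<dots> = el D (\<sigma> x) 1 * s * q k" by (simp add: mult.assoc s(4)[OF k] 2)
      finally show ?thesis by (simp add: left_diff_distrib)
    qed
    then have "s * beta D g (el D x 1) - el D (\<sigma> x) 1 * s = 0" by (rule strong_sum_total[OF q2])
    then show ?thesis by simp
  qed
  moreover have "strong_sum (\<lambda>k. el D (w k) 1 * Vfin D g (\<xi> k) * beta D g (el D 1 (adj (v k)))) K s"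
    by (rule strong_sum_eq[OF s(1)]) (simp add: p_def q_def Vfin_eq vM el_adj flip: beta_simps(1,2))
  ultimately show ?thesis using sB s(2,3) by (auto simp: implements_def unitaries_def)
qed

text \<open>The isometry t of an irreducible subobject \<zeta> cannot be orthogonal to all
  \<open>w k\<close>, whose ranges span everything. So \<zeta> has a nonzero intertwiner into some
  summand, which has degree g.\<close>

lemma dsums_deg_gr:
  assumes "\<sigma> \<in> dsums_deg D g" "\<sigma> \<in> C" shows "\<sigma> \<in> gr g"
proof (rule gr_iff[THEN iffD2], intro conjI allI impI)
  fix \<zeta> assume \<zeta>: "irreducible_endo M \<zeta> \<and> subobject M \<zeta> \<sigma>"
  then obtain t where t: "\<zeta> \<in> End M" "t \<in> isometries M" "t \<in> intertwiners M \<zeta> \<sigma>" by (auto simp: subobject_def)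
  obtain K w \<xi> where K: "direct_sum M K w \<xi> \<sigma>" "\<And>k. k \<in> K \<Longrightarrow> \<xi> k \<in> Irr \<inter> gr g"
    using assms(1) by (auto simp: dsums_deg_def)
  have \<sigma>: "\<sigma> \<in> End M" by (rule C_End[OF assms(2)])
  have tot: "strong_sum (\<lambda>k. w k * adj (w k)) K 1" using K(1) by (simp add: direct_sum_def isometry_family_def)
  have "\<exists>k\<in>K. adj t * w k \<noteq> 0"
  proof (rule ccontr)
    assume *: "\<not> (\<exists>k\<in>K. adj t * w k \<noteq> 0)"
    have "adj t = 0" by (rule strong_sum_total[OF tot]) (use * in simp)
    then show False using t(2) M.one_neq_zero by (simp add: isometries_def)
  qed
  then obtain k where k: "k \<in> K" "adj t * w k \<noteq> 0" ..
  have \<xi>: "\<xi> k \<in> gr g" "\<xi> k \<in> Irr" using K(2)[OF k(1)] by auto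
  have it: "adj t * w k \<in> intertwiners M (\<xi> k) \<zeta>"
    by (rule M.int_mult[OF M.int_adj[OF t(3,1) \<sigma>] M.direct_sum_intertwiner[OF K(1) k(1)]])
  have "adj (adj t * w k) \<in> intertwiners M \<zeta> (\<xi> k)" by (rule M.int_adj[OF it Irr_End[OF \<xi>(2)] t(1)])
  moreover have "adj (adj t * w k) \<noteq> 0" using k(2) by (metis adj_adj adj_zero)
  ultimately show "\<zeta> \<in> gr g" by (rule gr_sub[OF \<xi>(1) conjunct1[OF \<zeta>] t(1)])
qed (rule assms)

lemma is_V_implements:
  assumes "\<sigma> \<in> dsums_deg D g" "is_V D g \<sigma> V" shows "implements g \<sigma> V"
proof (cases "\<sigma> \<in> C")
  case True
  then show ?thesis using assms implements_deg_unitary[OF dsums_deg_gr[OF assms(1) True]] by (simp add: is_V_def Vfin_eq)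
next
  case False
  then obtain K w \<xi> v where *: "direct_sum M K w \<xi> \<sigma>" "\<forall>k\<in>K. \<xi> k \<in> Irr \<inter> gr g" "isometry_family M K v"
    "strong_sum (\<lambda>k. el D (w k) 1 * Vfin D g (\<xi> k) * beta D g (el D 1 (adj (v k)))) K V" using assms(2) by (auto simp: is_V_def)
  obtain V' where V': "strong_sum (\<lambda>k. el D (w k) 1 * Vfin D g (\<xi> k) * beta D g (el D 1 (adj (v k)))) K V'" "implements g \<sigma> V'"
    using direct_sum_V[OF *(1) _ *(3), of g] *(2) by blast
  then show ?thesis using strong_sum_unique[OF *(4) V'(1)] by simp
qed

lemma is_V_exists:
  assumes "\<sigma> \<in> dsums_deg D g" shows "\<exists>V. is_V D g \<sigma> V"
proof (cases "\<sigma> \<in> C")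
  case False
  obtain K w \<xi> where K: "direct_sum M K w \<xi> \<sigma>" "\<forall>k\<in>K. \<xi> k \<in> Irr \<inter> gr g" using assms by (auto simp: dsums_deg_def)
  have w: "isometry_family M K w" using K(1) by (simp add: direct_sum_def)
  obtain V where "strong_sum (\<lambda>k. el D (w k) 1 * Vfin D g (\<xi> k) * beta D g (el D 1 (adj (w k)))) K V"
    using direct_sum_V[OF K(1) _ w, of g] K(2) by blast
  then show ?thesis unfolding is_V_def if_not_P[OF False] using K w by blast
qed (simp add: is_V_def)

section \<open>The relative Drinfeld center\<close>

lemma dsums_iff: "\<sigma> \<in> dsums D \<longleftrightarrow> \<sigma> \<in> End M \<and> generated_by M Irr \<sigma>"
proof
  assume "\<sigma> \<in> dsums D"
  then obtain K w \<xi> where K: "direct_sum M K w \<xi> \<sigma>" "\<And>k. k \<in> K \<Longrightarrow> \<xi> k \<in> Irr" by (auto simp: dsums_def)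
  show "\<sigma> \<in> End M \<and> generated_by M Irr \<sigma>" using M.direct_sum_generated[OF K] K(1) by (simp add: direct_sum_def)
next
  assume *: "\<sigma> \<in> End M \<and> generated_by M Irr \<sigma>"
  obtain \<phi> where "faithful_normal_state M \<phi>" using setting by (auto simp: lr_setting_def)
  from M.generated_direct_sum[OF this conjunct1[OF *] conjunct2[OF *]] show "\<sigma> \<in> dsums D"
    unfolding dsums_def using Irr_irr Irr_End by blast
qed

lemma dsums_deg_iff: "\<sigma> \<in> dsums_deg D g \<longleftrightarrow> \<sigma> \<in> End M \<and> generated_by M (Irr \<inter> gr g) \<sigma>"
proof
  assume "\<sigma> \<in> dsums_deg D g"
  then obtain K w \<xi> where K: "direct_sum M K w \<xi> \<sigma>" "\<And>k. k \<in> K \<Longrightarrow> \<xi> k \<in> Irr \<inter> gr g" by (auto simp: dsums_deg_def)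
  show "\<sigma> \<in> End M \<and> generated_by M (Irr \<inter> gr g) \<sigma>" using M.direct_sum_generated[OF K] K(1) by (simp add: direct_sum_def)
next
  assume *: "\<sigma> \<in> End M \<and> generated_by M (Irr \<inter> gr g) \<sigma>"
  obtain \<phi> where "faithful_normal_state M \<phi>" using setting by (auto simp: lr_setting_def)
  from M.generated_direct_sum[OF this conjunct1[OF *] conjunct2[OF *]] show "\<sigma> \<in> dsums_deg D g"
    unfolding dsums_deg_def using Irr_irr Irr_End by blast
qed

lemma generated_compose_C:
  assumes \<sigma>: "\<sigma> \<in> End M" "generated_by M S1 \<sigma>" "S1 \<subseteq> C" and \<rho>: "\<rho> \<in> End M" "generated_by M S2 \<rho>" "S2 \<subseteq> C"
    and S: "\<And>\<zeta> \<kappa>. \<zeta> \<in> S1 \<Longrightarrow> \<kappa> \<in> S2 \<Longrightarrow> generated_by M S3 (compose M \<zeta> \<kappa>)"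
  shows "generated_by M S3 (compose M \<sigma> \<rho>)"
proof (rule M.generated_compose[OF \<sigma>(1) \<rho>(1) \<sigma>(2) \<rho>(2)])
  show "\<zeta> \<in> End M \<and> (\<exists>\<zeta>'\<in>End M. \<exists>R R'. conjugate_solution M \<zeta> \<zeta>' R R')" if "\<zeta> \<in> S1" for \<zeta>
    using C_sol[of \<zeta>] C_End[of \<zeta>] C_End[OF C_conj, of \<zeta>] that \<sigma>(3) by blast
  show "S2 \<subseteq> End M" using \<rho>(3) C_End by blast
qed (rule S)

lemma dsums_compose: "\<sigma> \<in> dsums D \<Longrightarrow> \<rho> \<in> dsums D \<Longrightarrow> compose M \<sigma> \<rho> \<in> dsums D"
  unfolding dsums_iff using M.comp_End generated_compose_C[of \<sigma> Irr \<rho> Irr Irr] C_generated by (auto simp: subset_iff)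

lemma dsums_deg_compose: "\<sigma> \<in> dsums_deg D g \<Longrightarrow> \<rho> \<in> dsums_deg D h \<Longrightarrow> compose M \<sigma> \<rho> \<in> dsums_deg D (g + h)"
  unfolding dsums_deg_iff
  using M.comp_End generated_compose_C[of \<sigma> "Irr \<inter> gr g" \<rho> "Irr \<inter> gr h" "Irr \<inter> gr (g + h)"] gr_generated gr_comp
  by (auto simp: subset_iff)

lemma gr_dsums_deg: "\<sigma> \<in> gr g \<Longrightarrow> \<sigma> \<in> dsums_deg D g"
  unfolding dsums_deg_iff using gr_generated C_End gr_C by blast

lemma etaD:
  assumes "is_eta D \<sigma> e \<sigma>t"
  shows "\<sigma> \<in> dsums D" "\<sigma> \<in> End M" "fixes_right \<sigma>t" "\<sigma>t \<in> End B0" "\<And>x. x \<in> M \<Longrightarrow> \<sigma>t (el D x 1) = el D (\<sigma> x) 1"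
    "\<exists>\<Phi>\<in>End A. (\<forall>a\<in>A. \<sigma>t (\<iota> a) = \<iota> (\<Phi> a)) \<and> (\<forall>x\<in>M. \<forall>y\<in>M. \<Phi> (tp x y) = tp (\<sigma> x) y)"
proof -
  show d: "\<sigma> \<in> dsums D" using assms by (simp add: is_eta_def half_braiding_def Let_def)
  then show \<sigma>: "\<sigma> \<in> End M" by (simp add: dsums_iff)
  obtain \<Phi> where te: "is_tensor_endo tn M N \<sigma> (id_on N) \<Phi>" and eq: "\<forall>a\<in>A. \<sigma>t (\<iota> a) = \<iota> (\<Phi> a)"
    using assms by (auto simp: is_eta_def)
  have \<Phi>: "\<Phi> \<in> End A" "\<And>x y. x \<in> M \<Longrightarrow> y \<in> M \<Longrightarrow> \<Phi> (tp x y) = tp (\<sigma> x) y"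
    using te by (auto simp: is_tensor_endo_def algA_def)
  then show "\<exists>\<Phi>\<in>End A. (\<forall>a\<in>A. \<sigma>t (\<iota> a) = \<iota> (\<Phi> a)) \<and> (\<forall>x\<in>M. \<forall>y\<in>M. \<Phi> (tp x y) = tp (\<sigma> x) y)"
    using eq by blast
  show E: "\<sigma>t \<in> End B0" using assms by (simp add: is_eta_def)
  have el: "\<sigma>t (el D x y) = el D (\<sigma> x) y" if "x \<in> M" "y \<in> M" for x y using that eq \<Phi>(2) by (simp add: el_eq)
  show "\<sigma>t (el D x 1) = el D (\<sigma> x) 1" if "x \<in> M" for x using that el by simp
  show "fixes_right \<sigma>t" using E el hom_one[OF \<sigma>] by (simp add: fixes_right_def)
qed

text \<open>Multiplication by an element of 1 \<otimes> M^op, which commutes with M \<otimes> 1,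
  turns \<lambda> into the unitary L, and a unitary can be cancelled.\<close>

lemma lm_cancel: "\<pi> \<in> C \<Longrightarrow> x \<in> M \<Longrightarrow> y \<in> M \<Longrightarrow> el D x 1 * lm \<pi> = el D y 1 * lm \<pi> \<Longrightarrow> x = y"
proof -
  assume *: "\<pi> \<in> C" "x \<in> M" "y \<in> M" "el D x 1 * lm \<pi> = el D y 1 * lm \<pi>"
  have eq: "el D z 1 * L \<pi> = el D 1 (adj (R' \<pi>)) * (el D z 1 * lm \<pi>)" if "z \<in> M" for z
    using * that by (simp add: L_def el_mult')
  have "el D x 1 * L \<pi> = el D y 1 * L \<pi>" unfolding eq[OF *(2)] eq[OF *(3)] *(4) ..
  then have "el D x 1 * L \<pi> * adj (L \<pi>) = el D y 1 * L \<pi> * adj (L \<pi>)" by simp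
  then have "el D x 1 = el D y 1" using L_unitary[OF *(1)] by (simp add: mult.assoc)
  then show ?thesis using * el_left_inj by blast
qed

lemma End_el:
  assumes "\<phi> \<in> End B0" "x \<in> M" "y \<in> M" shows "\<phi> (el D x y) = \<phi> (el D x 1) * \<phi> (el D 1 y)"
  using hom_mult[OF assms(1), of "el D x 1" "el D 1 y"] assms(2,3) by (simp add: el_mult)

text \<open>The half braiding is recovered from \<open>\<tau>(L\<^sub>\<pi>) L\<^sub>\<pi>\<^sup>* \<in> M \<otimes> 1\<close>.\<close>

lemma etaI:
  assumes \<tau>: "fixes_right \<tau>" and \<Phi>: "\<Phi> \<in> End A" "\<And>a. a \<in> A \<Longrightarrow> \<tau> (\<iota> a) = \<iota> (\<Phi> a)"
    and \<mu>: "\<mu> \<in> dsums D" "\<And>x. x \<in> M \<Longrightarrow> \<tau> (el D x 1) = el D (\<mu> x) 1"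
  shows "\<exists>e. is_eta D \<mu> e \<tau>"
proof -
  have \<mu>E: "\<mu> \<in> End M" using \<mu>(1) by (simp add: dsums_iff)
  have \<tau>E: "\<tau> \<in> End B0" and \<tau>r: "\<And>y. y \<in> M \<Longrightarrow> \<tau> (el D 1 y) = el D 1 y" using \<tau> by (auto simp: fixes_right_def)
  note h = hom_mem[OF \<tau>E] hom_mult[OF \<tau>E]
  note [simp] = hom_mem[OF \<mu>E]
  have "\<exists>m\<in>M. \<tau> (L \<pi>) = el D m 1 * L \<pi>" if \<pi>: "\<pi> \<in> gr 0" for \<pi>
  proof -
    note U = L_unitaries[OF \<pi>]
    obtain m where m: "m \<in> M" "\<tau> (L \<pi>) * adj (L \<pi>) = el D m 1"
      using fixes_right_mult[OF \<tau> U, of "cj \<pi>"] L_right[OF gr_C[OF \<pi>]] gr_C[OF \<pi>] by auto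
    then show ?thesis using un[OF U] by (metis mult.assoc mult_1_right)
  qed
  then obtain m where m: "\<And>\<pi>. \<pi> \<in> gr 0 \<Longrightarrow> m \<pi> \<in> M" "\<And>\<pi>. \<pi> \<in> gr 0 \<Longrightarrow> \<tau> (L \<pi>) = el D (m \<pi>) 1 * L \<pi>" by metis
  have lmB: "lm \<pi> \<in> B0" if "\<pi> \<in> gr 0" for \<pi> by (rule lm_Bg[OF that])
  have \<tau>lm: "\<tau> (lm \<pi>) = el D (m \<pi>) 1 * lm \<pi>" if \<pi>: "\<pi> \<in> gr 0" for \<pi>
    unfolding lm_L[OF gr_C[OF \<pi>]] using m[OF \<pi>] un(1)[OF L_unitaries[OF \<pi>]] gr_C[OF \<pi>] by (simp add: h \<tau>r mult.assoc)
  have unit: "m \<pi> * adj (m \<pi>) = 1 \<and> adj (m \<pi>) * m \<pi> = 1" if \<pi>: "\<pi> \<in> gr 0" for \<pi>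
  proof -
    note U = L_unitaries[OF \<pi>]
    have "el D (m \<pi>) 1 = \<tau> (L \<pi>) * adj (L \<pi>)" using m[OF \<pi>] by (simp add: mult.assoc un[OF U])
    then have "el D (m \<pi>) 1 \<in> unitaries B0" using un_mult[OF un_hom[OF \<tau>E U] un_adj[OF U]] by simp
    then have "el D (m \<pi> * adj (m \<pi>)) 1 = el D 1 1" "el D (adj (m \<pi>) * m \<pi>) 1 = el D 1 1"
      using m(1)[OF \<pi>] by (simp_all add: unitaries_def el_adj el_mult)
    then show ?thesis using el_left_inj m(1)[OF \<pi>] M.one_mem M.mult_mem M.adj_mem by metis
  qed
  \<comment> \<open>An \<eta>-extension carries the adjoint of the half braiding in front of
    \<lambda>, hence the adjoint here. Each axiom for \<open>?e\<close> results from applying \<tau>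
    to a relation among the \<lambda> and cancelling \<lambda>.\<close>
  let ?e = "\<lambda>\<pi>. adj (m \<pi>)"
  have inter: "m \<pi> * \<pi> (\<mu> x) = \<mu> (\<pi> x) * m \<pi>" if \<pi>: "\<pi> \<in> gr 0" and x: "x \<in> M" for \<pi> x
  proof (rule lm_cancel[OF gr_C[OF \<pi>]])
    have "\<tau> (lm \<pi>) * \<tau> (el D x 1) = \<tau> (el D (\<pi> x) 1) * \<tau> (lm \<pi>)"
      using lm_el[OF gr_C[OF \<pi>] x M.one_mem] gr_C[OF \<pi>] x lmB[OF \<pi>] by (simp flip: h(2))
    then show "el D (m \<pi> * \<pi> (\<mu> x)) 1 * lm \<pi> = el D (\<mu> (\<pi> x) * m \<pi>) 1 * lm \<pi>"
      using x m(1)[OF \<pi>] gr_C[OF \<pi>] lmB[OF \<pi>]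
      by (simp add: h \<tau>lm[OF \<pi>] \<mu>(2) lm_el mult.assoc el_mult')
  qed (use x m(1)[OF \<pi>] gr_C[OF \<pi>] in auto)
  have int: "?e \<pi> \<in> intertwiners M (compose M \<mu> \<pi>) (compose M \<pi> \<mu>)" if \<pi>: "\<pi> \<in> gr 0" for \<pi>
  proof (rule M.intertwinersI)
    show "?e \<pi> \<in> M" using m(1)[OF \<pi>] by simp
    fix x assume x: "x \<in> M"
    have "adj (m \<pi> * \<pi> (\<mu> (adj x))) = adj (\<mu> (\<pi> (adj x)) * m \<pi>)" using inter[OF \<pi>, of "adj x"] x by simp
    then show "?e \<pi> * compose M \<mu> \<pi> x = compose M \<pi> \<mu> x * ?e \<pi>"
      using x gr_C[OF \<pi>] by (simp add: hom_adj[OF \<mu>E] C_adj)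
  qed
  have comp: "?e (compose M \<pi> \<rho>) = \<pi> (?e \<rho>) * ?e \<pi>" if \<pi>: "\<pi> \<in> gr 0" and \<rho>: "\<rho> \<in> gr 0" for \<pi> \<rho>
  proof -
    note C = gr_C[OF \<pi>] gr_C[OF \<rho>]
    have \<pi>\<rho>: "compose M \<pi> \<rho> \<in> gr 0" using gr_comp[OF \<pi> \<rho>] by simp
    have "\<tau> (lm \<pi>) * \<tau> (lm \<rho>) = \<tau> (lm (compose M \<pi> \<rho>))" using lm_mult[OF C] lmB[OF \<pi>] lmB[OF \<rho>] by (simp flip: h(2))
    then have "el D (m \<pi> * \<pi> (m \<rho>)) 1 * lm (compose M \<pi> \<rho>) = el D (m (compose M \<pi> \<rho>)) 1 * lm (compose M \<pi> \<rho>)"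
      using C m(1)[OF \<pi>] m(1)[OF \<rho>] lmB[OF \<pi>] lmB[OF \<rho>]
      by (simp add: h \<tau>lm \<pi> \<rho> \<pi>\<rho> mult.assoc lm_el' lm_mult el_mult')
    then have "m \<pi> * \<pi> (m \<rho>) = m (compose M \<pi> \<rho>)"
      by (rule lm_cancel[OF C_comp[OF C], rotated 2]) (use C m(1)[OF \<pi>] m(1)[OF \<rho>] m(1)[OF \<pi>\<rho>] in auto)
    then show ?thesis using C m(1)[OF \<rho>] by (simp add: C_adj flip: \<open>m \<pi> * \<pi> (m \<rho>) = m (compose M \<pi> \<rho>)\<close>)
  qed
  have nat: "?e \<rho> * \<mu> T = T * ?e \<pi>" if \<pi>: "\<pi> \<in> gr 0" and \<rho>: "\<rho> \<in> gr 0" and T: "T \<in> intertwiners M \<pi> \<rho>" for \<pi> \<rho> T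
  proof -
    note C = gr_C[OF \<pi>] gr_C[OF \<rho>]
    have TM: "T \<in> M" by (rule M.int_mem[OF T])
    have "\<tau> (el D T 1) * \<tau> (lm \<pi>) = \<tau> (el D 1 (adj T)) * \<tau> (lm \<rho>)"
      using lm_int[OF C T] lmB[OF \<pi>] lmB[OF \<rho>] TM by (simp flip: h(2))
    then have "el D (\<mu> T * m \<pi>) 1 * lm \<pi> = el D 1 (adj T) * (el D (m \<rho>) 1 * lm \<rho>)"
      using C m(1)[OF \<pi>] m(1)[OF \<rho>] lmB[OF \<pi>] lmB[OF \<rho>] TM by (simp add: h \<tau>lm \<pi> \<rho> \<tau>r \<mu>(2) el_mult')
    also have "\<dots> = el D (m \<rho>) 1 * (el D 1 (adj T) * lm \<rho>)" using TM m(1)[OF \<rho>] by (simp add: el_mult')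
    also have "\<dots> = el D (m \<rho> * T) 1 * lm \<pi>" unfolding lm_int[OF C T, symmetric] using TM m(1)[OF \<rho>] by (simp add: el_mult')
    finally have "\<mu> T * m \<pi> = m \<rho> * T"
      by (rule lm_cancel[OF C(1), rotated 2]) (use C m(1)[OF \<pi>] m(1)[OF \<rho>] TM in auto)
    then have "?e \<rho> * (\<mu> T * m \<pi>) * ?e \<pi> = ?e \<rho> * (m \<rho> * T) * ?e \<pi>" by simp
    moreover have "?e \<rho> * (m \<rho> * T) * ?e \<pi> = T * ?e \<pi>" using unit[OF \<rho>] by (simp flip: mult.assoc)
    moreover have "?e \<rho> * (\<mu> T * m \<pi>) * ?e \<pi> = ?e \<rho> * \<mu> T" using unit[OF \<pi>] by (simp add: mult.assoc)
    ultimately show ?thesis by simp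
  qed
  have "half_braiding D \<mu> ?e"
    unfolding half_braiding_def Let_def using \<mu>(1) int comp nat unit m(1) by (auto simp: unitaries_def)
  moreover have "\<Phi> (tensor_op tn x y) = tensor_op tn (\<mu> x) y" if xy: "x \<in> M" "y \<in> N" for x y
  proof -
    obtain y' where y': "y' \<in> M" "y = j y'" using j_surj[OF xy(2)] by blast
    have "\<iota> (\<Phi> (tp x y')) = el D (\<mu> x) y'"
      using \<Phi>(2)[of "tp x y'"] xy y' End_el[OF \<tau>E xy(1) y'(1)] by (simp add: \<mu>(2) \<tau>r el_mult) (simp add: el_eq)
    then show ?thesis using y' xy incl_inj hom_mem[OF \<Phi>(1)] by (simp add: el_eq)
  qed
  then have "is_tensor_endo tn M N \<mu> (id_on N) \<Phi>" using \<Phi>(1) by (simp add: is_tensor_endo_def algA_def)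
  ultimately have "is_eta D \<mu> ?e \<tau>"
    unfolding is_eta_def using \<tau>E \<Phi>(2) \<tau>lm by auto
  then show ?thesis by blast
qed

lemma eta_compose:
  assumes "is_eta D \<sigma> e \<sigma>t" "is_eta D \<rho> f \<rho>t"
  shows "\<exists>e'. is_eta D (compose M \<sigma> \<rho>) e' (compose B0 \<sigma>t \<rho>t)"
proof -
  note S = etaD[OF assms(1)] and R = etaD[OF assms(2)]
  obtain \<Phi> where \<Phi>: "\<Phi> \<in> End A" "\<forall>a\<in>A. \<sigma>t (\<iota> a) = \<iota> (\<Phi> a)" using S(6) by blast
  obtain \<Psi> where \<Psi>: "\<Psi> \<in> End A" "\<forall>a\<in>A. \<rho>t (\<iota> a) = \<iota> (\<Psi> a)" using R(6) by blast
  show ?thesis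
  proof (rule etaI)
    show "fixes_right (compose B0 \<sigma>t \<rho>t)"
      using S(3) R(3) B0.comp_End[OF R(4) S(4)] by (simp add: fixes_right_def compose_eq)
    show "compose A \<Phi> \<Psi> \<in> End A" by (rule A.comp_End[OF \<Psi>(1) \<Phi>(1)])
    show "compose B0 \<sigma>t \<rho>t (\<iota> a) = \<iota> (compose A \<Phi> \<Psi> a)" if "a \<in> A" for a
      using that \<Phi> \<Psi> hom_mem[OF \<Psi>(1)] Bg_incl by (simp add: compose_eq)
    show "compose M \<sigma> \<rho> \<in> dsums D" by (rule dsums_compose[OF S(1) R(1)])
    show "compose B0 \<sigma>t \<rho>t (el D x 1) = el D (compose M \<sigma> \<rho> x) 1" if "x \<in> M" for x
      using that S(5) R(5) hom_mem[OF R(2)] by (simp add: compose_eq)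
  qed
qed

lemma fixes_right_induced:
  assumes "fixes_right \<tau>"
  shows "\<exists>\<mu>\<in>extensional M. \<forall>x\<in>M. \<mu> x \<in> M \<and> \<tau> (el D x 1) = el D (\<mu> x) 1"
proof -
  have "\<forall>x\<in>M. \<exists>y\<in>M. \<tau> (el D x 1) = el D y 1" using fixes_right_left[OF assms] by blast
  then obtain f where "\<forall>x\<in>M. f x \<in> M \<and> \<tau> (el D x 1) = el D (f x) 1" by metis
  then show ?thesis by (intro bexI[of _ "restrict f M"]) auto
qed

text \<open>The relation holds on elementary tensors and is multiplicative. It survives
  \<sigma>-weak limits because the image of \<A> consists of the fixed points of E, so membership is
  an equation between continuous maps.\<close>

lemma fixes_right_incl:
  assumes \<tau>: "fixes_right \<tau>" and a: "a \<in> A"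
  shows "\<exists>b\<in>A. \<tau> (\<iota> a) = \<iota> b"
proof -
  have \<tau>E: "\<tau> \<in> End B0" and \<tau>r: "\<And>y. y \<in> M \<Longrightarrow> \<tau> (el D 1 y) = el D 1 y" using \<tau> by (auto simp: fixes_right_def)
  have iB: "\<iota> a \<in> B0" if "a \<in> A" for a using that by (rule Bg_incl)
  note h = hom_mem[OF \<tau>E] hom_add[OF \<tau>E] hom_mult[OF \<tau>E] hom_scale[OF \<tau>E] hom_adj[OF \<tau>E] hom_one[OF \<tau>E] iB
  let ?S = "{a\<in>A. \<tau> (\<iota> a) \<in> \<iota> ` A}"
  have "a \<in> ?S"
  proof (rule A_induct[OF _ _ _ _ _ _ _ _ a])
    show "?S \<subseteq> A" by blast
    show "1 \<in> ?S" by (simp add: h) (metis A.one_mem imageI incl_one)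
    fix x y assume xy: "x \<in> M" "y \<in> M"
    obtain x' where x': "x' \<in> M" "\<tau> (el D x 1) = el D x' 1" using fixes_right_left[OF \<tau> xy(1)] by blast
    have "\<tau> (\<iota> (tp x y)) = el D x' y" using xy x' End_el[OF \<tau>E xy] by (simp add: \<tau>r el_mult) (simp add: el_eq)
    then show "tp x y \<in> ?S" using xy x' by simp
  next
    fix x y assume "x \<in> ?S" "y \<in> ?S"
    then obtain x' y' where *: "x \<in> A" "y \<in> A" "x' \<in> A" "y' \<in> A" "\<tau> (\<iota> x) = \<iota> x'" "\<tau> (\<iota> y) = \<iota> y'" by auto
    show "x + y \<in> ?S" using * by (simp add: incl_add h) (simp flip: incl_add)
    show "x * y \<in> ?S" using * by (simp add: incl_mult h) (simp flip: incl_mult)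
  next
    fix c x assume "x \<in> ?S"
    then obtain x' where *: "x \<in> A" "x' \<in> A" "\<tau> (\<iota> x) = \<iota> x'" by auto
    show "scaleOp c x \<in> ?S" using * by (simp add: incl_scale h) (simp flip: incl_scale)
  next
    fix x assume "x \<in> ?S"
    then obtain x' where *: "x \<in> A" "x' \<in> A" "\<tau> (\<iota> x) = \<iota> x'" by auto
    show "adj x \<in> ?S" using * by (simp add: incl_adj h) (simp flip: incl_adj)
  next
    fix x assume x: "x \<in> A" "x \<in> sigma_weak closure_of ?S"
    have c: "continuous_map (subtopology sigma_weak A) (subtopology sigma_weak B0) \<iota>"
      using incl_hom0 by (simp add: normal_homs_def)
    have c': "continuous_map (subtopology sigma_weak A) sigma_weak (\<tau> \<circ> \<iota>)"
      by (rule continuous_map_compose[OF c hom_cont[OF \<tau>E]])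
    have "continuous_map (subtopology sigma_weak A) (subtopology sigma_weak B) (\<tau> \<circ> \<iota>)"
      using c' Bg_B[OF h(1)[OF iB]] by (auto simp: continuous_map_in_subtopology)
    from continuous_map_compose[OF this E_cont]
    have c'': "continuous_map (subtopology sigma_weak A) sigma_weak (E \<circ> (\<tau> \<circ> \<iota>))" .
    have "(E \<circ> (\<tau> \<circ> \<iota>)) x = (\<tau> \<circ> \<iota>) x"
      by (rule eq_on_closure[OF c'' c' _ _ x]) (auto simp: E_id)
    then show "x \<in> ?S" using x(1) E_mem[OF Bg_B[OF h(1)[OF iB[OF x(1)]]]] by simp
  qed
  then show ?thesis by auto
qed

text \<open>The endomorphism \<open>\<tau>\<close> is \<open>Ad L\<^sub>\<xi> \<circ> \<rho>t \<circ> Ad L\<^sub>\<xi>\<^sup>*\<close>. It maps \<open>\<A>\<close> into \<open>\<A>\<close>, and for the normality of its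
  restriction one needs a formula inside \<open>\<A>\<close>: the operator \<open>Nn\<close> intertwines \<open>\<tau>\<close> with
  \<open>\<Psi> = (\<xi> \<otimes> \<xi>\<^sup>o\<^sup>p) \<Phi>\<^sub>\<rho> (\<xi>' \<otimes> \<xi>'\<^sup>o\<^sup>p)\<close> for the conjugate \<open>\<xi>'\<close> of \<open>\<xi>\<close>, and the expectation \<open>E\<close> turns \<open>Nn\<close> into
  an element of \<open>\<A>\<close>. Slicing it gives an intertwiner with a left inverse from \<open>\<mu>\<close> to \<open>\<kappa> = \<xi>\<rho>\<xi>'\<close>.\<close>

lemma eta_gact:
  assumes eta: "is_eta D \<rho> f \<rho>t" and \<xi>: "\<xi> \<in> gr h"
  defines "\<tau> \<equiv> Ad B0 (adj (gv h \<rho>t (deg_unitary h \<xi>))) (gact D h \<rho>t)"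
  shows "\<exists>\<mu> e. is_eta D \<mu> e \<tau> \<and> (\<forall>g. \<rho> \<in> dsums_deg D g \<longrightarrow> \<mu> \<in> dsums_deg D (h + g - h))"
proof -
  note S = etaD[OF eta]
  obtain \<Phi>\<rho> where \<Phi>\<rho>: "\<Phi>\<rho> \<in> End A" "\<And>a. a \<in> A \<Longrightarrow> \<rho>t (\<iota> a) = \<iota> (\<Phi>\<rho> a)"
    "\<And>x y. x \<in> M \<Longrightarrow> y \<in> M \<Longrightarrow> \<Phi>\<rho> (tp x y) = tp (\<rho> x) y" using S(6) by blast
  let ?L = "L \<xi>" let ?V = "deg_unitary h \<xi>" let ?z = "cj \<xi>"
  have C: "\<xi> \<in> C" "?z \<in> C" using gr_C[OF \<xi>] by auto
  have fr: "fixes_right \<tau>" unfolding \<tau>_def by (rule gact_fixes_right[OF S(3) \<xi>])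
  have \<tau>E: "\<tau> \<in> End B0" using fr by (simp add: fixes_right_def)
  note V = deg_unitary[OF \<xi>]
  note LU = L_unitary[OF C(1)]
  have LB: "?L \<in> Bg h" by (rule L_Bg[OF \<xi>])
  have LxL: "adj ?L * x * ?L \<in> B0" if "x \<in> B0" for x using Bg_mult[OF Bg_mult[OF Bg_adj[OF LB] that] LB] by simp
  have zL: "lm ?z * ?L \<in> B0" using Bg_mult[OF lm_Bg[OF gr_conj[OF \<xi>]] LB] by simp
  note r = hom_mem[OF S(4)] hom_mult[OF S(4)]
  \<comment> \<open>Since V = L \<open>u\<^sub>h\<close>^*, the group unitaries in the translate
    cancel against those in V, and only conjugations by L around \<rho>t remain.\<close>
  have \<tau>: "\<tau> x = ?L * \<rho>t (adj ?L * x * ?L) * adj ?L" if x: "x \<in> B0" for x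
  proof -
    note rh = hom_mem[OF S(4)] hom_mult[OF S(4)] hom_adj[OF S(4)] un_hom[OF S(4)]
    let ?b = "beta D (- h) ?V"
    have bu: "?b \<in> unitaries B0" by (rule un_beta[OF V(1)])
    have gv: "gv h \<rho>t ?V = beta D h (\<rho>t ?b) * adj ?V" using un(1)[OF V(1)] by (simp add: gv_def)
    have "\<tau> x = ?V * beta D h (\<rho>t (adj ?b * beta D (- h) x * ?b)) * adj ?V"
      unfolding \<tau>_def gv using x V(1) bu by (simp add: Ad_app rh un beta_simps mult.assoc)
    also have "adj ?b * beta D (- h) x * ?b = beta D (- h) (adj ?V * x * ?V)" using x V(1) by (simp add: beta_simps un)
    also have "\<dots> = adj ?L * x * ?L"
      using beta_eq[of "adj ?V * x * ?V" "- h"] x V(1) by (simp add: un del: beta_mem) (simp add: deg_unitary_def u_adj mult.assoc u_mult u_mult')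
    finally show ?thesis using r(1)[OF LxL[OF x]] by (simp add: beta_eq deg_unitary_def u_adj mult.assoc u_mult u_mult')
  qed
  have iB: "\<iota> a \<in> B0" if "a \<in> A" for a using that by (rule Bg_incl)
  define Nn where "Nn = lm \<xi> * \<rho>t (lm ?z * ?L) * adj ?L"
  define \<Psi> where "\<Psi> = compose A (Phi \<xi>) (compose A \<Phi>\<rho> (Phi ?z))"
  have \<Psi>E: "\<Psi> \<in> End A" unfolding \<Psi>_def by (intro A.comp_End Phi C \<Phi>\<rho>(1))
  have \<Psi>tp: "\<Psi> (tp x 1) = tp (\<xi> (\<rho> (?z x))) 1" if "x \<in> M" for x
    using that C hom_mem[OF S(2)] Phi(3)[OF C(1), of "\<rho> (?z x)" 1] Phi(3)[OF C(2), of x 1] \<Phi>\<rho>(3)[of "?z x" 1]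
    by (simp add: \<Psi>_def compose_eq)
  have mid: "lm \<xi> * \<rho>t (lm ?z * \<iota> a * ?L) * adj ?L = \<iota> (\<Psi> a) * Nn" if a: "a \<in> A" for a
  proof -
    have za: "Phi ?z a \<in> A" using hom_mem[OF Phi(1)[OF C(2)] a] .
    have "lm ?z * \<iota> a * ?L = \<iota> (Phi ?z a) * (lm ?z * ?L)" using Phi(2)[OF C(2) a] by (simp flip: mult.assoc)
    then have "\<rho>t (lm ?z * \<iota> a * ?L) = \<iota> (\<Phi>\<rho> (Phi ?z a)) * \<rho>t (lm ?z * ?L)"
      using r(2)[OF iB[OF za] zL] \<Phi>\<rho>(2)[OF za] by simp
    then have "lm \<xi> * \<rho>t (lm ?z * \<iota> a * ?L) * adj ?L = (lm \<xi> * \<iota> (\<Phi>\<rho> (Phi ?z a))) * \<rho>t (lm ?z * ?L) * adj ?L" by (simp add: mult.assoc)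
    also have "lm \<xi> * \<iota> (\<Phi>\<rho> (Phi ?z a)) = \<iota> (\<Psi> a) * lm \<xi>"
      using Phi(2)[OF C(1) hom_mem[OF \<Phi>\<rho>(1) za]] a by (simp add: \<Psi>_def compose_eq)
    finally show ?thesis by (simp add: Nn_def mult.assoc)
  qed
  have N1: "Nn * \<tau> (\<iota> a) = \<iota> (\<Psi> a) * Nn" if a: "a \<in> A" for a
  proof -
    have "Nn * \<tau> (\<iota> a) = lm \<xi> * (\<rho>t (lm ?z * ?L) * ((adj ?L * ?L) * \<rho>t (adj ?L * \<iota> a * ?L))) * adj ?L"
      by (simp only: Nn_def \<tau>[OF iB[OF a]] mult.assoc)
    also have "\<dots> = lm \<xi> * \<rho>t (lm ?z * ?L * (adj ?L * \<iota> a * ?L)) * adj ?L"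
      by (simp only: LU mult_1_left r(2)[OF zL LxL[OF iB[OF a]]])
    also have "lm ?z * ?L * (adj ?L * \<iota> a * ?L) = lm ?z * (?L * adj ?L) * \<iota> a * ?L" by (simp only: mult.assoc)
    finally show ?thesis unfolding mid[OF a, symmetric] by (simp only: LU mult_1_right)
  qed
  let ?s = "\<xi> (\<rho> (adj (R \<xi>)))"
  have sM: "?s \<in> M" using C hom_mem[OF S(2)] by simp
  \<comment> \<open>For a = 1 this says that the element in front is a left inverse of
    \<open>Nn\<close>. Thus \<tau> on \<A> is recovered from \<Psi>, of which it is a kind of
    subobject.\<close>
  have N2: "\<tau> (\<iota> a) = el D ?s (adj (R' \<xi>)) * (\<iota> (\<Psi> a) * Nn)" if a: "a \<in> A" for a
  proof -
    have Rm: "adj (R \<xi>) \<in> M" "adj (R' \<xi>) \<in> M" using C by auto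
    have zB: "lm ?z * \<iota> a * ?L \<in> B0" using Bg_mult[OF Bg_mult[OF lm_Bg[OF gr_conj[OF \<xi>]] iB[OF a]] LB] by simp
    have "\<tau> (\<iota> a) = el D 1 (adj (R' \<xi>)) * lm \<xi> * \<rho>t (el D (adj (R \<xi>)) 1 * (lm ?z * \<iota> a * ?L)) * adj ?L"
      using \<tau>[OF iB[OF a]] L_adj[OF C(1)] by (simp add: L_def[of \<xi>, symmetric] mult.assoc)
    also have "\<dots> = el D 1 (adj (R' \<xi>)) * (lm \<xi> * el D (\<rho> (adj (R \<xi>))) 1) * \<rho>t (lm ?z * \<iota> a * ?L) * adj ?L"
      using r(2)[OF el_mem[OF Rm(1) M.one_mem] zB] S(5)[OF Rm(1)] by (simp add: mult.assoc)
    also have "\<dots> = el D ?s (adj (R' \<xi>)) * (lm \<xi> * \<rho>t (lm ?z * \<iota> a * ?L) * adj ?L)"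
      using lm_el[OF C(1) hom_mem[OF S(2) Rm(1)] M.one_mem] C sM Rm by (simp add: mult.assoc el_mult')
    finally show ?thesis unfolding mid[OF a] .
  qed
  have NB: "Nn \<in> B" using Bg_B[OF r(1)[OF zL]] Bg_B[OF LB] C by (simp add: Nn_def)
  obtain c where c: "c \<in> A" "E Nn = \<iota> c" using E_mem[OF NB] by blast
  let ?b = "tp ?s (adj (R' \<xi>))"
  have bA: "?b \<in> A" using sM C by simp
  define \<Phi> where "\<Phi> = (\<lambda>a\<in>A. ?b * \<Psi> a * c)"
  have \<Phi>A: "\<Phi> a \<in> A" if "a \<in> A" for a using that bA c hom_mem[OF \<Psi>E] by (simp add: \<Phi>_def)
  have \<tau>\<Phi>: "\<tau> (\<iota> a) = \<iota> (\<Phi> a)" if a: "a \<in> A" for a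
  proof -
    have \<Psi>a: "\<Psi> a \<in> A" by (rule hom_mem[OF \<Psi>E a])
    obtain b where "b \<in> A" "\<tau> (\<iota> a) = \<iota> b" using fixes_right_incl[OF fr a] by blast
    then have "\<tau> (\<iota> a) = E (\<tau> (\<iota> a))" by (simp add: E_id)
    also have "\<dots> = E (\<iota> (?b * \<Psi> a) * Nn)" unfolding N2[OF a] using bA \<Psi>a by (simp add: el_eq incl_mult mult.assoc)
    also have "\<dots> = \<iota> (?b * \<Psi> a * c)" using E_left[OF A.mult_mem[OF bA \<Psi>a] NB] bA \<Psi>a c by (simp add: incl_mult)
    finally show ?thesis using a by (simp add: \<Phi>_def)
  qed
  note t = hom_mem[OF \<tau>E] hom_add[OF \<tau>E] hom_mult[OF \<tau>E] hom_scale[OF \<tau>E] hom_adj[OF \<tau>E] hom_one[OF \<tau>E] iB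
  have eqA: "x = y" if "\<iota> x = \<iota> y" "x \<in> A" "y \<in> A" for x y using that incl_inj by blast
  \<comment> \<open>Continuity is what the formula for \<Phi> provides. The algebraic properties are
    inherited from \<tau> through the injectivity of \<iota>.\<close>
  have \<Phi>E: "\<Phi> \<in> End A"
  proof (rule normal_homsI)
    show "\<Phi> \<in> extensional A" by (simp add: \<Phi>_def)
    show "\<Phi> (x + y) = \<Phi> x + \<Phi> y" if "x \<in> A" "y \<in> A" for x y
      by (rule eqA) (use that in \<open>simp_all add: \<Phi>A incl_add t flip: \<tau>\<Phi>\<close>)
    show "\<Phi> (x * y) = \<Phi> x * \<Phi> y" if "x \<in> A" "y \<in> A" for x y
      by (rule eqA) (use that in \<open>simp_all add: \<Phi>A incl_mult t flip: \<tau>\<Phi>\<close>)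
    show "\<Phi> (scaleOp k x) = scaleOp k (\<Phi> x)" if "x \<in> A" for k x
      by (rule eqA) (use that in \<open>simp_all add: \<Phi>A incl_scale t flip: \<tau>\<Phi>\<close>)
    show "\<Phi> (adj x) = adj (\<Phi> x)" if "x \<in> A" for x
      by (rule eqA) (use that in \<open>simp_all add: \<Phi>A incl_adj t flip: \<tau>\<Phi>\<close>)
    show "\<Phi> 1 = 1" by (rule eqA) (simp_all add: \<Phi>A t flip: \<tau>\<Phi>)
    show "continuous_map (subtopology sigma_weak A) sigma_weak \<Phi>"
      by (rule continuous_map_eq[OF continuous_map_mult_both[OF hom_cont[OF \<Psi>E]]]) (simp add: \<Phi>_def)
  qed (rule \<Phi>A)
  obtain \<mu> where \<mu>: "\<mu> \<in> extensional M" "\<And>x. x \<in> M \<Longrightarrow> \<mu> x \<in> M" "\<And>x. x \<in> M \<Longrightarrow> \<tau> (el D x 1) = el D (\<mu> x) 1"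
    using fixes_right_induced[OF fr] by blast
  obtain b0 :: 'h2 where "norm b0 = 1" using hilbert_nontrivial(2) by blast
  then have b0: "cinner b0 b0 = 1" by (simp add: cinner_self)
  define \<kappa> where "\<kappa> = compose M \<xi> (compose M \<rho> ?z)"
  have \<kappa>E: "\<kappa> \<in> End M" unfolding \<kappa>_def by (intro M.comp_End C_End C S(2))
  let ?Rc = "tp 1 (adj (R' \<xi>)) * c"
  \<comment> \<open>Slicing at a unit vector returns \<mu>(x) from \<mu>(x) \<otimes> 1. The factor
    R'^* sits in the second leg, so it commutes with \<kappa>(x) \<otimes> 1 and can be included in
    the sliced element.\<close>
  define tt where "tt = T.slice b0 b0 ?Rc"
  have RcA: "?Rc \<in> A" using C c by simp
  have ttM: "tt \<in> M" unfolding tt_def by (rule slice_mem[OF RcA])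
  have tp\<mu>: "tp (\<mu> x) 1 = tp ?s 1 * (tp (\<kappa> x) 1 * ?Rc)" if x: "x \<in> M" for x
  proof (rule eqA)
    have "\<iota> (tp (\<mu> x) 1) = \<iota> (\<Phi> (tp x 1))" using \<mu>(3)[OF x] \<tau>\<Phi>[of "tp x 1"] x by (simp add: el_eq)
    also have "\<Phi> (tp x 1) = tp ?s 1 * (tp (\<kappa> x) 1 * ?Rc)"
    proof -
      have "\<Phi> (tp x 1) = ?b * tp (\<kappa> x) 1 * c" using x C hom_mem[OF S(2)] \<Psi>tp[OF x] by (simp add: \<Phi>_def \<kappa>_def)
      also have "?b * tp (\<kappa> x) 1 = tp ?s 1 * (tp (\<kappa> x) 1 * tp 1 (adj (R' \<xi>)))" by (simp add: T.tensor_op_mult)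
      finally show ?thesis by (simp add: mult.assoc)
    qed
    finally show "\<iota> (tp (\<mu> x) 1) = \<iota> (tp ?s 1 * (tp (\<kappa> x) 1 * ?Rc))" .
  qed (use x \<mu>(2) sM hom_mem[OF \<kappa>E] RcA in simp_all)
  have \<mu>eq: "\<mu> x = ?s * \<kappa> x * tt" if x: "x \<in> M" for x
  proof -
    have "T.slice b0 b0 (tp (\<mu> x) 1) = ?s * (\<kappa> x * tt)"
      unfolding tp\<mu>[OF x] tt_def by (simp only: j_one T.slice_mult_left)
    then show ?thesis using b0 by (simp add: T.slice_tensor mult.assoc)
  qed
  have eqM: "x = y" if "el D x 1 = el D y 1" "x \<in> M" "y \<in> M" for x y using that el_left_inj by blast
  have \<mu>E: "\<mu> \<in> End M"
  proof (rule normal_homsI)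
    show "\<mu> (x + y) = \<mu> x + \<mu> y" if "x \<in> M" "y \<in> M" for x y
      by (rule eqM) (use that in \<open>simp_all add: \<mu>(2) el_add_left t flip: \<mu>(3)\<close>)
    show "\<mu> (x * y) = \<mu> x * \<mu> y" if xy: "x \<in> M" "y \<in> M" for x y
    proof (rule eqM)
      have "el D (\<mu> x * \<mu> y) 1 = \<tau> (el D x 1) * \<tau> (el D y 1)" using xy by (simp add: \<mu> el_mult)
      also have "\<dots> = \<tau> (el D (x * y) 1)" using xy by (simp add: el_mult flip: t(3))
      finally show "el D (\<mu> (x * y)) 1 = el D (\<mu> x * \<mu> y) 1" using xy by (simp add: \<mu>)
    qed (use xy \<mu>(2) in simp_all)
    show "\<mu> (scaleOp k x) = scaleOp k (\<mu> x)" if "x \<in> M" for k x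
      by (rule eqM) (use that in \<open>simp_all add: \<mu>(2) el_scale_left t flip: \<mu>(3)\<close>)
    show "\<mu> (adj x) = adj (\<mu> x)" if x: "x \<in> M" for x
    proof (rule eqM)
      have "el D (adj (\<mu> x)) 1 = adj (\<tau> (el D x 1))" using x by (simp add: \<mu> el_adj)
      also have "\<dots> = \<tau> (el D (adj x) 1)" using x by (simp add: el_adj flip: t(5))
      finally show "el D (\<mu> (adj x)) 1 = el D (adj (\<mu> x)) 1" using x by (simp add: \<mu>)
    qed (use x \<mu>(2) in simp_all)
    show "\<mu> 1 = 1" by (rule eqM) (use \<mu>(3)[of 1] in \<open>simp_all add: \<mu>(2) t\<close>)
    show "continuous_map (subtopology sigma_weak M) sigma_weak \<mu>"
      by (rule continuous_map_eq[OF continuous_map_mult_both[OF hom_cont[OF \<kappa>E]]]) (simp add: \<mu>eq)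
  qed (rule \<mu>)+
  have tt: "tt \<in> intertwiners M \<mu> \<kappa>"
  proof (rule M.intertwinersI[OF ttM])
    fix x assume x: "x \<in> M"
    have \<kappa>x: "\<kappa> x \<in> M" by (rule hom_mem[OF \<kappa>E x])
    have "E (Nn * \<tau> (\<iota> (tp x 1))) = E (\<iota> (\<Psi> (tp x 1)) * Nn)" using N1[of "tp x 1"] x by simp
    then have "\<iota> (c * tp (\<mu> x) 1) = \<iota> (tp (\<kappa> x) 1 * c)"
      using x \<mu>(2,3)[OF x] \<Psi>tp[OF x] NB c \<kappa>x C hom_mem[OF S(2)] by (simp add: el_eq E_right E_left incl_mult \<kappa>_def)
    then have ct: "c * tp (\<mu> x) 1 = tp (\<kappa> x) 1 * c" by (rule eqA) (use c \<mu>(2)[OF x] \<kappa>x in simp_all)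
    have "tp 1 (adj (R' \<xi>)) * tp (\<kappa> x) 1 = tp (\<kappa> x) 1 * tp 1 (adj (R' \<xi>))" by (simp add: T.tensor_op_mult)
    then have "?Rc * tensor_op tn (\<mu> x) 1 = tensor_op tn (\<kappa> x) 1 * ?Rc" using ct by (simp add: mult.assoc) (simp flip: mult.assoc)
    then have "T.slice b0 b0 (?Rc * tensor_op tn (\<mu> x) 1) = T.slice b0 b0 (tensor_op tn (\<kappa> x) 1 * ?Rc)" by simp
    then show "tt * \<mu> x = \<kappa> x * tt" by (simp only: T.slice_mult_left T.slice_mult_right tt_def)
  qed
  have st: "?s * tt = 1" using \<mu>eq[of 1] hom_one[OF \<kappa>E] hom_one[OF \<mu>E] by simp
  \<comment> \<open>The adjoint of \<open>tt\<close> carries intertwiners into \<kappa> to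
    intertwiners into \<mu>, and the left inverse \<open>?s\<close> undoes it. So the generating
    property of \<kappa> passes to \<mu>, together with the degree.\<close>
  have gen\<mu>: "generated_by M SS \<mu>" if SS: "generated_by M SS \<kappa>" for SS
    unfolding generated_by_def
  proof (intro ballI impI)
    fix y assume y: "y \<in> M" and z: "\<forall>\<zeta>\<in>SS. \<forall>t\<in>intertwiners M \<zeta> \<mu>. y * t = 0"
    have "y * adj tt = 0"
    proof (rule generated_byD[OF SS])
      show "y * adj tt \<in> M" using y ttM by simp
      fix \<zeta> q assume "\<zeta> \<in> SS" "q \<in> intertwiners M \<zeta> \<kappa>"
      then show "y * adj tt * q = 0" using z M.int_mult[OF M.int_adj[OF tt \<mu>E \<kappa>E]] by (simp add: mult.assoc)
    qed
    then have "y * adj (?s * tt) = 0" by (simp flip: mult.assoc)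
    then show "y = 0" by (simp add: st)
  qed
  have "generated_by M Irr \<kappa>"
    using dsums_compose[OF _ dsums_compose[OF S(1)]] C_generated C_End C by (auto simp: \<kappa>_def dsums_iff)
  then have \<mu>d: "\<mu> \<in> dsums D" using \<mu>E gen\<mu> by (simp add: dsums_iff)
  have deg: "\<mu> \<in> dsums_deg D (h + g - h)" if g: "\<rho> \<in> dsums_deg D g" for g
  proof -
    have "\<kappa> \<in> dsums_deg D (h + (g + - h))"
      unfolding \<kappa>_def by (intro dsums_deg_compose g gr_dsums_deg gr_conj \<xi>)
    moreover have "h + (g + - h) = h + g - h" by (simp only: add.assoc diff_conv_add_uminus)
    ultimately have "generated_by M (Irr \<inter> gr (h + g - h)) \<kappa>" by (simp only: dsums_deg_iff)
    then show ?thesis using \<mu>E gen\<mu> by (simp add: dsums_deg_iff)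
  qed
  obtain e where "is_eta D \<mu> e \<tau>" using etaI[OF fr \<Phi>E \<tau>\<Phi> \<mu>d \<mu>(3)] by blast
  then show ?thesis using deg by blast
qed

section \<open>The \<open>G\<close>-braiding\<close>

lemma ZcatE:
  assumes "\<theta> \<in> Zcat D"
  obtains \<rho> f \<rho>t v where "is_eta D \<rho> f \<rho>t" "v \<in> unitaries B0" "\<theta> = Ad B0 v \<rho>t"
  using assms by (auto simp: Zcat_def unitarily_equivalent_def)

lemma ZdegE:
  assumes "\<theta> \<in> Zdeg D g"
  obtains \<rho> f \<rho>t v where "\<rho> \<in> dsums_deg D g" "is_eta D \<rho> f \<rho>t" "v \<in> unitaries B0" "\<theta> = Ad B0 v \<rho>t"
  using assms by (auto simp: Zdeg_def unitarily_equivalent_def)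

lemma Rrep_Ad: "is_eta D \<rho> f \<rho>t \<Longrightarrow> v \<in> unitaries B0 \<Longrightarrow> Rrep (Ad B0 v \<rho>t) v \<rho>t"
  using etaD(3,4) Ad_End by (simp add: Rrep_def Ad_app)

lemma Rrep_eq: assumes "Rrep \<theta> v \<rho>" shows "\<theta> = Ad B0 v \<rho>"
  by (rule extensionalityI[of _ B0]) (use RrepD[OF assms] hom_ext[of \<theta> B0 B0] in \<open>auto simp: Ad_def\<close>)

lemma Ad_one: "\<rho> \<in> End B0 \<Longrightarrow> Ad B0 1 \<rho> = \<rho>"
  by (rule extensionalityI[of _ B0]) (use hom_ext[of \<rho> B0 B0] in \<open>auto simp: Ad_def\<close>)

lemma Rrep_Zcat: "Rrep \<theta> v \<rho>t \<Longrightarrow> is_eta D \<rho> f \<rho>t \<Longrightarrow> \<theta> \<in> Zcat D"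
  using Rrep_eq RrepD(1,2) unfolding Zcat_def unitarily_equivalent_def by blast

lemma Rrep_Zdeg: "Rrep \<theta> v \<rho>t \<Longrightarrow> is_eta D \<rho> f \<rho>t \<Longrightarrow> \<rho> \<in> dsums_deg D g \<Longrightarrow> \<theta> \<in> Zdeg D g"
  using Rrep_eq RrepD(1,2) unfolding Zdeg_def unitarily_equivalent_def by blast

lemma Zcat_Rrep: assumes "\<theta> \<in> Zcat D" obtains v \<rho> where "Rrep \<theta> v \<rho>"
  using assms Rrep_Ad by (elim ZcatE) blast

lemma Zcat_compose:
  assumes "\<xi> \<in> Zcat D" "\<eta> \<in> Zcat D" shows "compose B0 \<xi> \<eta> \<in> Zcat D"
proof -
  obtain \<rho> f \<rho>t v where 1: "is_eta D \<rho> f \<rho>t" "v \<in> unitaries B0" "\<xi> = Ad B0 v \<rho>t" by (rule ZcatE[OF assms(1)])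
  obtain \<rho>' f' \<rho>t' v' where 2: "is_eta D \<rho>' f' \<rho>t'" "v' \<in> unitaries B0" "\<eta> = Ad B0 v' \<rho>t'" by (rule ZcatE[OF assms(2)])
  obtain e where "is_eta D (compose M \<rho> \<rho>') e (compose B0 \<rho>t \<rho>t')" using eta_compose[OF 1(1) 2(1)] by blast
  then show ?thesis unfolding 1(3) 2(3) by (rule Rrep_Zcat[OF Rrep_compose[OF Rrep_Ad[OF 1(1,2)] Rrep_Ad[OF 2(1,2)]]])
qed

lemma Zdeg_compose:
  assumes "\<xi> \<in> Zdeg D g" "\<eta> \<in> Zdeg D h" shows "compose B0 \<xi> \<eta> \<in> Zdeg D (g + h)"
proof -
  obtain \<rho> f \<rho>t v where 1: "\<rho> \<in> dsums_deg D g" "is_eta D \<rho> f \<rho>t" "v \<in> unitaries B0" "\<xi> = Ad B0 v \<rho>t" by (rule ZdegE[OF assms(1)])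
  obtain \<rho>' f' \<rho>t' v' where 2: "\<rho>' \<in> dsums_deg D h" "is_eta D \<rho>' f' \<rho>t'" "v' \<in> unitaries B0" "\<eta> = Ad B0 v' \<rho>t'" by (rule ZdegE[OF assms(2)])
  obtain e where "is_eta D (compose M \<rho> \<rho>') e (compose B0 \<rho>t \<rho>t')" using eta_compose[OF 1(2) 2(2)] by blast
  then show ?thesis unfolding 1(4) 2(4)
    by (rule Rrep_Zdeg[OF Rrep_compose[OF Rrep_Ad[OF 1(2,3)] Rrep_Ad[OF 2(2,3)]]]) (rule dsums_deg_compose[OF 1(1) 2(1)])
qed

lemma Zcat_gact: assumes "\<theta> \<in> Zcat D" shows "gact D h \<theta> \<in> Zcat D"
proof -
  obtain \<rho> f \<rho>t v where 1: "is_eta D \<rho> f \<rho>t" "v \<in> unitaries B0" "\<theta> = Ad B0 v \<rho>t" by (rule ZcatE[OF assms])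
  obtain \<xi> where \<xi>: "\<xi> \<in> gr h" using gr_nonempty by blast
  obtain \<mu> e where "is_eta D \<mu> e (Ad B0 (adj (gv h \<rho>t (deg_unitary h \<xi>))) (gact D h \<rho>t))" using eta_gact[OF 1(1) \<xi>] by blast
  then show ?thesis unfolding 1(3) by (rule Rrep_Zcat[OF Rrep_gact[OF Rrep_Ad[OF 1(1,2)] \<xi>]])
qed

lemma Zdeg_gact: assumes "\<theta> \<in> Zdeg D g" shows "gact D h \<theta> \<in> Zdeg D (h + g - h)"
proof -
  obtain \<rho> f \<rho>t v where 1: "\<rho> \<in> dsums_deg D g" "is_eta D \<rho> f \<rho>t" "v \<in> unitaries B0" "\<theta> = Ad B0 v \<rho>t" by (rule ZdegE[OF assms])
  obtain \<xi> where \<xi>: "\<xi> \<in> gr h" using gr_nonempty by blast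
  obtain \<mu> e where \<mu>: "is_eta D \<mu> e (Ad B0 (adj (gv h \<rho>t (deg_unitary h \<xi>))) (gact D h \<rho>t))" "\<mu> \<in> dsums_deg D (h + g - h)"
    using eta_gact[OF 1(2) \<xi>] 1(1) by blast
  show ?thesis unfolding 1(4) by (rule Rrep_Zdeg[OF Rrep_gact[OF Rrep_Ad[OF 1(2,3)] \<xi>] \<mu>])
qed

text \<open>With W = U V and X = \<open>beta D (- g) W\<close> the map \<alpha> is forced, and it
  fixes M \<otimes> 1 precisely because V implements \<sigma>. Expanding \<open>eps\<close> for this
  X cancels W^* W and leaves the formula of the canonical extension.\<close>

lemma implements_Lrep:
  assumes eta: "is_eta D \<sigma> e \<sigma>t" and U: "U \<in> unitaries B0" and V: "implements g \<sigma> V" and r: "Rrep \<theta>2 v \<rho>"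
  shows "\<exists>X \<alpha>. Lrep g (Ad B0 U \<sigma>t) X \<alpha> \<and>
    beta D g (eps X \<alpha> v \<rho>) = beta D g v * gact D g \<rho> U * (gact D g \<rho> V * adj V) * adj U * Ad B0 U \<sigma>t (adj v)"
proof -
  note S = etaD[OF eta] and R = RrepD[OF r]
  have Vu: "V \<in> unitaries B0" and V2: "\<And>x. x \<in> M \<Longrightarrow> V * beta D g (el D x 1) = el D (\<sigma> x) 1 * V"
    using V by (auto simp: implements_def)
  let ?\<theta> = "Ad B0 U \<sigma>t"
  have \<theta>E: "?\<theta> \<in> End B0" by (rule Ad_End[OF S(4) U])
  define W where "W = U * V"
  have W: "W \<in> unitaries B0" unfolding W_def by (rule un_mult[OF U Vu])
  define X where "X = beta D (- g) W"
  define \<alpha> where "\<alpha> = compose B0 (beta D (- g)) (Ad B0 (adj W) ?\<theta>)"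
  have \<alpha>E: "\<alpha> \<in> End B0" unfolding \<alpha>_def by (intro B0.comp_End beta_End Ad_End \<theta>E un_adj W)
  have \<alpha>: "\<alpha> x = beta D (- g) (adj W * ?\<theta> x * W)" if "x \<in> B0" for x
    using that by (simp add: \<alpha>_def compose_eq Ad_app)
  have "\<alpha> (el D x 1) = el D x 1" if x: "x \<in> M" for x
  proof -
    have "adj W * ?\<theta> (el D x 1) * W = adj V * (el D (\<sigma> x) 1 * V)"
      using x U by (simp add: W_def Ad_app S(5) mult.assoc un)
    also have "\<dots> = beta D g (el D x 1)" unfolding V2[OF x, symmetric] by (simp add: un(4)[OF Vu])
    finally show ?thesis using x by (simp add: \<alpha>)
  qed
  then have fl: "fixes_left \<alpha>" using \<alpha>E by (simp add: fixes_left_def)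
  have X: "X \<in> unitaries B0" unfolding X_def by (rule un_beta[OF W])
  have bX: "beta D g X = W" using W by (simp add: X_def un)
  have b\<alpha>: "beta D g (\<alpha> x) = adj W * ?\<theta> x * W" if "x \<in> B0" for x
    using that W hom_mem[OF \<theta>E that] by (simp add: \<alpha> un)
  have "?\<theta> x = beta D g (X * \<alpha> x * adj X)" if x: "x \<in> B0" for x
    using x X W hom_mem[OF \<alpha>E x] by (simp add: beta_simps un bX b\<alpha> mult.assoc)
  then have "Lrep g ?\<theta> X \<alpha>" using \<theta>E X fl by (simp add: Lrep_def)
  moreover have "beta D g (eps X \<alpha> v \<rho>) = beta D g v * gact D g \<rho> U * (gact D g \<rho> V * adj V) * adj U * ?\<theta> (adj v)"
  proof -
    have vB: "v \<in> B0" "adj v \<in> B0" using R(2) by (auto simp: un)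
    have "beta D g (eps X \<alpha> v \<rho>) = beta D g v * beta D g (\<rho> X) * beta D g (\<alpha> (adj v)) * adj (beta D g X)"
      unfolding eps_def using vB X hom_mem[OF \<alpha>E] hom_mem[OF R(3)] by (simp add: beta_simps un)
    also have "\<dots> = beta D g v * gact D g \<rho> W * (adj W * ?\<theta> (adj v) * W) * adj W"
      unfolding b\<alpha>[OF vB(2)] bX using W by (simp add: un X_def)
    also have "\<dots> = beta D g v * gact D g \<rho> W * adj W * ?\<theta> (adj v)" using W by (simp add: mult.assoc un)
    also have "gact D g \<rho> W = gact D g \<rho> U * gact D g \<rho> V"
      unfolding W_def by (rule hom_mult[OF gact_End[OF R(3)] un(1)[OF U] un(1)[OF Vu]])
    finally show ?thesis by (simp add: W_def mult.assoc del: gact_app)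
  qed
  ultimately show ?thesis by blast
qed

lemma braiding_value_eps:
  assumes "braiding_value D \<theta>1 \<theta>2 W"
  shows "\<exists>g X \<alpha> v \<rho>. Lrep g \<theta>1 X \<alpha> \<and> Rrep \<theta>2 v \<rho> \<and> W = beta D g (eps X \<alpha> v \<rho>)"
proof -
  obtain g \<sigma> e \<sigma>t \<rho> f \<rho>t V u' v where *: "u' \<in> unitaries B0" "v \<in> unitaries B0" "\<sigma> \<in> dsums_deg D g" "is_eta D \<sigma> e \<sigma>t"
    "is_eta D \<rho> f \<rho>t" "is_V D g \<sigma> V" "\<theta>1 = Ad B0 u' \<sigma>t" "\<theta>2 = Ad B0 v \<rho>t"
    "W = beta D g v * gact D g \<rho>t u' * (gact D g \<rho>t V * adj V) * adj u' * \<theta>1 (adj v)"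
    using assms unfolding braiding_value_def by blast
  note r = Rrep_Ad[OF *(5,2)]
  obtain X \<alpha> where "Lrep g (Ad B0 u' \<sigma>t) X \<alpha>"
    "beta D g (eps X \<alpha> v \<rho>t) = beta D g v * gact D g \<rho>t u' * (gact D g \<rho>t V * adj V) * adj u' * Ad B0 u' \<sigma>t (adj v)"
    using implements_Lrep[OF *(4,1) is_V_implements[OF *(3,6)] r] by blast
  then show ?thesis using r *(7,8,9) by metis
qed

text \<open>Uniqueness for the definite description: all values come from left and right
  presentations of the same two endomorphisms, which \<open>eps_independent\<close>
  compares.\<close>

lemma braiding_eqI:
  assumes "braiding_value D \<theta>1 \<theta>2 W" shows "braiding D \<theta>1 \<theta>2 = W"
  unfolding braiding_def
proof (rule the_equality)
  fix W' assume W': "braiding_value D \<theta>1 \<theta>2 W'"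
  obtain g X \<alpha> v \<rho> where 1: "Lrep g \<theta>1 X \<alpha>" "Rrep \<theta>2 v \<rho>" "W = beta D g (eps X \<alpha> v \<rho>)"
    using braiding_value_eps[OF assms] by blast
  obtain g' X' \<alpha>' v' \<rho>' where 2: "Lrep g' \<theta>1 X' \<alpha>'" "Rrep \<theta>2 v' \<rho>'" "W' = beta D g' (eps X' \<alpha>' v' \<rho>')"
    using braiding_value_eps[OF W'] by blast
  show "W' = W" unfolding 1(3) 2(3) by (rule eps_independent[OF 2(1) 1(1) 2(2) 1(2)])
qed (rule assms)

lemma braiding_valueI:
  assumes "\<sigma> \<in> dsums_deg D g" "is_eta D \<sigma> e \<sigma>t" "is_eta D \<rho> f \<rho>t" "is_V D g \<sigma> V" "u' \<in> unitaries B0" "v \<in> unitaries B0"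
  shows "braiding_value D (Ad B0 u' \<sigma>t) (Ad B0 v \<rho>t)
    (beta D g v * gact D g \<rho>t u' * (gact D g \<rho>t V * adj V) * adj u' * Ad B0 u' \<sigma>t (adj v))"
  unfolding braiding_value_def using assms by blast

lemma Zdeg_Lrep: assumes "\<theta> \<in> Zdeg D g" obtains X \<alpha> where "Lrep g \<theta> X \<alpha>"
proof -
  obtain \<rho> f \<rho>t v where 1: "\<rho> \<in> dsums_deg D g" "is_eta D \<rho> f \<rho>t" "v \<in> unitaries B0" "\<theta> = Ad B0 v \<rho>t" by (rule ZdegE[OF assms])
  obtain V where "is_V D g \<rho> V" using is_V_exists[OF 1(1)] by blast
  then show thesis
    using implements_Lrep[OF 1(2,3) is_V_implements[OF 1(1)] Rrep_Ad[OF 1(2,3)]] that 1(4) by blast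
qed

lemma braiding_eps:
  assumes "\<theta>1 \<in> Zdeg D g" "\<theta>2 \<in> Zcat D" and l: "Lrep g' \<theta>1 X \<alpha>" and r: "Rrep \<theta>2 v \<rho>"
  shows "braiding D \<theta>1 \<theta>2 = beta D g' (eps X \<alpha> v \<rho>)"
proof -
  obtain \<sigma> e \<sigma>t u' where 1: "\<sigma> \<in> dsums_deg D g" "is_eta D \<sigma> e \<sigma>t" "u' \<in> unitaries B0" "\<theta>1 = Ad B0 u' \<sigma>t" by (rule ZdegE[OF assms(1)])
  obtain \<zeta> f \<zeta>t w where 2: "is_eta D \<zeta> f \<zeta>t" "w \<in> unitaries B0" "\<theta>2 = Ad B0 w \<zeta>t" by (rule ZcatE[OF assms(2)])
  obtain V where V: "is_V D g \<sigma> V" using is_V_exists[OF 1(1)] by blast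
  note val = braiding_valueI[OF 1(1,2) 2(1) V 1(3) 2(2), folded 1(4) 2(3)]
  obtain k Y \<alpha>' v' \<rho>' where e: "Lrep k \<theta>1 Y \<alpha>'" "Rrep \<theta>2 v' \<rho>'" "braiding D \<theta>1 \<theta>2 = beta D k (eps Y \<alpha>' v' \<rho>')"
    using braiding_value_eps[OF val] braiding_eqI[OF val] by metis
  show ?thesis unfolding e(3) by (rule eps_independent[OF e(1) l e(2) r])
qed

lemma braiding_eta:
  assumes "\<sigma> \<in> dsums_deg D g" "is_eta D \<sigma> e \<sigma>t" "is_eta D \<rho> f \<rho>t" "is_V D g \<sigma> V"
  shows "braiding D \<sigma>t \<rho>t = gact D g \<rho>t V * adj V"
proof -
  have "braiding_value D \<sigma>t \<rho>t (beta D g 1 * gact D g \<rho>t 1 * (gact D g \<rho>t V * adj V) * adj 1 * \<sigma>t (adj 1))"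
    using braiding_valueI[OF assms un_one un_one] etaD(4)[OF assms(2)] etaD(4)[OF assms(3)] by (simp add: Ad_one del: gact_app)
  then have "braiding_value D \<sigma>t \<rho>t (gact D g \<rho>t V * adj V)"
    using hom_one[OF beta_End] hom_one[OF gact_End[OF etaD(4)[OF assms(3)]]] hom_one[OF etaD(4)[OF assms(2)]] by (simp del: gact_app)
  then show ?thesis by (rule braiding_eqI)
qed

lemma braiding_Ad:
  assumes "\<sigma> \<in> dsums_deg D g" "is_eta D \<sigma> e \<sigma>t" "is_eta D \<rho> f \<rho>t" "u' \<in> unitaries B0" "v \<in> unitaries B0"
  shows "braiding D (Ad B0 u' \<sigma>t) (Ad B0 v \<rho>t)
    = beta D g v * gact D g \<rho>t u' * braiding D \<sigma>t \<rho>t * adj u' * Ad B0 u' \<sigma>t (adj v)"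
proof -
  obtain V where V: "is_V D g \<sigma> V" using is_V_exists[OF assms(1)] by blast
  show ?thesis unfolding braiding_eta[OF assms(1-3) V] by (rule braiding_eqI[OF braiding_valueI[OF assms(1-3) V assms(4,5)]])
qed

lemma braiding_unitary:
  assumes "\<sigma> \<in> Zdeg D g" "\<rho> \<in> Zcat D" shows "braiding D \<sigma> \<rho> \<in> unitaries B0"
proof -
  obtain X \<alpha> where l: "Lrep g \<sigma> X \<alpha>" by (rule Zdeg_Lrep[OF assms(1)])
  obtain v \<rho>' where r: "Rrep \<rho> v \<rho>'" by (rule Zcat_Rrep[OF assms(2)])
  show ?thesis unfolding braiding_eps[OF assms l r] by (rule un_beta[OF eps_unitary[OF l r]])
qed

lemma braiding_intertwines:
  assumes "\<sigma> \<in> Zdeg D g" "\<rho> \<in> Zcat D"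
  shows "braiding D \<sigma> \<rho> \<in> intertwiners B0 (compose B0 \<sigma> \<rho>) (compose B0 (gact D g \<rho>) \<sigma>)"
proof (rule B0.intertwinersI)
  obtain X \<alpha> where l: "Lrep g \<sigma> X \<alpha>" by (rule Zdeg_Lrep[OF assms(1)])
  obtain v \<rho>' where r: "Rrep \<rho> v \<rho>'" by (rule Zcat_Rrep[OF assms(2)])
  note L = LrepD[OF l] and R = RrepD[OF r]
  show "braiding D \<sigma> \<rho> \<in> B0" using un(1)[OF braiding_unitary[OF assms]] .
  fix x assume x: "x \<in> B0"
  have a: "X * \<alpha> y * adj X \<in> B0" if "y \<in> B0" for y using that un(1)[OF L(2)] hom_mem[OF L(3)] by simp
  have e: "eps X \<alpha> v \<rho>' \<in> B0" by (rule un(1)[OF eps_unitary[OF l r]])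
  have \<rho>x: "\<rho> x \<in> B0" by (rule hom_mem[OF R(1) x])
  have "beta D g (eps X \<alpha> v \<rho>' * (X * \<alpha> (\<rho> x) * adj X)) = beta D g (\<rho> (X * \<alpha> x * adj X) * eps X \<alpha> v \<rho>')"
    unfolding eps_BF0[OF l r x] ..
  then show "braiding D \<sigma> \<rho> * compose B0 \<sigma> \<rho> x = compose B0 (gact D g \<rho>) \<sigma> x * braiding D \<sigma> \<rho>"
    unfolding braiding_eps[OF assms l r]
    using x \<rho>x e a[OF x] a[OF \<rho>x] hom_mem[OF R(1) a[OF x]] by (simp add: compose_eq L(6) hom_mult[OF beta_End])
qed

lemma braiding_compose_right:
  assumes "\<sigma> \<in> Zdeg D g" "\<xi> \<in> Zcat D" "\<eta> \<in> Zcat D"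
  shows "gact D g \<xi> (braiding D \<sigma> \<eta>) * braiding D \<sigma> \<xi> = braiding D \<sigma> (compose B0 \<xi> \<eta>)"
proof -
  obtain X \<alpha> where l: "Lrep g \<sigma> X \<alpha>" by (rule Zdeg_Lrep[OF assms(1)])
  obtain v \<rho> where r: "Rrep \<xi> v \<rho>" by (rule Zcat_Rrep[OF assms(2)])
  obtain v' \<rho>' where r': "Rrep \<eta> v' \<rho>'" by (rule Zcat_Rrep[OF assms(3)])
  have e: "eps X \<alpha> v \<rho> \<in> B0" "eps X \<alpha> v' \<rho>' \<in> B0" using eps_unitary[OF l r] eps_unitary[OF l r'] un(1) by auto
  show ?thesis
    unfolding braiding_eps[OF assms(1,2) l r] braiding_eps[OF assms(1,3) l r']
      braiding_eps[OF assms(1) Zcat_compose[OF assms(2,3)] l Rrep_compose[OF r r']] eps_BF1[OF l r r', symmetric]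
    using e hom_mem[OF RrepD(1)[OF r]] by (simp add: hom_mult[OF beta_End])
qed

lemma braiding_natural_right:
  assumes "\<sigma> \<in> Zdeg D g" "\<rho> \<in> Zcat D" "\<rho>' \<in> Zcat D" "T \<in> intertwiners B0 \<rho> \<rho>'"
  shows "beta D g T * braiding D \<sigma> \<rho> = braiding D \<sigma> \<rho>' * \<sigma> T"
proof -
  obtain X \<alpha> where l: "Lrep g \<sigma> X \<alpha>" by (rule Zdeg_Lrep[OF assms(1)])
  obtain v \<zeta> where r: "Rrep \<rho> v \<zeta>" by (rule Zcat_Rrep[OF assms(2)])
  obtain v' \<zeta>' where r': "Rrep \<rho>' v' \<zeta>'" by (rule Zcat_Rrep[OF assms(3)])
  note L = LrepD[OF l]
  have T: "T \<in> B0" by (rule B0.int_mem[OF assms(4)])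
  have e: "eps X \<alpha> v \<zeta> \<in> B0" "eps X \<alpha> v' \<zeta>' \<in> B0" using eps_unitary[OF l r] eps_unitary[OF l r'] un(1) by auto
  have "beta D g (T * eps X \<alpha> v \<zeta>) = beta D g (eps X \<alpha> v' \<zeta>' * (X * \<alpha> T * adj X))"
    unfolding eps_natural_right[OF l r r' assms(4)] ..
  then show ?thesis
    unfolding braiding_eps[OF assms(1,2) l r] braiding_eps[OF assms(1,3) l r']
    using e T un(1)[OF L(2)] hom_mem[OF L(3) T] by (simp add: L(6) hom_mult[OF beta_End])
qed

lemma braiding_compose_left:
  assumes "\<sigma> \<in> Zdeg D g" "\<rho> \<in> Zdeg D h" "\<xi> \<in> Zcat D"
  shows "braiding D \<sigma> (gact D h \<xi>) * \<sigma> (braiding D \<rho> \<xi>) = braiding D (compose B0 \<sigma> \<rho>) \<xi>"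
proof -
  obtain X \<alpha> where l: "Lrep g \<sigma> X \<alpha>" by (rule Zdeg_Lrep[OF assms(1)])
  obtain Y \<alpha>' where l': "Lrep h \<rho> Y \<alpha>'" by (rule Zdeg_Lrep[OF assms(2)])
  obtain v \<zeta> where r: "Rrep \<xi> v \<zeta>" by (rule Zcat_Rrep[OF assms(3)])
  obtain \<pi> where \<pi>: "\<pi> \<in> gr h" using gr_nonempty by blast
  show ?thesis
    unfolding braiding_eps[OF assms(1) Zcat_gact[OF assms(3)] l Rrep_gact[OF r \<pi>]] braiding_eps[OF assms(2,3) l' r]
      braiding_eps[OF Zdeg_compose[OF assms(1,2)] assms(3) Lrep_compose[OF l l' \<pi>] r]
    by (rule eps_BF2[OF l l' r \<pi>])
qed

lemma braiding_natural_left: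
  assumes "\<sigma> \<in> Zdeg D g" "\<sigma>' \<in> Zdeg D g" "\<xi> \<in> Zcat D" "T \<in> intertwiners B0 \<sigma> \<sigma>'"
  shows "gact D g \<xi> T * braiding D \<sigma> \<xi> = braiding D \<sigma>' \<xi> * T"
proof -
  obtain X \<alpha> where l: "Lrep g \<sigma> X \<alpha>" by (rule Zdeg_Lrep[OF assms(1)])
  obtain X' \<alpha>' where l': "Lrep g \<sigma>' X' \<alpha>'" by (rule Zdeg_Lrep[OF assms(2)])
  obtain v \<zeta> where r: "Rrep \<xi> v \<zeta>" by (rule Zcat_Rrep[OF assms(3)])
  have T: "T \<in> B0" by (rule B0.int_mem[OF assms(4)])
  \<comment> \<open>The left presentation has \<beta> outermost, so the intertwiner is first pulled
    back by it.\<close>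
  let ?S = "beta D (- g) T"
  have S: "?S \<in> B0" "beta D g ?S = T" using T by auto
  have e: "eps X \<alpha> v \<zeta> \<in> B0" "eps X' \<alpha>' v \<zeta> \<in> B0" using eps_unitary[OF l r] eps_unitary[OF l' r] un(1) by auto
  have "\<xi> ?S * eps X \<alpha> v \<zeta> = eps X' \<alpha>' v \<zeta> * ?S"
    by (rule eps_natural_left[OF l l' r _ S(1)]) (use S(2) assms(4) in simp)
  then have "beta D g (\<xi> ?S * eps X \<alpha> v \<zeta>) = beta D g (eps X' \<alpha>' v \<zeta> * ?S)" by simp
  then show ?thesis
    unfolding braiding_eps[OF assms(1,3) l r] braiding_eps[OF assms(2,3) l' r]
    using e S T hom_mem[OF RrepD(1)[OF r] S(1)] by (simp add: hom_mult[OF beta_End])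
qed

lemma braiding_gact:
  assumes "\<sigma> \<in> Zdeg D g" "\<rho> \<in> Zcat D"
  shows "braiding D (gact D k \<sigma>) (gact D k \<rho>) = beta D k (braiding D \<sigma> \<rho>)"
proof -
  obtain X \<alpha> where l: "Lrep g \<sigma> X \<alpha>" by (rule Zdeg_Lrep[OF assms(1)])
  obtain v \<zeta> where r: "Rrep \<rho> v \<zeta>" by (rule Zcat_Rrep[OF assms(2)])
  obtain \<pi> where \<pi>: "\<pi> \<in> gr (- k)" using gr_nonempty by blast
  obtain \<pi>' where \<pi>': "\<pi>' \<in> gr k" using gr_nonempty by blast
  show ?thesis
    unfolding braiding_eps[OF assms l r]
      braiding_eps[OF Zdeg_gact[OF assms(1)] Zcat_gact[OF assms(2)] Lrep_gact[OF l \<pi>] Rrep_gact[OF r \<pi>']]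
    by (rule eps_BF3[OF l r \<pi> \<pi>'])
qed

end

theorem theorem3p14:
  fixes D :: "('h::chilbert, 'h2::chilbert, 'k::chilbert, 'l::chilbert, 'g::group_add) lr_data"
  assumes "lr_setting D"
  shows
    \<comment> \<open>the family on \<open>\<eta>\<close>-extensions and its canonical extension to \<open>Z\<close>\<close>
    "(\<forall>g \<sigma> e \<sigma>t \<rho> f \<rho>t V. \<sigma> \<in> dsums_deg D g \<and> is_eta D \<sigma> e \<sigma>t \<and> is_eta D \<rho> f \<rho>t \<and> is_V D g \<sigma> V
        \<longrightarrow> braiding D \<sigma>t \<rho>t = gact D g \<rho>t V * adj V) \<and>
     (\<forall>g \<sigma> e \<sigma>t \<rho> f \<rho>t. \<forall>u\<in>unitaries (algB0 D). \<forall>v\<in>unitaries (algB0 D).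
        \<sigma> \<in> dsums_deg D g \<and> is_eta D \<sigma> e \<sigma>t \<and> is_eta D \<rho> f \<rho>t
        \<longrightarrow> braiding D (Ad (algB0 D) u \<sigma>t) (Ad (algB0 D) v \<rho>t) =
              beta D g v * gact D g \<rho>t u * braiding D \<sigma>t \<rho>t * adj u * Ad (algB0 D) u \<sigma>t (adj v)) \<and>
     (\<forall>g. \<forall>\<sigma>\<in>Zdeg D g. \<forall>\<rho>\<in>Zcat D. braiding D \<sigma> \<rho> \<in> unitaries (algB0 D)) \<and>
     \<comment> \<open>BF0\<close>
     (\<forall>g. \<forall>\<sigma>\<in>Zdeg D g. \<forall>\<rho>\<in>Zcat D.
        braiding D \<sigma> \<rho> \<in> intertwiners (algB0 D) (compose (algB0 D) \<sigma> \<rho>) (compose (algB0 D) (gact D g \<rho>) \<sigma>)) \<and>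
     \<comment> \<open>BF1\<close>
     (\<forall>g. \<forall>\<sigma>\<in>Zdeg D g. \<forall>\<xi>\<in>Zcat D. \<forall>\<eta>\<in>Zcat D.
        gact D g \<xi> (braiding D \<sigma> \<eta>) * braiding D \<sigma> \<xi> = braiding D \<sigma> (compose (algB0 D) \<xi> \<eta>)) \<and>
     (\<forall>g. \<forall>\<sigma>\<in>Zdeg D g. \<forall>\<rho>\<in>Zcat D. \<forall>\<rho>'\<in>Zcat D. \<forall>T\<in>intertwiners (algB0 D) \<rho> \<rho>'.
        beta D g T * braiding D \<sigma> \<rho> = braiding D \<sigma> \<rho>' * \<sigma> T) \<and>
     \<comment> \<open>BF2\<close>
     (\<forall>g h. \<forall>\<sigma>\<in>Zdeg D g. \<forall>\<rho>\<in>Zdeg D h. \<forall>\<xi>\<in>Zcat D.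
        braiding D \<sigma> (gact D h \<xi>) * \<sigma> (braiding D \<rho> \<xi>) = braiding D (compose (algB0 D) \<sigma> \<rho>) \<xi>) \<and>
     (\<forall>g. \<forall>\<sigma>\<in>Zdeg D g. \<forall>\<sigma>'\<in>Zdeg D g. \<forall>\<xi>\<in>Zcat D. \<forall>T\<in>intertwiners (algB0 D) \<sigma> \<sigma>'.
        gact D g \<xi> T * braiding D \<sigma> \<xi> = braiding D \<sigma>' \<xi> * T) \<and>
     \<comment> \<open>BF3\<close>
     (\<forall>g k. \<forall>\<sigma>\<in>Zdeg D g. \<forall>\<rho>\<in>Zcat D. braiding D (gact D k \<sigma>) (gact D k \<rho>) = beta D k (braiding D \<sigma> \<rho>))"
proof -
  interpret lr D by (unfold_locales) (rule assms)
  show ?thesis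
    by (intro conjI allI ballI impI)
      ((elim conjE)?, (rule braiding_eta braiding_Ad braiding_unitary braiding_intertwines braiding_compose_right
        braiding_natural_right braiding_compose_left braiding_natural_left braiding_gact; assumption))+
qed

end
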